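(* Let $k$ be an even non-negative integer, let $\chi$ be an odd primitive Dirichlet character modulo $q$, and let $a,x>0$. Then \begin{align*} \sum_{n=1}^\infty\sigma_{k,\chi}(n) K_0(a\sqrt{nx})=&\ \delta_k \frac{2}{a^2x} L(1,\chi)- \frac{ L(-k,\chi) }{4}\left( \log \left(\frac{8\pi}{a^2} \right) +\frac{ L'(-k,\chi)}{ L(-k,\chi)} -2\gamma \right)+\frac{ L(-k,\chi) }{4} \log x\\ &+(-1)^{\frac{k}{2}}\frac{i\,k!\,q^k}{2 ({2\pi })^{k+1} } \tau(\chi) \sum_{n=1}^\infty \bar{\sigma}_{k, \bar{\chi}}(n) \left(\frac{1}{n^{k+1}}-\frac{1}{( n+\frac{a^2qx}{16\pi^2} )^{k+1} } \right), \end{align*} where $\delta_k=1$ if $k=0$ and $\delta_k=0$ if $k>0$, and $\gamma$ is Euler's constant.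
   Context: For a Dirichlet character $\chi$ and $z\in\mathbb{C}$: $\sigma_{z,\chi}(n)=\sum_{d\mid n}d^z\chi(d)$ and $\bar{\sigma}_{z,\chi}(n)=\sum_{d\mid n}d^z\chi(n/d)$. $\tau(\chi)=\sum_{h=1}^q\chi(h)e^{2\pi i h/q}$ is the Gauss sum, $L(s,\chi)$ the Dirichlet $L$-function, and $K_0$ the modified Bessel function of the second kind of order $0$. *)

theory Defs
  imports "HOL-Complex_Analysis.Complex_Analysis"
begin

definition dirichlet_char :: "nat \<Rightarrow> (nat \<Rightarrow> complex) \<Rightarrow> bool" where
  "dirichlet_char q chi \<longleftrightarrow> q > 0 \<and> (\<forall>n. chi (n + q) = chi n) \<and>
     (\<forall>m n. chi (m * n) = chi m * chi n) \<and> chi 1 = 1 \<and>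
     (\<forall>n. chi n = 0 \<longleftrightarrow> \<not> coprime n q)"

definition primitive_dirichlet_char :: "nat \<Rightarrow> (nat \<Rightarrow> complex) \<Rightarrow> bool" where
  "primitive_dirichlet_char q chi \<longleftrightarrow> dirichlet_char q chi \<and>
     (\<forall>d. d dvd q \<and> d < q \<longrightarrow>
        \<not> (\<forall>n. coprime n q \<and> n mod d = 1 mod d \<longrightarrow> chi n = 1))"

definition odd_dirichlet_char :: "nat \<Rightarrow> (nat \<Rightarrow> complex) \<Rightarrow> bool" where
  "odd_dirichlet_char q chi \<longleftrightarrow> chi (q - 1) = -1"

text \<open>Dirichlet L-function of a non-principal character: the entire function
  agreeing with the Dirichlet series on Re s > 1 (analytic continuation).\<close>
definition dirichlet_L :: "(nat \<Rightarrow> complex) \<Rightarrow> complex \<Rightarrow> complex" where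
  "dirichlet_L chi = (THE f. f holomorphic_on UNIV \<and>
     (\<forall>s. 1 < Re s \<longrightarrow> (\<lambda>n. chi (Suc n) / of_nat (Suc n) powr s) sums f s))"

definition gauss_sum :: "nat \<Rightarrow> (nat \<Rightarrow> complex) \<Rightarrow> complex" where
  "gauss_sum q chi = (\<Sum>h=1..q. chi h * exp (2 * of_real pi * \<i> * of_nat h / of_nat q))"

definition sigma_chi :: "complex \<Rightarrow> (nat \<Rightarrow> complex) \<Rightarrow> nat \<Rightarrow> complex" where
  "sigma_chi z chi n = (\<Sum>d | d dvd n. of_nat d powr z * chi d)"

definition sigma_bar_chi :: "complex \<Rightarrow> (nat \<Rightarrow> complex) \<Rightarrow> nat \<Rightarrow> complex" where
  "sigma_bar_chi z chi n = (\<Sum>d | d dvd n. of_nat d powr z * chi (n div d))"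

definition bessel_K0 :: "real \<Rightarrow> real" where
  "bessel_K0 x = (LBINT t:{0..}. exp (- (x * cosh t)))"

end

theory Submission
  imports Defs "HOL-Number_Theory.Residues" "HOL-Real_Asymp.Real_Asymp"
begin

text \<open>Substituting \<open>K\<^sub>0 (2 sqrt y) = 1/2 \<integral> exp (- t - y/t) dt/t\<close> turns the Bessel series into an integral
  over the positive half-line of the Lambert series with coefficients \<open>\<sigma>\<close>. Lipschitz summation,
  applied to the partial fraction expansion of the generating function of the character, transforms
  the Lambert series at \<open>y\<close> into the dual one, with coefficients \<open>\<sigma>-bar\<close>, at \<open>4 \<pi>\<^sup>2 / (q y)\<close>, up to
  the terms involving \<open>L (1, \<chi>)\<close> and \<open>L (-k, \<chi>)\<close>. Integrated term by term, the dual series gives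
  \<open>k! \<Sum> \<sigma>-bar (n) (c / (n + c))\<^bsup>k+1\<^esup>\<close>, which diverges; hence an extra factor \<open>t\<^sup>s\<close> is
  inserted. For \<open>s > 0\<close> the sum is compared with \<open>\<Sum> \<sigma>-bar (n) (c / n)\<^bsup>k+1+s\<^esup>\<close>, which is
  \<open>\<zeta> (1 + s) L (k + 1 + s, \<chi>-bar)\<close> up to a power of \<open>c\<close>. As \<open>s \<rightarrow> 0\<close>, the poles of the zeta and
  Gamma functions cancel by the functional equation, leaving \<open>L' (-k, \<chi>)\<close>, the logarithms and
  Euler's constant. Since the statement divides by \<open>L (-k, \<chi>)\<close>, one also needs
  \<open>L (k + 1, \<chi>-bar) \<noteq> 0\<close>. This is delicate only for \<open>k = 0\<close>: if \<open>L (1, \<chi>)\<close> vanished, the weight one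
  transformation would make the Lambert series \<open>\<Lambda>\<close> rapidly decreasing at \<open>0\<close>, so the multiplicative convolution
  of \<open>\<Lambda>\<close> with its conjugate at \<open>v\<close> would tend to \<open>0\<close> as \<open>v \<rightarrow> 0\<close>; but this convolution is a
  series in Bessel functions whose coefficients, those of \<open>(\<zeta> (s) L (s, \<chi>)) (\<zeta> (s) L (s, \<chi>-bar))\<close>, are
  nonnegative with first term bounded away from \<open>0\<close>.\<close>

section \<open>Sums over the integers and the Lipschitz summation formula\<close>

text \<open>Parity drives the method: the exponent \<open>k + 1\<close> is odd and so is the
  character, so in every lattice sum the terms at opposite points add up instead of cancelling, and
  one-sided sums extend to all integers. The Lipschitz formula needs exponent at least 2, and
  absolute convergence of the double sum needs exponent above 2; this is why \<open>k = 0\<close> is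
  reached only by integrating the case \<open>k = 2\<close>.

  \<open>dirichlet_L\<close> is characterised by its properties, so an entire continuation must be
  built before a value at \<open>- k\<close> can be discussed. The series with terms n chi(n) exp (-
  n t) has absolutely convergent partial fractions, hence stays bounded as t tends to 0. Its Mellin
  transform therefore reaches the strip -1 < Re s < 0, where integrating the partial fractions term
  by term yields the functional equation.

  In the final limit no Laurent expansion is used. If V (s) is the coefficient of zeta (1 + s), then
  the coefficient of Gamma (s) is - V (0), and only V (s) (zeta (1 + s) - 1/s), V (0) (Gamma (s) -
  1/s) and (V (s) - V (0)) / s have to converge, along a sequence of real s.\<close>

lemma has_sum_int_split:
  fixes f :: "int \<Rightarrow> 'a :: real_normed_vector"
  assumes "((\<lambda>n. f (int n)) has_sum a) UNIV" "((\<lambda>n. f (- int n - 1)) has_sum b) UNIV"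
  shows   "(f has_sum (a + b)) UNIV"
proof -
  have "(f has_sum a) {0..}"
    using assms(1) by (subst has_sum_reindex_bij_witness[of _ int nat]) auto
  moreover have "(f has_sum b) {..<0}"
    using assms(2)
    by (subst has_sum_reindex_bij_witness[of _ "\<lambda>n. - int n - 1" "\<lambda>m. nat (- m - 1)" UNIV
          "\<lambda>n. f (- int n - 1)"]) auto
  ultimately have "(f has_sum (a + b)) ({0..} \<union> {..<0})"
    by (intro has_sum_Un_disjoint) auto
  moreover have "{0..} \<union> {..<0} = (UNIV :: int set)" by auto
  ultimately show ?thesis by simp
qed

lemma summable_on_nat_powr:
  fixes \<alpha> :: real
  assumes "\<alpha> > 1"
  shows "(\<lambda>n::nat. (real n + 1) powr (-\<alpha>)) summable_on UNIV"
proof -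
  have "summable (\<lambda>n::nat. real n powr (-\<alpha>))"
    using assms by (subst summable_real_powr_iff) auto
  then have "summable (\<lambda>n::nat. real (Suc n) powr (-\<alpha>))"
    by (subst summable_Suc_iff)
  then show ?thesis
    by (subst summable_on_UNIV_nonneg_real_iff) (auto simp: add.commute)
qed

lemma summable_on_int_powr:
  fixes \<alpha> :: real
  assumes "\<alpha> > 1"
  shows "(\<lambda>m::int. (of_int \<bar>m\<bar> + 1) powr (-\<alpha>)) summable_on UNIV"
proof -
  have 1: "(\<lambda>n::nat. (of_int \<bar>int n\<bar> + 1) powr (-\<alpha>)) summable_on UNIV"
    using summable_on_nat_powr[OF assms] by simp
  have "(\<lambda>n::nat. (real n + 1) powr (-\<alpha>)) summable_on Suc ` UNIV"
    using summable_on_nat_powr[OF assms] by (rule summable_on_subset) auto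
  then have 2: "(\<lambda>n::nat. (of_int \<bar>- int n - 1\<bar> + 1) powr (-\<alpha>)) summable_on UNIV"
    by (subst (asm) summable_on_reindex) (auto simp: o_def add_ac)
  from has_sum_int_split[OF has_sum_infsum[OF 1] has_sum_infsum[OF 2]] show ?thesis
    by (rule has_sum_imp_summable)
qed

text \<open>The modulus X of z + m is at least Im z and at least |m| - |z|; \<open>K\<close> is
  chosen so that these two bounds together give |m| + 1 <= K X.\<close>

lemma norm_plus_of_int_ge:
  assumes "Im z > 0"
  obtains \<delta> where "\<delta> > 0" "\<And>m::int. norm (z + of_int m) \<ge> \<delta> * (of_int \<bar>m\<bar> + 1)"
proof
  define K where "K = 1 + (norm z + 1) / Im z"
  have K: "K > 0" unfolding K_def using assms by (intro add_pos_pos divide_pos_pos) (auto simp: add_nonneg_pos)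
  then show "1 / K > 0" by simp
  fix m :: int
  define X where "X = norm (z + of_int m)"
  have "Im z \<le> X" using abs_Im_le_cmod[of "z + of_int m"] assms by (simp add: X_def)
  have "of_int \<bar>m\<bar> = norm (of_int m :: complex)" by simp
  also have "\<dots> \<le> X + norm z" unfolding X_def
    by (metis add_diff_cancel_left' norm_triangle_ineq4)
  finally have "of_int \<bar>m\<bar> + 1 \<le> X + (norm z + 1) * 1" by simp
  also have "1 \<le> X / Im z" using \<open>Im z \<le> X\<close> assms by simp
  then have "X + (norm z + 1) * 1 \<le> X + (norm z + 1) * (X / Im z)"
    by (intro add_left_mono mult_left_mono) auto
  also have "\<dots> = K * X" by (simp add: K_def field_simps)
  finally show "1 / K * (of_int \<bar>m\<bar> + 1) \<le> norm (z + of_int m)"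
    using K by (simp add: X_def field_simps)
qed

lemma summable_on_int_inverse_power:
  assumes "Im z > 0" "n \<ge> 2"
  shows "(\<lambda>m::int. norm (1 / (z + of_int m) ^ n)) summable_on UNIV"
proof -
  obtain \<delta> where \<delta>: "\<delta> > 0" "\<And>m::int. norm (z + of_int m) \<ge> \<delta> * (of_int \<bar>m\<bar> + 1)"
    using norm_plus_of_int_ge[OF assms(1)] by blast
  have "(\<lambda>m::int. (1 / \<delta> ^ n) * (of_int \<bar>m\<bar> + 1) powr (- real n)) summable_on UNIV"
    using assms(2) by (intro summable_on_cmult_right summable_on_int_powr) auto
  then show ?thesis
  proof (rule Infinite_Sum.abs_summable_on_comparison_test')
    fix m :: int
    have "norm (1 / (z + of_int m) ^ n) \<le> 1 / (\<delta> * (of_int \<bar>m\<bar> + 1)) ^ n"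
    proof -
      have pos: "\<delta> * (of_int \<bar>m\<bar> + 1) > 0" using \<delta>(1) by (intro mult_pos_pos) auto
      show ?thesis unfolding norm_divide norm_power norm_one
        using pos \<delta>(2)[of m] less_le_trans[OF pos \<delta>(2)[of m]]
        by (intro divide_left_mono power_mono mult_pos_pos[OF zero_less_power zero_less_power]) linarith+
    qed
    also have "\<dots> = (1 / \<delta> ^ n) * (of_int \<bar>m\<bar> + 1) powr (- real n)"
      by (subst powr_minus) (simp add: powr_realpow power_mult_distrib divide_simps)
    finally show "norm (1 / (z + of_int m) ^ n) \<le> (1 / \<delta> ^ n) * (of_int \<bar>m\<bar> + 1) powr (- real n)" .
  qed
qed

text \<open>Both sides of Euler's reflection formula for Gamma (z) Gamma (1 - z) are differentiated,
  and the common factor pi / sin (pi z) is cancelled.\<close>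

lemma Digamma_reflection:
  fixes z :: complex
  assumes "z \<notin> \<int>"
  shows "Digamma (1 - z) - Digamma z = of_real pi * cot (of_real pi * z)"
proof -
  have z: "z \<notin> \<int>\<^sub>\<le>\<^sub>0" "1 - z \<notin> \<int>\<^sub>\<le>\<^sub>0" using assms
    by (auto dest: nonpos_Ints_Int)
  have sin: "sin (of_real pi * z) \<noteq> 0"
    using assms by (auto simp: sin_eq_0)
  have "((\<lambda>z. Gamma z * Gamma (1 - z)) has_field_derivative
          (Gamma z * Gamma (1 - z)) * (Digamma z - Digamma (1 - z))) (at z)"
    using z by (auto intro!: derivative_eq_intros simp: algebra_simps)
  moreover have "((\<lambda>z. of_real pi / sin (of_real pi * z)) has_field_derivative
          - (of_real pi / sin (of_real pi * z)) * (of_real pi * cot (of_real pi * z))) (at z)"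
    using sin by (auto intro!: derivative_eq_intros simp: cot_def power2_eq_square field_simps)
  ultimately have "(Gamma z * Gamma (1 - z)) * (Digamma z - Digamma (1 - z)) =
     - (of_real pi / sin (of_real pi * z)) * (of_real pi * cot (of_real pi * z))"
    unfolding Gamma_reflection_complex by (rule DERIV_unique)
  then have "(of_real pi / sin (of_real pi * z)) * (Digamma z - Digamma (1 - z) + of_real pi * cot (of_real pi * z)) = 0"
    unfolding Gamma_reflection_complex by (simp add: algebra_simps)
  then have "Digamma z - Digamma (1 - z) + of_real pi * cot (of_real pi * z) = 0"
    using sin by simp
  then show ?thesis by (metis add.commute add_diff_cancel_left' diff_diff_eq2 diff_0_right eq_iff_diff_eq_0)
qed

text \<open>Termwise differentiation multiplies coefficients by the index and keeps the disc of
  convergence; the extra factor \<open>w\<close> undoes the index shift built into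
  \<open>diffs\<close>.\<close>

lemma summable_power_times_geometric:
  fixes w :: "'a :: {real_normed_field, banach}"
  assumes "norm w < 1"
  shows "summable (\<lambda>n. of_nat n ^ p * w ^ n)"
  using assms
proof (induction p arbitrary: w)
  case 0
  then show ?case by (simp add: summable_geometric)
next
  case (Suc p)
  have "summable (\<lambda>n. diffs (\<lambda>n. of_nat n ^ p :: 'a) n * w ^ n)"
    by (rule termdiff_converges[OF Suc.prems Suc.IH])
  then have "summable (\<lambda>n. w * (diffs (\<lambda>n. of_nat n ^ p :: 'a) n * w ^ n))"
    by (rule summable_mult)
  also have "(\<lambda>n. w * (diffs (\<lambda>n. of_nat n ^ p :: 'a) n * w ^ n)) = (\<lambda>n. of_nat (Suc n) ^ Suc p * w ^ Suc n)"
    by (auto simp: diffs_def fun_eq_iff)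
  finally show ?case by (subst (asm) summable_Suc_iff)
qed

lemma DERIV_power_times_geometric:
  fixes w :: complex
  assumes "norm w < 1" "p \<ge> 1"
  shows "((\<lambda>w. \<Sum>n. of_nat n ^ p * w ^ n) has_field_derivative
            (\<Sum>n. of_nat (Suc n) ^ Suc p * w ^ n)) (at w)"
proof -
  obtain K where K: "norm w < K" "K < 1" using assms(1) dense by blast
  have "((\<lambda>w. \<Sum>n. of_nat n ^ p * w ^ n) has_field_derivative
            (\<Sum>n. diffs (\<lambda>n. of_nat n ^ p) n * w ^ n)) (at w)"
    by (rule termdiffs_strong[where K = "of_real K"])
       (use K le_less_trans[OF norm_ge_zero K(1)] in \<open>auto intro!: summable_power_times_geometric\<close>)
  then show ?thesis by (simp add: diffs_def)
qed

text \<open>In the upper half-plane cot (pi z) is a power series in exp (2 pi i z), and each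
  differentiation in z multiplies the n-th coefficient by 2 pi i n. The induction starts at 1
  because for \<open>p = 0\<close> the term n = 0 would be 1, while the cotangent carries only half
  of that constant.\<close>

lemma Polygamma_reflection:
  assumes "Im z > 0" "p \<ge> 1"
  shows "(-1) ^ Suc p * Polygamma p z + Polygamma p (1 - z) =
           (-2 * of_real pi * \<i>) ^ Suc p * (\<Sum>n. of_nat n ^ p * exp (2 * of_real pi * \<i> * z) ^ n)"
  using assms(2,1)
proof (induction p arbitrary: z rule: dec_induct)
  case base
  let ?w = "\<lambda>z. exp (2 * of_real pi * \<i> * z)"
  have np: "z \<notin> \<int>" if "Im z > 0" for z using that by (auto elim!: Ints_cases)
  have np2: "z \<notin> \<int>\<^sub>\<le>\<^sub>0" "1 - z \<notin> \<int>\<^sub>\<le>\<^sub>0" if "Im z > 0" for z :: complex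
    using that by (auto elim!: nonpos_Ints_cases simp: complex_eq_iff)
  have w1: "norm (?w z) < 1" if "Im z > 0" for z using that by (simp add: mult_pos_pos)
  have w1': "?w z \<noteq> 1" if "Im z > 0" for z using w1[OF that] by (metis less_irrefl norm_one)
  have cot: "of_real pi * cot (of_real pi * z) = - of_real pi * \<i> * (1 + ?w z) / (1 - ?w z)"
    if "Im z > 0" for z
  proof -
    define u where "u = exp (\<i> * (of_real pi * z))"
    have u: "u \<noteq> 0" by (simp add: u_def)
    have uw: "u\<^sup>2 = ?w z" by (simp add: u_def flip: exp_double) (simp add: mult_ac)
    have "u\<^sup>2 \<noteq> 1" using w1'[OF that] uw by simp
    have iu: "exp (- (\<i> * (of_real pi * z))) = 1 / u" by (simp add: u_def exp_minus field_simps)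
    have "u - 1/u \<noteq> 0" using \<open>u\<^sup>2 \<noteq> 1\<close> u by (auto simp: field_simps power2_eq_square)
    have "cot (of_real pi * z) = ((u + 1/u) / 2) / ((u - 1/u) / (2 * \<i>))"
      unfolding cot_def sin_exp_eq cos_exp_eq iu u_def[symmetric] by simp
    also have "\<dots> = \<i> * (u\<^sup>2 + 1) / (u\<^sup>2 - 1)"
      using u \<open>u\<^sup>2 \<noteq> 1\<close> \<open>u - 1/u \<noteq> 0\<close> by (simp add: divide_simps power2_eq_square)
    also have "\<dots> = - \<i> * (1 + ?w z) / (1 - ?w z)"
      using \<open>u\<^sup>2 \<noteq> 1\<close> unfolding uw[symmetric] by (simp add: divide_simps) (simp add: algebra_simps)
    finally show ?thesis by simp
  qed
  have "((\<lambda>z. Digamma (1 - z) - Digamma z) has_field_derivative - Polygamma 1 (1 - z) - Polygamma 1 z) (at z)"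
    using np2[OF base] by (auto intro!: derivative_eq_intros)
  moreover have "((\<lambda>z. - of_real pi * \<i> * (1 + ?w z) / (1 - ?w z)) has_field_derivative
       - of_real pi * \<i> * (2 * of_real pi * \<i> * ?w z * 2) / (1 - ?w z)\<^sup>2) (at z)"
    using w1'[OF base] by (auto intro!: derivative_eq_intros simp: power2_eq_square) (simp add: algebra_simps)
  moreover have "eventually (\<lambda>u. Im u > 0) (nhds z)"
    using base open_halfspace_Im_gt[of 0] by (simp add: eventually_nhds) blast
  then have ev: "eventually (\<lambda>z. Digamma (1 - z) - Digamma z = - of_real pi * \<i> * (1 + ?w z) / (1 - ?w z)) (nhds z)"
    by eventually_elim (simp add: Digamma_reflection[OF np] cot)
  ultimately have *: "- Polygamma 1 (1 - z) - Polygamma 1 z =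
      - of_real pi * \<i> * (2 * of_real pi * \<i> * ?w z * 2) / (1 - ?w z)\<^sup>2"
    using DERIV_cong_ev[OF refl ev refl] DERIV_unique by blast
  have "(\<lambda>n. of_nat (Suc n) * ?w z ^ n) sums (1 / (1 - ?w z)\<^sup>2)"
    using geometric_deriv_sums[OF w1[OF base]] by simp
  then have "(\<lambda>n. ?w z * (of_nat (Suc n) * ?w z ^ n)) sums (?w z * (1 / (1 - ?w z)\<^sup>2))"
    by (rule sums_mult)
  then have "(\<lambda>n. of_nat (Suc n) ^ 1 * ?w z ^ Suc n) sums (?w z / (1 - ?w z)\<^sup>2)"
    by (simp add: mult_ac)
  then have "(\<lambda>n. of_nat n ^ 1 * ?w z ^ n) sums (?w z / (1 - ?w z)\<^sup>2)"
    by (subst (asm) sums_Suc_iff) simp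
  then have "(\<Sum>n. of_nat n ^ 1 * ?w z ^ n) = ?w z / (1 - ?w z)\<^sup>2"
    by (rule sums_unique[symmetric])
  then show ?case using arg_cong[OF *, of uminus] by (simp add: power2_eq_square)
next
  case (step p)
  let ?w = "\<lambda>z. exp (2 * of_real pi * \<i> * z)"
  have np2: "z \<notin> \<int>\<^sub>\<le>\<^sub>0" "1 - z \<notin> \<int>\<^sub>\<le>\<^sub>0" if "Im z > 0" for z :: complex
    using that by (auto elim!: nonpos_Ints_cases simp: complex_eq_iff)
  have w1: "norm (?w z) < 1" if "Im z > 0" for z using that by (simp add: mult_pos_pos)
  have "((\<lambda>z. (-1) ^ Suc p * Polygamma p z + Polygamma p (1 - z)) has_field_derivative
         ((-1) ^ Suc p * Polygamma (Suc p) z - Polygamma (Suc p) (1 - z))) (at z)"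
    using np2[OF step.prems] by (auto intro!: derivative_eq_intros)
  moreover have "((\<lambda>z. (-2 * of_real pi * \<i>) ^ Suc p * (\<Sum>n. of_nat n ^ p * ?w z ^ n)) has_field_derivative
      (-2 * of_real pi * \<i>) ^ Suc p * ((\<Sum>n. of_nat (Suc n) ^ Suc p * ?w z ^ n) * (2 * of_real pi * \<i> * ?w z))) (at z)"
    by (rule derivative_eq_intros DERIV_chain2[OF DERIV_power_times_geometric] w1 step.prems step.hyps refl | simp add: w1 step.prems)+
  moreover have "eventually (\<lambda>u. Im u > 0) (nhds z)"
    using step.prems open_halfspace_Im_gt[of 0] by (simp add: eventually_nhds) blast
  then have ev: "eventually (\<lambda>z. (-1) ^ Suc p * Polygamma p z + Polygamma p (1 - z) =
       (-2 * of_real pi * \<i>) ^ Suc p * (\<Sum>n. of_nat n ^ p * ?w z ^ n)) (nhds z)"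
    by eventually_elim (rule step.IH)
  ultimately have *: "(-1) ^ Suc p * Polygamma (Suc p) z - Polygamma (Suc p) (1 - z) =
     (-2 * of_real pi * \<i>) ^ Suc p * ((\<Sum>n. of_nat (Suc n) ^ Suc p * ?w z ^ n) * (2 * of_real pi * \<i> * ?w z))"
    using DERIV_cong_ev[OF refl ev refl] DERIV_unique by blast
  have sm: "summable (\<lambda>n. of_nat n ^ Suc p * ?w z ^ n)"
    by (rule summable_power_times_geometric[OF w1[OF step.prems]])
  have sm': "summable (\<lambda>n. of_nat (Suc n) ^ Suc p * ?w z ^ n)"
  proof -
    have "summable (\<lambda>n. of_nat (Suc n) ^ Suc p * ?w z ^ Suc n)"
      using sm by (subst summable_Suc_iff)
    then have "summable (\<lambda>n. (of_nat (Suc n) ^ Suc p * ?w z ^ Suc n) / ?w z)" by (rule summable_divide)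
    then show ?thesis by (simp add: mult.assoc)
  qed
  have "(\<Sum>n. of_nat (Suc n) ^ Suc p * ?w z ^ n) * ?w z = (\<Sum>n. of_nat (Suc n) ^ Suc p * ?w z ^ Suc n)"
    by (subst suminf_mult2[OF sm']) (simp add: mult_ac)
  also have "\<dots> = (\<Sum>n. of_nat n ^ Suc p * ?w z ^ n)"
    by (subst suminf_split_head[OF sm]) simp
  finally have **: "(\<Sum>n. of_nat (Suc n) ^ Suc p * ?w z ^ n) * ?w z = (\<Sum>n. of_nat n ^ Suc p * ?w z ^ n)" .
  have "(-1) ^ Suc (Suc p) * Polygamma (Suc p) z + Polygamma (Suc p) (1 - z) =
      - ((-1) ^ Suc p * Polygamma (Suc p) z - Polygamma (Suc p) (1 - z))" by simp
  also have "\<dots> = (-2 * of_real pi * \<i>) ^ Suc (Suc p) * ((\<Sum>n. of_nat (Suc n) ^ Suc p * ?w z ^ n) * ?w z)"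
    by (subst *) simp
  finally show ?case unfolding ** .
qed

text \<open>Up to sign and factorial, the terms with m >= 0 sum to \<open>Polygamma p z\<close> and
  those with m < 0 to \<open>Polygamma p (1 - z)\<close>, because z - n - 1 = - (1 - z + n). The
  reflection formula adds the two halves.\<close>

lemma lipschitz_summation:
  assumes "Im z > 0" "p \<ge> 1"
  shows "((\<lambda>m::int. 1 / (z + of_int m) ^ Suc p) has_sum
           (-2 * of_real pi * \<i>) ^ Suc p / fact p * (\<Sum>n. of_nat n ^ p * exp (2 * of_real pi * \<i> * z) ^ n)) UNIV"
proof -
  have nz: "z \<noteq> 0" "1 - z \<noteq> 0" using assms by (auto simp: complex_eq_iff)
  have sm: "(\<lambda>m::int. norm (1 / (z + of_int m) ^ Suc p)) summable_on UNIV"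
    using assms by (intro summable_on_int_inverse_power) auto
  have sm1: "(\<lambda>n::nat. norm (1 / (z + of_int (int n)) ^ Suc p)) summable_on UNIV"
    using summable_on_subset[OF sm subset_UNIV, of "range int"] by (subst (asm) summable_on_reindex) (auto simp: o_def inj_on_def)
  have sm2: "(\<lambda>n::nat. norm (1 / (z + of_int (- int n - 1)) ^ Suc p)) summable_on UNIV"
    using summable_on_subset[OF sm subset_UNIV, of "range (\<lambda>n. - int n - 1)"] by (subst (asm) summable_on_reindex) (auto simp: o_def inj_on_def)
  have "(\<lambda>k. 1 / (z + of_int (int k)) ^ Suc p) sums ((-1) ^ Suc p * Polygamma p z / fact p)"
    using Polygamma_LIMSEQ[OF nz(1), of p] assms(2) by (simp add: field_simps)
  then have 1: "((\<lambda>k. 1 / (z + of_int (int k)) ^ Suc p) has_sum ((-1) ^ Suc p * Polygamma p z / fact p)) UNIV"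
    using sm1 by (intro norm_summable_imp_has_sum) (auto simp: summable_on_imp_summable)
  have eq: "1 / (z + of_int (- int k - 1)) ^ Suc p = (-1) ^ Suc p * inverse ((1 - z + of_nat k) ^ Suc p)" for k
  proof -
    have "z + of_int (- int k - 1) = (-1) * (1 - z + of_nat k)" by simp
    then have "(z + of_int (- int k - 1)) ^ Suc p = (-1) ^ Suc p * (1 - z + of_nat k) ^ Suc p"
      by (simp only: power_mult_distrib)
    then show ?thesis by (simp only:) (cases "even p"; simp add: divide_inverse)
  qed
  have "(\<lambda>k. (-1) ^ Suc p * inverse ((1 - z + of_nat k) ^ Suc p)) sums ((-1) ^ Suc p * ((-1) ^ Suc p * Polygamma p (1 - z) / fact p))"
    using Polygamma_LIMSEQ[OF nz(2), of p] assms(2) by (intro sums_mult) simp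
  also have "(-1) ^ Suc p * ((-1) ^ Suc p * Polygamma p (1 - z) / fact p) = Polygamma p (1 - z) / fact p"
    by (cases "even p") auto
  finally have "(\<lambda>k. 1 / (z + of_int (- int k - 1)) ^ Suc p) sums (Polygamma p (1 - z) / fact p)"
    by (simp only: eq)
  then have 2: "((\<lambda>k. 1 / (z + of_int (- int k - 1)) ^ Suc p) has_sum (Polygamma p (1 - z) / fact p)) UNIV"
    using sm2 by (intro norm_summable_imp_has_sum) (auto simp: summable_on_imp_summable)
  from has_sum_int_split[OF 1 2] have "((\<lambda>m::int. 1 / (z + of_int m) ^ Suc p) has_sum
      ((-1) ^ Suc p * Polygamma p z + Polygamma p (1 - z)) / fact p) UNIV"
    by (simp only: add_divide_distrib)
  then show ?thesis
    by (simp only: Polygamma_reflection[OF assms] times_divide_eq_left)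
qed

section \<open>Exponential series with polynomially bounded coefficients\<close>

definition exp_series :: "(nat \<Rightarrow> complex) \<Rightarrow> real \<Rightarrow> complex" where
  "exp_series a t = (\<Sum>n. a n * of_real (exp (- (real n * t))))"

lemma summable_power_times_exp:
  assumes "t > 0"
  shows "summable (\<lambda>n. real n ^ p * exp (- (real n * t)))"
proof -
  have "summable (\<lambda>n. real n ^ p * exp (-t) ^ n)"
    using assms by (intro summable_power_times_geometric) auto
  then show ?thesis by (simp add: exp_of_nat_mult[symmetric])
qed

lemma exp_series_abs_summable:
  fixes a :: "nat \<Rightarrow> complex"
  assumes "\<And>n. norm (a n) \<le> C * real n ^ p" "t > 0"
  shows "summable (\<lambda>n. norm (a n * of_real (exp (- (real n * t)))))"
proof (rule summable_comparison_test')
  show "summable (\<lambda>n. C * (real n ^ p * exp (- (real n * t))))"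
    by (intro summable_mult summable_power_times_exp assms)
  show "norm (norm (a n * of_real (exp (- (real n * t))))) \<le> C * (real n ^ p * exp (- (real n * t)))" for n
    using mult_right_mono[OF assms(1)[of n], of "exp (- (real n * t))"] by (simp add: norm_mult mult.assoc del: mult_le_cancel_right_pos)
qed

lemma exp_series_sums:
  assumes "\<And>n. norm (a n) \<le> C * real n ^ p" "t > 0"
  shows "(\<lambda>n. a n * of_real (exp (- (real n * t)))) sums exp_series a t"
  unfolding exp_series_def
  by (rule summable_sums[OF summable_norm_cancel[OF exp_series_abs_summable[OF assms]]])

lemma exp_series_has_sum:
  assumes "\<And>n. norm (a n) \<le> C * real n ^ p" "t > 0"
  shows "((\<lambda>n. a n * of_real (exp (- (real n * t)))) has_sum exp_series a t) UNIV"
  by (rule norm_summable_imp_has_sum[OF exp_series_abs_summable[OF assms] exp_series_sums[OF assms]])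

text \<open>The complex version of \<open>exp_series\<close>, written as a power series in exp (- z)
  so that it can be differentiated termwise. Complex arguments also occur in their own right: in
  weight one they carry the oscillating phases of the dual side.\<close>

definition cexp_series :: "(nat \<Rightarrow> complex) \<Rightarrow> complex \<Rightarrow> complex" where
  "cexp_series a z = (\<Sum>n. a n * exp (- z) ^ n)"

lemma exp_series_conv_cexp: "exp_series a t = cexp_series a (of_real t)"
  unfolding exp_series_def cexp_series_def
  by (simp add: exp_of_real exp_of_nat_mult[symmetric] flip: of_real_minus of_real_power)

lemma cexp_series_sums:
  assumes a: "\<And>n. norm (a n) \<le> C * real n ^ p" and z: "Re z > 0"
  shows "(\<lambda>n. a n * exp (- z) ^ n) sums cexp_series a z"
  unfolding cexp_series_def
proof (rule summable_sums, rule summable_norm_cancel, rule summable_comparison_test')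
  show "summable (\<lambda>n. C * (real n ^ p * norm (exp (- z)) ^ n))"
    using z by (intro summable_mult summable_power_times_geometric) auto
  show "norm (norm (a n * exp (- z) ^ n)) \<le> C * (real n ^ p * norm (exp (- z)) ^ n)" for n
    using mult_right_mono[OF a[of n], of "norm (exp (- z)) ^ n"] by (simp add: norm_mult norm_power mult.assoc)
qed

lemma DERIV_cexp_series:
  assumes a: "\<And>n. norm (a n) \<le> C * real n ^ p" and z: "Re z > 0"
  shows "(cexp_series a has_field_derivative - cexp_series (\<lambda>n. of_nat n * a n) z) (at z)"
proof -
  define F where "F x = (\<Sum>n. a n * x ^ n)" for x :: complex
  have sm: "summable (\<lambda>n. a n * x ^ n)" if x: "norm x < 1" for x
  proof (rule summable_norm_cancel, rule summable_comparison_test')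
    show "summable (\<lambda>n. C * (real n ^ p * norm x ^ n))"
      using x by (intro summable_mult summable_power_times_geometric) auto
    show "norm (norm (a n * x ^ n)) \<le> C * (real n ^ p * norm x ^ n)" for n
      using mult_right_mono[OF a[of n], of "norm x ^ n"] by (simp add: norm_mult norm_power mult.assoc)
  qed
  define x where "x = exp (- z)"
  have "norm x < 1" using z by (simp add: x_def)
  then obtain K where K: "norm x < K" "K < 1" using dense by blast
  have K0: "K > 0" using K(1) norm_ge_zero[of x] by linarith
  have "(F has_field_derivative (\<Sum>n. diffs a n * x ^ n)) (at (exp (- z)))"
    unfolding F_def x_def[symmetric]
    by (rule termdiffs_strong[where K = "of_real K"]) (use K K0 in \<open>auto intro!: sm\<close>)
  moreover have "((\<lambda>z. exp (- z)) has_field_derivative (- x)) (at z)"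
    by (auto intro!: derivative_eq_intros simp: x_def)
  ultimately have "((\<lambda>z. F (exp (- z))) has_field_derivative (\<Sum>n. diffs a n * x ^ n) * (- x)) (at z)"
    by (rule DERIV_chain2)
  moreover have "(\<lambda>z. F (exp (- z))) = cexp_series a" by (auto simp: F_def cexp_series_def)
  moreover have "(\<Sum>n. diffs a n * x ^ n) * (- x) = - cexp_series (\<lambda>n. of_nat n * a n) z"
  proof -
    have sd: "summable (\<lambda>n. diffs a n * x ^ n)"
      by (rule termdiff_converges[where K = K]) (use K K0 in \<open>auto intro!: sm\<close>)
    have a': "norm (of_nat n * a n) \<le> C * real n ^ Suc p" for n
      using mult_left_mono[OF a[of n], of "real n"] by (simp add: norm_mult mult_ac)
    have "(\<Sum>n. diffs a n * x ^ n) * x = (\<Sum>n. (diffs a n * x ^ n) * x)"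
      by (rule suminf_mult2[OF sd])
    also have "\<dots> = (\<Sum>n. (of_nat (Suc n) * a (Suc n)) * exp (- z) ^ Suc n)"
      by (intro suminf_cong) (simp add: diffs_def x_def mult_ac)
    also have "\<dots> = cexp_series (\<lambda>n. of_nat n * a n) z"
      unfolding cexp_series_def
      by (subst suminf_split_head[OF sums_summable[OF cexp_series_sums[OF a' z]]]) simp
    finally show ?thesis by simp
  qed
  ultimately show ?thesis by simp
qed

lemma exp_series_has_vector_derivative:
  assumes a: "\<And>n. norm (a n) \<le> C * real n ^ p" and t: "t > 0"
  shows "(exp_series a has_vector_derivative - exp_series (\<lambda>n. of_nat n * a n) t) (at t)"
proof -
  have "(complex_of_real has_vector_derivative of_real 1) (at t)"
    by (rule has_vector_derivative_of_real) (auto intro!: derivative_eq_intros)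
  then have "((cexp_series a \<circ> complex_of_real) has_vector_derivative of_real 1 * (- cexp_series (\<lambda>n. of_nat n * a n) (of_real t))) (at t)"
    by (rule field_vector_diff_chain_at) (rule DERIV_cexp_series[OF a], use t in simp)
  moreover have "cexp_series a \<circ> complex_of_real = exp_series a" by (auto simp: exp_series_conv_cexp)
  ultimately show ?thesis by (simp add: exp_series_conv_cexp)
qed

lemma exp_series_continuous_on:
  assumes a: "\<And>n. norm (a n) \<le> C * real n ^ p"
  shows "continuous_on {0<..} (exp_series a)"
proof (rule continuous_at_imp_continuous_on, intro ballI)
  fix t :: real assume "t \<in> {0<..}"
  then show "isCont (exp_series a) t"
    using has_vector_derivative_continuous[OF exp_series_has_vector_derivative[OF a, of t]] by simp
qed

section \<open>Odd primitive characters and their Gauss sums\<close>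

locale odd_primitive_character =
  fixes q :: nat and chi :: "nat \<Rightarrow> complex"
  assumes prim: "primitive_dirichlet_char q chi" and odd: "odd_dirichlet_char q chi"
begin

lemma char: "dirichlet_char q chi"
  using prim by (simp add: primitive_dirichlet_char_def)

lemma chi_period: "chi (n + q) = chi n"
  and chi_mult: "chi (m * n) = chi m * chi n"
  and chi_1 [simp]: "chi 1 = 1" "chi (Suc 0) = 1"
  and chi_eq_0_iff: "chi n = 0 \<longleftrightarrow> \<not> coprime n q"
  using char by (auto simp: dirichlet_char_def)

text \<open>For modulus 1 or 2 the residue -1 is represented by 0 or 1, where the character has the
  value 1, against oddness.\<close>

lemma q_gt_2: "q > 2"
proof (rule ccontr)
  assume "\<not> q > 2"
  moreover have "q > 0" using char by (simp add: dirichlet_char_def)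
  ultimately have "q = 1 \<or> q = 2" by auto
  then show False
  proof
    assume q: "q = 1"
    have "chi 0 = 1" using chi_period[of 0] q by simp
    with odd q show False by (simp add: odd_dirichlet_char_def)
  next
    assume "q = 2"
    with odd show False by (simp add: odd_dirichlet_char_def)
  qed
qed

lemma chi_0 [simp]: "chi 0 = 0"
  using q_gt_2 by (simp add: chi_eq_0_iff)

lemma chi_q [simp]: "chi q = 0"
  using chi_period[of 0] by simp

lemma chi_plus_mult: "chi (n + m * q) = chi n"
proof (induction m)
  case (Suc m)
  have "n + Suc m * q = (n + m * q) + q" by simp
  then show ?case using Suc chi_period[of "n + m * q"] by (simp only:)
qed auto

lemma chi_mod: "chi (n mod q) = chi n"
  using chi_plus_mult[of "n mod q" "n div q"] by simp

lemma chi_cong: "[m = n] (mod q) \<Longrightarrow> chi m = chi n"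
  by (metis chi_mod cong_def)

lemma chi_power: "chi (n ^ k) = chi n ^ k"
  by (induction k) (auto simp: chi_mult)

lemma norm_chi: "norm (chi n) = (if coprime n q then 1 else 0)"
proof (cases "coprime n q")
  case True
  have "chi n ^ totient q = chi (n ^ totient q)" by (simp add: chi_power)
  also have "\<dots> = chi 1" using euler_theorem[OF True] by (rule chi_cong)
  finally have "norm (chi n) ^ totient q = 1" by (simp flip: norm_power)
  then have "norm (chi n) = 1"
    using q_gt_2 by (metis norm_ge_zero power_eq_1_iff totient_gt_0_iff less_irrefl zero_less_imp_eq_int not_less_zero power_eq_1_iff neq0_conv gr_implies_not0 real_norm_def abs_of_nonneg norm_ge_zero)
  then show ?thesis using True by simp
qed (use chi_eq_0_iff[of n] in auto)

lemma norm_chi_le_1: "norm (chi n) \<le> 1"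
  by (simp add: norm_chi)

lemma cnj_character: "odd_primitive_character q (cnj \<circ> chi)"
proof
  show "primitive_dirichlet_char q (cnj \<circ> chi)"
    unfolding primitive_dirichlet_char_def
  proof (intro conjI allI impI)
    show "dirichlet_char q (cnj \<circ> chi)" using char by (auto simp: dirichlet_char_def)
    fix d assume "d dvd q \<and> d < q"
    then obtain n where "coprime n q" "n mod d = 1 mod d" "chi n \<noteq> 1"
      using prim unfolding primitive_dirichlet_char_def by blast
    then show "\<not> (\<forall>n. coprime n q \<and> n mod d = 1 mod d \<longrightarrow> (cnj \<circ> chi) n = 1)"
      by (metis comp_apply complex_cnj_cnj complex_cnj_one)
  qed
  show "odd_dirichlet_char q (cnj \<circ> chi)" using odd by (simp add: odd_dirichlet_char_def)
qed

text \<open>The lattice sums run over all integers; there oddness becomes a sign under r -> -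
  r.\<close>

definition chi_int :: "int \<Rightarrow> complex" where
  "chi_int r = chi (nat (r mod int q))"

lemma chi_int_of_nat [simp]: "chi_int (int n) = chi n"
  by (simp add: chi_int_def zmod_int[symmetric] chi_mod)

text \<open>Modulo \<open>q\<close>, - r is congruent to (q - 1) r, so multiplicativity splits off
  the value \<open>chi (q - 1)\<close>.\<close>

lemma chi_int_uminus: "chi_int (- r) = - chi_int r"
proof -
  define a where "a = nat (r mod int q)"
  have a: "int a = r mod int q" using q_gt_2 by (simp add: a_def)
  have "int (((q - 1) * a) mod q) = (int (q - 1) * int a) mod int q" by (simp add: zmod_int)
  also have "int (q - 1) = int q - 1" using q_gt_2 by simp
  also have "((int q - 1) * int a) mod int q = (int q * int a - int a) mod int q" by (simp add: algebra_simps)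
  also have "\<dots> = (- int a) mod int q"
    by (metis add_uminus_conv_diff mod_mult_self4 mult.commute)
  also have "\<dots> = (- r) mod int q" by (simp add: a mod_minus_eq)
  finally have "nat ((- r) mod int q) = ((q - 1) * a) mod q" by linarith
  then have "chi_int (- r) = chi (((q - 1) * a) mod q)" by (simp add: chi_int_def)
  also have "\<dots> = chi (q - 1) * chi a" by (simp add: chi_mod chi_mult)
  also have "\<dots> = - chi_int r" using odd by (simp add: odd_dirichlet_char_def chi_int_def a_def)
  finally show ?thesis .
qed

lemma chi_int_0 [simp]: "chi_int 0 = 0"
  by (simp add: chi_int_def)

lemma norm_chi_int_le_1: "norm (chi_int r) \<le> 1"
  by (simp add: chi_int_def norm_chi_le_1)

section \<open>Additive characters modulo \<open>q\<close> and the Gauss sum\<close>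

definition unity_root :: "nat \<Rightarrow> complex" where
  "unity_root h = cis (2 * pi * real h / real q)"

lemma unity_root_add: "unity_root (m + n) = unity_root m * unity_root n"
  by (simp add: unity_root_def cis_mult add_divide_distrib ring_distribs)

lemma unity_root_mult: "unity_root (m * n) = unity_root m ^ n"
proof -
  have "unity_root m ^ n = cis (real n * (2 * pi * real m / real q))"
    unfolding unity_root_def by (rule Complex.DeMoivre)
  then show ?thesis by (simp only: unity_root_def of_nat_mult) (simp add: mult_ac)
qed

lemma unity_root_mult_q: "unity_root (q * n) = 1"
proof -
  have "unity_root (q * n) = unity_root q ^ n" by (rule unity_root_mult)
  also have "unity_root q = 1" using q_gt_2 by (simp add: unity_root_def)
  finally show ?thesis by simp
qed

lemma unity_root_mod: "unity_root (n mod q) = unity_root n"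
proof -
  have "unity_root n = unity_root (q * (n div q) + n mod q)" by simp
  also have "\<dots> = unity_root (n mod q)" by (simp only: unity_root_add unity_root_mult_q) simp
  finally show ?thesis by simp
qed

lemma unity_root_cong: "[m = n] (mod q) \<Longrightarrow> unity_root m = unity_root n"
  by (metis unity_root_mod cong_def)

text \<open>Multiplication by a unit permutes the residues, since an injective map of a finite set
  into itself is onto.\<close>

lemma sum_mult_coprime:
  fixes f :: "nat \<Rightarrow> complex"
  assumes "coprime m q"
  shows "(\<Sum>h<q. f ((h * m) mod q)) = (\<Sum>h<q. f h)"
proof -
  have inj: "inj_on (\<lambda>h. (h * m) mod q) {..<q}"
  proof (rule inj_onI)
    fix x y assume xy: "x \<in> {..<q}" "y \<in> {..<q}" "(x * m) mod q = (y * m) mod q"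
    then have "[x * m = y * m] (mod q)" by (simp add: cong_def)
    then have "[x = y] (mod q)" using assms cong_mult_rcancel_nat by blast
    then show "x = y" using xy by (auto simp: cong_def)
  qed
  have "(\<lambda>h. (h * m) mod q) ` {..<q} \<subseteq> {..<q}" using q_gt_2 by auto
  then have "(\<lambda>h. (h * m) mod q) ` {..<q} = {..<q}"
    by (rule endo_inj_surj[OF finite_lessThan _ inj])
  with inj show ?thesis
    using sum.reindex[OF inj, of f] by (simp add: o_def)
qed

lemma gauss_sum_altdef: "gauss_sum q chi = (\<Sum>h<q. chi h * unity_root h)"
proof -
  have "gauss_sum q chi = (\<Sum>h=1..q. chi h * unity_root h)"
    unfolding gauss_sum_def unity_root_def by (intro sum.cong refl) (simp add: cis_conv_exp mult_ac)
  also have "\<dots> = (\<Sum>h<q. chi h * unity_root h)"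
    using q_gt_2 by (intro sum.mono_neutral_cong) (auto simp: not_le Suc_le_eq not_less le_less)
  finally show ?thesis .
qed

text \<open>For a unit \<open>n\<close>, substitute h n for h. Otherwise primitivity, applied to the
  proper divisor q / gcd (n, q), gives a unit m congruent to 1 modulo that divisor with
  \<open>chi m\<close> different from 1. Then m n and n agree modulo \<open>q\<close>, so
  substituting h m for h multiplies the sum by \<open>chi m\<close>, and the sum must
  vanish.\<close>

lemma gauss_sum_separable:
  "(\<Sum>h<q. chi h * unity_root (h * n)) = cnj (chi n) * gauss_sum q chi"
proof (cases "coprime n q")
  case True
  have "cnj (chi n) * gauss_sum q chi = cnj (chi n) * (\<Sum>h<q. chi ((h * n) mod q) * unity_root ((h * n) mod q))"
    unfolding gauss_sum_altdef using sum_mult_coprime[OF True, of "\<lambda>h. chi h * unity_root h"] by simp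
  also have "\<dots> = (chi n * cnj (chi n)) * (\<Sum>h<q. chi h * unity_root (h * n))"
    by (simp add: sum_distrib_left chi_mod unity_root_mod chi_mult mult_ac)
  also have "chi n * cnj (chi n) = 1"
    using norm_chi[of n] True by (simp add: complex_norm_square[symmetric])
  finally show ?thesis by simp
next
  case False
  define g where "g = gcd n q"
  have g: "g > 1" "g dvd n" "g dvd q" using False q_gt_2
    unfolding g_def coprime_iff_gcd_eq_1 by (auto, metis One_nat_def Suc_lessI gcd_pos_nat not_less_zero)
  define d where "d = q div g"
  have dg: "d * g = q" using g by (simp add: d_def)
  have "d dvd q" using dg by (metis dvd_triv_left)
  moreover have "d < q" using g q_gt_2 by (simp add: d_def)
  ultimately obtain m where m: "coprime m q" "m mod d = 1 mod d" "chi m \<noteq> 1"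
    using prim unfolding primitive_dirichlet_char_def by blast
  have "[m * n = 1 * n] (mod q)"
  proof -
    obtain n' where n': "n = g * n'" using g by blast
    have "[m = 1] (mod d)" using m by (simp add: cong_def)
    then have "[m * g = 1 * g] (mod (d * g))" by (simp add: cong_def mod_mult_mult2)
    then have "[m * g * n' = 1 * g * n'] (mod q)" unfolding dg by (rule cong_mult[OF _ cong_refl])
    then show ?thesis by (simp add: n' mult_ac)
  qed
  then have mn: "[h * m * n = h * n] (mod q)" for h
    by (metis cong_scalar_left mult.assoc mult_1)
  let ?G = "\<Sum>h<q. chi h * unity_root (h * n)"
  have "?G = (\<Sum>h<q. chi ((h * m) mod q) * unity_root (((h * m) mod q) * n))"
    using sum_mult_coprime[OF m(1), of "\<lambda>h. chi h * unity_root (h * n)"] by simp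
  also have "\<dots> = (\<Sum>h<q. chi m * (chi h * unity_root (h * n)))"
  proof (intro sum.cong refl)
    fix h
    have "unity_root (((h * m) mod q) * n) = unity_root (h * n)"
      by (rule unity_root_cong) (metis cong_mod_left cong_refl cong_scalar_right cong_trans mn)
    then show "chi ((h * m) mod q) * unity_root (((h * m) mod q) * n) = chi m * (chi h * unity_root (h * n))"
      by (simp add: chi_mod chi_mult)
  qed
  also have "\<dots> = chi m * ?G" by (simp add: sum_distrib_left)
  finally have "(1 - chi m) * ?G = 0" by (simp add: algebra_simps)
  then have "?G = 0" using m by simp
  moreover have "chi n = 0" using False by (simp add: chi_eq_0_iff)
  ultimately show ?thesis by simp
qed

text \<open>A geometric sum whose ratio is a q-th root of unity, different from 1 unless the two
  indices agree.\<close>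

lemma unity_root_orthogonal:
  assumes "h < q" "h' < q"
  shows "(\<Sum>n<q. unity_root (h * n) * cnj (unity_root (h' * n))) = (if h = h' then of_nat q else 0)"
proof -
  define x where "x = unity_root h * cnj (unity_root h')"
  have x: "unity_root (h * n) * cnj (unity_root (h' * n)) = x ^ n" for n
    by (simp add: x_def unity_root_mult power_mult_distrib)
  have n1: "unity_root h' * cnj (unity_root h') = 1"
    by (simp add: unity_root_def complex_norm_square[symmetric])
  show ?thesis
  proof (cases "h = h'")
    case True
    then show ?thesis unfolding x using n1 by (simp add: x_def)
  next
    case False
    have "x \<noteq> 1"
    proof
      assume "x = 1"
      then have "unity_root h = unity_root h'"
        using n1 by (metis mult.commute mult_1 mult.assoc x_def)
      then show False
        using Complex.bij_betw_roots_unity[of q] assms False q_gt_2 unfolding unity_root_def bij_betw_def inj_on_def by auto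
    qed
    moreover have "x ^ q = 1"
      using unity_root_mult_q[of h] unity_root_mult_q[of h']
      by (simp add: x_def power_mult_distrib unity_root_mult[symmetric] mult.commute flip: complex_cnj_power)
    ultimately show ?thesis unfolding x using False by (simp add: sum_gp_strict)
  qed
qed

text \<open>Parseval: the sum over n of the squared moduli of the separated sums equals
  \<open>N\<close> |tau|^2 by separability and \<open>N\<close> q by orthogonality. The term at 1
  shows that \<open>N\<close> is not zero.\<close>

lemma norm_gauss_sum: "gauss_sum q chi * cnj (gauss_sum q chi) = of_nat q"
proof -
  define \<tau> where "\<tau> = gauss_sum q chi"
  define N where "N = (\<Sum>h<q. chi h * cnj (chi h))"
  have "N = of_real (\<Sum>h<q. (norm (chi h))\<^sup>2)" by (simp add: N_def complex_norm_square of_real_sum del: of_real_power)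
  moreover have "(\<Sum>h<q. (norm (chi h))\<^sup>2) \<ge> (norm (chi 1))\<^sup>2"
    using q_gt_2 by (intro member_le_sum) auto
  then have "(\<Sum>h<q. (norm (chi h))\<^sup>2) \<noteq> 0" by auto
  ultimately have N: "N \<noteq> 0" by (metis of_real_eq_0_iff)
  have "N * (\<tau> * cnj \<tau>) = (\<Sum>n<q. (cnj (chi n) * \<tau>) * cnj (cnj (chi n) * \<tau>))"
    unfolding N_def sum_distrib_right by (intro sum.cong refl) (simp add: mult_ac)
  also have "\<dots> = (\<Sum>n<q. (\<Sum>h<q. chi h * unity_root (h * n)) * cnj (\<Sum>h<q. chi h * unity_root (h * n)))"
    by (simp add: gauss_sum_separable \<tau>_def)
  also have "\<dots> = (\<Sum>n<q. \<Sum>h<q. \<Sum>h'<q. chi h * cnj (chi h') * (unity_root (h * n) * cnj (unity_root (h' * n))))"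
    by (simp add: sum_product mult_ac)
  also have "\<dots> = (\<Sum>h<q. \<Sum>n<q. \<Sum>h'<q. chi h * cnj (chi h') * (unity_root (h * n) * cnj (unity_root (h' * n))))"
    by (rule sum.swap)
  also have "\<dots> = (\<Sum>h<q. \<Sum>h'<q. \<Sum>n<q. chi h * cnj (chi h') * (unity_root (h * n) * cnj (unity_root (h' * n))))"
    by (intro sum.cong refl sum.swap)
  also have "\<dots> = (\<Sum>h<q. \<Sum>h'<q. chi h * cnj (chi h') * (if h = h' then of_nat q else 0))"
    by (intro sum.cong refl) (simp add: unity_root_orthogonal flip: sum_distrib_left)
  also have "\<dots> = N * of_nat q"
    by (simp add: N_def sum_distrib_right if_distrib[of "\<lambda>x. _ * x"] cong: if_cong)
  finally show ?thesis using N by (simp add: \<tau>_def)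
qed

lemma gauss_sum_nonzero: "gauss_sum q chi \<noteq> 0"
  using norm_gauss_sum q_gt_2 by auto

section \<open>The character exponential series and its partial fractions\<close>

definition chi_series :: "nat \<Rightarrow> real \<Rightarrow> complex" where
  "chi_series p = exp_series (\<lambda>n. chi n * of_nat n ^ p)"

lemma chi_series_coeff_bound: "norm (chi n * of_nat n ^ p) \<le> 1 * real n ^ p"
  using mult_right_mono[OF norm_chi_le_1[of n], of "real n ^ p"] by (simp add: norm_mult norm_power)

text \<open>The points where exp (- q t) = 1, that is, the candidate poles of the generating
  function of the character.\<close>

definition freq :: "int \<Rightarrow> complex" where
  "freq r = 2 * of_real pi * \<i> * of_int r / of_nat q"

text \<open>The integers r are grouped by their residue j modulo \<open>q\<close>, and each class is
  a Lipschitz sum. Adding the classes leaves, for every n, the conjugate of the sum of chi (j) e (j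
  n / q), which separability turns into \<open>chi n\<close> times the conjugate Gauss sum.\<close>

lemma chi_series_partial_fractions:
  assumes t: "t > 0" and p: "p \<ge> 1"
  shows "((\<lambda>r. cnj (chi_int r) / (of_real t + freq r) ^ Suc p) has_sum
           cnj (gauss_sum q chi) / fact p * chi_series p t) UNIV"
proof -
  \<comment> \<open>Chosen so that - 2 pi i (z_j + m) = t + \<open>freq (j - q m)\<close>; its
    imaginary part is positive because t is.\<close>
  define z where "z j = - of_nat j / of_nat q + \<i> * of_real t / (2 * of_real pi)" for j :: nat
  have Imz: "Im (z j) > 0" for j using t by (simp add: z_def)
  define S where "S j = (\<Sum>n. of_nat n ^ p * exp (2 * of_real pi * \<i> * z j) ^ n)" for j
  have w: "exp (2 * of_real pi * \<i> * z j) = of_real (exp (-t)) * cnj (unity_root j)" for j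
  proof -
    have "2 * of_real pi * \<i> * z j = - of_real t + \<i> * of_real (- (2 * pi * real j / real q))"
      using q_gt_2 by (simp add: z_def field_simps)
    then show ?thesis by (simp add: exp_add exp_of_real unity_root_def cis_cnj cis_conv_exp[symmetric] flip: of_real_minus)
  qed
  have "((\<lambda>r. cnj (chi_int r) / (of_real t + freq r) ^ Suc p) has_sum cnj (chi j) / fact p * S j) {r. r mod int q = int j}"
    if j: "j < q" for j
  proof -
    have "((\<lambda>m::int. (cnj (chi j) / (-2 * of_real pi * \<i>) ^ Suc p) * (1 / (z j + of_int m) ^ Suc p)) has_sum
        (cnj (chi j) / (-2 * of_real pi * \<i>) ^ Suc p) * ((-2 * of_real pi * \<i>) ^ Suc p / fact p * S j)) UNIV"
      unfolding S_def by (rule has_sum_cmult_right[OF lipschitz_summation[OF Imz p]])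
    also have "(cnj (chi j) / (-2 * of_real pi * \<i>) ^ Suc p) * ((-2 * of_real pi * \<i>) ^ Suc p / fact p * S j) = cnj (chi j) / fact p * S j"
      by simp
    also have "((\<lambda>m::int. (cnj (chi j) / (-2 * of_real pi * \<i>) ^ Suc p) * (1 / (z j + of_int m) ^ Suc p)) has_sum
          cnj (chi j) / fact p * S j) UNIV \<longleftrightarrow> ?thesis"
    proof (rule sym, rule has_sum_reindex_bij_witness[of _ "\<lambda>m. int j - int q * m" "\<lambda>r. (int j - r) div int q"])
      fix r assume r: "r \<in> {r. r mod int q = int j}"
      then have "int q dvd int j - r" by (metis dvd_minus_mod dvd_minus_iff minus_diff_eq mem_Collect_eq)
      then obtain m where m: "int j - r = int q * m" by blast
      then have r': "r = int j - int q * m" by simp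
      have m': "(int j - r) div int q = m" using m q_gt_2 by simp
      then show "int j - int q * ((int j - r) div int q) = r" using r' by simp
      have "of_real t + freq r = (-2 * of_real pi * \<i>) * (z j + of_int m)"
        using q_gt_2 by (simp add: freq_def z_def r' field_simps)
      moreover have "chi_int r = chi j" using r by (simp add: chi_int_def)
      ultimately show "cnj (chi j) / (-2 * of_real pi * \<i>) ^ Suc p * (1 / (z j + of_int ((int j - r) div int q)) ^ Suc p) =
            cnj (chi_int r) / (of_real t + freq r) ^ Suc p"
        unfolding m' by (simp only: power_mult_distrib) simp
    next
      fix m
      show "int j - int q * m \<in> {r. r mod int q = int j}"
        using j by (simp add: mod_diff_eq[symmetric, of "int j"])
    qed (use q_gt_2 in auto)
    finally show ?thesis .
  qed
  then have "((\<lambda>r. cnj (chi_int r) / (of_real t + freq r) ^ Suc p) has_sum (\<Sum>j<q. cnj (chi j) / fact p * S j))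
       (\<Union>j\<in>{..<q}. {r. r mod int q = int j})"
    by (intro sum_has_sum) auto
  moreover have "(\<Union>j\<in>{..<q}. {r. r mod int q = int j}) = UNIV"
  proof (intro equalityI subsetI UNIV_I)
    fix r
    have "nat (r mod int q) < q" "r mod int q = int (nat (r mod int q))"
      using q_gt_2 by (auto simp: nat_less_iff)
    then show "r \<in> (\<Union>j\<in>{..<q}. {r. r mod int q = int j})" by blast
  qed
  moreover have "(\<Sum>j<q. cnj (chi j) / fact p * S j) = cnj (gauss_sum q chi) / fact p * chi_series p t"
  proof -
    have w1: "norm (exp (2 * of_real pi * \<i> * z j)) < 1" for j
      unfolding w using t by (simp add: norm_mult unity_root_def)
    have sm: "summable (\<lambda>n. of_nat n ^ p * exp (2 * of_real pi * \<i> * z j) ^ n)" for j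
      by (rule summable_power_times_geometric[OF w1])
    have "(\<Sum>j<q. cnj (chi j) / fact p * S j) = (1 / fact p) * (\<Sum>j<q. cnj (chi j) * S j)"
      by (simp add: sum_distrib_left)
    also have "(\<Sum>j<q. cnj (chi j) * S j) =
        (\<Sum>j<q. \<Sum>n. cnj (chi j) * (of_nat n ^ p * exp (2 * of_real pi * \<i> * z j) ^ n))"
      unfolding S_def by (intro sum.cong refl suminf_mult[symmetric] sm)
    also have "\<dots> = (\<Sum>n. \<Sum>j<q. cnj (chi j) * (of_nat n ^ p * exp (2 * of_real pi * \<i> * z j) ^ n))"
      by (intro suminf_sum[symmetric] summable_mult sm)
    also have "\<dots> = (\<Sum>n. cnj (gauss_sum q chi) * (chi n * of_nat n ^ p * of_real (exp (- (real n * t)))))"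
    proof (intro suminf_cong)
      fix n
      have "(\<Sum>j<q. cnj (chi j) * (of_nat n ^ p * exp (2 * of_real pi * \<i> * z j) ^ n)) =
            of_nat n ^ p * of_real (exp (-t)) ^ n * cnj (\<Sum>j<q. chi j * unity_root (j * n))"
        unfolding w by (simp add: sum_distrib_left power_mult_distrib unity_root_mult mult_ac)
      also have "of_real (exp (-t)) ^ n = complex_of_real (exp (- (real n * t)))"
        by (simp add: exp_of_nat_mult[symmetric] flip: of_real_power)
      finally show "(\<Sum>j<q. cnj (chi j) * (of_nat n ^ p * exp (2 * of_real pi * \<i> * z j) ^ n)) =
            cnj (gauss_sum q chi) * (chi n * of_nat n ^ p * of_real (exp (- (real n * t))))"
        by (simp add: gauss_sum_separable mult_ac)
    qed
    also have "\<dots> = cnj (gauss_sum q chi) * chi_series p t"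
      unfolding chi_series_def exp_series_def
      by (intro suminf_mult sums_summable[OF exp_series_sums[OF chi_series_coeff_bound t]])
    finally show ?thesis by simp
  qed
  ultimately show ?thesis by simp
qed

lemma freq_0 [simp]: "freq 0 = 0" and freq_uminus: "freq (- r) = - freq r"
  by (auto simp: freq_def)

lemma norm_plus_freq_ge: "norm (of_real t + freq r) \<ge> 2 * pi * of_int \<bar>r\<bar> / real q"
  using abs_Im_le_cmod[of "of_real t + freq r"] q_gt_2 by (simp add: freq_def abs_mult)

lemma norm_plus_freq_ge':
  assumes "r \<noteq> 0"
  shows "norm (of_real t + freq r) \<ge> (of_int \<bar>r\<bar> + 1) / real q"
proof -
  have "(of_int \<bar>r\<bar> + 1 :: real) \<le> 2 * of_int \<bar>r\<bar>" using assms by linarith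
  also have "\<dots> \<le> 2 * pi * of_int \<bar>r\<bar>"
    using pi_gt3 by (intro mult_right_mono) auto
  finally have "(of_int \<bar>r\<bar> + 1) / real q \<le> 2 * pi * of_int \<bar>r\<bar> / real q"
    by (intro divide_right_mono) auto
  with norm_plus_freq_ge[of r t] show ?thesis by linarith
qed

text \<open>The bound is uniform in t because r = 0, the only term that could blow up as t tends to
  0, carries the factor \<open>chi_int 0 = 0\<close>.\<close>

lemma norm_partial_fraction_le:
  "norm (cnj (chi_int r) / (of_real t + freq r) ^ n) \<le> real q ^ n * (of_int \<bar>r\<bar> + 1) powr (- real n)"
proof (cases "r = 0")
  case False
  have pos: "(of_int \<bar>r\<bar> + 1) / real q > 0" using q_gt_2 by auto
  have "norm (cnj (chi_int r) / (of_real t + freq r) ^ n) \<le> 1 / ((of_int \<bar>r\<bar> + 1) / real q) ^ n"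
    unfolding norm_divide norm_power complex_mod_cnj
    using pos norm_plus_freq_ge'[OF False, of t] norm_chi_int_le_1[of r]
    by (intro frac_le power_mono zero_less_power) auto
  also have "\<dots> = real q ^ n * (of_int \<bar>r\<bar> + 1) powr (- real n)"
    by (subst powr_minus) (simp add: powr_realpow divide_simps)
  finally show ?thesis .
qed auto

text \<open>The exponential series itself gives no control as t tends to 0. The partial fractions
  do, and weight 1 is the smallest for which they converge absolutely.\<close>

lemma chi_series_1_bounded: obtains M where "\<And>t. t > 0 \<Longrightarrow> norm (chi_series 1 t) \<le> M"
proof
  define M0 where "M0 = (\<Sum>\<^sub>\<infinity>r::int. (real q)\<^sup>2 * (of_int \<bar>r\<bar> + 1) powr (-2))"
  fix t :: real assume t: "t > 0"
  have "norm (cnj (gauss_sum q chi) / fact 1 * chi_series 1 t) \<le> M0"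
  proof (rule norm_infsum_le[OF chi_series_partial_fractions[OF t]])
    show "((\<lambda>r. (real q)\<^sup>2 * (of_int \<bar>r\<bar> + 1) powr (-2)) has_sum M0) UNIV"
      unfolding M0_def by (intro has_sum_infsum summable_on_cmult_right summable_on_int_powr) auto
    show "norm (cnj (chi_int r) / (of_real t + freq r) ^ Suc 1) \<le> (real q)\<^sup>2 * (of_int \<bar>r\<bar> + 1) powr (-2)" for r
      using norm_partial_fraction_le[of r t "Suc 1"] by (simp add: numeral_2_eq_2)
  qed auto
  then show "norm (chi_series 1 t) \<le> M0 / norm (gauss_sum q chi)"
    using gauss_sum_nonzero by (simp add: norm_mult field_simps)
qed

text \<open>For t >= 1 and n >= 1, n t is at least (n + t) / 2, which splits off the decay in t and
  leaves a convergent series. For t < 1 the preceding bound is enough after adjusting the constant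
  by exp (1/2).\<close>

lemma chi_series_1_bound: obtains M where "M > 0" "\<And>t. t > 0 \<Longrightarrow> norm (chi_series 1 t) \<le> M * exp (- t / 2)"
proof -
  obtain M1 where M1: "\<And>t. t > 0 \<Longrightarrow> norm (chi_series 1 t) \<le> M1" using chi_series_1_bounded by blast
  define M2 where "M2 = (\<Sum>n. real n * exp (- (real n * (1/2))))"
  have sm2: "summable (\<lambda>n. real n * exp (- (real n * (1/2))))"
    using summable_power_times_exp[of "1/2" 1] by simp
  have large: "norm (chi_series 1 t) \<le> M2 * exp (- t / 2)" if t: "t \<ge> 1" for t
  proof -
    have "norm (chi_series 1 t) \<le> (\<Sum>n. exp (- t / 2) * (real n * exp (- (real n * (1/2)))))"
      unfolding chi_series_def exp_series_def
    proof (rule norm_suminf_le)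
      show "summable (\<lambda>n. exp (- t / 2) * (real n * exp (- (real n * (1/2)))))" by (intro summable_mult sm2)
      fix n
      show "norm (chi n * of_nat n ^ 1 * of_real (exp (- (real n * t)))) \<le> exp (- t / 2) * (real n * exp (- (real n * (1/2))))"
      proof (cases "n = 0")
        case False
        have "real n / 2 * 1 \<le> real n / 2 * t" "1 / 2 * t \<le> real n / 2 * t"
          using t False by (intro mult_left_mono mult_right_mono; simp)+
        then have "- (real n * t) \<le> - t / 2 + - (real n * (1/2))" by (simp add: field_simps)
        then have "exp (- (real n * t)) \<le> exp (- t / 2) * exp (- (real n * (1/2)))"
          unfolding exp_add[symmetric] by simp
        then have "real n * exp (- (real n * t)) \<le> real n * (exp (- t / 2) * exp (- (real n * (1/2))))"
          by (intro mult_left_mono) auto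
        moreover have "norm (chi n * of_nat n ^ 1 * of_real (exp (- (real n * t)))) \<le> 1 * (real n * exp (- (real n * t)))"
          using mult_right_mono[OF norm_chi_le_1[of n], of "real n * exp (- (real n * t))"] by (simp add: norm_mult)
        ultimately show ?thesis by (simp add: mult_ac)
      qed auto
    qed
    also have "\<dots> = M2 * exp (- t / 2)" unfolding M2_def by (subst suminf_mult[OF sm2]) simp
    finally show ?thesis .
  qed
  define M where "M = max 1 (max M2 (M1 * exp (1/2)))"
  show ?thesis
  proof (rule that)
    show "M > 0" by (simp add: M_def)
    fix t :: real assume t: "t > 0"
    show "norm (chi_series 1 t) \<le> M * exp (- t / 2)"
    proof (cases "t \<ge> 1")
      case True
      have "M2 * exp (- t / 2) \<le> M * exp (- t / 2)" by (intro mult_right_mono) (auto simp: M_def)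
      with large[OF True] show ?thesis by linarith
    next
      case False
      have "M1 \<ge> 0" using M1[OF t] norm_ge_zero order_trans by blast
      then have "M1 * 1 \<le> M1 * (exp (1/2) * exp (- t / 2))"
        using False by (intro mult_left_mono) (auto simp: exp_add[symmetric] simp del: exp_minus)
      also have "\<dots> = (M1 * exp (1/2)) * exp (- t / 2)" by simp
      also have "\<dots> \<le> M * exp (- t / 2)" by (intro mult_right_mono) (auto simp: M_def)
      finally show ?thesis using M1[OF t] by linarith
    qed
  qed
qed

lemma chi_series_continuous_on: "continuous_on {0<..} (chi_series p)"
  unfolding chi_series_def by (rule exp_series_continuous_on[OF chi_series_coeff_bound])

end

section \<open>Integrals over the positive half-line\<close>

lemma set_borel_measurable_pos:
  fixes f :: "real \<Rightarrow> 'a::{real_normed_vector, second_countable_topology}"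
  assumes "continuous_on {0<..} f"
  shows "set_borel_measurable lborel {0<..} f"
  using set_measurable_continuous_on[OF _ assms] by (simp add: set_borel_measurable_def)

lemma set_integrable_dominated_pos:
  fixes f :: "real \<Rightarrow> 'a::{banach, second_countable_topology}" and g :: "real \<Rightarrow> real"
  assumes "set_integrable lborel {0<..} g" "continuous_on {0<..} f" "\<And>t. t > 0 \<Longrightarrow> norm (f t) \<le> g t"
  shows "set_integrable lborel {0<..} f"
  by (rule set_integrable_bound[OF assms(1) set_borel_measurable_pos[OF assms(2)]])
     (use assms(3) in \<open>auto intro!: AE_I2 intro: order_trans[OF _ abs_ge_self]\<close>)

lemma
  fixes f :: "nat \<Rightarrow> real \<Rightarrow> 'a::{banach, second_countable_topology}"
  assumes "\<And>i. set_integrable lborel A (f i)" "summable (\<lambda>i. LBINT x:A. norm (f i x))"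
    and "\<And>x. x \<in> A \<Longrightarrow> summable (\<lambda>i. norm (f i x))"
  shows set_integrable_suminf: "set_integrable lborel A (\<lambda>x. \<Sum>i. f i x)"
    and set_integral_sums: "(\<lambda>i. LBINT x:A. f i x) sums (LBINT x:A. (\<Sum>i. f i x))"
proof -
  have sm: "summable (\<lambda>i. norm (indicator A x *\<^sub>R f i x))" for x
    using assms(3)[of x] by (cases "x \<in> A") auto
  have eq: "(\<Sum>i. indicator A x *\<^sub>R f i x) = indicator A x *\<^sub>R (\<Sum>i. f i x)" for x
    by (cases "x \<in> A") auto
  have 1: "integrable lborel (\<lambda>x. indicator A x *\<^sub>R f i x)" for i
    using assms(1) by (simp add: set_integrable_def)
  have 2: "summable (\<lambda>i. LBINT x. norm (indicator A x *\<^sub>R f i x))"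
    using assms(2) by (simp add: set_lebesgue_integral_def)
  from integrable_suminf[OF 1 _ 2] sums_integral[OF 1 _ 2] sm
  show "set_integrable lborel A (\<lambda>x. \<Sum>i. f i x)" "(\<lambda>i. LBINT x:A. f i x) sums (LBINT x:A. (\<Sum>i. f i x))"
    by (simp_all add: set_integrable_def set_lebesgue_integral_def eq)
qed

lemma set_integral_pos_dominated_convergence:
  fixes f :: "nat \<Rightarrow> real \<Rightarrow> 'a::{banach, second_countable_topology}" and h :: "real \<Rightarrow> real"
  assumes "set_integrable lborel {0<..} h" "\<And>n. continuous_on {0<..} (f n)" "continuous_on {0<..} g"
    and "\<And>n t. t > 0 \<Longrightarrow> norm (f n t) \<le> h t" "\<And>t. t > 0 \<Longrightarrow> (\<lambda>n. f n t) \<longlonglongrightarrow> g t"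
  shows "(\<lambda>n. LBINT t:{0<..}. f n t) \<longlonglongrightarrow> (LBINT t:{0<..}. g t)"
  unfolding set_lebesgue_integral_def
proof (rule integral_dominated_convergence)
  show "(\<lambda>x. indicator {0<..} x *\<^sub>R g x) \<in> borel_measurable lborel"
    using set_borel_measurable_pos[OF assms(3)] by (simp add: set_borel_measurable_def)
  show "(\<lambda>x. indicator {0<..} x *\<^sub>R f i x) \<in> borel_measurable lborel" for i
    using set_borel_measurable_pos[OF assms(2)] by (simp add: set_borel_measurable_def)
  show "integrable lborel (\<lambda>x. indicator {0<..} x *\<^sub>R h x)"
    using assms(1) by (simp add: set_integrable_def)
  show "AE x in lborel. (\<lambda>i. indicator {0<..} x *\<^sub>R f i x) \<longlonglongrightarrow> indicator {0<..} x *\<^sub>R g x"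
    using assms(5) by (intro AE_I2) (auto simp: indicator_def)
  show "AE x in lborel. norm (indicator {0<..} x *\<^sub>R f i x) \<le> indicator {0<..} x *\<^sub>R h x" for i
    using assms(4) by (intro AE_I2) (auto simp: indicator_def)
qed

lemma
  assumes s: "s > (0::real)" and b: "b > 0"
  shows set_integrable_Gamma: "set_integrable lborel {0<..} (\<lambda>t. t powr (s - 1) * exp (- (b * t)))"
    and set_integral_Gamma: "(LBINT t:{0<..}. t powr (s - 1) * exp (- (b * t))) = Gamma s / b powr s"
proof -
  define f where "f t = indicator {0..} t * t powr (s - 1) / exp t" for t :: real
  have "(\<integral>\<^sup>+t. ennreal (f t) \<partial>lborel) = ennreal (Gamma s)"
    using Gamma_conv_nn_integral_real[OF s] by (simp add: f_def)
  moreover have "f \<in> borel_measurable lborel" unfolding f_def by measurable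
  ultimately have f: "integrable lborel f" "integral\<^sup>L lborel f = Gamma s"
    using nn_integral_eq_integrable[of f lborel "Gamma s"] s by (auto simp: f_def less_imp_le)
  have eq: "f (0 + b * t) = b powr (s - 1) * (indicator {0<..} t *\<^sub>R (t powr (s - 1) * exp (- (b * t))))" for t
    using b by (auto simp: f_def indicator_def exp_minus powr_mult field_simps zero_le_mult_iff)
  have "integrable lborel (\<lambda>t. f (0 + b * t))"
    by (rule lborel_integrable_real_affine[OF f(1)]) (use b in auto)
  then have "integrable lborel (\<lambda>t. (1 / b powr (s - 1)) * f (0 + b * t))"
    by (rule integrable_mult_right)
  then show i: "set_integrable lborel {0<..} (\<lambda>t. t powr (s - 1) * exp (- (b * t)))"
    unfolding eq set_integrable_def using b by simp
  have "Gamma s = \<bar>b\<bar> *\<^sub>R (LBINT t. f (0 + b * t))"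
    using lborel_integral_real_affine[of b f 0] b f(2) by simp
  also have "\<dots> = b * b powr (s - 1) * (LBINT t:{0<..}. t powr (s - 1) * exp (- (b * t)))"
    unfolding eq set_lebesgue_integral_def using b by simp
  also have "b * b powr (s - 1) = b powr s" using b by (simp add: powr_diff)
  finally show "(LBINT t:{0<..}. t powr (s - 1) * exp (- (b * t))) = Gamma s / b powr s"
    using b by (simp add: field_simps)
qed

text \<open>The substitution t = b sqrt (u / (1 - u)), for which t^2 + b^2 = b^2 / (1 - u), yields
  the Beta integral with parameters 1 + s/2 and 1 - s/2.\<close>

lemma
  assumes s: "-1 < s" "s < (0::real)" and b: "b > 0"
  shows set_integrable_beta_kernel: "set_integrable lborel {0<..} (\<lambda>t. t powr (s + 1) / (t\<^sup>2 + b\<^sup>2)\<^sup>2)"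
    and set_integral_beta_kernel:
      "(LBINT t:{0<..}. t powr (s + 1) / (t\<^sup>2 + b\<^sup>2)\<^sup>2) = b powr (s - 2) / 2 * (Gamma (1 + s/2) * Gamma (1 - s/2))"
proof -
  define f where "f t = t powr (s + 1) / (t\<^sup>2 + b\<^sup>2)\<^sup>2" for t
  define g where "g u = b * (u / (1 - u)) powr (1/2)" for u
  define g' where "g' u = b * ((1/2) * (u / (1 - u)) powr (-1/2) / (1 - u)\<^sup>2)" for u
  have fg: "f (g u) * g' u = b powr (s - 2) / 2 * (u powr (s/2) * (1 - u) powr (-(s/2)))" if u: "0 < u" "u < 1" for u
  proof -
    define v where "v = u / (1 - u)"
    have v: "v > 0" using u by (simp add: v_def)
    have "(g u)\<^sup>2 = b\<^sup>2 * v"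
      using v by (simp add: g_def v_def[symmetric] power_mult_distrib powr_half_sqrt)
    then have "(g u)\<^sup>2 + b\<^sup>2 = b\<^sup>2 / (1 - u)" using u by (simp add: v_def field_simps)
    moreover have "(g u) powr (s + 1) = b powr (s + 1) * v powr ((s + 1) / 2)"
      using b v by (simp add: g_def v_def[symmetric] powr_mult powr_powr)
    ultimately have "f (g u) = b powr (s + 1) * v powr ((s + 1) / 2) / (b\<^sup>2 / (1 - u))\<^sup>2"
      by (simp only: f_def)
    then have "f (g u) * g' u = (b powr (s + 1) * b / b ^ 4) / 2 * (v powr ((s + 1)/2) * v powr (-1/2))"
      using u b by (simp add: g'_def v_def[symmetric] power_divide flip: power_mult)
    also have "v powr ((s + 1)/2) * v powr (-1/2) = v powr (s/2)"
      by (simp add: powr_add[symmetric] add_divide_distrib)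
    also have "\<dots> = u powr (s/2) * (1 - u) powr (-(s/2))"
      using u by (simp add: v_def powr_divide powr_minus_divide)
    also have "b powr (s + 1) * b / b ^ 4 = b powr (s - 2)"
      using b by (simp add: powr_add powr_diff power2_eq_square power4_eq_xxxx)
    finally show ?thesis .
  qed
  have beta: "set_integrable lborel {0..1} (\<lambda>u. u powr ((s/2 + 1) - 1) * (1 - u) powr ((1 - s/2) - 1))"
    using s by (intro integrable_Beta) auto
  have beta1: "set_integrable lborel {0<..<1} (\<lambda>u. u powr (s/2) * (1 - u) powr (-(s/2)))"
    using set_integrable_subset[OF beta, of "{0<..<1}"] by (simp add: greaterThanLessThan_subseteq_atLeastAtMost_iff)
  have beta': "(LBINT u:{0<..<1}. u powr (s/2) * (1 - u) powr (-(s/2))) = Gamma (1 + s/2) * Gamma (1 - s/2)"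
  proof -
    have "((\<lambda>u. u powr (s/2) * (1 - u) powr (-(s/2))) has_integral Beta (s/2 + 1) (1 - s/2)) {0<..<1}"
      using has_integral_Beta_real[of "s/2 + 1" "1 - s/2"] s by (simp add: has_integral_Icc_iff_Ioo)
    then have "(LBINT u:{0<..<1}. u powr (s/2) * (1 - u) powr (-(s/2))) = Beta (s/2 + 1) (1 - s/2)"
      unfolding set_borel_integral_eq_integral(2)[OF beta1] by (rule integral_unique)
    then show ?thesis by (simp add: Beta_def add.commute Gamma_numeral)
  qed
  have chi_series: "einterval 0 1 = {0<..<1::real}" by (auto simp: einterval_def zero_ereal_def one_ereal_def)
  have E': "einterval 0 \<infinity> = ({0<..} :: real set)" by (auto simp: einterval_def zero_ereal_def)
  have int: "set_integrable lborel (einterval 0 1) (\<lambda>x. f (g x) * g' x)"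
  proof -
    have "set_integrable lborel {0<..<1} (\<lambda>u. b powr (s - 2) / 2 * (u powr (s/2) * (1 - u) powr (-(s/2))))"
      by (intro set_integrable_mult_right) (rule beta1)
    also have "?this \<longleftrightarrow> ?thesis" unfolding chi_series by (rule set_integrable_cong) (auto simp: fg)
    finally show ?thesis .
  qed
  have sub: "set_integrable lborel (einterval 0 \<infinity>) f" "(LBINT x=0..\<infinity>. f x) = (LBINT x=0..1. f (g x) * g' x)"
  proof -
    have d: "DERIV g x :> g' x" if "0 < ereal x" "ereal x < 1" for x
    proof -
      have x: "0 < x" "x < 1" using that by (auto simp: zero_ereal_def one_ereal_def)
      have "((\<lambda>u. u / (1 - u)) has_real_derivative 1 / (1 - x)\<^sup>2) (at x)"
        using x by (auto intro!: derivative_eq_intros simp: power2_eq_square field_simps)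
      note d = DERIV_fun_powr[OF this, of "1/2"]
      have "(x / (1 - x)) > 0" using x by simp
      from DERIV_cmult[OF d[OF this], of b] show ?thesis unfolding g_def g'_def
        by (simp add: mult_ac)
    qed
    have c1: "isCont f (g x)" if "0 < ereal x" "ereal x < 1" for x
    proof -
      have x: "0 < x" "x < 1" using that by (auto simp: zero_ereal_def one_ereal_def)
      then have gx: "g x > 0" using b by (simp add: g_def)
      have "isCont f y" if "y > 0" for y
        unfolding f_def using that b by (intro continuous_intros) (auto simp: add_nonneg_eq_0_iff)
      then show ?thesis using gx by blast
    qed
    have c2: "isCont g' x" if "0 < ereal x" "ereal x < 1" for x
    proof -
      have x: "0 < x" "x < 1" using that by (auto simp: zero_ereal_def one_ereal_def)
      then show ?thesis unfolding g'_def by (intro continuous_intros) auto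
    qed
    have l0: "((ereal \<circ> g \<circ> real_of_ereal) \<longlongrightarrow> 0) (at_right 0)"
    proof -
      have "(g \<longlongrightarrow> 0) (at_right 0)" unfolding g_def by real_asymp
      then show ?thesis by (simp add: zero_ereal_def ereal_tendsto_simps)
    qed
    have l1: "((ereal \<circ> g \<circ> real_of_ereal) \<longlongrightarrow> \<infinity>) (at_left 1)"
    proof -
      have "filterlim g at_top (at_left 1)" unfolding g_def using b by real_asymp
      then show ?thesis by (simp add: one_ereal_def ereal_tendsto_simps)
    qed
    note * = interval_integral_substitution_nonneg[of 0 1 g g' f, OF _ d c1 c2 _ _ l0 l1 int]
    show "set_integrable lborel (einterval 0 \<infinity>) f"
      by (rule *(1)) (use b in \<open>auto simp: f_def g'_def zero_ereal_def one_ereal_def intro!: divide_nonneg_nonneg\<close>)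
    show "(LBINT x=0..\<infinity>. f x) = (LBINT x=0..1. f (g x) * g' x)"
      by (rule *(2)) (use b in \<open>auto simp: f_def g'_def zero_ereal_def one_ereal_def intro!: divide_nonneg_nonneg\<close>)
  qed
  show "set_integrable lborel {0<..} (\<lambda>t. t powr (s + 1) / (t\<^sup>2 + b\<^sup>2)\<^sup>2)"
    using sub(1) unfolding E' f_def .
  have "(LBINT t:{0<..}. f t) = (LBINT x=0..\<infinity>. f x)"
    by (simp add: interval_lebesgue_integral_def E')
  also have "\<dots> = (LBINT u:{0<..<1}. f (g u) * g' u)"
    unfolding sub(2) by (simp add: interval_lebesgue_integral_def chi_series)
  also have "\<dots> = (LBINT u:{0<..<1}. b powr (s - 2) / 2 * (u powr (s/2) * (1 - u) powr (-(s/2))))"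
    by (intro set_lebesgue_integral_cong) (auto simp: fg)
  also have "\<dots> = b powr (s - 2) / 2 * (LBINT u:{0<..<1}. u powr (s/2) * (1 - u) powr (-(s/2)))"
    by (rule set_integral_mult_right)
  finally show "(LBINT t:{0<..}. t powr (s + 1) / (t\<^sup>2 + b\<^sup>2)\<^sup>2) = b powr (s - 2) / 2 * (Gamma (1 + s/2) * Gamma (1 - s/2))"
    unfolding f_def beta' .
qed


section \<open>Analytic continuation and functional equation\<close>

text \<open>The identity theorem in the form needed below, where the integrals are evaluated only at
  real s.\<close>

lemma holomorphic_eq_on_real_segment:
  assumes "f holomorphic_on S" "g holomorphic_on S" "open S" "connected S" "a < b"
    and "\<And>x. a < x \<Longrightarrow> x < b \<Longrightarrow> complex_of_real x \<in> S"
    and "\<And>x. a < x \<Longrightarrow> x < b \<Longrightarrow> f (complex_of_real x) = g (complex_of_real x)" and "z \<in> S"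
  shows "f z = g z"
proof -
  define \<xi> where "\<xi> = (a + b) / 2"
  have \<xi>: "a < \<xi>" "\<xi> < b" using assms(5) by (auto simp: \<xi>_def)
  have "complex_of_real \<xi> islimpt (complex_of_real ` {a<..<b})"
    unfolding islimpt_approachable
  proof (intro allI impI)
    fix e :: real assume "e > 0"
    define d where "d = min (e / 2) ((b - a) / 4)"
    have d: "d > 0" "d < e" "d \<le> (b - a) / 4" using \<open>e > 0\<close> assms(5) unfolding d_def by (auto simp: min_def)
    have "\<xi> + d \<in> {a<..<b}" using d by (auto simp: \<xi>_def field_simps)
    then show "\<exists>x'\<in>complex_of_real ` {a<..<b}. x' \<noteq> complex_of_real \<xi> \<and> dist x' (complex_of_real \<xi>) < e"
      using d by (intro bexI[of _ "complex_of_real (\<xi> + d)"] imageI) (auto simp: dist_norm)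
  qed
  then have "f z - g z = 0"
    by (rule analytic_continuation[of "\<lambda>z. f z - g z" S "complex_of_real ` {a<..<b}", rotated 5])
       (use assms \<xi> in \<open>auto intro!: holomorphic_intros\<close>)
  then show ?thesis by simp
qed

text \<open>The index 0 is counted twice by the pairs, which is harmless because
  \<open>f 0 = 0\<close>.\<close>

lemma has_sum_int_pairs:
  fixes f :: "int \<Rightarrow> 'a :: banach"
  assumes "(f has_sum S) UNIV" "f 0 = 0"
  shows "((\<lambda>n. f (int n) + f (- int n)) has_sum S) UNIV"
proof -
  have sm: "f summable_on A" for A
    using summable_on_subset_banach[OF has_sum_imp_summable[OF assms(1)], of A] by simp
  have 1: "((\<lambda>n. f (int n)) has_sum infsum f {0..}) UNIV"
    using has_sum_infsum[OF sm, of "{0..}"] by (subst (asm) has_sum_reindex_bij_witness[of _ int nat]) auto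
  have 2: "((\<lambda>n. f (- int n)) has_sum infsum f {..0}) UNIV"
    using has_sum_infsum[OF sm, of "{..0}"]
    by (subst (asm) has_sum_reindex_bij_witness[of _ "\<lambda>n. - int n" "\<lambda>m. nat (- m)" UNIV "\<lambda>n. f (- int n)"]) auto
  have "infsum f {0..} = infsum f {0<..}"
    by (rule infsum_cong_neutral) (use assms(2) in auto)
  moreover have "(f has_sum (infsum f {0<..} + infsum f {..0})) ({0<..} \<union> {..0})"
    by (intro has_sum_Un_disjoint has_sum_infsum sm) auto
  moreover have "{0<..} \<union> {..0} = (UNIV :: int set)" by auto
  ultimately have "S = infsum f {0..} + infsum f {..0}" using has_sum_unique[OF assms(1)] by metis
  then show ?thesis using has_sum_add[OF 1 2] by simp
qed

text \<open>The reflection formula at - s/2 and at - s, compared through sin (2 x) = 2 sin x cos x.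
  It turns the value of the Beta integral into the cosine of the classical functional
  equation.\<close>

lemma Gamma_double_angle:
  assumes "-1 < s" "s < (0::real)"
  shows "Gamma (1 + s/2) * Gamma (1 - s/2) = Gamma (1 + s) * Gamma (1 - s) * cos (pi * s / 2)"
proof -
  have refl: "Gamma x * Gamma (1 - x) = pi / sin (pi * x)" for x :: real
  proof -
    have "complex_of_real (Gamma x * Gamma (1 - x)) = Gamma (of_real x) * Gamma (1 - of_real x)"
      by (simp add: Gamma_complex_of_real[symmetric])
    also have "\<dots> = of_real pi / sin (of_real pi * of_real x)"
      by (rule Gamma_reflection_complex)
    also have "\<dots> = of_real (pi / sin (pi * x))"
      by (simp add: sin_of_real[symmetric])
    finally have "complex_of_real (Gamma x * Gamma (1 - x)) = of_real (pi / sin (pi * x))" .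
    then show ?thesis by (simp only: of_real_eq_iff)
  qed
  have np: "x \<notin> \<int>\<^sub>\<le>\<^sub>0" if "x > 0" for x :: real using that by (auto elim!: nonpos_Ints_cases)
  have 1: "Gamma (1 - s/2) = (-s/2) * Gamma (-s/2)"
    using Gamma_plus1[of "-s/2", OF np] assms by (simp add: add.commute)
  have 2: "Gamma (1 - s) = (-s) * Gamma (-s)"
    using Gamma_plus1[of "-s", OF np] assms by (simp add: add.commute)
  have sin: "sin (pi * (-s)) = 2 * sin (pi * (-s/2)) * cos (pi * s / 2)"
    using sin_double[of "pi * (-s/2)"] by (simp add: field_simps)
  have c: "cos (pi * s / 2) > 0"
  proof (rule cos_gt_zero_pi)
    have "pi * (-1) < pi * s" using assms by (intro mult_strict_left_mono) auto
    then show "- (pi/2) < pi * s / 2" by simp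
    have "pi * s < pi * 0" using assms by (intro mult_strict_left_mono) auto
    then show "pi * s / 2 < pi / 2" using pi_gt_zero by linarith
  qed
  have "Gamma (1 + s/2) * Gamma (1 - s/2) = (-s/2) * (Gamma (-s/2) * Gamma (1 - (-s/2)))"
    unfolding 1 by simp
  also have "\<dots> = (-s/2) * (pi / sin (pi * (-s/2)))" unfolding refl ..
  also have "\<dots> = (-s) * (pi / sin (pi * (-s))) * cos (pi * s / 2)"
    unfolding sin using c by simp
  also have "\<dots> = (-s) * (Gamma (-s) * Gamma (1 - (-s))) * cos (pi * s / 2)" unfolding refl ..
  also have "\<dots> = Gamma (1 + s) * Gamma (1 - s) * cos (pi * s / 2)" unfolding 2 by simp
  finally show ?thesis .
qed

context odd_primitive_character
begin

section \<open>Continuation of the Dirichlet series by a Mellin transform\<close>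

definition dirichlet_series :: "complex \<Rightarrow> complex" where
  "dirichlet_series s = (\<Sum>n. chi (Suc n) / of_nat (Suc n) powr s)"

lemma norm_dirichlet_term_le: "norm (chi (Suc n) / of_nat (Suc n) powr s) \<le> real (Suc n) powr (- Re s)"
proof -
  have "norm (of_nat (Suc n) powr s :: complex) = real (Suc n) powr Re s"
    by (subst norm_powr_real_powr) auto
  then have "norm (chi (Suc n) / of_nat (Suc n) powr s) \<le> 1 / real (Suc n) powr Re s"
    unfolding norm_divide using norm_chi_le_1[of "Suc n"] by (simp add: divide_right_mono)
  then show ?thesis by (simp add: powr_minus divide_inverse)
qed

lemma summable_Suc_powr: "\<alpha> > 1 \<Longrightarrow> summable (\<lambda>n. real (Suc n) powr (- \<alpha>))"
  using summable_Suc_iff[of "\<lambda>n. real n powr (-\<alpha>)"] by (simp add: summable_real_powr_iff)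

lemma dirichlet_series_sums:
  assumes "Re s > 1"
  shows "(\<lambda>n. chi (Suc n) / of_nat (Suc n) powr s) sums dirichlet_series s"
  unfolding dirichlet_series_def
  by (rule summable_sums, rule summable_norm_cancel, rule summable_comparison_test'[OF summable_Suc_powr[OF assms]])
     (use norm_dirichlet_term_le[of _ s] in auto)

lemma dirichlet_series_holomorphic: "dirichlet_series holomorphic_on {s. Re s > 1}"
proof (rule holomorphic_uniform_sequence)
  show "open {s. Re s > 1}" by (rule open_halfspace_Re_gt)
  show "(\<lambda>s. \<Sum>n<N. chi (Suc n) / of_nat (Suc n) powr s) holomorphic_on {s. Re s > 1}" for N
    by (intro holomorphic_intros) (auto simp del: of_nat_Suc)
  fix x assume x: "x \<in> {s. Re s > 1}"
  define d where "d = (Re x - 1) / 2"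
  have d: "d > 0" using x by (simp add: d_def)
  have Re: "Re s \<ge> 1 + d" if "s \<in> cball x d" for s
    using that abs_Re_le_cmod[of "x - s"] by (simp add: dist_norm d_def field_simps)
  have "uniform_limit (cball x d) (\<lambda>N s. \<Sum>n<N. chi (Suc n) / of_nat (Suc n) powr s) dirichlet_series sequentially"
    unfolding dirichlet_series_def[abs_def]
  proof (rule Weierstrass_m_test)
    show "summable (\<lambda>n. real (Suc n) powr (-(1 + d)))" using d by (intro summable_Suc_powr) auto
    fix n s assume "s \<in> cball x d"
    have "norm (chi (Suc n) / of_nat (Suc n) powr s) \<le> real (Suc n) powr (- Re s)" by (rule norm_dirichlet_term_le)
    also have "\<dots> \<le> real (Suc n) powr (-(1 + d))" using Re[OF \<open>s \<in> cball x d\<close>] by (intro powr_mono) auto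
    finally show "norm (chi (Suc n) / of_nat (Suc n) powr s) \<le> real (Suc n) powr (-(1 + d))" .
  qed
  moreover have "cball x d \<subseteq> {s. Re s > 1}" using Re d by fastforce
  ultimately show "\<exists>d>0. cball x d \<subseteq> {s. Re s > 1} \<and>
     uniform_limit (cball x d) (\<lambda>N s. \<Sum>n<N. chi (Suc n) / of_nat (Suc n) powr s) dirichlet_series sequentially"
    using d by blast
qed

text \<open>Equal to Gamma (s + 1) L (s, chi). Using weight 1 instead of weight 0 shifts the Gamma
  factor by one, and the boundedness of \<open>chi_series 1\<close> near 0 makes the integral
  converge for Re s > -1, beyond the line Re s = 0.\<close>

definition mellin :: "complex \<Rightarrow> complex" where
  "mellin s = (LBINT t:{0<..}. of_real t powr s * chi_series 1 t)"

lemma continuous_on_mellin_integrand: "continuous_on {0<..} (\<lambda>t. complex_of_real t powr s * chi_series 1 t)"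
  by (intro continuous_intros chi_series_continuous_on) auto

lemma norm_real_powr: "t > 0 \<Longrightarrow> norm (complex_of_real t powr s) = t powr Re s"
  by (subst norm_powr_real_powr) auto

lemma set_integrable_powr_exp:
  fixes \<alpha> M :: real
  shows "\<alpha> > -1 \<Longrightarrow> set_integrable lborel {0<..} (\<lambda>t. M * (t powr \<alpha> * exp (- t / 2)))"
  using set_integrable_Gamma[of "\<alpha> + 1" "1/2"] by (intro set_integrable_mult_right) simp

lemma mellin_integrable:
  assumes "Re s > -1"
  shows "set_integrable lborel {0<..} (\<lambda>t. of_real t powr s * chi_series 1 t)"
proof -
  obtain M where M: "M > 0" "\<And>t. t > 0 \<Longrightarrow> norm (chi_series 1 t) \<le> M * exp (- t / 2)" using chi_series_1_bound by blast
  show ?thesis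
  proof (rule set_integrable_dominated_pos[OF set_integrable_powr_exp[OF assms] continuous_on_mellin_integrand])
    fix t :: real assume "t > 0"
    then show "norm (of_real t powr s * chi_series 1 t) \<le> M * (t powr Re s * exp (- t / 2))"
      using mult_left_mono[OF M(2)[of t], of "t powr Re s"] by (simp add: norm_mult norm_real_powr mult_ac)
  qed
qed

text \<open>Over the compact intervals \<open>I n\<close> the integral is holomorphic by
  differentiation under the integral sign. On a closed disc all tails are bounded by
  \<open>H n\<close>, free of s: a power of t lies below the sum of the two powers with extreme
  exponents.\<close>

lemma mellin_holomorphic: "mellin holomorphic_on {s. Re s > -1}"
proof (rule holomorphic_uniform_sequence)
  define I where "I n = {1 / (real n + 1)..real n + 1}" for n
  have Ipos: "t > 0" if "t \<in> I n" for t n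
    using that unfolding I_def by (auto intro: less_le_trans[of 0 "1 / (real n + 1)"])
  show "open {s. Re s > -1}" by (rule open_halfspace_Re_gt)
  let ?g = "\<lambda>n s. integral (I n) (\<lambda>t. exp (s * of_real (ln t)) * chi_series 1 t)"
  show "?g n holomorphic_on {s. Re s > -1}" for n
  proof -
    have ctE: "continuous_on (I n) (chi_series 1)"
      by (rule continuous_on_subset[OF chi_series_continuous_on]) (auto dest: Ipos)
    have ctl: "continuous_on (I n) ln"
      by (intro continuous_intros) (auto dest: Ipos)
    have "(\<lambda>s. integral (cbox (1 / (real n + 1)) (real n + 1)) (\<lambda>t. exp (s * of_real (ln t)) * chi_series 1 t)) holomorphic_on UNIV"
    proof (rule leibniz_rule_holomorphic)
      show "((\<lambda>s. exp (s * of_real (ln t)) * chi_series 1 t) has_field_derivative of_real (ln t) * exp (s * of_real (ln t)) * chi_series 1 t) (at s within UNIV)" for s t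
        by (auto intro!: derivative_eq_intros)
      show "(\<lambda>t. exp (s * of_real (ln t)) * chi_series 1 t) integrable_on cbox (1 / (real n + 1)) (real n + 1)" for s
        using ctE ctl unfolding I_def by (intro integrable_continuous continuous_intros) auto
      have "continuous_on (UNIV \<times> I n) (\<lambda>x. chi_series 1 (snd x))" "continuous_on (UNIV \<times> I n) (\<lambda>x. ln (snd x))"
        by (rule continuous_on_compose2[OF ctE] continuous_on_compose2[OF ctl]; auto intro!: continuous_intros)+
      then show "continuous_on (UNIV \<times> cbox (1 / (real n + 1)) (real n + 1)) (\<lambda>(s, t). of_real (ln t) * exp (s * of_real (ln t)) * chi_series 1 t)"
        unfolding I_def case_prod_unfold by (intro continuous_intros) auto
    qed auto
    then show ?thesis unfolding I_def cbox_interval by (rule holomorphic_on_subset) auto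
  qed
  obtain M where M: "M > 0" "\<And>t. t > 0 \<Longrightarrow> norm (chi_series 1 t) \<le> M * exp (- t / 2)" using chi_series_1_bound by blast
  fix x assume x: "x \<in> {s. Re s > -1}"
  define d where "d = (Re x + 1) / 2"
  have d: "d > 0" using x by (simp add: d_def)
  define \<sigma>0 \<sigma>1 where "\<sigma>0 = Re x - d" and "\<sigma>1 = Re x + d"
  have Re: "Re s \<ge> \<sigma>0" "Re s \<le> \<sigma>1" if "s \<in> cball x d" for s
    using that abs_Re_le_cmod[of "x - s"] by (auto simp: dist_norm \<sigma>0_def \<sigma>1_def)
  have \<sigma>: "\<sigma>0 > -1" "\<sigma>1 > -1" using x by (auto simp: \<sigma>0_def \<sigma>1_def d_def field_simps)
  define h where "h t = M * (t powr \<sigma>0 * exp (- t / 2)) + M * (t powr \<sigma>1 * exp (- t / 2))" for t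
  have h: "set_integrable lborel {0<..} h" unfolding h_def
    using set_integrable_powr_exp[OF \<sigma>(1), of M] set_integrable_powr_exp[OF \<sigma>(2), of M] by (rule set_integral_add)
  have h0: "h t \<ge> 0" for t using M(1) by (simp add: h_def)
  have bound: "norm (of_real t powr s * chi_series 1 t) \<le> h t" if "s \<in> cball x d" "t > 0" for s t
  proof -
    have "t powr Re s \<le> t powr \<sigma>0 + t powr \<sigma>1"
    proof (cases "t \<ge> 1")
      case True
      then have "t powr Re s \<le> t powr \<sigma>1" using Re(2)[OF that(1)] by (intro powr_mono) auto
      then show ?thesis using powr_ge_zero[of t \<sigma>0] by linarith
    next
      case False
      then have "t powr Re s \<le> t powr \<sigma>0" using Re(1)[OF that(1)] that(2) by (intro powr_mono') auto
      then show ?thesis using powr_ge_zero[of t \<sigma>1] by linarith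
    qed
    then have "t powr Re s * norm (chi_series 1 t) \<le> (t powr \<sigma>0 + t powr \<sigma>1) * (M * exp (- t / 2))"
      using M(2)[OF that(2)] by (intro mult_mono) auto
    then show ?thesis using that(2) by (simp add: norm_mult norm_real_powr h_def algebra_simps)
  qed
  define H where "H n = (LBINT t:{0<..} - I n. h t)" for n
  have sub: "{0<..} - I n \<in> sets lborel" for n unfolding I_def by auto
  have diff: "norm (mellin s - ?g n s) \<le> H n" if s: "s \<in> cball x d" for n s
  proof -
    have "Re s > -1" using Re(1)[OF s] \<sigma> by linarith
    note int = mellin_integrable[OF this]
    have "set_integrable lborel (I n) (\<lambda>t. of_real t powr s * chi_series 1 t)"
      by (rule set_integrable_subset[OF int]) (auto simp: I_def[symmetric] dest: Ipos, simp add: I_def)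
    note i1 = this
    have i2: "set_integrable lborel ({0<..} - I n) (\<lambda>t. of_real t powr s * chi_series 1 t)"
      by (rule set_integrable_subset[OF int sub]) auto
    have "mellin s = (LBINT t:I n \<union> ({0<..} - I n). of_real t powr s * chi_series 1 t)"
      unfolding mellin_def by (rule arg_cong[where f = "\<lambda>A. set_lebesgue_integral lborel A _"]) (auto dest: Ipos)
    also have "\<dots> = (LBINT t:I n. of_real t powr s * chi_series 1 t) + (LBINT t:{0<..} - I n. of_real t powr s * chi_series 1 t)"
      by (rule set_integral_Un[OF _ i1 i2]) auto
    also have "(LBINT t:I n. of_real t powr s * chi_series 1 t) = ?g n s"
      unfolding set_borel_integral_eq_integral(2)[OF i1]
      by (rule integral_cong) (auto dest!: Ipos simp: powr_def Ln_of_real mult_ac)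
    finally have "mellin s - ?g n s = (LBINT t:{0<..} - I n. of_real t powr s * chi_series 1 t)" by simp
    also have "norm \<dots> \<le> (LBINT t:{0<..} - I n. norm (of_real t powr s * chi_series 1 t))"
      by (rule set_integral_norm_bound[OF i2])
    also have "\<dots> \<le> H n" unfolding H_def
      by (rule set_integral_mono[OF set_integrable_norm[OF i2] set_integrable_subset[OF h sub]])
         (use bound[OF s] in auto)
    finally show ?thesis .
  qed
  have H: "H \<longlonglongrightarrow> 0"
  proof -
    have "(\<lambda>n. LBINT t. indicator ({0<..} - I n) t *\<^sub>R h t) \<longlonglongrightarrow> integral\<^sup>L lborel (\<lambda>_::real. 0::real)"
    proof (rule integral_dominated_convergence[of "\<lambda>_. 0" lborel "\<lambda>n t. indicator ({0<..} - I n) t *\<^sub>R h t" "\<lambda>t. indicator {0<..} t *\<^sub>R h t"])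
      show "(\<lambda>t. indicator ({0<..} - I n) t *\<^sub>R h t) \<in> borel_measurable lborel" for n
        using set_integrable_subset[OF h sub, of n] unfolding set_integrable_def by auto
      show "integrable lborel (\<lambda>t. indicator {0<..} t *\<^sub>R h t)" using h by (simp add: set_integrable_def)
      show "AE t in lborel. norm (indicator ({0<..} - I n) t *\<^sub>R h t) \<le> indicator {0<..} t *\<^sub>R h t" for n
        using h0 by (intro AE_I2) (auto simp: indicator_def)
      have "(\<lambda>n. indicator ({0<..} - I n) t *\<^sub>R h t) \<longlonglongrightarrow> 0" for t :: real
      proof (cases "t > 0")
        case True
        obtain N where N: "real N \<ge> t" "real N \<ge> 1 / t"
          using real_arch_simple[of "max t (1/t)"] by (auto simp: max_def split: if_splits)
        have "t \<in> I n" if "n \<ge> N" for n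
        proof -
          have "1 / t \<le> real n + 1" using N(2) that by linarith
          then have "1 / (real n + 1) \<le> t" using True by (simp add: field_simps)
          then show ?thesis using N that by (auto simp: I_def)
        qed
        then have "eventually (\<lambda>n. indicator ({0<..} - I n) t *\<^sub>R h t = 0) sequentially"
          unfolding eventually_sequentially by (intro exI[of _ N]) auto
        then show ?thesis by (rule tendsto_eventually)
      qed auto
      then show "AE t in lborel. (\<lambda>n. indicator ({0<..} - I n) t *\<^sub>R h t) \<longlonglongrightarrow> 0" by auto
    qed auto
    then show ?thesis by (simp add: H_def[abs_def] set_lebesgue_integral_def)
  qed
  have "uniform_limit (cball x d) ?g mellin sequentially"
  proof (rule uniform_limitI)
    fix e :: real assume "e > 0"
    then have "eventually (\<lambda>n. H n < e) sequentially" using order_tendstoD(2)[OF H] by blast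
    then show "eventually (\<lambda>n. \<forall>s\<in>cball x d. dist (?g n s) (mellin s) < e) sequentially"
    proof eventually_elim
      case (elim n)
      show ?case
      proof
        fix s assume "s \<in> cball x d"
        from diff[OF this, of n] elim show "dist (?g n s) (mellin s) < e"
          unfolding dist_norm norm_minus_commute[of "?g n s"] by linarith
      qed
    qed
  qed
  moreover have "cball x d \<subseteq> {s. Re s > -1}" using Re \<sigma> by fastforce
  ultimately show "\<exists>d>0. cball x d \<subseteq> {s. Re s > -1} \<and> uniform_limit (cball x d) ?g mellin sequentially"
    using d by blast
qed

end

lemma set_integral_nonneg:
  fixes f :: "_ \<Rightarrow> real"
  shows "(\<And>x. x \<in> A \<Longrightarrow> f x \<ge> 0) \<Longrightarrow> (LINT x:A|M. f x) \<ge> 0"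
  unfolding set_lebesgue_integral_def by (intro Bochner_Integration.integral_nonneg) (auto simp: indicator_def)

lemma of_real_nat_powr_minus: "complex_of_real (real n powr (- a)) = 1 / of_nat n powr of_real a"
proof -
  have "of_nat n powr of_real a = complex_of_real (real n powr a)"
    using powr_of_real[of "real n" a] by simp
  then show ?thesis by (simp only: powr_minus of_real_inverse divide_inverse mult_1)
qed

lemma set_integrable_of_real:
  assumes "set_integrable M A f"
  shows "set_integrable M A (\<lambda>x. complex_of_real (f x))"
proof -
  have "integrable M (\<lambda>x. complex_of_real (indicator A x *\<^sub>R f x))"
    using assms unfolding set_integrable_def by (intro integrable_of_real)
  then show ?thesis by (simp add: set_integrable_def scaleR_conv_of_real)
qed

context odd_primitive_character
begin

text \<open>Termwise Gamma integrals; the weight \<open>n\<close> cancels one of the s + 1 powers of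
  \<open>n\<close> that each of them produces.\<close>

lemma mellin_eq_dirichlet_series:
  assumes s: "s > (1::real)"
  shows "mellin (of_real s) = of_real (Gamma (s + 1)) * dirichlet_series (of_real s)"
proof -
  define f where "f i t = chi (Suc i) * of_real (real (Suc i) * (t powr ((s + 1) - 1) * exp (- (real (Suc i) * t))))" for i and t :: real
  have G: "set_integrable lborel {0<..} (\<lambda>t. t powr ((s + 1) - 1) * exp (- (real (Suc i) * t)))"
    "(LBINT t:{0<..}. t powr ((s + 1) - 1) * exp (- (real (Suc i) * t))) = Gamma (s + 1) / real (Suc i) powr (s + 1)" for i
    using s by (intro set_integrable_Gamma set_integral_Gamma; simp)+
  have G': "(LBINT t:{0<..}. real (Suc i) * (t powr ((s + 1) - 1) * exp (- (real (Suc i) * t)))) = Gamma (s + 1) * real (Suc i) powr (-s)" for i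
    by (subst set_integral_mult_right, subst G(2)) (simp add: powr_add powr_minus field_simps del: of_nat_Suc)
  have int: "set_integrable lborel {0<..} (f i)" for i
    unfolding f_def
    by (intro set_integrable_mult_right set_integrable_of_real G)
  have "(\<lambda>i. LBINT t:{0<..}. f i t) sums (LBINT t:{0<..}. (\<Sum>i. f i t))"
  proof (rule set_integral_sums[OF int])
    show "summable (\<lambda>i. LBINT t:{0<..}. norm (f i t))"
    proof (rule summable_comparison_test')
      show "summable (\<lambda>i. Gamma (s + 1) * real (Suc i) powr (-s))"
        by (intro summable_mult summable_Suc_powr s)
      fix i
      have nf: "norm (f i t) \<le> 1 * (real (Suc i) * (t powr ((s + 1) - 1) * exp (- (real (Suc i) * t))))" for t
        unfolding f_def norm_mult[of "chi (Suc i)"] norm_of_real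
        by (subst abs_of_nonneg) (simp, rule mult_right_mono[OF norm_chi_le_1], simp)
      have "(LBINT t:{0<..}. norm (f i t)) \<le> (LBINT t:{0<..}. real (Suc i) * (t powr ((s + 1) - 1) * exp (- (real (Suc i) * t))))"
        by (rule set_integral_mono[OF set_integrable_norm[OF int] set_integrable_mult_right[OF G(1)]])
           (use nf in simp)
      also have "\<dots> = Gamma (s + 1) * real (Suc i) powr (-s)" by (rule G')
      finally show "norm (LBINT t:{0<..}. norm (f i t)) \<le> Gamma (s + 1) * real (Suc i) powr (-s)"
        by (subst real_norm_def, subst abs_of_nonneg) (auto intro!: set_integral_nonneg)
    qed
    fix t :: real assume "t \<in> {0<..}"
    then have t: "t > 0" by simp
    have "summable (\<lambda>i. t powr s * norm (chi (Suc i) * of_nat (Suc i) ^ 1 * of_real (exp (- (real (Suc i) * t)))))"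
      using exp_series_abs_summable[OF chi_series_coeff_bound[of _ 1] t]
      by (intro summable_mult) (subst summable_Suc_iff)
    then show "summable (\<lambda>i. norm (f i t))" by (simp add: f_def norm_mult mult_ac)
  qed
  moreover have "(LBINT t:{0<..}. f i t) = of_real (Gamma (s + 1)) * (chi (Suc i) / of_nat (Suc i) powr of_real s)" for i
  proof -
    have "(LBINT t:{0<..}. f i t) = chi (Suc i) * of_real (LBINT t:{0<..}. real (Suc i) * (t powr ((s + 1) - 1) * exp (- (real (Suc i) * t))))"
      unfolding f_def by (simp only: set_integral_mult_right set_integral_complex_of_real)
    also have "\<dots> = of_real (Gamma (s + 1)) * (chi (Suc i) * of_real (real (Suc i) powr (-s)))"
      unfolding G' by simp
    also have "complex_of_real (real (Suc i) powr (-s)) = 1 / of_nat (Suc i) powr of_real s"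
      by (rule of_real_nat_powr_minus)
    finally show ?thesis by simp
  qed
  moreover have "(\<lambda>i. of_real (Gamma (s + 1)) * (chi (Suc i) / of_nat (Suc i) powr of_real s)) sums
       (of_real (Gamma (s + 1)) * dirichlet_series (of_real s))"
    using s by (intro sums_mult dirichlet_series_sums) simp
  ultimately have "(LBINT t:{0<..}. (\<Sum>i. f i t)) = of_real (Gamma (s + 1)) * dirichlet_series (of_real s)"
    using sums_unique2 by (simp only:)
  moreover have "(LBINT t:{0<..}. (\<Sum>i. f i t)) = mellin (of_real s)"
    unfolding mellin_def
  proof (intro set_lebesgue_integral_cong allI impI)
    fix t :: real assume "t \<in> {0<..}"
    then have t: "t > 0" by simp
    have "(\<lambda>n. chi n * of_nat n ^ 1 * of_real (exp (- (real n * t)))) sums chi_series 1 t"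
      unfolding chi_series_def by (rule exp_series_sums[OF chi_series_coeff_bound t])
    then have "(\<lambda>n. chi (Suc n) * of_nat (Suc n) ^ 1 * of_real (exp (- (real (Suc n) * t)))) sums chi_series 1 t"
      by (subst sums_Suc_iff) simp
    then have "(\<lambda>n. of_real (t powr s) * (chi (Suc n) * of_nat (Suc n) ^ 1 * of_real (exp (- (real (Suc n) * t))))) sums (of_real (t powr s) * chi_series 1 t)"
      by (rule sums_mult)
    then have "(\<lambda>i. f i t) sums (of_real (t powr s) * chi_series 1 t)"
      by (simp add: f_def mult_ac)
    moreover have "complex_of_real (t powr s) = of_real t powr of_real s" using t by (simp add: powr_of_real)
    ultimately show "(\<Sum>i. f i t) = of_real t powr of_real s * chi_series 1 t"
      using sums_unique by metis
  qed auto
  ultimately show ?thesis by simp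
qed

section \<open>The functional equation from the partial fractions\<close>

definition ang_freq :: "nat \<Rightarrow> real" where "ang_freq n = 2 * pi * real n / real q"

lemma ang_freq_pos: "n > 0 \<Longrightarrow> ang_freq n > 0"
  using q_gt_2 by (simp add: ang_freq_def)

lemma freq_of_nat: "freq (int n) = \<i> * of_real (ang_freq n)"
  by (simp add: freq_def ang_freq_def)

text \<open>With b for the frequency, oddness pairs r with - r into 1 / (t + i b)^2 - 1 / (t - i
  b)^2 = - 4 i b t / (t^2 + b^2)^2; the factor i on the right-hand side makes the kernel real and
  positive.\<close>

lemma chi_series_1_series:
  assumes t: "t > 0"
  shows "((\<lambda>n. cnj (chi n) * of_real (4 * ang_freq n * (t / (t\<^sup>2 + (ang_freq n)\<^sup>2)\<^sup>2))) has_sum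
            (\<i> * cnj (gauss_sum q chi) * chi_series 1 t)) UNIV"
proof -
  have "((\<lambda>n. cnj (chi_int (int n)) / (of_real t + freq (int n)) ^ Suc 1 +
         cnj (chi_int (- int n)) / (of_real t + freq (- int n)) ^ Suc 1) has_sum
          cnj (gauss_sum q chi) / fact 1 * chi_series 1 t) UNIV"
    by (rule has_sum_int_pairs[OF chi_series_partial_fractions[OF t]]) auto
  then have "((\<lambda>n. \<i> * (cnj (chi_int (int n)) / (of_real t + freq (int n)) ^ Suc 1 +
         cnj (chi_int (- int n)) / (of_real t + freq (- int n)) ^ Suc 1)) has_sum
          \<i> * (cnj (gauss_sum q chi) / fact 1 * chi_series 1 t)) UNIV"
    by (rule has_sum_cmult_right)
  also have "(\<lambda>n. \<i> * (cnj (chi_int (int n)) / (of_real t + freq (int n)) ^ Suc 1 +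
         cnj (chi_int (- int n)) / (of_real t + freq (- int n)) ^ Suc 1)) =
      (\<lambda>n. cnj (chi n) * of_real (4 * ang_freq n * (t / (t\<^sup>2 + (ang_freq n)\<^sup>2)\<^sup>2)))"
  proof
    fix n
    define z where "z = of_real t + \<i> * of_real (ang_freq n)"
    define w where "w = of_real t - \<i> * of_real (ang_freq n)"
    have zw: "z * w = of_real (t\<^sup>2 + (ang_freq n)\<^sup>2)"
      by (simp add: z_def w_def algebra_simps power2_eq_square)
    have "t\<^sup>2 + (ang_freq n)\<^sup>2 \<noteq> 0" using t by (simp add: add_nonneg_eq_0_iff)
    then have nz: "z \<noteq> 0" "w \<noteq> 0" using zw by (auto simp del: of_real_add of_real_power)
    have "1 / z\<^sup>2 - 1 / w\<^sup>2 = (w\<^sup>2 - z\<^sup>2) / (z * w)\<^sup>2"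
      using nz by (simp add: field_simps)
    also have "w\<^sup>2 - z\<^sup>2 = - 4 * \<i> * of_real (ang_freq n * t)"
      by (simp add: z_def w_def power2_eq_square algebra_simps)
    finally have *: "1 / z\<^sup>2 - 1 / w\<^sup>2 = - 4 * \<i> * of_real (ang_freq n * t) / of_real ((t\<^sup>2 + (ang_freq n)\<^sup>2)\<^sup>2)"
      unfolding zw by simp
    have "\<i> * (cnj (chi_int (int n)) / (of_real t + freq (int n)) ^ Suc 1 +
         cnj (chi_int (- int n)) / (of_real t + freq (- int n)) ^ Suc 1) = \<i> * cnj (chi n) * (1 / z\<^sup>2 - 1 / w\<^sup>2)"
      by (simp add: chi_int_uminus freq_uminus freq_of_nat z_def w_def power2_eq_square algebra_simps)
    also have "\<dots> = cnj (chi n) * of_real (4 * ang_freq n * (t / (t\<^sup>2 + (ang_freq n)\<^sup>2)\<^sup>2))"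
    proof -
      have ii: "\<i> * \<i> = -1" by simp
      have "\<i> * c * (- 4 * \<i> * y / X) = c * (4 * y / X)" for c y X :: complex
      proof -
        have "\<i> * c * (- 4 * \<i> * y / X) = (\<i> * \<i>) * (c * (- 4 * y / X))"
          by (simp only: mult_ac times_divide_eq_left times_divide_eq_right)
        then show ?thesis unfolding ii by simp
      qed
      then show ?thesis unfolding * by (simp add: mult_ac)
    qed
    finally show "\<i> * (cnj (chi_int (int n)) / (of_real t + freq (int n)) ^ Suc 1 +
         cnj (chi_int (- int n)) / (of_real t + freq (- int n)) ^ Suc 1) =
          cnj (chi n) * of_real (4 * ang_freq n * (t / (t\<^sup>2 + (ang_freq n)\<^sup>2)\<^sup>2))" .
  qed
  finally show ?thesis by (simp add: mult.assoc)
qed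

text \<open>The paired partial fractions are integrated against t^s term by term. Each integral is a
  beta kernel proportional to n^(s - 1), and for s < 0 these add up to the convergent Dirichlet
  series of the conjugate character at 1 - s.\<close>

lemma mellin_strip:
  assumes s: "-1 < s" "s < (0::real)"
  shows "\<i> * cnj (gauss_sum q chi) * mellin (of_real s) =
     of_real (2 * (Gamma (1 + s/2) * Gamma (1 - s/2)) * (2 * pi / q) powr (s - 1)) *
     odd_primitive_character.dirichlet_series (cnj \<circ> chi) (1 - of_real s)"
proof -
  interpret C: odd_primitive_character q "cnj \<circ> chi" by (rule cnj_character)
  define \<kappa> where "\<kappa> = Gamma (1 + s/2) * Gamma (1 - s/2)"
  define f where "f i t = cnj (chi (Suc i)) * of_real (4 * ang_freq (Suc i) * (t powr (s + 1) / (t\<^sup>2 + (ang_freq (Suc i))\<^sup>2)\<^sup>2))" for i and t :: real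
  have bp: "ang_freq (Suc i) > 0" for i by (rule ang_freq_pos) simp
  note B = set_integrable_beta_kernel[OF s bp] set_integral_beta_kernel[OF s bp]
  have B': "(LBINT t:{0<..}. 4 * ang_freq (Suc i) * (t powr (s + 1) / (t\<^sup>2 + (ang_freq (Suc i))\<^sup>2)\<^sup>2)) = 2 * \<kappa> * (2 * pi / q) powr (s - 1) * real (Suc i) powr (s - 1)" for i
  proof -
    have "(LBINT t:{0<..}. 4 * ang_freq (Suc i) * (t powr (s + 1) / (t\<^sup>2 + (ang_freq (Suc i))\<^sup>2)\<^sup>2)) = 2 * \<kappa> * (ang_freq (Suc i) * ang_freq (Suc i) powr (s - 2))"
      by (subst set_integral_mult_right, subst B(2)) (simp add: \<kappa>_def)
    also have "ang_freq (Suc i) * ang_freq (Suc i) powr (s - 2) = ang_freq (Suc i) powr (s - 1)"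
      using bp[of i] by (simp add: powr_diff power2_eq_square)
    also have "ang_freq (Suc i) powr (s - 1) = ((2 * pi / q) * real (Suc i)) powr (s - 1)" by (simp add: ang_freq_def)
    also have "\<dots> = (2 * pi / q) powr (s - 1) * real (Suc i) powr (s - 1)"
      by (rule powr_mult)
    finally show ?thesis by simp
  qed
  have int: "set_integrable lborel {0<..} (f i)" for i
    unfolding f_def by (intro set_integrable_mult_right set_integrable_of_real B)
  have \<kappa>: "\<kappa> > 0" unfolding \<kappa>_def using s by (intro mult_pos_pos Gamma_real_pos) auto
  define K where "K = 2 * \<kappa> * (2 * pi / q) powr (s - 1)"
  have fle: "norm (f i t) \<le> 4 * ang_freq (Suc i) * (t powr (s + 1) / (t\<^sup>2 + (ang_freq (Suc i))\<^sup>2)\<^sup>2)" for i t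
  proof -
    have "norm (f i t) = norm (chi (Suc i)) * (4 * ang_freq (Suc i) * (t powr (s + 1) / (t\<^sup>2 + (ang_freq (Suc i))\<^sup>2)\<^sup>2))"
      unfolding f_def norm_mult[of "cnj (chi (Suc i))"] norm_of_real complex_mod_cnj
      using bp[of i] by (subst abs_of_nonneg) auto
    also have "\<dots> \<le> 1 * (4 * ang_freq (Suc i) * (t powr (s + 1) / (t\<^sup>2 + (ang_freq (Suc i))\<^sup>2)\<^sup>2))"
      using bp[of i] by (intro mult_right_mono norm_chi_le_1) auto
    finally show ?thesis by simp
  qed
  have hs: "((\<lambda>i. f i t) has_sum (\<i> * cnj (gauss_sum q chi) * (of_real (t powr s) * chi_series 1 t))) UNIV" if t: "t > 0" for t
  proof -
    have "((\<lambda>n. cnj (chi n) * of_real (4 * ang_freq n * (t / (t\<^sup>2 + (ang_freq n)\<^sup>2)\<^sup>2))) has_sum (\<i> * cnj (gauss_sum q chi) * chi_series 1 t)) (range Suc)"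
      using chi_series_1_series[OF t]
      by (rule has_sum_cong_neutral[THEN iffD1, rotated -1]) (auto simp: ang_freq_def, metis chi_0 complex_cnj_zero_iff not0_implies_Suc rangeI)
    then have "((\<lambda>i. cnj (chi (Suc i)) * of_real (4 * ang_freq (Suc i) * (t / (t\<^sup>2 + (ang_freq (Suc i))\<^sup>2)\<^sup>2))) has_sum
         (\<i> * cnj (gauss_sum q chi) * chi_series 1 t)) UNIV"
      by (subst (asm) has_sum_reindex) (auto simp: o_def)
    then have "((\<lambda>i. of_real (t powr s) * (cnj (chi (Suc i)) * of_real (4 * ang_freq (Suc i) * (t / (t\<^sup>2 + (ang_freq (Suc i))\<^sup>2)\<^sup>2)))) has_sum
         of_real (t powr s) * (\<i> * cnj (gauss_sum q chi) * chi_series 1 t)) UNIV"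
      by (rule has_sum_cmult_right)
    moreover have "of_real (t powr s) * (cnj (chi (Suc i)) * of_real (4 * ang_freq (Suc i) * (t / (t\<^sup>2 + (ang_freq (Suc i))\<^sup>2)\<^sup>2))) = f i t" for i
      using t by (simp add: f_def powr_add mult_ac)
    ultimately show ?thesis by (simp add: mult_ac)
  qed
  have "(\<lambda>i. LBINT t:{0<..}. f i t) sums (LBINT t:{0<..}. (\<Sum>i. f i t))"
  proof (rule set_integral_sums[OF int])
    show "summable (\<lambda>i. LBINT t:{0<..}. norm (f i t))"
    proof (rule summable_comparison_test')
      show "summable (\<lambda>i. K * real (Suc i) powr (-(1 - s)))"
        using s by (intro summable_mult summable_Suc_powr) auto
      fix i
      have "(LBINT t:{0<..}. norm (f i t)) \<le> (LBINT t:{0<..}. 4 * ang_freq (Suc i) * (t powr (s + 1) / (t\<^sup>2 + (ang_freq (Suc i))\<^sup>2)\<^sup>2))"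
        by (rule set_integral_mono[OF set_integrable_norm[OF int] _ fle])
           (intro set_integrable_mult_right B)
      also have "\<dots> = K * real (Suc i) powr (-(1 - s))" unfolding B' K_def by simp
      finally show "norm (LBINT t:{0<..}. norm (f i t)) \<le> K * real (Suc i) powr (-(1 - s))"
        by (subst real_norm_def, subst abs_of_nonneg) (auto intro!: set_integral_nonneg)
    qed
    fix t :: real assume "t \<in> {0<..}"
    then have "(\<lambda>i. f i t) summable_on UNIV" using hs[of t] has_sum_imp_summable by auto
    then show "summable (\<lambda>i. norm (f i t))"
      by (metis summable_on_iff_abs_summable_on_complex summable_on_imp_summable)
  qed
  moreover have "(LBINT t:{0<..}. f i t) = of_real K * (cnj (chi (Suc i)) / of_nat (Suc i) powr (1 - of_real s))" for i
  proof -
    have "(LBINT t:{0<..}. f i t) = cnj (chi (Suc i)) * of_real (LBINT t:{0<..}. 4 * ang_freq (Suc i) * (t powr (s + 1) / (t\<^sup>2 + (ang_freq (Suc i))\<^sup>2)\<^sup>2))"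
      unfolding f_def by (simp only: set_integral_mult_right set_integral_complex_of_real)
    also have "\<dots> = of_real K * (cnj (chi (Suc i)) * of_real (real (Suc i) powr (-(1 - s))))"
      unfolding B' K_def by simp
    also have "complex_of_real (real (Suc i) powr (-(1 - s))) = 1 / of_nat (Suc i) powr (of_real (1 - s))"
      by (rule of_real_nat_powr_minus)
    finally show ?thesis by simp
  qed
  moreover have "(\<lambda>i. of_real K * (cnj (chi (Suc i)) / of_nat (Suc i) powr (1 - of_real s))) sums
       (of_real K * C.dirichlet_series (1 - of_real s))"
  proof -
    have "Re (1 - of_real s) > 1" using s by simp
    from sums_mult[OF C.dirichlet_series_sums[OF this], of "of_real K"] show ?thesis by (simp only: comp_apply)
  qed
  ultimately have "(LBINT t:{0<..}. (\<Sum>i. f i t)) = of_real K * C.dirichlet_series (1 - of_real s)"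
    using sums_unique2 by (simp only:)
  moreover have "(LBINT t:{0<..}. (\<Sum>i. f i t)) = (LBINT t:{0<..}. (\<i> * cnj (gauss_sum q chi)) * (of_real t powr of_real s * chi_series 1 t))"
  proof (intro set_lebesgue_integral_cong allI impI)
    fix t :: real assume "t \<in> {0<..}"
    then have t: "t > 0" by simp
    have "complex_of_real (t powr s) = of_real t powr of_real s" using t by (simp add: powr_of_real)
    then show "(\<Sum>i. f i t) = (\<i> * cnj (gauss_sum q chi)) * (of_real t powr of_real s * chi_series 1 t)"
      using sums_unique[OF has_sum_imp_sums[OF hs[OF t]]] by simp
  qed auto
  ultimately show ?thesis
    unfolding mellin_def set_integral_mult_right K_def \<kappa>_def by simp
qed

text \<open>Dividing by Gamma is written with the entire function \<open>rGamma\<close>, so that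
  only the convergence of the Mellin integral limits the domain.\<close>

definition L_right :: "complex \<Rightarrow> complex" where
  "L_right s = rGamma (s + 1) * mellin s"

text \<open>The factor of the asymmetric functional equation of an odd character. The inverse of the
  conjugate Gauss sum stands for tau / q, since |tau|^2 = q.\<close>

definition fe_factor :: "complex \<Rightarrow> complex" where
  "fe_factor s = (-2 * \<i> / cnj (gauss_sum q chi)) * Gamma (1 - s) * cos (of_real pi * s / 2) *
      of_real (2 * pi / q) powr (s - 1)"

definition L_left :: "complex \<Rightarrow> complex" where
  "L_left s = fe_factor s * odd_primitive_character.dirichlet_series (cnj \<circ> chi) (1 - s)"

lemma L_right_holomorphic: "L_right holomorphic_on {s. Re s > -1}"
  unfolding L_right_def by (intro holomorphic_intros mellin_holomorphic)

lemma fe_factor_holomorphic: "fe_factor holomorphic_on {s. Re s < 1}"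
  unfolding fe_factor_def using q_gt_2
  by (intro holomorphic_intros) (auto elim!: nonpos_Ints_cases simp: complex_eq_iff)

lemma L_left_holomorphic: "L_left holomorphic_on {s. Re s < 0}"
proof -
  interpret C: odd_primitive_character q "cnj \<circ> chi" by (rule cnj_character)
  have "(\<lambda>s. C.dirichlet_series (1 - s)) holomorphic_on {s. Re s < 0}"
  proof -
    have "(C.dirichlet_series \<circ> (\<lambda>s. 1 - s)) holomorphic_on {s. Re s < 0}"
      by (rule holomorphic_on_compose_gen[OF _ C.dirichlet_series_holomorphic]) (auto intro!: holomorphic_intros)
    then show ?thesis unfolding comp_def[of C.dirichlet_series] .
  qed
  moreover have "fe_factor holomorphic_on {s. Re s < 0}"
    by (rule holomorphic_on_subset[OF fe_factor_holomorphic]) auto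
  ultimately show ?thesis unfolding L_left_def by (intro holomorphic_intros)
qed

lemma rGamma_real: "rGamma (complex_of_real x + 1) = of_real (1 / Gamma (1 + x))"
proof -
  have "complex_of_real x + 1 = of_real (1 + x)" by simp
  then show ?thesis
    by (simp only: rGamma_inverse_Gamma Gamma_complex_of_real divide_inverse of_real_inverse mult_1)
qed

lemma L_right_eq_dirichlet_series:
  assumes "Re s > 1"
  shows "L_right s = dirichlet_series s"
proof (rule holomorphic_eq_on_real_segment[where f = L_right and g = dirichlet_series and S = "{s. Re s > 1}" and a = 1 and b = 2 and z = s])
  show "L_right holomorphic_on {s. Re s > 1}"
    by (rule holomorphic_on_subset[OF L_right_holomorphic]) auto
  fix x :: real assume "1 < x" "x < 2"
  have "Gamma (1 + x) \<noteq> 0" using Gamma_real_pos[of "1 + x"] \<open>1 < x\<close> by linarith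
  then have "rGamma (of_real x + 1) * of_real (Gamma (x + 1)) = (1 :: complex)"
    unfolding rGamma_real of_real_mult[symmetric] by (simp add: add.commute)
  then show "L_right (of_real x) = dirichlet_series (of_real x)"
    unfolding L_right_def mellin_eq_dirichlet_series[OF \<open>1 < x\<close>] by (simp flip: mult.assoc)
qed (use assms in \<open>auto intro!: dirichlet_series_holomorphic open_halfspace_Re_gt convex_connected convex_halfspace_Re_gt\<close>)

lemma L_right_eq_L_left:
  assumes "Re s > -1" "Re s < 0"
  shows "L_right s = L_left s"
proof -
  let ?S = "{s. Re s > -1} \<inter> {s. Re s < 0}"
  show ?thesis
  proof (rule holomorphic_eq_on_real_segment[where f = L_right and g = L_left and S = ?S and a = "-1" and b = 0 and z = s])
    show "open ?S" by (intro open_Int open_halfspace_Re_gt open_halfspace_Re_lt)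
    show "connected ?S" by (intro convex_connected convex_Int convex_halfspace_Re_gt convex_halfspace_Re_lt)
    show "L_right holomorphic_on ?S" by (rule holomorphic_on_subset[OF L_right_holomorphic]) auto
    show "L_left holomorphic_on ?S" by (rule holomorphic_on_subset[OF L_left_holomorphic]) auto
    show "s \<in> ?S" using assms by simp
    fix x :: real assume x: "-1 < x" "x < 0"
    then show "complex_of_real x \<in> ?S" by simp
    define D where "D = odd_primitive_character.dirichlet_series (cnj \<circ> chi) (1 - of_real x)"
    define \<tau> where "\<tau> = cnj (gauss_sum q chi)"
    have \<tau>: "\<tau> \<noteq> 0" using gauss_sum_nonzero by (simp add: \<tau>_def)
    have G: "Gamma (1 + x) > 0" using x by (intro Gamma_real_pos) auto
    have G1: "Gamma (1 - complex_of_real x) = of_real (Gamma (1 - x))"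
      by (metis Gamma_complex_of_real of_real_1 of_real_diff)
    have co: "cos (complex_of_real pi * of_real x / 2) = of_real (cos (pi * x / 2))"
      by (simp add: cos_of_real[symmetric])
    have pw: "complex_of_real (2 * pi / q) powr (of_real x - 1) = of_real ((2 * pi / q) powr (x - 1))"
      using q_gt_2 powr_of_real[of "2 * pi / q" "x - 1"] by (simp del: of_real_divide of_real_mult)
    have mel: "\<i> * \<tau> * mellin (of_real x) = of_real (2 * (Gamma (1 + x) * Gamma (1 - x) * cos (pi * x / 2)) * (2 * pi / q) powr (x - 1)) * D"
      using mellin_strip[OF x] unfolding Gamma_double_angle[OF x] D_def \<tau>_def .
    have "mellin (of_real x) = (-\<i> / \<tau>) * (of_real (2 * (Gamma (1 + x) * Gamma (1 - x) * cos (pi * x / 2)) * (2 * pi / q) powr (x - 1)) * D)"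
    proof -
      have "mellin (of_real x) = (-\<i> / \<tau>) * (\<i> * \<tau> * mellin (of_real x))" using \<tau> by simp
      then show ?thesis by (simp only: mel)
    qed
    then have "L_right (of_real x) = of_real (1 / Gamma (1 + x)) * ((-\<i> / \<tau>) * (of_real (2 * (Gamma (1 + x) * Gamma (1 - x) * cos (pi * x / 2)) * (2 * pi / q) powr (x - 1)) * D))"
      by (simp only: L_right_def rGamma_real)
    also have "\<dots> = (-2 * \<i> / \<tau>) * of_real (Gamma (1 - x)) * of_real (cos (pi * x / 2)) * of_real ((2 * pi / q) powr (x - 1)) * D"
      using G by simp
    also have "\<dots> = L_left (of_real x)"
      unfolding L_left_def fe_factor_def G1 co pw D_def[symmetric] \<tau>_def[symmetric] ..
    finally show "L_right (of_real x) = L_left (of_real x)" .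
  qed simp
qed

definition L_glued :: "complex \<Rightarrow> complex" where
  "L_glued s = (if Re s > -1 then L_right s else L_left s)"

text \<open>The half-planes Re s > -1 and Re s < 0 cover the plane, and the two formulas agree on
  the strip where they overlap.\<close>

lemma L_glued_holomorphic: "L_glued holomorphic_on UNIV"
proof -
  have "L_glued holomorphic_on {s. Re s > -1}"
    by (rule holomorphic_transform[OF L_right_holomorphic]) (auto simp: L_glued_def)
  moreover have "L_glued holomorphic_on {s. Re s < 0}"
    by (rule holomorphic_transform[OF L_left_holomorphic]) (auto simp: L_glued_def L_right_eq_L_left)
  ultimately have "L_glued holomorphic_on ({s. Re s > -1} \<union> {s. Re s < 0})"
    by (intro holomorphic_on_Un open_halfspace_Re_gt open_halfspace_Re_lt)
  moreover have "{s. Re s > -1} \<union> {s. Re s < 0} = (UNIV :: complex set)" by auto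
  ultimately show ?thesis by simp
qed

text \<open>The description in \<open>dirichlet_L\<close> selects a function only once existence is
  known; uniqueness is analytic continuation from Re s > 1.\<close>

lemma dirichlet_L_eq_glued: "dirichlet_L chi = L_glued"
  unfolding dirichlet_L_def
proof (rule the_equality)
  show "L_glued holomorphic_on UNIV \<and>
    (\<forall>s. 1 < Re s \<longrightarrow> (\<lambda>n. chi (Suc n) / of_nat (Suc n) powr s) sums L_glued s)"
    using L_glued_holomorphic dirichlet_series_sums by (auto simp: L_glued_def L_right_eq_dirichlet_series)
  fix f assume f: "f holomorphic_on UNIV \<and>
    (\<forall>s. 1 < Re s \<longrightarrow> (\<lambda>n. chi (Suc n) / of_nat (Suc n) powr s) sums f s)"
  show "f = L_glued"
  proof
    fix s
    show "f s = L_glued s"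
    proof (rule analytic_continuation_open[where f = f and g = L_glued and z = s and s = "{s. Re s > 1}" and s' = UNIV])
      fix z assume "z \<in> {s. 1 < Re s}"
      then have z: "Re z > 1" by simp
      then have "f z = dirichlet_series z" using f dirichlet_series_sums[OF z] sums_unique2 by blast
      then show "f z = L_glued z" using z by (simp add: L_glued_def L_right_eq_dirichlet_series)
    next
      have "2 \<in> {s::complex. 1 < Re s}" by simp
      then show "{s::complex. 1 < Re s} \<noteq> {}" by blast
    qed (use f L_glued_holomorphic in \<open>auto intro: open_halfspace_Re_gt\<close>)
  qed
qed

lemma dirichlet_L_holomorphic: "dirichlet_L chi holomorphic_on UNIV"
  by (simp add: dirichlet_L_eq_glued L_glued_holomorphic)

lemma dirichlet_L_sums:
  "Re s > 1 \<Longrightarrow> (\<lambda>n. chi (Suc n) / of_nat (Suc n) powr s) sums dirichlet_L chi s"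
  using dirichlet_series_sums by (simp add: dirichlet_L_eq_glued L_glued_def L_right_eq_dirichlet_series)

lemma dirichlet_L_mellin: "Re s > -1 \<Longrightarrow> dirichlet_L chi s = rGamma (s + 1) * mellin s"
  by (simp add: dirichlet_L_eq_glued L_glued_def L_right_def)

text \<open>For Re s < 0 this is the construction of the continuation. It is extended to Re s < 1,
  where the factor is still holomorphic, in order to include s = 0, the point that belongs to
  \<open>k = 0\<close>.\<close>

theorem dirichlet_L_functional_equation:
  assumes "Re s < 1"
  shows "dirichlet_L chi s = fe_factor s * dirichlet_L (cnj \<circ> chi) (1 - s)"
proof -
  interpret C: odd_primitive_character q "cnj \<circ> chi" by (rule cnj_character)
  show ?thesis
  proof (rule analytic_continuation_open[where f = "dirichlet_L chi" and z = s
        and g = "\<lambda>s. fe_factor s * dirichlet_L (cnj \<circ> chi) (1 - s)" and s = "{s. Re s < 0}" and s' = "{s. Re s < 1}"])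
    show "connected {s. Re s < 1}" by (intro convex_connected convex_halfspace_Re_lt)
    show "dirichlet_L chi holomorphic_on {s. Re s < 1}"
      by (rule holomorphic_on_subset[OF dirichlet_L_holomorphic]) auto
    have "(\<lambda>s. dirichlet_L (cnj \<circ> chi) (1 - s)) holomorphic_on {s. Re s < 1}"
    proof -
      have "(dirichlet_L (cnj \<circ> chi) \<circ> (\<lambda>s. 1 - s)) holomorphic_on {s. Re s < 1}"
        by (rule holomorphic_on_compose_gen[OF _ C.dirichlet_L_holomorphic]) (auto intro!: holomorphic_intros)
      then show ?thesis unfolding comp_def[of "dirichlet_L (cnj \<circ> chi)"] .
    qed
    then show "(\<lambda>s. fe_factor s * dirichlet_L (cnj \<circ> chi) (1 - s)) holomorphic_on {s. Re s < 1}"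
      by (intro holomorphic_intros fe_factor_holomorphic)
    have "-1 \<in> {s::complex. Re s < 0}" by simp
    then show "{s::complex. Re s < 0} \<noteq> {}" by blast
    fix z assume "z \<in> {s. Re s < 0}"
    then have z: "Re z < 0" by simp
    then have "C.dirichlet_series (1 - z) = dirichlet_L (cnj \<circ> chi) (1 - z)"
      by (simp add: C.dirichlet_L_eq_glued C.L_glued_def C.L_right_eq_dirichlet_series)
    moreover have "dirichlet_L chi z = L_left z"
      using z by (auto simp: dirichlet_L_eq_glued L_glued_def L_right_eq_L_left)
    ultimately show "dirichlet_L chi z = fe_factor z * dirichlet_L (cnj \<circ> chi) (1 - z)"
      by (simp add: L_left_def)
  qed (use assms in \<open>auto intro: open_halfspace_Re_lt\<close>)
qed

end

section \<open>Summation over pairs and divisors\<close>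

lemma summable_on_product:
  fixes u :: "'a \<Rightarrow> real" and v :: "'b \<Rightarrow> real"
  assumes "u summable_on A" "v summable_on B" "\<And>a. a \<in> A \<Longrightarrow> u a \<ge> 0" "\<And>b. b \<in> B \<Longrightarrow> v b \<ge> 0"
  shows "(\<lambda>(a, b). u a * v b) summable_on A \<times> B"
proof (rule summable_on_SigmaI)
  show "((\<lambda>b. (case (a, b) of (a, b) \<Rightarrow> u a * v b)) has_sum u a * infsum v B) B" if "a \<in> A" for a
    using assms(2) by (auto intro!: has_sum_cmult_right)
  show "(\<lambda>a. u a * infsum v B) summable_on A" using assms(1) by (intro summable_on_cmult_left)
qed (use assms in auto)

lemma has_sum_Suc_iff:
  fixes f :: "nat \<Rightarrow> 'a :: real_normed_vector"
  assumes "f 0 = 0"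
  shows "((\<lambda>n. f (Suc n)) has_sum S) UNIV \<longleftrightarrow> (f has_sum S) UNIV"
proof -
  have 0: "n = 0" if "n \<notin> range Suc" for n using that by (cases n) auto
  have "(f has_sum S) UNIV \<longleftrightarrow> (f has_sum S) (range Suc)"
    by (rule has_sum_cong_neutral) (use 0 assms in auto)
  also have "\<dots> \<longleftrightarrow> ((\<lambda>n. f (Suc n)) has_sum S) UNIV"
    by (subst has_sum_reindex) (auto simp: o_def)
  finally show ?thesis ..
qed

lemma has_sum_divisors:
  fixes f :: "nat \<Rightarrow> nat \<Rightarrow> 'a :: banach"
  assumes "((\<lambda>(d, m). f d m) has_sum S) ({1..} \<times> {1..})"
  shows "((\<lambda>n. \<Sum>d | d dvd n. f d (n div d)) has_sum S) {1..}"
proof -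
  have "((\<lambda>(n, d). f d (n div d)) has_sum S) (SIGMA n:{1..}. {d. d dvd n})"
    using assms
    by (subst (asm) has_sum_reindex_bij_witness[of "{1..} \<times> {1..}" "\<lambda>(n, d). (d, n div d)" "\<lambda>(d, m). (d * m, d)"
          "SIGMA n:{1..}. {d. d dvd n}" "\<lambda>(n, d). f d (n div d)"])
       (auto simp: Suc_le_eq dvd_div_eq_0_iff elim!: dvdE intro!: Nat.gr0I)
  then show ?thesis
    by (rule has_sum_SigmaD) (auto intro!: has_sum_finiteI)
qed

lemma summable_on_powers_exp:
  assumes "t > 0"
  shows "(\<lambda>n. real n ^ p * exp (- (real n * t))) summable_on A"
proof -
  have "(\<lambda>n. real n ^ p * exp (- (real n * t))) summable_on UNIV"
    using summable_power_times_exp[OF assms, of p] by (subst summable_on_UNIV_nonneg_real_iff) auto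
  then show ?thesis by (rule summable_on_subset) auto
qed

text \<open>From (d - 1) (m - 1) >= 0 one gets d m >= d + m - 1, so the double series lies below a
  product of single ones; the factor exp t pays for the -1.\<close>

lemma summable_on_pairs_exp:
  assumes t: "t > 0"
  shows "(\<lambda>(d, m). real d ^ k * exp (- (real d * real m * t))) summable_on {1..} \<times> {1..}"
proof -
  have "(\<lambda>(d, m). (real d ^ k * exp (- (real d * t))) * (exp t * (real m ^ 0 * exp (- (real m * t))))) summable_on {1..} \<times> {1..}"
    by (intro summable_on_product summable_on_cmult_right summable_on_powers_exp t) auto
  then show ?thesis
  proof (rule summable_on_comparison_test)
    fix x :: "nat \<times> nat" assume x: "x \<in> {1..} \<times> {1..}"
    obtain d m where dm: "x = (d, m)" "d \<ge> 1" "m \<ge> 1" using x by auto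
    have "(real d - 1) * (real m - 1) \<ge> 0" using dm by (intro mult_nonneg_nonneg) auto
    then have "real d + real m - 1 \<le> real d * real m" by (simp add: algebra_simps)
    then have "(real d + real m - 1) * t \<le> real d * real m * t" using t by (intro mult_right_mono) auto
    then have "exp (- (real d * real m * t)) \<le> exp (- (real d * t)) * (exp t * exp (- (real m * t)))"
      unfolding exp_add[symmetric] by (simp add: algebra_simps)
    then have "real d ^ k * exp (- (real d * real m * t)) \<le> real d ^ k * (exp (- (real d * t)) * (exp t * exp (- (real m * t))))"
      by (intro mult_left_mono) auto
    then show "(case x of (d, m) \<Rightarrow> real d ^ k * exp (- (real d * real m * t))) \<le>
        (case x of (d, m) \<Rightarrow> (real d ^ k * exp (- (real d * t))) * (exp t * (real m ^ 0 * exp (- (real m * t)))))"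
      by (simp add: dm mult_ac)
  qed auto
qed

section \<open>The Eisenstein double sum\<close>

context odd_primitive_character
begin

text \<open>Under (x, r) -> (- x, - r) both the character value and the odd power
  \<open>Suc k\<close> change sign, so the partial fractions do not see the sign of
  \<open>x\<close>.\<close>

lemma chi_series_partial_fractions_abs:
  assumes x: "x \<noteq> 0" and k: "even k" "k \<ge> 1"
  shows "((\<lambda>r. cnj (chi_int r) / (of_real x + freq r) ^ Suc k) has_sum
            cnj (gauss_sum q chi) / fact k * chi_series k \<bar>x\<bar>) UNIV"
proof (cases "x > 0")
  case True
  then show ?thesis using chi_series_partial_fractions[OF _ k(2), of x] by simp
next
  case False
  then have x': "- x > 0" using x by simp
  have "((\<lambda>r. cnj (chi_int r) / (of_real (- x) + freq r) ^ Suc k) has_sum cnj (gauss_sum q chi) / fact k * chi_series k (- x)) UNIV"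
    by (rule chi_series_partial_fractions[OF x' k(2)])
  then have "((\<lambda>r. cnj (chi_int (- r)) / (of_real (- x) + freq (- r)) ^ Suc k) has_sum cnj (gauss_sum q chi) / fact k * chi_series k (- x)) UNIV"
    by (subst has_sum_reindex_bij_witness[of UNIV uminus uminus UNIV]) auto
  moreover have "cnj (chi_int (- r)) / (of_real (- x) + freq (- r)) ^ Suc k = cnj (chi_int r) / (of_real x + freq r) ^ Suc k" for r
  proof -
    have "of_real (- x) + freq (- r) = - (of_real x + freq r)" by (simp add: freq_uminus)
    then have "(of_real (- x) + freq (- r)) ^ Suc k = - ((of_real x + freq r) ^ Suc k)"
      using k(1) by (simp only: power_minus_odd[of "Suc k"] even_Suc not_not)
    then show ?thesis by (simp only: chi_int_uminus) simp
  qed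
  ultimately show ?thesis using False by simp
qed

text \<open>The modulus of the denominator's base is at least |m y + w| and at least a multiple of
  |r| + 1. Of its k + 1 powers, 3/2 are spent on each of these two bounds, which makes both sums
  converge, and the remaining k - 2 are estimated by \<open>\<delta>\<close>; this requires
  \<open>k >= 2\<close>. The index set \<open>M\<close> is kept general so that m = 0 can be left
  out when w = 0.\<close>

lemma double_sum_interchange:
  fixes w y \<delta> :: real and M :: "int set"
  assumes k: "even k" "k \<ge> 2" and \<delta>: "\<delta> > 0" "\<And>m. m \<in> M \<Longrightarrow> \<bar>of_int m * y + w\<bar> \<ge> \<delta>"
    and sm: "(\<lambda>m. \<bar>of_int m * y + w\<bar> powr (-3/2)) summable_on M"
    and g: "\<And>r. ((\<lambda>m. cnj (chi_int r) / (of_real (of_int m * y + w) + freq r) ^ Suc k) has_sum g r) M"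
  obtains T where "(g has_sum T) UNIV"
    "((\<lambda>m. cnj (gauss_sum q chi) / fact k * chi_series k \<bar>of_int m * y + w\<bar>) has_sum T) M"
proof -
  define f where "f m r = cnj (chi_int r) / (of_real (of_int m * y + w) + freq r) ^ Suc k" for m r
  have bound: "norm (f m r) \<le> (1 / \<delta> ^ (k - 2)) * \<bar>of_int m * y + w\<bar> powr (-3/2) * (real q powr (3/2) * (of_int \<bar>r\<bar> + 1) powr (-3/2))"
    if "m \<in> M" for m r
  proof (cases "r = 0")
    case False
    define X where "X = norm (of_real (of_int m * y + w) + freq r)"
    define x where "x = \<bar>of_int m * y + w\<bar>"
    define z where "z = (of_int \<bar>r\<bar> + 1) / real q"
    have pm: "a powr (-3/2) = 1 / a powr (3/2)" for a :: real
      using powr_minus_divide[of a "3/2"] by simp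
    have z: "z > 0" using q_gt_2 by (simp add: z_def)
    have x: "x \<ge> \<delta>" using \<delta>(2)[OF that] by (simp add: x_def)
    have "x \<le> X" using abs_Re_le_cmod[of "of_real (of_int m * y + w) + freq r"]
      by (simp add: X_def x_def freq_def)
    have "z \<le> X" unfolding X_def z_def by (rule norm_plus_freq_ge'[OF False])
    have X: "X > 0" using z \<open>z \<le> X\<close> by linarith
    have "Suc k = (k - 2) + 3" using k(2) by simp
    then have "X ^ Suc k = X ^ (k - 2) * X ^ 3" by (metis power_add)
    also have "X ^ 3 = X powr (3/2) * X powr (3/2)"
      using X by (simp add: powr_add[symmetric] flip: powr_numeral)
    finally have "X ^ Suc k = X ^ (k - 2) * (X powr (3/2) * X powr (3/2))" .
    moreover have "\<delta> ^ (k - 2) * (x powr (3/2) * z powr (3/2)) \<le> X ^ (k - 2) * (X powr (3/2) * X powr (3/2))"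
      using \<delta>(1) x z \<open>x \<le> X\<close> \<open>z \<le> X\<close> by (intro mult_mono power_mono powr_mono2) auto
    ultimately have le: "\<delta> ^ (k - 2) * (x powr (3/2) * z powr (3/2)) \<le> X ^ Suc k" by simp
    have pos: "\<delta> ^ (k - 2) * (x powr (3/2) * z powr (3/2)) > 0" using \<delta>(1) x z by auto
    have "norm (f m r) \<le> 1 / X ^ Suc k"
      unfolding f_def norm_divide norm_power X_def complex_mod_cnj
      by (intro divide_right_mono norm_chi_int_le_1) auto
    also have "\<dots> \<le> 1 / (\<delta> ^ (k - 2) * (x powr (3/2) * z powr (3/2)))"
      using le by (intro divide_left_mono mult_pos_pos[OF zero_less_power[OF X] pos]) auto
    also have "\<dots> = (1 / \<delta> ^ (k - 2)) * x powr (-3/2) * z powr (-3/2)"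
      unfolding pm by simp
    also have "z powr (-3/2) = real q powr (3/2) * (of_int \<bar>r\<bar> + 1) powr (-3/2)"
      unfolding pm z_def using q_gt_2 by (simp add: powr_divide)
    finally show ?thesis by (simp add: x_def)
  qed (use \<delta>(1) in \<open>auto simp: f_def\<close>)
  have sum1: "(\<lambda>(m, r). (1 / \<delta> ^ (k - 2)) * \<bar>of_int m * y + w\<bar> powr (-3/2) * (real q powr (3/2) * (of_int \<bar>r\<bar> + 1) powr (-3/2)))
      summable_on M \<times> UNIV"
  proof (rule summable_on_product)
    show "(\<lambda>r::int. real q powr (3/2) * (of_int \<bar>r\<bar> + 1) powr (-3/2)) summable_on UNIV"
      using summable_on_int_powr[of "3/2"] by (intro summable_on_cmult_right) simp
    show "(\<lambda>m. (1 / \<delta> ^ (k - 2)) * \<bar>of_int m * y + w\<bar> powr (-3/2)) summable_on M"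
      by (intro summable_on_cmult_right sm)
  qed (use \<delta>(1) in auto)
  have "(\<lambda>x. norm (case x of (m, r) \<Rightarrow> f m r)) summable_on M \<times> UNIV"
    by (rule Infinite_Sum.abs_summable_on_comparison_test'[OF sum1]) (use bound in auto)
  then have "(\<lambda>(m, r). f m r) summable_on M \<times> UNIV" by (rule abs_summable_summable)
  then obtain T where T: "((\<lambda>(m, r). f m r) has_sum T) (M \<times> UNIV)" by (auto simp: summable_on_def)
  show ?thesis
  proof (rule that)
    show "((\<lambda>m. cnj (gauss_sum q chi) / fact k * chi_series k \<bar>of_int m * y + w\<bar>) has_sum T) M"
    proof (rule has_sum_SigmaD[OF T])
      fix m assume "m \<in> M"
      then have nz: "of_int m * y + w \<noteq> 0" using \<delta> by fastforce
      show "((\<lambda>r. case (m, r) of (m, r) \<Rightarrow> f m r) has_sum cnj (gauss_sum q chi) / fact k * chi_series k \<bar>of_int m * y + w\<bar>) UNIV"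
        unfolding f_def prod.case by (rule chi_series_partial_fractions_abs[OF nz k(1)]) (use k(2) in simp)
    qed
    have "((\<lambda>(r, m). f m r) has_sum T) (UNIV \<times> M)"
      using T by (subst (asm) has_sum_swap) simp
    then show "(g has_sum T) UNIV"
      by (rule has_sum_SigmaD) (use g in \<open>simp add: f_def\<close>)
  qed
qed

text \<open>The row r = n > 0 of the double sum, after summation over m by the Lipschitz formula at
  z = (w + i \<open>ang_freq n\<close>) / y. The shift \<open>w\<close> enters only as a phase, and
  4 pi^2 / (q y) is the dual variable.\<close>

definition fourier_term :: "nat \<Rightarrow> real \<Rightarrow> nat \<Rightarrow> real \<Rightarrow> complex" where
  "fourier_term k y n w = cnj (chi n) * ((-2 * of_real pi * \<i> / of_real y) ^ Suc k / fact k *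
      (\<Sum>j. of_nat j ^ k * (exp (2 * of_real pi * \<i> * of_real w / of_real y) *
          of_real (exp (- (real n * (4 * pi\<^sup>2 / (real q * y)))))) ^ j))"

lemma lipschitz_row:
  assumes y: "y > 0" and n: "n > 0" and k: "k \<ge> 1"
  shows "((\<lambda>m::int. cnj (chi n) / (of_real (of_int m * y + w) + freq (int n)) ^ Suc k) has_sum fourier_term k y n w) UNIV"
proof -
  define z where "z = (of_real w + \<i> * of_real (ang_freq n)) / of_real y"
  have Im: "Im z > 0" using y ang_freq_pos[OF n] by (simp add: z_def Im_divide_of_real)
  have ex: "exp (2 * of_real pi * \<i> * z) = exp (2 * of_real pi * \<i> * of_real w / of_real y) *
          of_real (exp (- (real n * (4 * pi\<^sup>2 / (real q * y)))))"
  proof -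
    have "2 * of_real pi * \<i> * z = 2 * of_real pi * \<i> * of_real w / of_real y + of_real (- (real n * (4 * pi\<^sup>2 / (real q * y))))"
      using y q_gt_2 by (simp add: z_def ang_freq_def field_simps power2_eq_square)
    then show ?thesis by (simp only: exp_add exp_of_real)
  qed
  have "((\<lambda>m::int. (cnj (chi n) / of_real y ^ Suc k) * (1 / (z + of_int m) ^ Suc k)) has_sum
     (cnj (chi n) / of_real y ^ Suc k) * ((-2 * of_real pi * \<i>) ^ Suc k / fact k * (\<Sum>j. of_nat j ^ k * exp (2 * of_real pi * \<i> * z) ^ j))) UNIV"
    by (rule has_sum_cmult_right[OF lipschitz_summation[OF Im k]])
  also have "(cnj (chi n) / of_real y ^ Suc k) * ((-2 * of_real pi * \<i>) ^ Suc k / fact k * (\<Sum>j. of_nat j ^ k * exp (2 * of_real pi * \<i> * z) ^ j)) = fourier_term k y n w"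
    unfolding fourier_term_def ex power_divide by simp
  also have "(\<lambda>m::int. (cnj (chi n) / of_real y ^ Suc k) * (1 / (z + of_int m) ^ Suc k)) =
     (\<lambda>m. cnj (chi n) / (of_real (of_int m * y + w) + freq (int n)) ^ Suc k)"
  proof
    fix m :: int
    have "of_real (of_int m * y + w) + freq (int n) = of_real y * (z + of_int m)"
      using y by (simp add: z_def freq_of_nat field_simps)
    then show "(cnj (chi n) / of_real y ^ Suc k) * (1 / (z + of_int m) ^ Suc k) =
        cnj (chi n) / (of_real (of_int m * y + w) + freq (int n)) ^ Suc k"
      by (simp only: power_mult_distrib) simp
  qed
  finally show ?thesis .
qed

text \<open>Replacing m by - m negates the base of the odd power, and the oddness of the character
  absorbs the sign; only \<open>w\<close> is left negated.\<close>

lemma lipschitz_row_uminus: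
  assumes y: "y > 0" and n: "n > 0" and k: "k \<ge> 1" "even k"
  shows "((\<lambda>m::int. cnj (chi_int (- int n)) / (of_real (of_int m * y + w) + freq (- int n)) ^ Suc k) has_sum fourier_term k y n (- w)) UNIV"
proof -
  have "((\<lambda>m::int. cnj (chi n) / (of_real (of_int m * y - w) + freq (int n)) ^ Suc k) has_sum fourier_term k y n (- w)) UNIV"
    using lipschitz_row[OF y n k(1), of "- w"] by simp
  then have "((\<lambda>m::int. cnj (chi n) / (of_real (of_int (- m) * y - w) + freq (int n)) ^ Suc k) has_sum fourier_term k y n (- w)) UNIV"
    by (subst has_sum_reindex_bij_witness[of UNIV uminus uminus UNIV]) auto
  moreover have "cnj (chi n) / (of_real (of_int (- m) * y - w) + freq (int n)) ^ Suc k =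
      cnj (chi_int (- int n)) / (of_real (of_int m * y + w) + freq (- int n)) ^ Suc k" for m
  proof -
    have "of_real (of_int (- m) * y - w) + freq (int n) = - (of_real (of_int m * y + w) + freq (- int n))"
      by (simp add: freq_uminus)
    then have "(of_real (of_int (- m) * y - w) + freq (int n)) ^ Suc k = - ((of_real (of_int m * y + w) + freq (- int n)) ^ Suc k)"
      using k(2) by (simp only: power_minus_odd[of "Suc k"] even_Suc not_not)
    then show ?thesis by (simp only: chi_int_uminus chi_int_of_nat) simp
  qed
  ultimately show ?thesis by simp
qed

definition row :: "nat \<Rightarrow> real \<Rightarrow> real \<Rightarrow> int \<Rightarrow> complex" where
  "row k y w r = (if r > 0 then fourier_term k y (nat r) w else if r < 0 then fourier_term k y (nat (- r)) (- w) else 0)"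

lemma row_has_sum:
  assumes y: "y > 0" and k: "k \<ge> 1" "even k"
  shows "((\<lambda>m::int. cnj (chi_int r) / (of_real (of_int m * y + w) + freq r) ^ Suc k) has_sum row k y w r) UNIV"
proof -
  consider n where "n > 0" "r = int n" | n where "n > 0" "r = - int n" | "r = 0"
    by (metis linorder_neqE_linordered_idom neg_0_less_iff_less of_nat_0_less_iff zero_less_imp_eq_int minus_minus)
  then show ?thesis
  proof cases
    case 1
    then show ?thesis using lipschitz_row[OF y 1(1) k(1), of w] by (simp add: row_def)
  next
    case 2
    then show ?thesis using lipschitz_row_uminus[OF y 2(1) k, of w] by (simp add: row_def)
  qed (auto simp: row_def)
qed

lemma row_pairs:
  assumes "(row k y w has_sum T) UNIV"
  shows "((\<lambda>n. fourier_term k y n w + fourier_term k y n (- w)) has_sum T) UNIV"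
proof -
  have "((\<lambda>n. row k y w (int n) + row k y w (- int n)) has_sum T) UNIV"
    by (rule has_sum_int_pairs[OF assms]) (simp add: row_def)
  moreover have "row k y w (int n) + row k y w (- int n) = fourier_term k y n w + fourier_term k y n (- w)" for n
    by (cases "n = 0") (auto simp: row_def fourier_term_def)
  ultimately show ?thesis by simp
qed

text \<open>A shift strictly between two lattice points keeps \<open>of_int m * y + w\<close> away
  from 0, so no term has to be removed.\<close>

lemma poisson_interior:
  assumes w: "0 < w" "w < y" and k: "even k" "k \<ge> 2"
  obtains T where "((\<lambda>m::int. cnj (gauss_sum q chi) / fact k * chi_series k \<bar>of_int m * y + w\<bar>) has_sum T) UNIV"
    "((\<lambda>n. fourier_term k y n w + fourier_term k y n (- w)) has_sum T) UNIV"
proof -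
  have y: "y > 0" using w by simp
  \<comment> \<open>Half the distance from \<open>w\<close> to the nearer end point: for m = - n < 0
    the distance is at least 2 n \<open>\<delta>\<close>, and 2 n >= n + 1.\<close>
  define \<delta> where "\<delta> = min w (y - w) / 2"
  have \<delta>: "\<delta> > 0" "2 * \<delta> \<le> w" "2 * \<delta> \<le> y - w" using w by (auto simp: \<delta>_def)
  have ge: "\<bar>of_int m * y + w\<bar> \<ge> \<delta> * (of_int \<bar>m\<bar> + 1)" for m :: int
  proof (cases "m \<ge> 0")
    case True
    have "of_int m * \<delta> \<le> of_int m * y" using True \<delta> w by (intro mult_left_mono) auto
    then have "of_int m * \<delta> + \<delta> \<le> of_int m * y + w" using \<delta> by linarith
    then show ?thesis using True by (simp add: algebra_simps)
  next
    case False
    define n where "n = real_of_int (- m)"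
    have n: "n \<ge> 1" using False by (simp add: n_def)
    have "(n - 1) * (2 * \<delta>) \<le> (n - 1) * y" using n \<delta> w by (intro mult_left_mono) auto
    then have "n * (2 * \<delta>) \<le> n * y - w" using \<delta> by (simp add: algebra_simps)
    moreover have "\<delta> * (n + 1) \<le> n * (2 * \<delta>)" using n \<delta>(1) by (simp add: algebra_simps)
    ultimately have "\<delta> * (n + 1) \<le> \<bar>- n * y + w\<bar>" by simp
    moreover have "of_int \<bar>m\<bar> = n" "of_int m = - n" using False by (auto simp: n_def)
    ultimately show ?thesis by (simp only:)
  qed
  have ge': "\<bar>of_int m * y + w\<bar> \<ge> \<delta>" for m :: int
  proof -
    have "\<delta> * 1 \<le> \<delta> * (of_int \<bar>m\<bar> + 1)" using \<delta>(1) by (intro mult_left_mono) auto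
    then show ?thesis using ge[of m] by linarith
  qed
  have sm: "(\<lambda>m::int. \<bar>of_int m * y + w\<bar> powr (-3/2)) summable_on UNIV"
  proof (rule summable_on_comparison_test)
    show "(\<lambda>m::int. \<delta> powr (-3/2) * (of_int \<bar>m\<bar> + 1) powr (-3/2)) summable_on UNIV"
      using summable_on_int_powr[of "3/2"] by (intro summable_on_cmult_right) simp
    fix m :: int
    have "\<bar>of_int m * y + w\<bar> powr (-3/2) \<le> (\<delta> * (of_int \<bar>m\<bar> + 1)) powr (-3/2)"
      using ge[of m] \<delta>(1) by (intro powr_mono2') auto
    then show "\<bar>of_int m * y + w\<bar> powr (-3/2) \<le> \<delta> powr (-3/2) * (of_int \<bar>m\<bar> + 1) powr (-3/2)"
      by (simp add: powr_mult)
  qed auto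
  have k1: "k \<ge> 1" using k by simp
  show ?thesis
    by (rule double_sum_interchange[OF k \<delta>(1) ge' sm row_has_sum[OF y k1 k(1)]])
       (use that row_pairs in blast)
qed

lemma dirichlet_L_has_sum:
  assumes p: "p \<ge> 2"
  shows "((\<lambda>n. chi (Suc n) / of_nat (Suc n) ^ p) has_sum dirichlet_L chi (of_nat p)) UNIV"
proof -
  have eq: "of_nat (Suc n) powr (of_nat p :: complex) = of_nat (Suc n) ^ p" for n
    by (rule powr_nat') (use p in auto)
  have "(\<lambda>n. chi (Suc n) / of_nat (Suc n) ^ p) sums dirichlet_L chi (of_nat p)"
    using dirichlet_L_sums[of "of_nat p"] p unfolding eq by simp
  moreover have "summable (\<lambda>n. norm (chi (Suc n) / of_nat (Suc n) ^ p))"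
  proof (rule summable_comparison_test')
    show "summable (\<lambda>n. real (Suc n) powr (- real p))" using p by (intro summable_Suc_powr) auto
    show "norm (norm (chi (Suc n) / of_nat (Suc n) ^ p)) \<le> real (Suc n) powr (- real p)" for n
      using norm_dirichlet_term_le[of n "of_nat p"] unfolding eq by simp
  qed
  ultimately show ?thesis by (rule norm_summable_imp_has_sum[rotated])
qed

text \<open>The sign of the cosine at - pi k / 2 combines with i^(k + 1). The value is stated in the
  shape in which it meets the terms m = 0 of the double sum, and so turns L (k + 1) of the conjugate
  character into L (- k, chi).\<close>

lemma fe_factor_neg_even:
  assumes "even k"
  shows "fe_factor (- of_nat k) = fact k / cnj (gauss_sum q chi) * (2 / (2 * of_real pi * \<i> / of_nat q) ^ Suc k)"
proof -
  obtain l where k: "k = 2 * l" using assms by blast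
  have G: "Gamma (1 - - of_nat k :: complex) = fact k" using Gamma_fact[of k, where 'a = complex] by simp
  have co: "cos (complex_of_real pi * (- of_nat k) / 2) = (-1) ^ l"
  proof -
    have "cos (complex_of_real pi * (- of_nat k) / 2) = cos (of_real (real l * pi))"
    proof -
      have "complex_of_real pi * (- of_nat k) / 2 = - of_real (real l * pi)" by (simp add: k)
      then show ?thesis by (simp only: cos_minus)
    qed
    also have "\<dots> = of_real (cos (real l * pi))" by (rule cos_of_real)
    also have "cos (real l * pi) = (-1) ^ l" by (rule cos_npi)
    finally show ?thesis by simp
  qed
  define x where "x = 2 * pi / real q"
  have x: "x > 0" using q_gt_2 by (simp add: x_def)
  have pw: "of_real x powr (- of_nat k - 1) = (1 / of_real x ^ Suc k :: complex)"
  proof -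
    have "- of_nat k - 1 = (- of_nat (Suc k) :: complex)" by simp
    then have "of_real x powr (- of_nat k - 1) = (of_real x powr (- of_nat (Suc k)) :: complex)" by (simp only:)
    also have "\<dots> = 1 / of_real x powr of_nat (Suc k)" by (simp only: powr_minus divide_inverse mult_1)
    also have "of_real x powr of_nat (Suc k) = (of_real x ^ Suc k :: complex)" by (rule powr_nat') (use x in auto)
    finally show ?thesis .
  qed
  have xi: "2 * of_real pi * \<i> / of_nat q = \<i> * of_real x" by (simp add: x_def)
  have ik: "\<i> ^ Suc k = (-1) ^ l * \<i>" by (simp add: k power_mult)
  have "-2 * \<i> / \<tau> * F * (-1) ^ l * (1 / X) = F / \<tau> * (2 / ((-1) ^ l * \<i> * X))" if "\<tau> \<noteq> 0" "X \<noteq> 0" for F X \<tau> :: complex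
    using that by (cases "even l") (auto simp: field_simps)
  then show ?thesis
    unfolding fe_factor_def G co x_def[symmetric] pw xi power_mult_distrib ik
    using gauss_sum_nonzero x by simp
qed

text \<open>At w = 0 the terms with m = 0 have no counterpart among the values of
  \<open>chi_series\<close>. They are removed, and their sum over r is a multiple of L (k + 1) of
  the conjugate character, hence of L (- k, chi). Both the sum over m and the sum over r are even,
  so everything is halved at the end.\<close>

lemma poisson_origin:
  assumes y: "0 < y" and k: "even k" "k \<ge> 2"
  obtains T where "((\<lambda>m. cnj (gauss_sum q chi) / fact k * chi_series k (real (Suc m) * y)) has_sum T) UNIV"
    "((\<lambda>n. fourier_term k y n 0) has_sum (T + cnj (gauss_sum q chi) / fact k * dirichlet_L chi (- of_nat k) / 2)) UNIV"
proof -
  have k1: "k \<ge> 1" using k by simp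
  have ge': "\<bar>of_int m * y + 0\<bar> \<ge> y" if "m \<in> UNIV - {0}" for m :: int
  proof -
    have "1 * y \<le> of_int \<bar>m\<bar> * y" using that y by (intro mult_right_mono) auto
    then show ?thesis using y by (simp add: abs_mult)
  qed
  have sm: "(\<lambda>m::int. \<bar>of_int m * y + 0\<bar> powr (-3/2)) summable_on UNIV - {0}"
  proof (rule summable_on_comparison_test)
    show "(\<lambda>m::int. (y / 2) powr (-3/2) * (of_int \<bar>m\<bar> + 1) powr (-3/2)) summable_on UNIV - {0}"
      using summable_on_int_powr[of "3/2"] by (intro summable_on_cmult_right) (rule summable_on_subset, auto)
    fix m :: int assume m: "m \<in> UNIV - {0}"
    have "(y / 2) * (of_int \<bar>m\<bar> + 1) \<le> (y / 2) * (2 * of_int \<bar>m\<bar>)" using m y by (intro mult_left_mono) auto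
    then have "\<bar>of_int m * y + 0\<bar> powr (-3/2) \<le> ((y / 2) * (of_int \<bar>m\<bar> + 1)) powr (-3/2)"
      using y by (intro powr_mono2') (auto simp: abs_mult mult_ac)
    then show "\<bar>of_int m * y + 0\<bar> powr (-3/2) \<le> (y / 2) powr (-3/2) * (of_int \<bar>m\<bar> + 1) powr (-3/2)"
      by (simp only: powr_mult)
  qed auto
  \<comment> \<open>The term m = 0 of the row r, which the full row sum contains but the restricted
    double sum does not.\<close>
  define h where "h r = cnj (chi_int r) / freq r ^ Suc k" for r
  have g: "((\<lambda>m::int. cnj (chi_int r) / (of_real (of_int m * y + 0) + freq r) ^ Suc k) has_sum (row k y 0 r - h r)) (UNIV - {0})" for r
  proof -
    have "((\<lambda>m::int. cnj (chi_int r) / (of_real (of_int m * y + 0) + freq r) ^ Suc k) has_sum h r) {0}"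
      by (rule has_sum_finiteI) (auto simp: h_def)
    from has_sum_Diff[OF row_has_sum[OF y k1 k(1)] this] show ?thesis by simp
  qed
  obtain T where T: "((\<lambda>r. row k y 0 r - h r) has_sum T) UNIV"
    "((\<lambda>m::int. cnj (gauss_sum q chi) / fact k * chi_series k \<bar>of_int m * y + 0\<bar>) has_sum T) (UNIV - {0})"
    by (rule double_sum_interchange[OF k y ge' sm g])
  define e where "e m = (if m = 0 then 0 else cnj (gauss_sum q chi) / fact k * chi_series k \<bar>of_int m * y\<bar>)" for m :: int
  have "(e has_sum T) UNIV"
    using T(2) by (rule has_sum_cong_neutral[THEN iffD1, rotated -1]) (auto simp: e_def)
  from has_sum_int_pairs[OF this] have "((\<lambda>m. e (int m) + e (- int m)) has_sum T) UNIV" by (simp add: e_def)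
  then have "((\<lambda>m. e (int (Suc m)) + e (- int (Suc m))) has_sum T) UNIV"
    by (subst has_sum_Suc_iff[of "\<lambda>m. e (int m) + e (- int m)"]) (simp add: e_def)
  moreover have "e (int (Suc m)) + e (- int (Suc m)) = 2 * (cnj (gauss_sum q chi) / fact k * chi_series k (real (Suc m) * y))" for m
    using y by (simp add: e_def abs_mult del: of_nat_Suc)
  ultimately have T2: "((\<lambda>m. 2 * (cnj (gauss_sum q chi) / fact k * chi_series k (real (Suc m) * y))) has_sum T) UNIV"
    by (simp only:)
  have T2': "((\<lambda>m. cnj (gauss_sum q chi) / fact k * chi_series k (real (Suc m) * y)) has_sum T / 2) UNIV"
    using has_sum_cmult_right[OF T2, of "1/2"] by simp
  define H where "H = cnj (gauss_sum q chi) / fact k * dirichlet_L chi (- of_nat k)"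
  have h: "(h has_sum H) UNIV"
  proof -
    interpret C: odd_primitive_character q "cnj \<circ> chi" by (rule cnj_character)
    define c where "c = (2 * of_real pi * \<i> / of_nat q) ^ Suc k"
    define Lk where "Lk = dirichlet_L (cnj \<circ> chi) (of_nat (Suc k))"
    have "((\<lambda>n. (cnj (chi (Suc n)) / of_nat (Suc n) ^ Suc k) * (1 / c)) has_sum Lk * (1 / c)) UNIV"
      using has_sum_cmult_left[OF C.dirichlet_L_has_sum[of "Suc k"], of "1 / c"] k(2) unfolding Lk_def comp_apply by simp
    moreover have "(cnj (chi (Suc n)) / of_nat (Suc n) ^ Suc k) * (1 / c) = h (int (Suc n))" for n
    proof -
      have "freq (int (Suc n)) = (2 * of_real pi * \<i> / of_nat q) * of_nat (Suc n)" by (simp add: freq_def)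
      then have "freq (int (Suc n)) ^ Suc k = c * of_nat (Suc n) ^ Suc k" by (simp only: c_def power_mult_distrib)
      then show ?thesis by (simp only: h_def chi_int_of_nat) simp
    qed
    ultimately have 1: "((\<lambda>n. h (int (Suc n))) has_sum Lk * (1 / c)) UNIV" by (simp only:)
    have hm: "h (- r) = h r" for r
    proof -
      have "freq (- r) ^ Suc k = - (freq r ^ Suc k)"
        using k(1) by (simp only: freq_uminus power_minus_odd[of "Suc k"] even_Suc not_not)
      then show ?thesis by (simp only: h_def chi_int_uminus) simp
    qed
    have "((\<lambda>n. h (int n)) has_sum Lk * (1 / c)) UNIV"
      using 1 by (subst (asm) has_sum_Suc_iff[of "\<lambda>n. h (int n)"]) (simp add: h_def)
    moreover have "((\<lambda>n. h (- int n - 1)) has_sum Lk * (1 / c)) UNIV"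
    proof -
      have "- int n - 1 = - int (Suc n)" for n by simp
      then show ?thesis using 1 by (simp only: hm)
    qed
    ultimately have "(h has_sum (Lk * (1 / c) + Lk * (1 / c))) UNIV" by (rule has_sum_int_split)
    moreover have "Lk * (1 / c) + Lk * (1 / c) = H"
    proof -
      have "dirichlet_L chi (- of_nat k) = fe_factor (- of_nat k) * Lk"
        using dirichlet_L_functional_equation[of "- of_nat k"] by (simp add: Lk_def)
      also have "fe_factor (- of_nat k) = fact k / cnj (gauss_sum q chi) * (2 / c)"
        unfolding c_def by (rule fe_factor_neg_even[OF k(1)])
      finally show ?thesis using gauss_sum_nonzero by (simp add: H_def)
    qed
    ultimately show ?thesis by simp
  qed
  have "((\<lambda>r. (row k y 0 r - h r) + h r) has_sum (T + H)) UNIV" by (rule has_sum_add[OF T(1) h])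
  then have "(row k y 0 has_sum (T + H)) UNIV" by simp
  from row_pairs[OF this] have "((\<lambda>n. 2 * fourier_term k y n 0) has_sum (T + H)) UNIV" by simp
  from has_sum_cmult_right[OF this, of "1/2"] have "((\<lambda>n. fourier_term k y n 0) has_sum (T / 2 + H / 2)) UNIV"
    by (simp add: add_divide_distrib)
  with T2' show ?thesis using that by (simp add: H_def)
qed

end

section \<open>Transformation of the Lambert series\<close>

lemma sigma_chi_altdef: "n \<ge> 1 \<Longrightarrow> sigma_chi (of_nat k) psi n = (\<Sum>d | d dvd n. of_nat d ^ k * psi d)"
  unfolding sigma_chi_def by (intro sum.cong refl) (auto simp: powr_nat' dvd_pos_nat)

lemma sigma_bar_chi_altdef:
  "n \<ge> 1 \<Longrightarrow> sigma_bar_chi (of_nat k) psi n = (\<Sum>d | d dvd n. of_nat d ^ k * psi (n div d))"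
  unfolding sigma_bar_chi_def by (intro sum.cong refl) (auto simp: powr_nat' dvd_pos_nat)

text \<open>Kept next to the crude bound n^(k + 1): that bound suffices against exponentials, but
  Dirichlet series with exponents just above k + 1 converge only thanks to the average size of this
  sum. At n = 0 the index set is infinite and the sum is 0 by convention; the same default of
  \<open>sigma_chi\<close> and \<open>sigma_bar_chi\<close> lets the series start at 0.\<close>

definition divisor_power_sum :: "nat \<Rightarrow> nat \<Rightarrow> real" where
  "divisor_power_sum k n = (\<Sum>d | d dvd n. real d ^ k)"

lemma divisor_power_sum_nonneg: "divisor_power_sum k n \<ge> 0"
  unfolding divisor_power_sum_def by (intro sum_nonneg) auto

lemma divisor_power_sum_le: "divisor_power_sum k n \<le> real n ^ Suc k"
proof (cases "n = 0")
  case False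
  have "divisor_power_sum k n \<le> (\<Sum>d | d dvd n. real n ^ k)"
    unfolding divisor_power_sum_def using False by (intro sum_mono power_mono) (auto dest: dvd_imp_le)
  also have "\<dots> = real (card {d. d dvd n}) * real n ^ k" by simp
  also have "card {d. d dvd n} \<le> card {1..n}"
    using False by (intro card_mono) (auto dest: dvd_imp_le simp: Suc_le_eq dvd_pos_nat)
  then have "real (card {d. d dvd n}) * real n ^ k \<le> real n * real n ^ k"
    by (intro mult_right_mono) auto
  finally show ?thesis by simp
qed (simp add: divisor_power_sum_def)

context odd_primitive_character
begin

lemma norm_sigma_chi_le: "norm (sigma_chi (of_nat k) chi n) \<le> divisor_power_sum k n"
proof (cases "n = 0")
  case False
  then have n: "n \<ge> 1" by simp
  have "norm (of_nat d ^ k * chi d) \<le> real d ^ k" for d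
    using mult_left_mono[OF norm_chi_le_1[of d], of "real d ^ k"] by (simp add: norm_mult norm_power)
  then show ?thesis unfolding sigma_chi_altdef[OF n] divisor_power_sum_def
    by (intro order_trans[OF norm_sum] sum_mono)
qed (simp add: sigma_chi_def divisor_power_sum_def)

lemma norm_sigma_bar_chi_le: "norm (sigma_bar_chi (of_nat k) (cnj \<circ> chi) n) \<le> divisor_power_sum k n"
proof (cases "n = 0")
  case False
  then have n: "n \<ge> 1" by simp
  have "norm (of_nat d ^ k * (cnj \<circ> chi) (n div d)) \<le> real d ^ k" for d
    using mult_left_mono[OF norm_chi_le_1[of "n div d"], of "real d ^ k"] by (simp add: norm_mult norm_power)
  then show ?thesis unfolding sigma_bar_chi_altdef[OF n] divisor_power_sum_def
    by (intro order_trans[OF norm_sum] sum_mono)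
qed (simp add: sigma_bar_chi_def divisor_power_sum_def)

definition lambert :: "nat \<Rightarrow> real \<Rightarrow> complex" where
  "lambert k = exp_series (sigma_chi (of_nat k) chi)"

definition lambert_dual :: "nat \<Rightarrow> real \<Rightarrow> complex" where
  "lambert_dual k = exp_series (sigma_bar_chi (of_nat k) (cnj \<circ> chi))"

lemma sigma_chi_bound: "norm (sigma_chi (of_nat k) chi n) \<le> 1 * real n ^ Suc k"
  using norm_sigma_chi_le[of k n] divisor_power_sum_le[of k n] by simp

lemma sigma_bar_chi_bound: "norm (sigma_bar_chi (of_nat k) (cnj \<circ> chi) n) \<le> 1 * real n ^ Suc k"
  using norm_sigma_bar_chi_le[of k n] divisor_power_sum_le[of k n] by simp

lemma has_sum_atLeast_1:
  assumes "f (0::nat) = (0 :: 'a :: real_normed_vector)"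
  shows "(f has_sum S) {1..} \<longleftrightarrow> (f has_sum S) UNIV"
  by (rule has_sum_cong_neutral) (use assms in \<open>auto simp: not_less_eq_eq\<close>)

lemma summable_on_lambert_pairs:
  assumes y: "y > 0"
  shows "(\<lambda>(d, m). of_nat d ^ k * chi d * of_real (exp (- (real d * real m * y)))) summable_on {1..} \<times> {1..}"
proof (rule abs_summable_summable, rule Infinite_Sum.abs_summable_on_comparison_test'[OF summable_on_pairs_exp[OF y, of k]], clarify)
  fix d m :: nat
  show "norm (of_nat d ^ k * chi d * of_real (exp (- (real d * real m * y)))) \<le> real d ^ k * exp (- (real d * real m * y))"
    using mult_right_mono[OF norm_chi_le_1[of d], of "real d ^ k * exp (- (real d * real m * y))"]
    by (simp add: norm_mult norm_power mult_ac)
qed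

lemma chi_series_has_sum: "t > 0 \<Longrightarrow> ((\<lambda>d. chi d * of_nat d ^ k * of_real (exp (- (real d * t)))) has_sum chi_series k t) {1..}"
  unfolding chi_series_def by (subst has_sum_atLeast_1) (auto intro!: exp_series_has_sum[OF chi_series_coeff_bound])

lemma lambert_has_sum:
  assumes y: "y > 0"
  shows "((\<lambda>m. chi_series k (real (Suc m) * y)) has_sum lambert k y) UNIV"
proof -
  obtain T where T: "((\<lambda>(d, m). of_nat d ^ k * chi d * of_real (exp (- (real d * real m * y)))) has_sum T) ({1..} \<times> {1..})"
    using summable_on_lambert_pairs[OF y] by (auto simp: summable_on_def)
  have "((\<lambda>n. \<Sum>d | d dvd n. of_nat d ^ k * chi d * of_real (exp (- (real d * real (n div d) * y)))) has_sum T) {1..}"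
    by (rule has_sum_divisors[OF T])
  also have "?this \<longleftrightarrow> ((\<lambda>n. sigma_chi (of_nat k) chi n * of_real (exp (- (real n * y)))) has_sum T) {1..}"
  proof (rule has_sum_cong)
    fix n :: nat assume "n \<in> {1..}"
    then have n: "n \<ge> 1" by simp
    have "real d * real (n div d) = real n" if "d dvd n" for d
      using that by (metis dvd_mult_div_cancel of_nat_mult)
    then show "(\<Sum>d | d dvd n. of_nat d ^ k * chi d * of_real (exp (- (real d * real (n div d) * y)))) =
        sigma_chi (of_nat k) chi n * of_real (exp (- (real n * y)))"
      unfolding sigma_chi_altdef[OF n] by (simp add: sum_distrib_right)
  qed
  finally have "((\<lambda>n. sigma_chi (of_nat k) chi n * of_real (exp (- (real n * y)))) has_sum T) UNIV"
    by (subst (asm) has_sum_atLeast_1) (auto simp: sigma_chi_def)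
  then have T': "T = lambert k y"
    using exp_series_has_sum[OF sigma_chi_bound y] has_sum_unique unfolding lambert_def by blast
  have "((\<lambda>(m, d). of_nat d ^ k * chi d * of_real (exp (- (real d * real m * y)))) has_sum T) ({1..} \<times> {1..})"
    using T by (subst has_sum_swap) simp
  then have "((\<lambda>m. chi_series k (real m * y)) has_sum T) {1..}"
  proof (rule has_sum_SigmaD)
    fix m :: nat assume "m \<in> {1..}"
    then have "real m * y > 0" using y by simp
    from chi_series_has_sum[OF this, of k]
    show "((\<lambda>d. case (m, d) of (m, d) \<Rightarrow> of_nat d ^ k * chi d * of_real (exp (- (real d * real m * y)))) has_sum chi_series k (real m * y)) {1..}"
      by (simp add: mult_ac)
  qed
  moreover have "{1..} = range Suc" by (auto simp: image_iff Suc_le_eq gr0_conv_Suc)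
  ultimately have "((\<lambda>m. chi_series k (real m * y)) has_sum T) (range Suc)" by simp
  then show ?thesis unfolding T' by (subst (asm) has_sum_reindex) (auto simp: o_def)
qed

text \<open>One absolutely convergent double sum, evaluated along both variables. The unimodular
  \<open>u\<close> is the phase of the shift. In the last form the inner series starts at j = 0,
  where \<open>k >= 1\<close> makes the term vanish.\<close>

lemma dual_pairs:
  assumes \<eta>: "\<eta> > 0" and u: "norm u \<le> 1"
  obtains X where
    "((\<lambda>(j, n). of_nat j ^ k * u ^ j * (cnj (chi n) * of_real (exp (- (real j * real n * \<eta>))))) has_sum X) ({1..} \<times> {1..})"
    "((\<lambda>j. of_nat j ^ k * u ^ j * odd_primitive_character.chi_series (cnj \<circ> chi) 0 (real j * \<eta>)) has_sum X) {1..}"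
    "k \<ge> 1 \<Longrightarrow> ((\<lambda>n. cnj (chi n) * (\<Sum>j. of_nat j ^ k * (u * of_real (exp (- (real n * \<eta>)))) ^ j)) has_sum X) {1..}"
proof -
  interpret C: odd_primitive_character q "cnj \<circ> chi" by (rule cnj_character)
  let ?f = "\<lambda>(j, n). of_nat j ^ k * u ^ j * (cnj (chi n) * of_real (exp (- (real j * real n * \<eta>))))"
  have "?f summable_on {1..} \<times> {1..}"
  proof (rule abs_summable_summable, rule Infinite_Sum.abs_summable_on_comparison_test'[OF summable_on_pairs_exp[OF \<eta>, of k]], clarify)
    fix j n :: nat
    have "norm u ^ j * norm (chi n) \<le> 1 * 1"
      using u norm_chi_le_1[of n] by (intro mult_mono power_le_one) auto
    from mult_right_mono[OF this, of "real j ^ k * exp (- (real j * real n * \<eta>))"]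
    show "norm (of_nat j ^ k * u ^ j * (cnj (chi n) * of_real (exp (- (real j * real n * \<eta>))))) \<le> real j ^ k * exp (- (real j * real n * \<eta>))"
      by (simp add: norm_mult norm_power mult_ac)
  qed
  then obtain X where X: "(?f has_sum X) ({1..} \<times> {1..})" by (auto simp: summable_on_def)
  show ?thesis
  proof (rule that[OF X])
    show "((\<lambda>j. of_nat j ^ k * u ^ j * C.chi_series 0 (real j * \<eta>)) has_sum X) {1..}"
    proof (rule has_sum_SigmaD[OF X])
      fix j :: nat assume "j \<in> {1..}"
      then have "real j * \<eta> > 0" using \<eta> by simp
      from has_sum_cmult_right[OF C.chi_series_has_sum[OF this, of 0], of "of_nat j ^ k * u ^ j"]
      show "((\<lambda>n. case (j, n) of (j, n) \<Rightarrow> of_nat j ^ k * u ^ j * (cnj (chi n) * of_real (exp (- (real j * real n * \<eta>))))) has_sum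
          of_nat j ^ k * u ^ j * C.chi_series 0 (real j * \<eta>)) {1..}"
        unfolding comp_apply by (simp add: mult_ac)
    qed
    assume k: "k \<ge> 1"
    have "((\<lambda>(n, j). of_nat j ^ k * u ^ j * (cnj (chi n) * of_real (exp (- (real j * real n * \<eta>))))) has_sum X) ({1..} \<times> {1..})"
      using X by (subst has_sum_swap) simp
    then show "((\<lambda>n. cnj (chi n) * (\<Sum>j. of_nat j ^ k * (u * of_real (exp (- (real n * \<eta>)))) ^ j)) has_sum X) {1..}"
    proof (rule has_sum_SigmaD)
      fix n :: nat assume n: "n \<in> {1..}"
      define v where "v = u * of_real (exp (- (real n * \<eta>)))"
      have v: "norm v < 1"
      proof -
        have "norm v \<le> 1 * exp (- (real n * \<eta>))" unfolding v_def norm_mult using u by (intro mult_mono) auto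
        also have "\<dots> < 1" using n \<eta> by simp
        finally show ?thesis .
      qed
      have "((\<lambda>j. of_nat j ^ k * v ^ j) has_sum (\<Sum>j. of_nat j ^ k * v ^ j)) UNIV"
      proof (rule norm_summable_imp_has_sum)
        have "summable (\<lambda>j. real j ^ k * norm v ^ j)" using v by (intro summable_power_times_geometric) auto
        then show "summable (\<lambda>j. norm (of_nat j ^ k * v ^ j))" by (simp add: norm_mult norm_power)
        show "(\<lambda>j. of_nat j ^ k * v ^ j) sums (\<Sum>j. of_nat j ^ k * v ^ j)"
          by (intro summable_sums summable_power_times_geometric v)
      qed
      then have "((\<lambda>j. of_nat j ^ k * v ^ j) has_sum (\<Sum>j. of_nat j ^ k * v ^ j)) {1..}"
        by (subst has_sum_atLeast_1) (use k in auto)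
      from has_sum_cmult_right[OF this, of "cnj (chi n)"]
      show "((\<lambda>j. case (n, j) of (n, j) \<Rightarrow> of_nat j ^ k * u ^ j * (cnj (chi n) * of_real (exp (- (real j * real n * \<eta>))))) has_sum
          cnj (chi n) * (\<Sum>j. of_nat j ^ k * (u * of_real (exp (- (real n * \<eta>)))) ^ j)) {1..}"
        unfolding v_def[symmetric]
        by (simp add: v_def power_mult_distrib exp_of_nat_mult[symmetric] mult_ac flip: of_real_power)
    qed
  qed
qed

lemma lambert_dual_has_sum:
  assumes \<eta>: "\<eta> > 0"
  shows "((\<lambda>(j, n). of_nat j ^ k * (cnj (chi n) * of_real (exp (- (real j * real n * \<eta>))))) has_sum lambert_dual k \<eta>) ({1..} \<times> {1..})"
proof -
  obtain T where T: "((\<lambda>(j, n). of_nat j ^ k * (cnj (chi n) * of_real (exp (- (real j * real n * \<eta>))))) has_sum T) ({1..} \<times> {1..})"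
    using dual_pairs[OF \<eta>, of 1 k] by auto
  have "((\<lambda>n. \<Sum>d | d dvd n. of_nat d ^ k * (cnj (chi (n div d)) * of_real (exp (- (real d * real (n div d) * \<eta>))))) has_sum T) {1..}"
    by (rule has_sum_divisors[OF T])
  also have "?this \<longleftrightarrow> ((\<lambda>n. sigma_bar_chi (of_nat k) (cnj \<circ> chi) n * of_real (exp (- (real n * \<eta>)))) has_sum T) {1..}"
  proof (rule has_sum_cong)
    fix n :: nat assume "n \<in> {1..}"
    then have n: "n \<ge> 1" by simp
    have "real d * real (n div d) = real n" if "d dvd n" for d
      using that by (metis dvd_mult_div_cancel of_nat_mult)
    then show "(\<Sum>d | d dvd n. of_nat d ^ k * (cnj (chi (n div d)) * of_real (exp (- (real d * real (n div d) * \<eta>))))) =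
        sigma_bar_chi (of_nat k) (cnj \<circ> chi) n * of_real (exp (- (real n * \<eta>)))"
      unfolding sigma_bar_chi_altdef[OF n] by (simp add: sum_distrib_right mult.assoc)
  qed
  finally have "((\<lambda>n. sigma_bar_chi (of_nat k) (cnj \<circ> chi) n * of_real (exp (- (real n * \<eta>)))) has_sum T) UNIV"
    by (subst (asm) has_sum_atLeast_1) (auto simp: sigma_bar_chi_def)
  then have T': "T = lambert_dual k \<eta>"
    using exp_series_has_sum[OF sigma_bar_chi_bound \<eta>] has_sum_unique unfolding lambert_dual_def by blast
  show ?thesis using T unfolding T' .
qed

lemma fourier_term_has_sum:
  assumes y: "y > 0" and k: "k \<ge> 1" and u: "u = exp (2 * of_real pi * \<i> * of_real w / of_real y)"
    and X: "((\<lambda>j. of_nat j ^ k * u ^ j * odd_primitive_character.chi_series (cnj \<circ> chi) 0 (real j * (4 * pi\<^sup>2 / (real q * y)))) has_sum X) {1..}"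
  shows "((\<lambda>n. fourier_term k y n w) has_sum ((-2 * of_real pi * \<i> / of_real y) ^ Suc k / fact k * X)) UNIV"
proof -
  have \<eta>: "4 * pi\<^sup>2 / (real q * y) > 0" using y q_gt_2 by simp
  have u1: "norm u \<le> 1" unfolding u by simp
  obtain X' where "((\<lambda>(j, n). of_nat j ^ k * u ^ j * (cnj (chi n) * of_real (exp (- (real j * real n * (4 * pi\<^sup>2 / (real q * y))))))) has_sum X') ({1..} \<times> {1..})"
    and X': "((\<lambda>j. of_nat j ^ k * u ^ j * odd_primitive_character.chi_series (cnj \<circ> chi) 0 (real j * (4 * pi\<^sup>2 / (real q * y)))) has_sum X') {1..}"
    "((\<lambda>n. cnj (chi n) * (\<Sum>j. of_nat j ^ k * (u * of_real (exp (- (real n * (4 * pi\<^sup>2 / (real q * y)))))) ^ j)) has_sum X') {1..}"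
    by (rule dual_pairs[OF \<eta> u1, of k]) (use k in blast)
  have "X' = X" by (rule has_sum_unique[OF X'(1) X])
  then have "((\<lambda>n. cnj (chi n) * (\<Sum>j. of_nat j ^ k * (u * of_real (exp (- (real n * (4 * pi\<^sup>2 / (real q * y)))))) ^ j)) has_sum X) {1..}"
    using X'(2) by simp
  then have "((\<lambda>n. cnj (chi n) * (\<Sum>j. of_nat j ^ k * (u * of_real (exp (- (real n * (4 * pi\<^sup>2 / (real q * y)))))) ^ j)) has_sum X) UNIV"
    by (subst (asm) has_sum_atLeast_1) auto
  from has_sum_cmult_right[OF this, of "(-2 * of_real pi * \<i> / of_real y) ^ Suc k / fact k"] show ?thesis
    unfolding fourier_term_def u by (simp add: mult_ac)
qed

text \<open>Poisson summation at the origin with both sides regrouped by divisors: the side over m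
  is the Lambert series, the side over n is the dual one at phase 1.\<close>

lemma lambert_transformation_ge_2:
  assumes y: "y > 0" and k: "even k" "k \<ge> 2"
  shows "lambert k y = - dirichlet_L chi (- of_nat k) / 2 +
     (-2 * of_real pi * \<i> / of_real y) ^ Suc k / cnj (gauss_sum q chi) * lambert_dual k (4 * pi\<^sup>2 / (real q * y))"
proof -
  define \<eta> where "\<eta> = 4 * pi\<^sup>2 / (real q * y)"
  have \<eta>: "\<eta> > 0" using y q_gt_2 by (simp add: \<eta>_def)
  define c where "c = (-2 * of_real pi * \<i> / complex_of_real y) ^ Suc k"
  define \<tau> where "\<tau> = cnj (gauss_sum q chi)"
  have \<tau>: "\<tau> \<noteq> 0" using gauss_sum_nonzero by (simp add: \<tau>_def)
  obtain T where T: "((\<lambda>m. \<tau> / fact k * chi_series k (real (Suc m) * y)) has_sum T) UNIV"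
    "((\<lambda>n. fourier_term k y n 0) has_sum (T + \<tau> / fact k * dirichlet_L chi (- of_nat k) / 2)) UNIV"
    using poisson_origin[OF y k] unfolding \<tau>_def by blast
  have "T = \<tau> / fact k * lambert k y"
    using has_sum_unique[OF T(1) has_sum_cmult_right[OF lambert_has_sum[OF y]]] .
  moreover obtain X where X: "((\<lambda>(j, n). of_nat j ^ k * 1 ^ j * (cnj (chi n) * of_real (exp (- (real j * real n * \<eta>))))) has_sum X) ({1..} \<times> {1..})"
    "((\<lambda>j. of_nat j ^ k * 1 ^ j * odd_primitive_character.chi_series (cnj \<circ> chi) 0 (real j * \<eta>)) has_sum X) {1..}"
    using dual_pairs[OF \<eta>, of 1 k] by auto
  have "X = lambert_dual k \<eta>"
    using X(1) lambert_dual_has_sum[OF \<eta>, of k] has_sum_unique by auto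
  have "((\<lambda>n. fourier_term k y n 0) has_sum (c / fact k * X)) UNIV"
    unfolding c_def by (rule fourier_term_has_sum[where u = 1]) (use y k X(2) in \<open>auto simp: \<eta>_def\<close>)
  then have "c / fact k * X = T + \<tau> / fact k * dirichlet_L chi (- of_nat k) / 2"
    using T(2) has_sum_unique by blast
  ultimately have "\<tau> / fact k * lambert k y = c / fact k * X - \<tau> / fact k * dirichlet_L chi (- of_nat k) / 2"
    by simp
  then have "fact k / \<tau> * (\<tau> / fact k * lambert k y) = fact k / \<tau> * (c / fact k * X - \<tau> / fact k * dirichlet_L chi (- of_nat k) / 2)"
    by simp
  then have "lambert k y = c / \<tau> * X - dirichlet_L chi (- of_nat k) / 2"
    using \<tau> by (simp add: right_diff_distrib)
  then show ?thesis unfolding \<open>X = _\<close> c_def \<tau>_def \<eta>_def by simp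
qed


text \<open>The shift inserts the convergence factor exp (- n w) into the Dirichlet series, so that
  the Mellin integral can be evaluated termwise even at s = 0 and s = 1.\<close>

lemma chi_series_1_shifted_integral:
  assumes s: "s \<ge> 0" and w: "w > 0"
  shows "(LBINT t:{0<..}. of_real (t powr s) * chi_series 1 (t + w)) =
     of_real (Gamma (s + 1)) * exp_series (\<lambda>n. chi n * of_real (real n powr (- s))) w"
proof -
  define f where "f n t = (chi n * of_real (real n * exp (- (real n * w)))) * of_real (t powr ((s + 1) - 1) * exp (- (real n * t)))" for n and t :: real
  have cb: "norm (chi n * of_real (real n powr (- s))) \<le> 1 * real n ^ 0" for n
  proof (cases "n = 0")
    case False
    then have "real n powr (- s) \<le> real n powr 0" using s by (intro powr_mono) auto
    then have "norm (chi n) * real n powr (- s) \<le> 1 * 1" using norm_chi_le_1[of n] False by (intro mult_mono) auto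
    then show ?thesis by (simp add: norm_mult)
  qed auto
  have int: "set_integrable lborel {0<..} (f n)" for n
  proof (cases "n = 0")
    case False
    then show ?thesis unfolding f_def using s
      by (intro set_integrable_mult_right set_integrable_of_real set_integrable_Gamma) auto
  qed (simp add: f_def set_integrable_def)
  have val: "(LBINT t:{0<..}. f n t) = of_real (Gamma (s + 1)) * (chi n * of_real (real n powr (- s)) * of_real (exp (- (real n * w))))" for n
  proof (cases "n = 0")
    case False
    have "(LBINT t:{0<..}. f n t) = (chi n * of_real (real n * exp (- (real n * w)))) * of_real (Gamma (s + 1) / real n powr (s + 1))"
      unfolding f_def set_integral_mult_right set_integral_complex_of_real
      by (subst set_integral_Gamma) (use False s in auto)
    also have "Gamma (s + 1) / real n powr (s + 1) = Gamma (s + 1) * real n powr (- s) / real n"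
      using False by (simp add: powr_add powr_minus_divide)
    finally show ?thesis using False by simp
  qed (simp add: f_def set_lebesgue_integral_def)
  have nval: "(LBINT t:{0<..}. norm (f n t)) \<le> Gamma (s + 1) * (real n ^ 0 * exp (- (real n * w)))" for n
  proof (cases "n = 0")
    case False
    have "(LBINT t:{0<..}. norm (f n t)) = (LBINT t:{0<..}. (norm (chi n) * (real n * exp (- (real n * w)))) * (t powr ((s + 1) - 1) * exp (- (real n * t))))"
      by (intro set_lebesgue_integral_cong) (auto simp: f_def norm_mult)
    also have "\<dots> = (norm (chi n) * (real n * exp (- (real n * w)))) * (Gamma (s + 1) / real n powr (s + 1))"
      by (subst set_integral_mult_right, subst set_integral_Gamma) (use False s in auto)
    also have "Gamma (s + 1) / real n powr (s + 1) = Gamma (s + 1) * real n powr (- s) / real n"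
      using False by (simp add: powr_add powr_minus_divide)
    also have "(norm (chi n) * (real n * exp (- (real n * w)))) * (Gamma (s + 1) * real n powr (- s) / real n) =
         (norm (chi n) * real n powr (- s)) * (Gamma (s + 1) * exp (- (real n * w)))"
      using False by simp
    also have "\<dots> \<le> 1 * (Gamma (s + 1) * exp (- (real n * w)))"
      using cb[of n] s by (intro mult_right_mono) (auto simp: norm_mult intro!: mult_nonneg_nonneg less_imp_le[OF Gamma_real_pos])
    finally show ?thesis by simp
  qed (use s in \<open>simp add: f_def set_lebesgue_integral_def less_imp_le[OF Gamma_real_pos]\<close>)
  have chi_series: "(\<lambda>n. f n t) sums (of_real (t powr s) * chi_series 1 (t + w))" "summable (\<lambda>n. norm (f n t))" if t: "t > 0" for t
  proof -
    have tw: "t + w > 0" using t w by simp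
    have eq: "of_real (t powr s) * (chi n * of_nat n ^ 1 * of_real (exp (- (real n * (t + w))))) = f n t" for n
      by (simp add: f_def ring_distribs exp_add exp_minus exp_diff mult_ac divide_simps)
    show "(\<lambda>n. f n t) sums (of_real (t powr s) * chi_series 1 (t + w))"
      using sums_mult[OF exp_series_sums[OF chi_series_coeff_bound tw, of 1], of "of_real (t powr s)"] unfolding eq chi_series_def .
    have "summable (\<lambda>n. norm (complex_of_real (t powr s)) * norm (chi n * of_nat n ^ 1 * of_real (exp (- (real n * (t + w))))))"
      by (intro summable_mult exp_series_abs_summable[OF chi_series_coeff_bound tw])
    then show "summable (\<lambda>n. norm (f n t))" unfolding norm_mult[symmetric] eq .
  qed
  have "(\<lambda>n. LBINT t:{0<..}. f n t) sums (LBINT t:{0<..}. (\<Sum>n. f n t))"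
  proof (rule set_integral_sums[OF int])
    show "summable (\<lambda>n. LBINT t:{0<..}. norm (f n t))"
    proof (rule summable_comparison_test')
      show "summable (\<lambda>n. Gamma (s + 1) * (real n ^ 0 * exp (- (real n * w))))"
        by (intro summable_mult summable_power_times_exp w)
      show "norm (LBINT t:{0<..}. norm (f n t)) \<le> Gamma (s + 1) * (real n ^ 0 * exp (- (real n * w)))" for n
        using nval[of n] by (subst real_norm_def, subst abs_of_nonneg) (auto intro!: set_integral_nonneg)
    qed
  qed (use chi_series(2) in auto)
  moreover have "(\<lambda>n. LBINT t:{0<..}. f n t) sums (of_real (Gamma (s + 1)) * exp_series (\<lambda>n. chi n * of_real (real n powr (- s))) w)"
    unfolding val by (intro sums_mult exp_series_sums[OF cb w])
  moreover have "(LBINT t:{0<..}. (\<Sum>n. f n t)) = (LBINT t:{0<..}. of_real (t powr s) * chi_series 1 (t + w))"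
    by (intro set_lebesgue_integral_cong) (use sums_unique[OF chi_series(1)] in auto)
  ultimately show ?thesis using sums_unique2 by metis
qed

text \<open>Abel summation of the Dirichlet series. The limit is taken inside the Mellin integral,
  with the exponential bound for \<open>chi_series 1\<close> as majorant, and therefore produces the
  continued L-function at s = 0 as well as at s = 1.\<close>

lemma exp_series_tendsto_L:
  assumes s: "s \<ge> 0" and w: "\<And>n. w n > 0" "w \<longlonglongrightarrow> 0"
  shows "(\<lambda>n. exp_series (\<lambda>n. chi n * of_real (real n powr (- s))) (w n)) \<longlonglongrightarrow> dirichlet_L chi (of_real s)"
proof -
  obtain M where M: "M > 0" "\<And>t. t > 0 \<Longrightarrow> norm (chi_series 1 t) \<le> M * exp (- t / 2)" using chi_series_1_bound by blast
  have G: "Gamma (s + 1) > 0" using s by (intro Gamma_real_pos) auto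
  have "(\<lambda>n. LBINT t:{0<..}. of_real (t powr s) * chi_series 1 (t + w n)) \<longlonglongrightarrow> (LBINT t:{0<..}. of_real (t powr s) * chi_series 1 t)"
  proof (rule set_integral_pos_dominated_convergence)
    show "set_integrable lborel {0<..} (\<lambda>t. M * (t powr s * exp (- t / 2)))"
      using s by (intro set_integrable_powr_exp) auto
    show "continuous_on {0<..} (\<lambda>t. of_real (t powr s) * chi_series 1 (t + w n))" for n
      by (intro continuous_intros continuous_on_compose2[OF chi_series_continuous_on]) (auto simp: add_pos_pos w)
    show "continuous_on {0<..} (\<lambda>t. of_real (t powr s) * chi_series 1 t)"
      by (intro continuous_intros chi_series_continuous_on) auto
    fix t :: real assume t: "t > 0"
    show "norm (of_real (t powr s) * chi_series 1 (t + w n)) \<le> M * (t powr s * exp (- t / 2))" for n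
    proof -
      have "norm (chi_series 1 (t + w n)) \<le> M * exp (- (t + w n) / 2)" using t w(1)[of n] by (intro M) auto
      also have "\<dots> \<le> M * exp (- t / 2)" using M(1) w(1)[of n] by (intro mult_left_mono) auto
      finally have "t powr s * norm (chi_series 1 (t + w n)) \<le> t powr s * (M * exp (- t / 2))"
        by (intro mult_left_mono) auto
      then show ?thesis by (simp add: norm_mult mult_ac)
    qed
    have "isCont (chi_series 1) t" using continuous_on_interior[OF chi_series_continuous_on, of t 1] t by (simp add: interior_open)
    moreover have "(\<lambda>n. t + w n) \<longlonglongrightarrow> t" using tendsto_add[OF tendsto_const w(2), of t] by simp
    ultimately have "(\<lambda>n. chi_series 1 (t + w n)) \<longlonglongrightarrow> chi_series 1 t" by (rule isCont_tendsto_compose)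
    then show "(\<lambda>n. of_real (t powr s) * chi_series 1 (t + w n)) \<longlonglongrightarrow> of_real (t powr s) * chi_series 1 t"
      by (intro tendsto_intros)
  qed
  then have "(\<lambda>n. of_real (1 / Gamma (s + 1)) * (of_real (Gamma (s + 1)) * exp_series (\<lambda>n. chi n * of_real (real n powr (- s))) (w n)))
     \<longlonglongrightarrow> of_real (1 / Gamma (s + 1)) * (LBINT t:{0<..}. of_real (t powr s) * chi_series 1 t)"
    unfolding chi_series_1_shifted_integral[OF s w(1)] by (intro tendsto_intros)
  moreover have "of_real (1 / Gamma (s + 1)) * (LBINT t:{0<..}. of_real (t powr s) * chi_series 1 t) = dirichlet_L chi (of_real s)"
  proof -
    have "mellin (of_real s) = (LBINT t:{0<..}. of_real (t powr s) * chi_series 1 t)"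
      unfolding mellin_def by (intro set_lebesgue_integral_cong) (auto simp: powr_of_real)
    moreover have "dirichlet_L chi (of_real s) = rGamma (of_real s + 1) * mellin (of_real s)"
      by (rule dirichlet_L_mellin) (use s in simp)
    ultimately show ?thesis by (simp only: rGamma_real add.commute[of s 1])
  qed
  ultimately show ?thesis using G by simp
qed

text \<open>Summing over m first gives a geometric series. A half-line of lattice points thus
  becomes one exponential series in the shift, and integrating in the shift amounts to dividing its
  coefficients by - d.\<close>

lemma chi_series_shifted_has_sum:
  assumes y: "y > 0" and v: "v > 0"
  shows "((\<lambda>m. chi_series k (real m * y + v)) has_sum exp_series (\<lambda>d. chi d * of_nat d ^ k / of_real (1 - exp (- (real d * y)))) v) UNIV"
proof -
  let ?f = "\<lambda>(m, d). chi d * of_nat d ^ k * of_real (exp (- (real d * (real m * y + v))))"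
  have ge1: "1 - exp (- (real d * y)) \<ge> 1 - exp (- y)" if "d \<ge> 1" for d
    using that y by simp
  have y1: "1 - exp (- y) > 0" using y by simp
  have cb: "norm (chi d * of_nat d ^ k / of_real (1 - exp (- (real d * y)))) \<le> 1 / (1 - exp (- y)) * real d ^ k" for d
  proof (cases "d = 0")
    case False
    then have d: "1 - exp (- (real d * y)) \<ge> 1 - exp (- y)" by (intro ge1) auto
    have "norm (chi d * of_nat d ^ k / of_real (1 - exp (- (real d * y)))) = norm (chi d * of_nat d ^ k) / (1 - exp (- (real d * y)))"
      unfolding norm_divide norm_of_real using d y1 by simp
    also have "\<dots> \<le> (1 * real d ^ k) / (1 - exp (- y))"
      using d y1 chi_series_coeff_bound[of d k] by (intro frac_le) auto
    finally show ?thesis by simp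
  qed (use y1 in auto)
  have "(\<lambda>(m, d). (real m ^ 0 * exp (- (real m * y))) * (real d ^ k * exp (- (real d * v)))) summable_on UNIV \<times> {1..}"
    by (intro summable_on_product summable_on_powers_exp y v) auto
  then have "(\<lambda>x. norm (?f x)) summable_on UNIV \<times> {1..}"
  proof (rule Infinite_Sum.abs_summable_on_comparison_test')
    fix x :: "nat \<times> nat" assume "x \<in> UNIV \<times> {1..}"
    then obtain m d where x: "x = (m, d)" and d: "d \<in> {1..}" by auto
    have "1 * (real m * y) \<le> real d * (real m * y)" using d y by (intro mult_right_mono) auto
    then have "exp (- (real d * (real m * y + v))) \<le> exp (- (real m * y)) * exp (- (real d * v))"
      unfolding exp_add[symmetric] by (simp add: algebra_simps)
    then have "norm (chi d * of_nat d ^ k) * exp (- (real d * (real m * y + v))) \<le> (1 * real d ^ k) * (exp (- (real m * y)) * exp (- (real d * v)))"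
      using chi_series_coeff_bound[of d k] by (intro mult_mono) auto
    then show "norm (?f x) \<le> (case x of (m, d) \<Rightarrow> (real m ^ 0 * exp (- (real m * y))) * (real d ^ k * exp (- (real d * v))))"
      by (simp add: x norm_mult norm_power mult_ac)
  qed
  then have "?f summable_on UNIV \<times> {1..}" by (rule abs_summable_summable)
  then obtain T where T: "(?f has_sum T) (UNIV \<times> {1..})" by (auto simp: summable_on_def)
  have 1: "((\<lambda>m. chi_series k (real m * y + v)) has_sum T) UNIV"
    by (rule has_sum_SigmaD[OF T]) (use chi_series_has_sum y v in \<open>auto simp: add_nonneg_pos\<close>)
  have "((\<lambda>(d, m). chi d * of_nat d ^ k * of_real (exp (- (real d * (real m * y + v))))) has_sum T) ({1..} \<times> UNIV)"
    using T by (subst has_sum_swap) simp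
  then have "((\<lambda>d. chi d * of_nat d ^ k / of_real (1 - exp (- (real d * y))) * of_real (exp (- (real d * v)))) has_sum T) {1..}"
  proof (rule has_sum_SigmaD)
    fix d :: nat assume d: "d \<in> {1..}"
    define x where "x = exp (- (real d * y))"
    have x: "0 < x" "x < 1" using d y by (auto simp: x_def)
    have "((\<lambda>m. x ^ m) has_sum 1 / (1 - x)) UNIV"
      using geometric_sums[of x] summable_geometric[of x] x by (intro norm_summable_imp_has_sum) (auto simp: norm_power)
    then have "((\<lambda>m. complex_of_real (x ^ m)) has_sum of_real (1 / (1 - x))) UNIV" by (rule has_sum_of_real)
    from has_sum_cmult_right[OF this, of "chi d * of_nat d ^ k * of_real (exp (- (real d * v)))"]
    have *: "((\<lambda>m. chi d * of_nat d ^ k * of_real (exp (- (real d * v))) * of_real (x ^ m)) has_sum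
        chi d * of_nat d ^ k / of_real (1 - x) * of_real (exp (- (real d * v)))) UNIV" by simp
    have "exp (- (real d * v)) * x ^ m = exp (- (real d * (real m * y + v)))" for m
      unfolding x_def exp_of_nat_mult[symmetric] exp_add[symmetric] by (simp add: algebra_simps)
    then have "chi d * of_nat d ^ k * of_real (exp (- (real d * v))) * of_real (x ^ m) =
        chi d * of_nat d ^ k * of_real (exp (- (real d * (real m * y + v))))" for m
      by (simp only: mult.assoc of_real_mult[symmetric])
    with * show "((\<lambda>m. case (d, m) of (d, m) \<Rightarrow> chi d * of_nat d ^ k * of_real (exp (- (real d * (real m * y + v))))) has_sum
        chi d * of_nat d ^ k / of_real (1 - exp (- (real d * y))) * of_real (exp (- (real d * v)))) UNIV"
      unfolding prod.case x_def[symmetric] by (simp only:)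
  qed
  then have "((\<lambda>d. chi d * of_nat d ^ k / of_real (1 - exp (- (real d * y))) * of_real (exp (- (real d * v)))) has_sum T) UNIV"
    by (subst (asm) has_sum_atLeast_1) auto
  then have "T = exp_series (\<lambda>d. chi d * of_nat d ^ k / of_real (1 - exp (- (real d * y)))) v"
    using exp_series_has_sum[OF cb v] has_sum_unique by blast
  with 1 show ?thesis by simp
qed

end

lemma exp_minus_periodic: "exp (- (z + 2 * of_real pi * \<i>)) = exp (- z)"
  by (simp add: exp_diff exp_minus)

context odd_primitive_character
begin

text \<open>For weight one the double sum does not converge absolutely. Instead the identity for
  \<open>k = 2\<close> is integrated three times in the shift \<open>w\<close>; the symmetry \<open>w \<mapsto> y - w\<close> and
  the limit \<open>w \<rightarrow> 0\<close> determine the constants of integration.\<close>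

lemma lambert_transformation_0:
  assumes y: "y > 0"
  shows "lambert 0 y = dirichlet_L chi 1 / of_real y - dirichlet_L chi 0 / 2 +
     (-2 * of_real pi * \<i> / of_real y) / cnj (gauss_sum q chi) * lambert_dual 0 (4 * pi\<^sup>2 / (real q * y))"
proof -
  interpret C: odd_primitive_character q "cnj \<circ> chi" by (rule cnj_character)
  define \<eta> where "\<eta> = 4 * pi\<^sup>2 / (real q * y)"
  have \<eta>: "\<eta> > 0" using y q_gt_2 by (simp add: \<eta>_def)
  define \<tau> where "\<tau> = cnj (gauss_sum q chi)"
  have \<tau>: "\<tau> \<noteq> 0" using gauss_sum_nonzero by (simp add: \<tau>_def)
  define \<omega> where "\<omega> = 2 * of_real pi * \<i> / complex_of_real y"

  \<comment> \<open>Coefficients of a half-line sum: \<open>p = 3\<close> belongs to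
    \<open>k = 2\<close>, \<open>p = 1\<close> to the sought case \<open>k = 0\<close>, and
    \<open>p = 0\<close> is one integration further.\<close>
  define \<alpha> where "\<alpha> p d = of_nat d ^ p * (chi d / of_nat d / of_real (1 - exp (- (real d * y))))" for p d
  define Ca where "Ca = 1 / (1 - exp (- y))"
  have y1: "1 - exp (- y) > 0" using y by simp
  have \<alpha>0: "norm (chi d / of_nat d / of_real (1 - exp (- (real d * y)))) \<le> Ca" for d
  proof (cases "d = 0")
    case False
    have d: "1 - exp (- y) \<le> 1 - exp (- (real d * y))" using False y by simp
    have "norm (chi d / of_nat d / of_real (1 - exp (- (real d * y)))) = norm (chi d) / real d / (1 - exp (- (real d * y)))"
      unfolding norm_divide norm_of_real using d y1 by simp
    also have "\<dots> \<le> 1 / (1 - exp (- y))"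
    proof (intro frac_le)
      show "norm (chi d) / real d \<le> 1" using norm_chi_le_1[of d] False by (simp add: divide_le_eq)
    qed (use d y1 in auto)
    finally show ?thesis by (simp add: Ca_def)
  qed (use y1 in \<open>simp add: Ca_def\<close>)
  have \<alpha>b: "norm (\<alpha> p d) \<le> Ca * real d ^ p" for p d
    using mult_left_mono[OF \<alpha>0[of d], of "real d ^ p"]
    by (simp only: \<alpha>_def norm_mult[of "of_nat d ^ p"] norm_power norm_of_nat mult.commute[of Ca] zero_le_power of_nat_0_le_iff)
  have \<alpha>S: "(\<lambda>n. of_nat n * \<alpha> p n) = \<alpha> (Suc p)" for p by (simp add: \<alpha>_def fun_eq_iff)
  have \<alpha>D: "(exp_series (\<alpha> p) has_vector_derivative - exp_series (\<alpha> (Suc p)) t) (at t)" if "t > 0" for p t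
    using exp_series_has_vector_derivative[OF \<alpha>b that, of p] unfolding \<alpha>S .
  \<comment> \<open>The lattice points with m >= 0 are seen from \<open>w\<close>, those with m < 0
    from \<open>y - w\<close>. The sign makes \<open>A (Suc p)\<close> the derivative of
    \<open>A p\<close>, and for \<open>p = 3\<close> it gives the full sum over the
    integers.\<close>
  define A where "A p w = (-1) ^ Suc p * exp_series (\<alpha> p) w + exp_series (\<alpha> p) (y - w)" for p w
  have AD: "(A p has_vector_derivative A (Suc p) w) (at w)" if w: "0 < w" "w < y" for p w
  proof -
    have "((\<lambda>w. y - w) has_vector_derivative (-1)) (at w)" by (auto intro!: derivative_eq_intros)
    from vector_diff_chain_at[OF this \<alpha>D[of "y - w" p]] w
    have "((\<lambda>w. exp_series (\<alpha> p) (y - w)) has_vector_derivative exp_series (\<alpha> (Suc p)) (y - w)) (at w)"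
      by (simp add: o_def)
    moreover have "((\<lambda>w. (-1) ^ Suc p * exp_series (\<alpha> p) w) has_vector_derivative (-1) ^ Suc p * (- exp_series (\<alpha> (Suc p)) w)) (at w)"
      by (intro has_vector_derivative_mult_right \<alpha>D w)
    ultimately have "((\<lambda>w. (-1) ^ Suc p * exp_series (\<alpha> p) w + exp_series (\<alpha> p) (y - w)) has_vector_derivative
        (-1) ^ Suc p * (- exp_series (\<alpha> (Suc p)) w) + exp_series (\<alpha> (Suc p)) (y - w)) (at w)"
      by (rule has_vector_derivative_add[rotated])
    then show ?thesis unfolding A_def[abs_def] by simp
  qed

  \<comment> \<open>The value at j \<open>\<eta>\<close> decays like exp (- j
    \<open>\<eta>\<close>). Half of this decay keeps the coefficients bounded; the other half is put
    into the variable \<open>z w\<close> below, whose real part must be positive for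
    \<open>cexp_series\<close>.\<close>
  define \<beta> where "\<beta> p j = of_nat j ^ p * (C.chi_series 0 (real j * \<eta>) * of_real (exp (real j * (\<eta> / 2))) / of_nat j)" for p j
  define Cb where "Cb = 1 / (1 - exp (- \<eta>))"
  have \<eta>1: "1 - exp (- \<eta>) > 0" using \<eta> by simp
  have E0: "norm (C.chi_series 0 t) \<le> exp (- t) / (1 - exp (- t))" if t: "t > 0" for t
  proof -
    have "((\<lambda>n. exp (- (real n * t))) has_sum (1 / (1 - exp (- t)))) UNIV"
    proof (rule norm_summable_imp_has_sum)
      have "(\<lambda>n. exp (- t) ^ n) sums (1 / (1 - exp (- t)))" using t by (intro geometric_sums) auto
      then show "(\<lambda>n. exp (- (real n * t))) sums (1 / (1 - exp (- t)))" by (simp add: exp_of_nat_mult[symmetric])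
      then show "summable (\<lambda>n. norm (exp (- (real n * t))))" by (simp add: sums_iff)
    qed
    then have g: "((\<lambda>n. exp (- t) * exp (- (real n * t))) has_sum (exp (- t) * (1 / (1 - exp (- t))))) UNIV"
      by (rule has_sum_cmult_right)
    have "((\<lambda>n. (cnj \<circ> chi) n * of_nat n ^ 0 * of_real (exp (- (real n * t)))) has_sum C.chi_series 0 t) UNIV"
      unfolding C.chi_series_def by (rule exp_series_has_sum[OF C.chi_series_coeff_bound t])
    then have "((\<lambda>n. (cnj \<circ> chi) (Suc n) * of_nat (Suc n) ^ 0 * of_real (exp (- (real (Suc n) * t)))) has_sum C.chi_series 0 t) UNIV"
      by (subst has_sum_Suc_iff[of "\<lambda>n. (cnj \<circ> chi) n * of_nat n ^ 0 * of_real (exp (- (real n * t)))"]) auto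
    then have "norm (C.chi_series 0 t) \<le> exp (- t) * (1 / (1 - exp (- t)))"
    proof (rule norm_infsum_le[OF _ g])
      fix n :: nat
      have "norm ((cnj \<circ> chi) (Suc n) * of_nat (Suc n) ^ 0 * complex_of_real (exp (- (real (Suc n) * t)))) \<le> 1 * exp (- (real (Suc n) * t))"
        unfolding norm_mult using norm_chi_le_1[of "Suc n"] by (intro mult_mono) auto
      also have "\<dots> = exp (- t) * exp (- (real n * t))" unfolding exp_add[symmetric] by (simp add: algebra_simps)
      finally show "norm ((cnj \<circ> chi) (Suc n) * of_nat (Suc n) ^ 0 * complex_of_real (exp (- (real (Suc n) * t)))) \<le> exp (- t) * exp (- (real n * t))" .
    qed
    then show ?thesis by simp
  qed
  have \<beta>0: "norm (C.chi_series 0 (real j * \<eta>) * of_real (exp (real j * (\<eta> / 2))) / of_nat j) \<le> Cb" for j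
  proof (cases "j = 0")
    case False
    define t where "t = real j * \<eta>"
    have t: "t \<ge> \<eta>" "t > 0" using False \<eta> by (auto simp: t_def)
    have "norm (C.chi_series 0 t * of_real (exp (real j * (\<eta> / 2))) / of_nat j) = norm (C.chi_series 0 t) * exp (t / 2) / real j"
      by (simp add: norm_mult norm_divide t_def)
    also have "\<dots> \<le> (exp (- t) / (1 - exp (- t))) * exp (t / 2) / 1"
      using E0[OF t(2)] False t(2) by (intro frac_le mult_right_mono) auto
    also have "\<dots> = exp (- (t / 2)) / (1 - exp (- t))"
      by (simp add: exp_add[symmetric])
    also have "\<dots> \<le> 1 / (1 - exp (- \<eta>))" using t \<eta>1 by (intro frac_le) auto
    finally show ?thesis by (simp add: t_def Cb_def)
  qed (use \<eta>1 in \<open>simp add: Cb_def\<close>)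
  have \<beta>b: "norm (\<beta> p j) \<le> Cb * real j ^ p" for p j
    using mult_left_mono[OF \<beta>0[of j], of "real j ^ p"]
    by (simp only: \<beta>_def norm_mult[of "of_nat j ^ p"] norm_power norm_of_nat mult.commute[of Cb] zero_le_power of_nat_0_le_iff)
  have \<beta>S: "(\<lambda>n. of_nat n * \<beta> p n) = \<beta> (Suc p)" for p by (simp add: \<beta>_def fun_eq_iff)
  define z where "z w = complex_of_real (\<eta> / 2) - \<omega> * of_real w" for w :: real
  have Rez: "Re (z w) > 0" for w using \<eta> by (simp add: z_def \<omega>_def)
  define B where "B p w = cexp_series (\<beta> p) (z w)" for p w
  have zD: "(z has_vector_derivative (- \<omega>)) (at w)" for w
    unfolding z_def by (auto intro!: derivative_eq_intros)
  have BD: "(B p has_vector_derivative \<omega> * B (Suc p) w) (at w)" for p w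
  proof -
    have "(cexp_series (\<beta> p) has_field_derivative - cexp_series (\<beta> (Suc p)) (z w)) (at (z w))"
      using DERIV_cexp_series[OF \<beta>b Rez, of p w] unfolding \<beta>S .
    from field_vector_diff_chain_at[OF zD this] show ?thesis by (simp add: B_def[abs_def] o_def)
  qed
  \<comment> \<open>Shifting \<open>w\<close> by \<open>y\<close> moves \<open>z\<close> by a period
    of the exponential.\<close>
  have Bper: "B p (y - w) = B p (- w)" for p w
  proof -
    have "z (- w) = z (y - w) + 2 * of_real pi * \<i>" using y by (simp add: z_def \<omega>_def field_simps)
    then show ?thesis by (simp only: B_def cexp_series_def exp_minus_periodic)
  qed
  have Bval: "((\<lambda>j. of_nat j ^ k * exp (2 * of_real pi * \<i> * of_real w / of_real y) ^ j * C.chi_series 0 (real j * \<eta>)) has_sum B (Suc k) w) {1..}" for k w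
  proof -
    let ?u = "exp (2 * of_real pi * \<i> * of_real w / of_real y)"
    have eq: "\<beta> (Suc k) j * exp (- z w) ^ j = of_nat j ^ k * ?u ^ j * C.chi_series 0 (real j * \<eta>)" if "j \<ge> 1" for j
    proof -
      have "exp (- z w) = ?u * of_real (exp (- (\<eta> / 2)))"
      proof -
        have "- z w = 2 * of_real pi * \<i> * of_real w / of_real y + of_real (- (\<eta> / 2))" by (simp add: z_def \<omega>_def)
        then show ?thesis by (simp only: exp_add exp_of_real)
      qed
      then have "exp (- z w) ^ j = ?u ^ j * of_real (exp (- (real j * (\<eta> / 2))))"
        by (simp add: power_mult_distrib exp_of_nat_mult[symmetric] flip: of_real_power)
      moreover have "complex_of_real (exp (real j * (\<eta> / 2))) * of_real (exp (- (real j * (\<eta> / 2)))) = 1"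
        unfolding of_real_mult[symmetric] exp_add[symmetric] by simp
      ultimately show ?thesis using that by (simp add: \<beta>_def mult_ac)
    qed
    have "((\<lambda>j. \<beta> (Suc k) j * exp (- z w) ^ j) has_sum B (Suc k) w) UNIV"
    proof (rule norm_summable_imp_has_sum)
      show "(\<lambda>j. \<beta> (Suc k) j * exp (- z w) ^ j) sums B (Suc k) w"
        unfolding B_def by (rule cexp_series_sums[OF \<beta>b Rez])
      show "summable (\<lambda>j. norm (\<beta> (Suc k) j * exp (- z w) ^ j))"
      proof (rule summable_comparison_test')
        show "summable (\<lambda>n. Cb * (real n ^ Suc k * norm (exp (- z w)) ^ n))"
          using Rez[of w] by (intro summable_mult summable_power_times_geometric) auto
        show "norm (norm (\<beta> (Suc k) n * exp (- z w) ^ n)) \<le> Cb * (real n ^ Suc k * norm (exp (- z w)) ^ n)" for n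
          using mult_right_mono[OF \<beta>b[of "Suc k" n], of "norm (exp (- z w)) ^ n"] by (simp add: norm_mult norm_power mult.assoc)
      qed
    qed
    then have "((\<lambda>j. \<beta> (Suc k) j * exp (- z w) ^ j) has_sum B (Suc k) w) {1..}"
      by (subst has_sum_atLeast_1) (auto simp: \<beta>_def)
    also have "?this \<longleftrightarrow> ?thesis" by (rule has_sum_cong) (use eq in auto)
    finally show ?thesis .
  qed

  \<comment> \<open>Normalised so that \<open>G (Suc p)\<close> is the derivative of
    \<open>G p\<close> and \<open>G 3\<close> is the right-hand side of the identity for
    \<open>k = 2\<close>.\<close>
  define G where "G p w = - (\<omega> ^ p / \<tau>) * (B p w - (-1) ^ p * B p (- w))" for p w
  have GD: "(G p has_vector_derivative G (Suc p) w) (at w)" for p w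
  proof -
    have "((\<lambda>w. - w) has_vector_derivative (-1)) (at w)" by (auto intro!: derivative_eq_intros)
    from vector_diff_chain_at[OF this BD[of p "- w"]]
    have "((\<lambda>w. B p (- w)) has_vector_derivative - (\<omega> * B (Suc p) (- w))) (at w)" by (simp add: o_def)
    then have "((\<lambda>w. - (\<omega> ^ p / \<tau>) * (B p w - (-1) ^ p * B p (- w))) has_vector_derivative
        - (\<omega> ^ p / \<tau>) * (\<omega> * B (Suc p) w - (-1) ^ p * (- (\<omega> * B (Suc p) (- w))))) (at w)"
      by (intro has_vector_derivative_mult_right has_vector_derivative_diff BD)
    then show ?thesis unfolding G_def[abs_def] by (simp add: algebra_simps)
  qed

  have A3: "A 3 w = G 3 w" if w: "0 < w" "w < y" for w
  proof -
    obtain T where T: "((\<lambda>m::int. \<tau> / fact 2 * chi_series 2 \<bar>of_int m * y + w\<bar>) has_sum T) UNIV"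
      "((\<lambda>n. fourier_term 2 y n w + fourier_term 2 y n (- w)) has_sum T) UNIV"
      using poisson_interior[OF w, of 2] unfolding \<tau>_def by auto
    have a3: "exp_series (\<lambda>d. chi d * of_nat d ^ 2 / of_real (1 - exp (- (real d * y)))) = exp_series (\<alpha> 3)"
      by (rule arg_cong[where f = exp_series]) (auto simp: \<alpha>_def fun_eq_iff eval_nat_numeral)
    have "((\<lambda>m. \<tau> / fact 2 * chi_series 2 \<bar>of_int (int m) * y + w\<bar>) has_sum \<tau> / fact 2 * exp_series (\<alpha> 3) w) UNIV"
      using has_sum_cmult_right[OF chi_series_shifted_has_sum[OF y w(1), of 2], of "\<tau> / fact 2"] y w unfolding a3
      by (simp add: add_nonneg_nonneg)
    moreover have "((\<lambda>m. \<tau> / fact 2 * chi_series 2 \<bar>of_int (- int m - 1) * y + w\<bar>) has_sum \<tau> / fact 2 * exp_series (\<alpha> 3) (y - w)) UNIV"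
    proof -
      have "\<bar>of_int (- int m - 1) * y + w\<bar> = real m * y + (y - w)" for m
      proof -
        have "real m * y \<ge> 0" using y by simp
        moreover have "of_int (- int m - 1) * y + w = - (real m * y + (y - w))" by (simp add: algebra_simps)
        ultimately show ?thesis using w by linarith
      qed
      then show ?thesis
        using has_sum_cmult_right[OF chi_series_shifted_has_sum[OF y, of "y - w" 2], of "\<tau> / fact 2"] w unfolding a3 by simp
    qed
    ultimately have "((\<lambda>m::int. \<tau> / fact 2 * chi_series 2 \<bar>of_int m * y + w\<bar>) has_sum
       (\<tau> / fact 2 * exp_series (\<alpha> 3) w + \<tau> / fact 2 * exp_series (\<alpha> 3) (y - w))) UNIV"
      by (rule has_sum_int_split)
    then have T1: "T = \<tau> / 2 * A 3 w" using has_sum_unique[OF T(1)] by (simp add: A_def ring_distribs)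
    have "((\<lambda>n. fourier_term 2 y n w) has_sum ((-2 * of_real pi * \<i> / of_real y) ^ Suc 2 / fact 2 * B (Suc 2) w)) UNIV" for w
      by (rule fourier_term_has_sum[OF y _ refl]) (use Bval[of 2 w] in \<open>auto simp: \<eta>_def\<close>)
    from has_sum_add[OF this[of w] this[of "- w"]]
    have T2: "T = (-2 * of_real pi * \<i> / of_real y) ^ Suc 2 / fact 2 * B (Suc 2) w + (-2 * of_real pi * \<i> / of_real y) ^ Suc 2 / fact 2 * B (Suc 2) (- w)"
      using has_sum_unique[OF T(2)] by simp
    have "-2 * of_real pi * \<i> / of_real y = - \<omega>" by (simp add: \<omega>_def)
    then have m3: "(-2 * of_real pi * \<i> / of_real y) ^ Suc 2 = - (\<omega> ^ 3)" by (simp only:) (simp add: eval_nat_numeral)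
    have "T = - (\<omega> ^ 3) / 2 * B 3 w + - (\<omega> ^ 3) / 2 * B 3 (- w)" using T2 unfolding m3 by simp
    then have "\<tau> / 2 * A 3 w = - (\<omega> ^ 3 / 2) * (B 3 w + B 3 (- w))"
      unfolding T1 by (simp add: ring_distribs)
    then have "2 / \<tau> * (\<tau> / 2 * A 3 w) = 2 / \<tau> * (- (\<omega> ^ 3 / 2) * (B 3 w + B 3 (- w)))" by (simp only:)
    then show ?thesis using \<tau> by (simp add: G_def)
  qed

  define D where "D p w = A p w - G p w" for p w
  have DD: "(D p has_vector_derivative D (Suc p) w) (at w within {0<..<y})" if "w \<in> {0<..<y}" for p w
    unfolding D_def[abs_def] using that
    by (intro has_vector_derivative_at_within[OF has_vector_derivative_diff] AD GD) auto
  have D3: "D 3 w = 0" if "w \<in> {0<..<y}" for w using that A3[of w] by (simp add: D_def)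
  \<comment> \<open>The reflection exchanges the two halves of \<open>A\<close> and, by periodicity,
    the values of \<open>B\<close> at \<open>w\<close> and at \<open>- w\<close>.\<close>
  have Dsym: "D p (y - w) = (-1) ^ Suc p * D p w" for p w
  proof -
    have "A p (y - w) = (-1) ^ Suc p * A p w" by (cases "even p") (auto simp: A_def)
    moreover have "B p (- (y - w)) = B p w" using Bper[of p "y - w"] by simp
    then have "G p (y - w) = (-1) ^ Suc p * G p w" using Bper[of p w] by (cases "even p") (auto simp: G_def algebra_simps)
    ultimately show ?thesis by (simp add: D_def algebra_simps)
  qed
  have "\<exists>c. \<forall>w\<in>{0<..<y}. D 2 w = c"
  proof (rule has_vector_derivative_zero_constant)
    show "(D 2 has_vector_derivative 0) (at w within {0<..<y})" if "w \<in> {0<..<y}" for w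
      using DD[OF that, of 2] D3[OF that] by (simp add: numeral_3_eq_3 numeral_2_eq_2)
  qed auto
  then obtain c2 where c2: "\<And>w. w \<in> {0<..<y} \<Longrightarrow> D 2 w = c2" by blast
  \<comment> \<open>\<open>D 2\<close> is constant and changes sign under reflection at y / 2. Hence
    \<open>D 1\<close> is constant and \<open>D 0\<close> is linear; since \<open>D 0\<close>
    changes sign too, only the slope \<open>c1\<close> remains unknown.\<close>
  have "c2 = 0"
  proof -
    have "D 2 (y / 2) = - D 2 (y / 2)" using Dsym[of 2 "y / 2"] by simp
    then show ?thesis using c2[of "y / 2"] y by simp
  qed
  have "\<exists>c. \<forall>w\<in>{0<..<y}. D 1 w = c"
  proof (rule has_vector_derivative_zero_constant)
    show "(D 1 has_vector_derivative 0) (at w within {0<..<y})" if "w \<in> {0<..<y}" for w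
      using DD[OF that, of 1] c2[OF that] \<open>c2 = 0\<close> by (simp add: numeral_2_eq_2)
  qed auto
  then obtain c1 where c1: "\<And>w. w \<in> {0<..<y} \<Longrightarrow> D 1 w = c1" by blast
  have "\<exists>c. \<forall>w\<in>{0<..<y}. D 0 w - of_real w * c1 = c"
  proof (rule has_vector_derivative_zero_constant)
    fix w assume w: "w \<in> {0<..<y}"
    have "((\<lambda>w. D 0 w - of_real w * c1) has_vector_derivative D 1 w - of_real 1 * c1) (at w within {0<..<y})"
      using DD[OF w, of 0]
      by (intro has_vector_derivative_diff has_vector_derivative_mult_left has_vector_derivative_of_real) (auto intro!: derivative_eq_intros)
    then show "((\<lambda>w. D 0 w - of_real w * c1) has_vector_derivative 0) (at w within {0<..<y})"
      using c1[OF w] by simp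
  qed auto
  then obtain c0 where c0: "\<And>w. w \<in> {0<..<y} \<Longrightarrow> D 0 w - of_real w * c1 = c0" by blast
  have "D 0 (y / 2) = - D 0 (y / 2)" using Dsym[of 0 "y / 2"] by simp
  then have "c0 = - of_real (y / 2) * c1" using c0[of "y / 2"] y by simp
  then have D0: "D 0 w = of_real (w - y / 2) * c1" if "w \<in> {0<..<y}" for w
    using c0[OF that] by (simp add: algebra_simps)

  \<comment> \<open>The offset 2 keeps the sequence strictly below \<open>y\<close> from its first
    term on.\<close>
  define w where "w n = y / real (n + 2)" for n :: nat
  have w: "w n \<in> {0<..<y}" for n
  proof -
    have "y * 1 < y * real (n + 2)" using y by (intro mult_strict_left_mono) auto
    then show ?thesis using y by (simp add: w_def divide_less_eq)
  qed
  have w0: "w \<longlonglongrightarrow> 0" unfolding w_def using y by real_asymp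
  have exps_cont: "(\<lambda>n. exp_series (\<alpha> p) (y - w n)) \<longlonglongrightarrow> exp_series (\<alpha> p) y"
    "(\<lambda>n. exp_series (\<alpha> p) (w n + y)) \<longlonglongrightarrow> exp_series (\<alpha> p) y" for p
  proof -
    have "isCont (exp_series (\<alpha> p)) y" using \<alpha>D[OF y, of p] by (rule has_vector_derivative_continuous)
    moreover have "(\<lambda>n. y - w n) \<longlonglongrightarrow> y" "(\<lambda>n. w n + y) \<longlonglongrightarrow> y"
      using tendsto_diff[OF tendsto_const w0, of y] tendsto_add[OF w0 tendsto_const, of y] by auto
    ultimately show "(\<lambda>n. exp_series (\<alpha> p) (y - w n)) \<longlonglongrightarrow> exp_series (\<alpha> p) y"
      "(\<lambda>n. exp_series (\<alpha> p) (w n + y)) \<longlonglongrightarrow> exp_series (\<alpha> p) y"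
      by (auto intro: isCont_tendsto_compose)
  qed
  have G_lim: "(\<lambda>n. G p (w n)) \<longlonglongrightarrow> G p 0" for p
    using isCont_tendsto_compose[OF has_vector_derivative_continuous[OF GD] w0, of p] .
  \<comment> \<open>Splits off the lattice point m = 0, the only one that meets the origin as the
    shift tends to 0. Its coefficients are those of L (1) for \<open>p = 0\<close> and of L (0) for
    \<open>p = 1\<close>, so its limit is an Abel limit.\<close>
  have split: "exp_series (\<alpha> p) t = exp_series (\<lambda>n. \<alpha> p n * of_real (1 - exp (- (real n * y)))) t + exp_series (\<alpha> p) (t + y)"
    if t: "t > 0" for p t
  proof -
    have "(\<lambda>n. \<alpha> p n * of_real (exp (- (real n * t))) - \<alpha> p n * of_real (exp (- (real n * (t + y))))) sums
        (exp_series (\<alpha> p) t - exp_series (\<alpha> p) (t + y))"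
      using t y by (intro sums_diff exp_series_sums[OF \<alpha>b]) auto
    also have "(\<lambda>n. \<alpha> p n * of_real (exp (- (real n * t))) - \<alpha> p n * of_real (exp (- (real n * (t + y))))) =
       (\<lambda>n. \<alpha> p n * of_real (1 - exp (- (real n * y))) * of_real (exp (- (real n * t))))"
    proof
      fix n
      have "exp (- (real n * (t + y))) = exp (- (real n * y)) * exp (- (real n * t))"
        unfolding exp_add[symmetric] by (simp add: algebra_simps)
      then show "\<alpha> p n * of_real (exp (- (real n * t))) - \<alpha> p n * of_real (exp (- (real n * (t + y)))) =
        \<alpha> p n * of_real (1 - exp (- (real n * y))) * of_real (exp (- (real n * t)))"
        by (simp add: algebra_simps)
    qed
    finally have "exp_series (\<lambda>n. \<alpha> p n * of_real (1 - exp (- (real n * y)))) t = exp_series (\<alpha> p) t - exp_series (\<alpha> p) (t + y)"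
      unfolding exp_series_def by (rule sums_unique[symmetric])
    then show ?thesis by simp
  qed
  have nz: "1 - exp (- (real n * y)) \<noteq> 0" if "n \<noteq> 0" for n using that y by simp
  have co0: "(\<lambda>n. \<alpha> 0 n * of_real (1 - exp (- (real n * y)))) = (\<lambda>n. chi n * of_real (real n powr (- 1)))"
  proof
    fix n show "\<alpha> 0 n * of_real (1 - exp (- (real n * y))) = chi n * of_real (real n powr (- 1))"
      using nz[of n] by (cases "n = 0") (auto simp: \<alpha>_def powr_minus_divide simp del: of_real_diff)
  qed
  have co1: "(\<lambda>n. \<alpha> 1 n * of_real (1 - exp (- (real n * y)))) = (\<lambda>n. chi n * of_real (real n powr (- 0)))"
  proof
    fix n show "\<alpha> 1 n * of_real (1 - exp (- (real n * y))) = chi n * of_real (real n powr (- 0))"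
      using nz[of n] by (cases "n = 0") (auto simp: \<alpha>_def simp del: of_real_diff)
  qed
  have wpos: "w n > 0" for n using w[of n] by simp
  \<comment> \<open>The limit at 0 of the linear function \<open>D 0\<close> determines the slope
    \<open>c1\<close>, because the parts at \<open>y\<close> cancel and
    \<open>G 0 0 = 0\<close>.\<close>
  have "(\<lambda>n. D 0 (w n)) \<longlonglongrightarrow> - dirichlet_L chi (of_real 1) - G 0 0"
  proof -
    have "(\<lambda>n. - (exp_series (\<lambda>n. chi n * of_real (real n powr (- 1))) (w n) + exp_series (\<alpha> 0) (w n + y)) + exp_series (\<alpha> 0) (y - w n) - G 0 (w n))
       \<longlonglongrightarrow> - (dirichlet_L chi (of_real 1) + exp_series (\<alpha> 0) y) + exp_series (\<alpha> 0) y - G 0 0"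
      by (intro tendsto_intros exps_cont G_lim exp_series_tendsto_L wpos w0) auto
    moreover have "D 0 (w n) = - (exp_series (\<lambda>n. chi n * of_real (real n powr (- 1))) (w n) + exp_series (\<alpha> 0) (w n + y)) + exp_series (\<alpha> 0) (y - w n) - G 0 (w n)" for n
      using split[OF wpos, of 0 n] unfolding co0 by (simp add: D_def A_def)
    ultimately show ?thesis by simp
  qed
  moreover have "(\<lambda>n. D 0 (w n)) \<longlonglongrightarrow> of_real (0 - y / 2) * c1"
    unfolding D0[OF w] by (intro tendsto_intros w0) simp
  ultimately have "- dirichlet_L chi (of_real 1) - G 0 0 = of_real (0 - y / 2) * c1"
    by (rule LIMSEQ_unique)
  then have "c1 = 2 * dirichlet_L chi 1 / of_real y" using y by (simp add: G_def field_simps)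
  \<comment> \<open>The constant \<open>D 1\<close> equals its limit at 0; here the two parts at
    \<open>y\<close> add up and give twice the Lambert series.\<close>
  have "(\<lambda>n. D 1 (w n)) \<longlonglongrightarrow> (dirichlet_L chi (of_real 0) + exp_series (\<alpha> 1) y) + exp_series (\<alpha> 1) y - G 1 0"
  proof -
    have "(\<lambda>n. (exp_series (\<lambda>n. chi n * of_real (real n powr (- 0))) (w n) + exp_series (\<alpha> 1) (w n + y)) + exp_series (\<alpha> 1) (y - w n) - G 1 (w n))
       \<longlonglongrightarrow> (dirichlet_L chi (of_real 0) + exp_series (\<alpha> 1) y) + exp_series (\<alpha> 1) y - G 1 0"
      by (intro tendsto_intros exps_cont G_lim exp_series_tendsto_L wpos w0) auto
    moreover have "D 1 (w n) = (exp_series (\<lambda>n. chi n * of_real (real n powr (- 0))) (w n) + exp_series (\<alpha> 1) (w n + y)) + exp_series (\<alpha> 1) (y - w n) - G 1 (w n)" for n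
      using split[OF wpos, of 1 n] unfolding co1 by (simp add: D_def A_def)
    ultimately show ?thesis by simp
  qed
  moreover have "(\<lambda>n. D 1 (w n)) \<longlonglongrightarrow> c1" unfolding c1[OF w] by simp
  ultimately have main: "(dirichlet_L chi (of_real 0) + exp_series (\<alpha> 1) y) + exp_series (\<alpha> 1) y - G 1 0 = c1"
    by (rule LIMSEQ_unique)
  have "exp_series (\<alpha> 1) y = lambert 0 y"
  proof -
    have "exp_series (\<lambda>d. chi d * of_nat d ^ 0 / of_real (1 - exp (- (real d * y)))) = exp_series (\<alpha> 1)"
      by (rule arg_cong[where f = exp_series]) (auto simp: \<alpha>_def fun_eq_iff)
    then have "((\<lambda>m. chi_series 0 (real m * y + y)) has_sum exp_series (\<alpha> 1) y) UNIV"
      using chi_series_shifted_has_sum[OF y y, of 0] by simp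
    moreover have "real m * y + y = real (Suc m) * y" for m by (simp add: algebra_simps)
    ultimately show ?thesis using lambert_has_sum[OF y, of 0] has_sum_unique by (simp only:) blast
  qed
  moreover have "G 1 0 = - 2 * \<omega> / \<tau> * lambert_dual 0 \<eta>"
  proof -
    obtain X where X: "((\<lambda>(j, n). of_nat j ^ 0 * 1 ^ j * (cnj (chi n) * of_real (exp (- (real j * real n * \<eta>))))) has_sum X) ({1..} \<times> {1..})"
      "((\<lambda>j. of_nat j ^ 0 * 1 ^ j * C.chi_series 0 (real j * \<eta>)) has_sum X) {1..}"
      using dual_pairs[OF \<eta>, of 1 0] by auto
    have "X = lambert_dual 0 \<eta>"
      using X(1) lambert_dual_has_sum[OF \<eta>, of 0] has_sum_unique by auto
    moreover have "B 1 0 = X" using Bval[of 0 0] X(2) has_sum_unique by auto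
    ultimately show ?thesis by (simp add: G_def)
  qed
  ultimately have "dirichlet_L chi 0 + 2 * lambert 0 y + 2 * \<omega> / \<tau> * lambert_dual 0 \<eta> = 2 * dirichlet_L chi 1 / of_real y"
    using main \<open>c1 = _\<close> by (simp add: add_ac)
  then have "lambert 0 y = dirichlet_L chi 1 / of_real y - dirichlet_L chi 0 / 2 - \<omega> / \<tau> * lambert_dual 0 \<eta>"
    by (simp add: field_simps)
  then show ?thesis by (simp add: \<omega>_def \<tau>_def \<eta>_def)
qed

theorem lambert_transformation:
  assumes y: "y > 0" and k: "even k"
  shows "lambert k y = (if k = 0 then dirichlet_L chi 1 / of_real y else 0) - dirichlet_L chi (- of_nat k) / 2 +
     (-2 * of_real pi * \<i> / of_real y) ^ Suc k / cnj (gauss_sum q chi) * lambert_dual k (4 * pi\<^sup>2 / (real q * y))"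
proof (cases "k = 0")
  case True
  then show ?thesis using lambert_transformation_0[OF y] by simp
next
  case False
  then have "k \<ge> 2" using k by (cases k rule: nat.exhaust) (auto simp: Suc_le_eq elim!: oddE)
  then show ?thesis using lambert_transformation_ge_2[OF y k] False by simp
qed

end

section \<open>The Bessel kernel\<close>

lemma cosh_ge_abs: "cosh u \<ge> \<bar>u::real\<bar>"
proof -
  have "1 + \<bar>u\<bar> + \<bar>u\<bar>\<^sup>2 / 2 \<le> exp \<bar>u\<bar>" by (rule exp_lower_Taylor_quadratic) simp
  moreover have "0 \<le> (\<bar>u\<bar> - 1)\<^sup>2" by simp
  then have "0 \<le> 1 - 2 * \<bar>u\<bar> + \<bar>u\<bar>\<^sup>2" by (simp add: power2_diff)
  ultimately have "2 * \<bar>u\<bar> \<le> exp \<bar>u\<bar>" by linarith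
  also have "\<dots> \<le> exp u + exp (- u)" by (cases "u \<ge> 0") auto
  finally show ?thesis by (simp add: cosh_def)
qed

lemma set_integrable_bessel_half:
  assumes z: "z > (0::real)"
  shows "set_integrable lborel {0<..} (\<lambda>u. exp (- (z * cosh u)))"
proof (rule set_integrable_dominated_pos)
  show "set_integrable lborel {0<..} (\<lambda>u. exp (- (z * u)))"
  proof -
    have "set_integrable lborel {0<..} (\<lambda>u. u powr (1 - 1) * exp (- (z * u)))"
      by (rule set_integrable_Gamma) (use z in auto)
    also have "?this \<longleftrightarrow> ?thesis" by (rule set_integrable_cong) auto
    finally show ?thesis .
  qed
  show "continuous_on {0<..} (\<lambda>u. exp (- (z * cosh u)))" by (intro continuous_intros)
  fix u :: real assume "u > 0"
  then have "z * u \<le> z * cosh u" using cosh_ge_abs[of u] z by (intro mult_left_mono) auto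
  then show "norm (exp (- (z * cosh u))) \<le> exp (- (z * u))" by simp
qed

lemma
  assumes z: "z > (0::real)"
  shows integrable_bessel: "integrable lborel (\<lambda>u. exp (- (z * cosh u)))"
    and bessel_K0_conv_pos: "bessel_K0 z = (LBINT u:{0<..}. exp (- (z * cosh u)))"
    and integral_bessel: "(LBINT u. exp (- (z * cosh u))) = 2 * bessel_K0 z"
proof -
  define F where "F u = indicator {0<..} u *\<^sub>R exp (- (z * cosh u))" for u :: real
  define G where "G u = indicator {0..} u *\<^sub>R exp (- (z * cosh u))" for u :: real
  have F: "integrable lborel F" using set_integrable_bessel_half[OF z] by (simp add: set_integrable_def F_def[abs_def])
  have Gm: "G \<in> borel_measurable lborel"
  proof -
    have "continuous_on {0..} (\<lambda>u. exp (- (z * cosh u)))" by (intro continuous_intros)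
    then have "set_borel_measurable borel {0..} (\<lambda>u. exp (- (z * cosh u)))"
      by (intro set_measurable_continuous_on) auto
    then show ?thesis by (simp add: set_borel_measurable_def G_def[abs_def])
  qed
  have ae: "AE u in lborel. F u = G u"
    using AE_lborel_singleton[of 0] by eventually_elim (auto simp: F_def G_def indicator_def)
  have G: "integrable lborel G" "integral\<^sup>L lborel G = integral\<^sup>L lborel F"
    using integrable_cong_AE[THEN iffD1, OF _ _ ae F] integral_cong_AE[OF _ _ ae] F Gm by auto
  have G': "integrable lborel (\<lambda>u. G (0 + (-1) * u))"
    by (rule lborel_integrable_real_affine[OF G(1)]) simp
  have GG: "integral\<^sup>L lborel (\<lambda>u. G (0 + (-1) * u)) = integral\<^sup>L lborel G"
    using lborel_integral_real_affine[of "-1" G 0] by simp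
  have sum: "exp (- (z * cosh u)) = F u + G (0 + (-1) * u)" for u
    by (auto simp: F_def G_def indicator_def)
  show "integrable lborel (\<lambda>u. exp (- (z * cosh u)))"
    unfolding sum by (intro Bochner_Integration.integrable_add F G')
  have "(LBINT u. exp (- (z * cosh u))) = integral\<^sup>L lborel F + integral\<^sup>L lborel (\<lambda>u. G (0 + (-1) * u))"
    unfolding sum by (intro Bochner_Integration.integral_add F G')
  also have "\<dots> = 2 * integral\<^sup>L lborel G" unfolding GG G(2) by simp
  also have GK: "integral\<^sup>L lborel G = bessel_K0 z" by (simp add: bessel_K0_def set_lebesgue_integral_def G_def[abs_def])
  finally show "(LBINT u. exp (- (z * cosh u))) = 2 * bessel_K0 z" .
  show "bessel_K0 z = (LBINT u:{0<..}. exp (- (z * cosh u)))"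
    using G(2) unfolding GK by (simp add: set_lebesgue_integral_def F_def[abs_def])
qed

text \<open>The substitution t = sqrt (r / p) exp u balances the two terms: p t + r / t becomes 2
  sqrt (p r) cosh u, and dt / t becomes du.\<close>

lemma
  assumes p: "p > (0::real)" and r: "r > 0"
  shows set_integrable_bessel_kernel: "set_integrable lborel {0<..} (\<lambda>t. exp (- (p * t + r / t)) / t)"
    and set_integral_bessel_kernel: "(LBINT t:{0<..}. exp (- (p * t + r / t)) / t) = 2 * bessel_K0 (2 * sqrt (p * r))"
proof -
  define z where "z = 2 * sqrt (p * r)"
  have z: "z > 0" using p r by (simp add: z_def)
  define c where "c = sqrt (r / p)"
  have c: "c > 0" using p r by (simp add: c_def)
  have pc: "p * c = sqrt (p * r)" "r / c = sqrt (p * r)"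
    using p r by (simp_all add: c_def real_sqrt_mult real_sqrt_divide field_simps)
  define f where "f t = exp (- (p * t + r / t)) / t" for t
  define g where "g u = c * exp u" for u
  have fg: "f (g u) * g u = exp (- (z * cosh u))" for u
  proof -
    have "p * g u = sqrt (p * r) * exp u" using pc(1) by (simp add: g_def flip: mult.assoc)
    moreover have "r / g u = sqrt (p * r) * exp (- u)" using pc(2) by (simp add: g_def exp_minus divide_inverse)
    ultimately have "p * g u + r / g u = z * cosh u" by (simp add: z_def cosh_def field_simps)
    moreover have "g u \<noteq> 0" using c by (simp add: g_def)
    ultimately show ?thesis by (simp add: f_def)
  qed
  have chi_series: "einterval (-\<infinity>) \<infinity> = (UNIV :: real set)" by (auto simp: einterval_def)
  have E': "einterval 0 \<infinity> = ({0<..} :: real set)" by (auto simp: einterval_def zero_ereal_def)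
  have int: "set_integrable lborel (einterval (-\<infinity>) \<infinity>) (\<lambda>u. f (g u) * g u)"
    unfolding chi_series fg using integrable_bessel[OF z] by (simp add: set_integrable_def)
  have d: "DERIV g u :> g u" for u unfolding g_def by (auto intro!: derivative_eq_intros)
  have cf: "isCont f (g u)" for u
  proof -
    have "g u > 0" using c by (simp add: g_def)
    moreover have "isCont f t" if "t > 0" for t unfolding f_def using that by (intro continuous_intros) auto
    ultimately show ?thesis by blast
  qed
  have cg: "isCont g u" for u unfolding g_def by (intro continuous_intros)
  have l0: "((ereal \<circ> g \<circ> real_of_ereal) \<longlongrightarrow> 0) (at_right (-\<infinity>))"
  proof -
    have "(g \<longlongrightarrow> 0) at_bot" unfolding g_def by real_asymp
    then show ?thesis by (simp add: zero_ereal_def ereal_tendsto_simps)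
  qed
  have l1: "((ereal \<circ> g \<circ> real_of_ereal) \<longlongrightarrow> \<infinity>) (at_left \<infinity>)"
  proof -
    have "filterlim g at_top at_top" unfolding g_def using c by real_asymp
    then show ?thesis by (simp add: ereal_tendsto_simps)
  qed
  have gp: "g u > 0" for u using c by (simp add: g_def)
  have fp: "0 \<le> f (g u)" for u using gp[of u] by (simp add: f_def)
  note * = interval_integral_substitution_nonneg[of "-\<infinity>" \<infinity> g g f, OF _ d cf cg fp less_imp_le[OF gp] l0 l1 int]
  show "set_integrable lborel {0<..} (\<lambda>t. exp (- (p * t + r / t)) / t)"
    using *(1) unfolding E' f_def by simp
  have "(LBINT t:{0<..}. f t) = (LBINT t=0..\<infinity>. f t)" by (simp add: interval_lebesgue_integral_def E')
  also have "\<dots> = (LBINT u=-\<infinity>..\<infinity>. f (g u) * g u)" using *(2) by simp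
  also have "\<dots> = (LBINT u. exp (- (z * cosh u)))" unfolding fg
    by (simp add: interval_lebesgue_integral_def chi_series set_lebesgue_integral_def)
  also have "\<dots> = 2 * bessel_K0 z" by (rule integral_bessel[OF z])
  finally show "(LBINT t:{0<..}. exp (- (p * t + r / t)) / t) = 2 * bessel_K0 (2 * sqrt (p * r))"
    unfolding f_def z_def .
qed

lemma exp_minus_le_power:
  assumes "x > (0::real)"
  shows "exp (- x) \<le> fact N / x ^ N"
proof -
  have "x ^ N / fact N \<le> exp x"
  proof -
    have "x ^ N / fact N = (\<Sum>n\<in>{N}. x ^ n / fact n)" by simp
    also have "\<dots> \<le> (\<Sum>n. x ^ n / fact n)"
      using assms summable_exp[of x] by (intro sum_le_suminf) (auto simp: field_simps)
    also have "\<dots> = exp x" by (simp add: exp_def divide_inverse mult.commute scaleR_conv_of_real)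
    finally show ?thesis .
  qed
  then show ?thesis using assms by (simp add: exp_minus field_simps)
qed

lemma bessel_K0_nonneg: "bessel_K0 z \<ge> 0"
  unfolding bessel_K0_def by (intro set_integral_nonneg) simp

text \<open>Only u in (0, 1] is kept, where z cosh u is at most 2 cosh 1. The lower bound does not
  depend on z, which is what the limit in the nonvanishing argument requires.\<close>

lemma bessel_K0_ge:
  assumes z: "0 < z" "z \<le> 2"
  shows "bessel_K0 z \<ge> exp (- (2 * cosh 1))"
proof -
  have int: "set_integrable lborel {0<..} (\<lambda>u. exp (- (z * cosh u)))" by (rule set_integrable_bessel_half[OF z(1)])
  have "exp (- (2 * cosh 1)) = (LBINT u:{0<..1::real}. exp (- (2 * cosh 1)))"
    by (simp add: set_lebesgue_integral_def)
  also have "\<dots> \<le> (LBINT u:{0<..1}. exp (- (z * cosh u)))"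
  proof (rule set_integral_mono)
    show "set_integrable lborel {0<..1::real} (\<lambda>u. exp (- (2 * cosh 1)) :: real)"
      by (simp add: set_integrable_def)
    show "set_integrable lborel {0<..1} (\<lambda>u. exp (- (z * cosh u)))"
      by (rule set_integrable_subset[OF int]) auto
    fix u :: real assume u: "u \<in> {0<..1}"
    have "cosh u \<le> cosh 1" using u by (subst cosh_real_nonneg_le_iff) auto
    then have "z * cosh u \<le> 2 * cosh 1" using z by (intro mult_mono) auto
    then show "exp (- (2 * cosh 1)) \<le> exp (- (z * cosh u))" by simp
  qed
  also have "\<dots> \<le> (LBINT u:{0<..}. exp (- (z * cosh u)))"
  proof -
    have "set_integrable lborel {0<..1} (\<lambda>u. exp (- (z * cosh u)))" by (rule set_integrable_subset[OF int]) auto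
    then show ?thesis using int unfolding set_lebesgue_integral_def set_integrable_def
      by (intro integral_mono) (auto simp: indicator_def)
  qed
  also have "\<dots> = bessel_K0 z" by (rule bessel_K0_conv_pos[OF z(1), symmetric])
  finally show ?thesis .
qed

section \<open>Dirichlet convolution\<close>

definition dconv :: "(nat \<Rightarrow> complex) \<Rightarrow> (nat \<Rightarrow> complex) \<Rightarrow> nat \<Rightarrow> complex" where
  "dconv f g n = (if n = 0 then 0 else \<Sum>d | d dvd n. f d * g (n div d))"

lemma dconv_commute: "dconv f g = dconv g f"
proof
  fix n show "dconv f g n = dconv g f n"
  proof (cases "n = 0")
    case False
    have "(\<Sum>d | d dvd n. f d * g (n div d)) = (\<Sum>d | d dvd n. g d * f (n div d))"
      by (rule sum.reindex_bij_witness[of _ "\<lambda>d. n div d" "\<lambda>d. n div d"])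
         (use False in \<open>auto simp: div_div_eq_right\<close>)
    then show ?thesis using False by (simp add: dconv_def)
  qed (simp add: dconv_def)
qed

lemma dconv_assoc: "dconv (dconv f g) h = dconv f (dconv g h)"
proof
  fix n show "dconv (dconv f g) h n = dconv f (dconv g h) n"
  proof (cases "n = 0")
    case False
    have fin: "finite {d. d dvd m}" if "m dvd n" for m
      using that False by (metis dvd_0_left_iff finite_divisors_nat neq0_conv)
    have "dconv (dconv f g) h n = (\<Sum>d | d dvd n. \<Sum>e | e dvd d. f e * g (d div e) * h (n div d))"
      using False by (auto simp: dconv_def sum_distrib_right intro!: sum.cong)
    also have "\<dots> = (\<Sum>(d, e)\<in>(SIGMA d:{d. d dvd n}. {e. e dvd d}). f e * g (d div e) * h (n div d))"
      using fin False by (subst sum.Sigma) auto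
    also have "\<dots> = (\<Sum>(e, c)\<in>(SIGMA e:{e. e dvd n}. {c. c dvd n div e}). f e * (g c * h (n div e div c)))"
      by (rule sum.reindex_bij_witness[of _ "\<lambda>(e, c). (e * c, e)" "\<lambda>(d, e). (e, d div e)"])
         (use False in \<open>auto simp: div_mult2_eq mult.assoc elim!: dvdE\<close>)
    also have "\<dots> = (\<Sum>e | e dvd n. \<Sum>c | c dvd n div e. f e * (g c * h (n div e div c)))"
      using fin False by (subst sum.Sigma) (auto simp: div_dvd_iff_mult intro!: fin)
    also have "\<dots> = dconv f (dconv g h) n"
      using False by (auto simp: dconv_def sum_distrib_left dvd_div_eq_0_iff intro!: sum.cong)
    finally show ?thesis .
  qed (simp add: dconv_def)
qed

lemma dconv_add_right: "dconv f (\<lambda>n. g n + h n) = (\<lambda>n. dconv f g n + dconv f h n)"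
  by (auto simp: dconv_def fun_eq_iff sum.distrib ring_distribs)

text \<open>Weighting by the exponent of a fixed prime is a derivation of the convolution algebra, just as
  multiplication by the logarithm is, but needs no von Mangoldt function.\<close>

definition val_weight :: "nat \<Rightarrow> (nat \<Rightarrow> complex) \<Rightarrow> nat \<Rightarrow> complex" where
  "val_weight p f n = of_nat (multiplicity p n) * f n"

definition prime_power_part :: "nat \<Rightarrow> (nat \<Rightarrow> complex) \<Rightarrow> nat \<Rightarrow> complex" where
  "prime_power_part p f n = (if \<exists>i\<ge>1. n = p ^ i then f n else 0)"

lemma val_weight_dconv:
  assumes "prime p"
  shows "val_weight p (dconv f g) = (\<lambda>n. dconv (val_weight p f) g n + dconv f (val_weight p g) n)"
proof
  fix n show "val_weight p (dconv f g) n = dconv (val_weight p f) g n + dconv f (val_weight p g) n"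
  proof (cases "n = 0")
    case False
    have "multiplicity p n = multiplicity p d + multiplicity p (n div d)" if "d dvd n" for d
    proof -
      have "n = d * (n div d)" using that by simp
      moreover have "d \<noteq> 0" "n div d \<noteq> 0" using that False by (auto simp: dvd_div_eq_0_iff)
      ultimately show ?thesis using assms
        by (metis prime_elem_multiplicity_mult_distrib prime_imp_prime_elem)
    qed
    then have "(\<Sum>d | d dvd n. of_nat (multiplicity p n) * (f d * g (n div d))) =
       (\<Sum>d | d dvd n. (of_nat (multiplicity p d) * f d) * g (n div d) + f d * (of_nat (multiplicity p (n div d)) * g (n div d)))"
      by (intro sum.cong refl) (auto simp: algebra_simps)
    then show ?thesis using False by (simp add: val_weight_def dconv_def sum_distrib_left sum.distrib)
  qed (simp add: val_weight_def dconv_def)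
qed

text \<open>The logarithmic derivative of an Euler factor: n has exactly as many divisors p^i with i
  >= 1 as its multiplicity says, and f (p^i) f (n / p^i) = f (n) for each of them.\<close>

lemma val_weight_multiplicative:
  assumes p: "prime p" and f: "\<And>m n. f (m * n) = f m * f n"
  shows "val_weight p f = dconv f (prime_power_part p f)"
proof
  fix n show "val_weight p f n = dconv f (prime_power_part p f) n"
  proof (cases "n = 0")
    case False
    have p1: "p > 1" by (rule prime_gt_1_nat[OF p])
    have "dconv f (prime_power_part p f) n = (\<Sum>d | d dvd n. prime_power_part p f d * f (n div d))"
      using False by (subst dconv_commute) (simp add: dconv_def)
    also have "\<dots> = (\<Sum>d\<in>(\<lambda>i. p ^ i) ` {1..multiplicity p n}. f n)"
    proof (rule sum.mono_neutral_cong_right)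
      show "finite {d. d dvd n}" using False by simp
      show "(\<lambda>i. p ^ i) ` {1..multiplicity p n} \<subseteq> {d. d dvd n}"
        using False p1 by (auto simp: power_dvd_iff_le_multiplicity)
      show "\<forall>d\<in>{d. d dvd n} - (\<lambda>i. p ^ i) ` {1..multiplicity p n}. prime_power_part p f d * f (n div d) = 0"
        using False p1 by (auto simp: prime_power_part_def power_dvd_iff_le_multiplicity)
      show "prime_power_part p f d * f (n div d) = f n" if "d \<in> (\<lambda>i. p ^ i) ` {1..multiplicity p n}" for d
      proof -
        obtain i where i: "d = p ^ i" "1 \<le> i" "i \<le> multiplicity p n" using \<open>d \<in> _\<close> by auto
        then have "d dvd n" using False p1 by (simp add: power_dvd_iff_le_multiplicity)
        then have "f d * f (n div d) = f n" by (metis dvd_mult_div_cancel f)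
        then show ?thesis using i by (auto simp: prime_power_part_def)
      qed
    qed
    also have "\<dots> = of_nat (card ((\<lambda>i. p ^ i) ` {1..multiplicity p n})) * f n" by simp
    also have "card ((\<lambda>i. p ^ i) ` {1..multiplicity p n}) = multiplicity p n"
      using p1 by (subst card_image) (auto simp: inj_on_def)
    finally show ?thesis by (simp add: val_weight_def)
  qed (simp add: val_weight_def dconv_def)
qed


section \<open>Bounds for exponential series\<close>

text \<open>Bounding exp (- n t) by a multiple of (n t)^-(j + 2) leaves the convergent series of 1 /
  n^2.\<close>

lemma suminf_power_exp_le:
  assumes j: "j \<ge> 1" and t: "t > 0"
  shows "(\<Sum>n. real n ^ j * exp (- (real n * t))) \<le> (fact (j + 2) * (\<Sum>n. 1 / (real n)\<^sup>2)) / t ^ (j + 2)"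
proof -
  have sm: "summable (\<lambda>n. 1 / (real n)\<^sup>2)"
    using inverse_power_summable[of 2, where 'a = real] by (simp add: inverse_eq_divide)
  have "(\<Sum>n. real n ^ j * exp (- (real n * t))) \<le> (\<Sum>n. (fact (j + 2) / t ^ (j + 2)) * (1 / (real n)\<^sup>2))"
  proof (rule suminf_le)
    show "summable (\<lambda>n. real n ^ j * exp (- (real n * t)))" by (rule summable_power_times_exp[OF t])
    show "summable (\<lambda>n. (fact (j + 2) / t ^ (j + 2)) * (1 / (real n)\<^sup>2))" by (intro summable_mult sm)
    fix n :: nat
    show "real n ^ j * exp (- (real n * t)) \<le> (fact (j + 2) / t ^ (j + 2)) * (1 / (real n)\<^sup>2)"
    proof (cases "n = 0")
      case True
      then show ?thesis using j by (cases j) auto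
    next
      case False
      have "real n ^ j * exp (- (real n * t)) \<le> real n ^ j * (fact (j + 2) / (real n * t) ^ (j + 2))"
        using False t by (intro mult_left_mono exp_minus_le_power) auto
      also have "\<dots> = (fact (j + 2) / t ^ (j + 2)) * (1 / (real n)\<^sup>2)"
      proof -
        have "(real n * t) ^ (j + 2) = real n ^ j * ((real n)\<^sup>2 * t ^ (j + 2))"
          by (simp add: power_mult_distrib power_add power2_eq_square)
        moreover have "real n ^ j * (F / (real n ^ j * ((real n)\<^sup>2 * t ^ (j + 2)))) = (F / t ^ (j + 2)) * (1 / (real n)\<^sup>2)" for F
          using False by simp
        ultimately show ?thesis by (simp only:)
      qed
      finally show ?thesis .
    qed
  qed
  also have "\<dots> = (fact (j + 2) / t ^ (j + 2)) * (\<Sum>n. 1 / (real n)\<^sup>2)" by (rule suminf_mult[OF sm])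
  finally show ?thesis by simp
qed

lemma suminf_power_exp_le_exp:
  assumes j: "j \<ge> 1" and t: "t \<ge> 1"
  shows "(\<Sum>n. real n ^ j * exp (- (real n * t))) \<le> (\<Sum>n. real n ^ j * exp (- (real n * (1/2)))) * exp (- t / 2)"
proof -
  have sm: "summable (\<lambda>n. real n ^ j * exp (- (real n * (1/2))))" by (rule summable_power_times_exp) simp
  have "(\<Sum>n. real n ^ j * exp (- (real n * t))) \<le> (\<Sum>n. (real n ^ j * exp (- (real n * (1/2)))) * exp (- t / 2))"
  proof (rule suminf_le)
    show "summable (\<lambda>n. real n ^ j * exp (- (real n * t)))" using t by (intro summable_power_times_exp) auto
    show "summable (\<lambda>n. (real n ^ j * exp (- (real n * (1/2)))) * exp (- t / 2))" by (rule summable_mult2[OF sm])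
    fix n :: nat
    show "real n ^ j * exp (- (real n * t)) \<le> (real n ^ j * exp (- (real n * (1/2)))) * exp (- t / 2)"
    proof (cases "n = 0")
      case True
      then show ?thesis using j by (cases j) auto
    next
      case False
      have "real n / 2 * 1 \<le> real n / 2 * t" "1 / 2 * t \<le> real n / 2 * t"
        using t False by (intro mult_left_mono mult_right_mono; simp)+
      then have "exp (- (real n * t)) \<le> exp (- (real n * (1/2))) * exp (- t / 2)"
        unfolding exp_add[symmetric] by (simp add: field_simps)
      then have "real n ^ j * exp (- (real n * t)) \<le> real n ^ j * (exp (- (real n * (1/2))) * exp (- t / 2))"
        by (intro mult_left_mono) auto
      then show ?thesis by (simp add: mult.assoc)
    qed
  qed
  also have "\<dots> = (\<Sum>n. real n ^ j * exp (- (real n * (1/2)))) * exp (- t / 2)" by (rule suminf_mult2[OF sm, symmetric])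
  finally show ?thesis .
qed

lemma norm_exp_series_le:
  assumes a: "\<And>n. norm (a n) \<le> 1 * real n ^ j" and t: "t > 0"
  shows "norm (exp_series a t) \<le> (\<Sum>n. real n ^ j * exp (- (real n * t)))"
  unfolding exp_series_def
proof (rule norm_suminf_le)
  show "summable (\<lambda>n. real n ^ j * exp (- (real n * t)))" by (rule summable_power_times_exp[OF t])
  show "norm (a n * of_real (exp (- (real n * t)))) \<le> real n ^ j * exp (- (real n * t))" for n
    using mult_right_mono[OF a[of n], of "exp (- (real n * t))"] by (simp add: norm_mult)
qed

text \<open>The order of quantifiers matters: \<open>K\<close> depends on the growth exponent alone
  and serves all coefficient sequences.\<close>

lemma exp_series_power_bound:
  assumes j: "j \<ge> 1"
  obtains K where "K > 0" "\<And>a t. (\<And>n. norm (a n) \<le> 1 * real n ^ j) \<Longrightarrow> t > 0 \<Longrightarrow> norm (exp_series a t) \<le> K / t ^ (j + 2)"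
proof -
  define K0 where "K0 = fact (j + 2) * (\<Sum>n. 1 / (real n)\<^sup>2)"
  show ?thesis
  proof (rule that)
    show "\<bar>K0\<bar> + 1 > 0" by simp
    fix a :: "nat \<Rightarrow> complex" and t :: real assume a: "\<And>n. norm (a n) \<le> 1 * real n ^ j" and t: "t > 0"
    have "norm (exp_series a t) \<le> K0 / t ^ (j + 2)"
      using norm_exp_series_le[OF a t] suminf_power_exp_le[OF j t] unfolding K0_def by (rule order_trans)
    also have "\<dots> \<le> (\<bar>K0\<bar> + 1) / t ^ (j + 2)" using t by (intro divide_right_mono) auto
    finally show "norm (exp_series a t) \<le> (\<bar>K0\<bar> + 1) / t ^ (j + 2)" .
  qed
qed

lemma exp_series_exp_bound:
  assumes j: "j \<ge> 1"
  obtains K where "K > 0" "\<And>a t. (\<And>n. norm (a n) \<le> 1 * real n ^ j) \<Longrightarrow> t \<ge> 1 \<Longrightarrow> norm (exp_series a t) \<le> K * exp (- t / 2)"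
proof -
  define K0 where "K0 = (\<Sum>n. real n ^ j * exp (- (real n * (1/2))))"
  show ?thesis
  proof (rule that)
    show "\<bar>K0\<bar> + 1 > 0" by simp
    fix a :: "nat \<Rightarrow> complex" and t :: real assume a: "\<And>n. norm (a n) \<le> 1 * real n ^ j" and t: "t \<ge> 1"
    have "norm (exp_series a t) \<le> K0 * exp (- t / 2)"
      using norm_exp_series_le[OF a, of t] suminf_power_exp_le_exp[OF j t] t unfolding K0_def by linarith
    also have "\<dots> \<le> (\<bar>K0\<bar> + 1) * exp (- t / 2)" by (intro mult_right_mono) auto
    finally show "norm (exp_series a t) \<le> (\<bar>K0\<bar> + 1) * exp (- t / 2)" .
  qed
qed

text \<open>In the kernel integral with p = 1 the factor exp (- x / t) is replaced by N! (t / x)^N,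
  which leaves Gamma (N).\<close>

lemma bessel_K0_le_power:
  assumes x: "x > 0" and N: "N \<ge> 1"
  shows "2 * bessel_K0 (2 * sqrt x) \<le> fact N * fact (N - 1) / x ^ N"
proof -
  have i: "set_integrable lborel {0<..} (\<lambda>t. exp (- (1 * t + x / t)) / t)" by (rule set_integrable_bessel_kernel) (use x in auto)
  have g: "set_integrable lborel {0<..} (\<lambda>t. (fact N / x ^ N) * (t powr (real N - 1) * exp (- (1 * t))))"
    by (intro set_integrable_mult_right set_integrable_Gamma) (use N in auto)
  have "2 * bessel_K0 (2 * sqrt x) = (LBINT t:{0<..}. exp (- (1 * t + x / t)) / t)"
    using set_integral_bessel_kernel[of 1 x] x by simp
  also have "\<dots> \<le> (LBINT t:{0<..}. (fact N / x ^ N) * (t powr (real N - 1) * exp (- (1 * t))))"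
  proof (rule set_integral_mono[OF i g])
    fix t :: real assume "t \<in> {0<..}"
    then have t: "t > 0" by simp
    have "exp (- (x / t)) \<le> fact N / (x / t) ^ N" using x t by (intro exp_minus_le_power) auto
    then have le: "exp (- t) / t * exp (- (x / t)) \<le> exp (- t) / t * (fact N / (x / t) ^ N)"
      using t by (intro mult_left_mono) auto
    have e1: "exp (- (1 * t + x / t)) / t = exp (- t) / t * exp (- (x / t))"
      by (simp add: exp_add[symmetric])
    have "t powr (real N - 1) = t ^ N / t" using t by (simp add: powr_diff powr_realpow)
    then have e2: "exp (- t) / t * (fact N / (x / t) ^ N) = (fact N / x ^ N) * (t powr (real N - 1) * exp (- (1 * t)))"
      using x t by (simp add: power_divide mult_ac)
    show "exp (- (1 * t + x / t)) / t \<le> (fact N / x ^ N) * (t powr (real N - 1) * exp (- (1 * t)))"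
      using le unfolding e1[symmetric] e2 .
  qed
  also have "\<dots> = (fact N / x ^ N) * (Gamma (real N) / 1 powr real N)"
    by (subst set_integral_mult_right, subst set_integral_Gamma) (use N in auto)
  also have "Gamma (real N) = fact (N - 1)" using Gamma_fact[of "N - 1", where 'a = real] N by (simp add: of_nat_diff)
  finally show ?thesis by simp
qed

lemma cnj_exp_series:
  assumes "\<And>n. norm (a n) \<le> C * real n ^ p" "t > 0"
  shows "cnj (exp_series a t) = exp_series (\<lambda>n. cnj (a n)) t"
proof -
  have "(\<lambda>n. cnj (a n * of_real (exp (- (real n * t))))) sums cnj (exp_series a t)"
    unfolding sums_cnj by (rule exp_series_sums[OF assms])
  then show ?thesis unfolding exp_series_def by (simp add: sums_iff)
qed

context odd_primitive_character
begin

definition rho :: "nat \<Rightarrow> complex" where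
  "rho = dconv (dconv chi (\<lambda>_. 1)) (dconv (cnj \<circ> chi) (\<lambda>_. 1))"

text \<open>The derivation rule applied to four completely multiplicative factors, two equal to 1
  and one each to the character and its conjugate. Their contributions at a prime power add up to 2
  + 2 Re chi, which is nonnegative.\<close>

lemma val_weight_rho:
  assumes p: "prime p"
  shows "val_weight p rho = dconv rho (\<lambda>n. prime_power_part p (\<lambda>n. of_real (2 + 2 * Re (chi n))) n)"
proof -
  let ?one = "\<lambda>_::nat. 1 :: complex"
  have one: "val_weight p ?one = dconv ?one (prime_power_part p ?one)"
    by (rule val_weight_multiplicative[OF p]) simp
  have *: "val_weight p (dconv f ?one) = dconv (dconv f ?one) (\<lambda>n. prime_power_part p f n + prime_power_part p ?one n)"
    if f: "\<And>m n. f (m * n) = f m * f n" for f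
  proof -
    have "dconv (dconv f (prime_power_part p f)) ?one = dconv (dconv f ?one) (prime_power_part p f)"
      by (metis dconv_assoc dconv_commute)
    moreover have "dconv f (dconv ?one (prime_power_part p ?one)) = dconv (dconv f ?one) (prime_power_part p ?one)"
      by (simp add: dconv_assoc)
    ultimately show ?thesis
      unfolding val_weight_dconv[OF p] one val_weight_multiplicative[OF p f] dconv_add_right by simp
  qed
  define h1 where "h1 n = prime_power_part p chi n + prime_power_part p ?one n" for n
  define h2 where "h2 n = prime_power_part p (cnj \<circ> chi) n + prime_power_part p ?one n" for n
  define r where "r = dconv chi ?one"
  define r' where "r' = dconv (cnj \<circ> chi) ?one"
  have r: "val_weight p r = dconv r h1" "val_weight p r' = dconv r' h2"
    unfolding r_def r'_def h1_def[abs_def] h2_def[abs_def] by (intro *; simp add: chi_mult)+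
  have "val_weight p rho = (\<lambda>n. dconv (dconv r h1) r' n + dconv r (dconv r' h2) n)"
    unfolding rho_def r_def[symmetric] r'_def[symmetric] val_weight_dconv[OF p] r ..
  also have "dconv (dconv r h1) r' = dconv (dconv r r') h1" by (metis dconv_assoc dconv_commute)
  also have "dconv r (dconv r' h2) = dconv (dconv r r') h2" by (simp add: dconv_assoc)
  also have "(\<lambda>n. dconv (dconv r r') h1 n + dconv (dconv r r') h2 n) = dconv rho (\<lambda>n. h1 n + h2 n)"
    unfolding dconv_add_right rho_def r_def r'_def ..
  also have "(\<lambda>n. h1 n + h2 n) = (\<lambda>n. prime_power_part p (\<lambda>n. of_real (2 + 2 * Re (chi n))) n)"
    by (auto simp: h1_def h2_def prime_power_part_def fun_eq_iff complex_eq_iff)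
  finally show ?thesis .
qed

text \<open>For a prime p dividing n, \<open>val_weight_rho\<close> expresses a positive multiple of
  \<open>rho n\<close> by nonnegative weights times values of \<open>rho\<close> at n / d. The
  weight at d = 1 is 0, so only smaller arguments occur and strong induction applies.\<close>

lemma rho_nonneg: "\<exists>x\<ge>0. rho n = of_real x"
proof (induction n rule: less_induct)
  case (less n)
  consider "n = 0" | "n = 1" | "n > 1" by linarith
  then show ?case
  proof cases
    case 1
    then show ?thesis by (auto simp: rho_def dconv_def intro!: exI[of _ 0])
  next
    case 2
    then show ?thesis by (auto simp: rho_def dconv_def intro!: exI[of _ 1])
  next
    case 3
    then obtain p where p: "prime p" "p dvd n" using prime_factor_nat[of n] by auto
    define v where "v = multiplicity p n"
    have v: "v > 0" using p 3 by (simp add: v_def prime_multiplicity_gt_zero_iff)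
    define h where "h n = (if \<exists>i\<ge>1. n = p ^ i then 2 + 2 * Re (chi n) else 0)" for n
    have h0: "h d \<ge> 0" for d
    proof -
      have "\<bar>Re (chi d)\<bar> \<le> 1" using abs_Re_le_cmod[of "chi d"] norm_chi_le_1[of d] by linarith
      then show ?thesis by (auto simp: h_def)
    qed
    have "p ^ i \<noteq> 1" if "i \<ge> 1" for i using prime_gt_1_nat[OF p(1)] that by simp
    then have h1: "h 1 = 0" unfolding h_def by metis
    have hh: "prime_power_part p (\<lambda>n. of_real (2 + 2 * Re (chi n))) d = of_real (h d)" for d
      unfolding prime_power_part_def h_def by (cases "\<exists>i\<ge>1. d = p ^ i") (simp_all only: if_True if_False of_real_0)
    define R where "R m = (SOME x. x \<ge> 0 \<and> rho m = of_real x)" for m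
    have R: "R m \<ge> 0" "rho m = of_real (R m)" if "m < n" for m
      using someI_ex[of "\<lambda>x. x \<ge> 0 \<and> rho m = of_real x"] less.IH[OF that] by (auto simp: R_def)
    have "of_nat v * rho n = val_weight p rho n" by (simp add: val_weight_def v_def)
    also have "\<dots> = dconv (\<lambda>n. of_real (h n)) rho n"
      unfolding val_weight_rho[OF p(1)] hh by (simp only: dconv_commute)
    also have "\<dots> = (\<Sum>d | d dvd n. of_real (h d) * rho (n div d))" using 3 by (simp add: dconv_def)
    also have "\<dots> = (\<Sum>d | d dvd n. of_real (h d * R (n div d)))"
    proof (intro sum.cong refl)
      fix d assume d: "d \<in> {d. d dvd n}"
      show "of_real (h d) * rho (n div d) = of_real (h d * R (n div d))"
      proof (cases "d = 1")
        case True
        then show ?thesis by (simp only: h1) simp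
      next
        case False
        moreover have "d \<noteq> 0" using dvd_pos_nat[of n d] d 3 by auto
        ultimately have "n div d < n" using 3 by (intro div_less_dividend) linarith+
        then show ?thesis using R(2) by simp
      qed
    qed
    also have "\<dots> = of_real (\<Sum>d | d dvd n. h d * R (n div d))" by simp
    finally have "rho n = of_real ((\<Sum>d | d dvd n. h d * R (n div d)) / real v)"
      using v by (simp add: field_simps)
    moreover have "(\<Sum>d | d dvd n. h d * R (n div d)) \<ge> 0"
    proof (intro sum_nonneg)
      fix d assume d: "d \<in> {d. d dvd n}"
      show "h d * R (n div d) \<ge> 0"
      proof (cases "d = 1")
        case True
        then show ?thesis by (simp only: h1 mult_zero_left order_refl)
      next
        case False
        moreover have "d \<noteq> 0" using dvd_pos_nat[of n d] d 3 by auto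
        ultimately have "n div d < n" using 3 by (intro div_less_dividend) linarith+
        then show ?thesis using R(1) h0 by simp
      qed
    qed
    ultimately show ?thesis by (intro exI[of _ "(\<Sum>d | d dvd n. h d * R (n div d)) / real v"]) auto
  qed
qed


section \<open>Nonvanishing at the edge of the critical strip\<close>

text \<open>The point 1 lies outside the half-plane where the series defines the L-function, so
  conjugation is carried out on the Abel sums and passes to the limit.\<close>

lemma cnj_dirichlet_L_1: "dirichlet_L (cnj \<circ> chi) 1 = cnj (dirichlet_L chi 1)"
proof -
  interpret C: odd_primitive_character q "cnj \<circ> chi" by (rule cnj_character)
  define w where "w n = 1 / (real n + 1)" for n
  have w: "w n > 0" for n by (simp add: w_def)
  have w0: "w \<longlonglongrightarrow> 0" unfolding w_def by real_asymp
  have cb: "norm (chi n * of_real (real n powr (- 1))) \<le> 1 * real n ^ 0" for n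
  proof (cases "n = 0")
    case False
    then have "norm (chi n) * real n powr (- 1) \<le> 1 * 1"
      using norm_chi_le_1[of n] by (intro mult_mono) (auto simp: powr_minus_divide)
    then show ?thesis by (simp only: norm_mult norm_of_real abs_of_nonneg[OF powr_ge_zero] power_0 mult_1)
  qed auto
  have "(\<lambda>n. cnj (exp_series (\<lambda>n. chi n * of_real (real n powr (- 1))) (w n))) \<longlonglongrightarrow> cnj (dirichlet_L chi (of_real 1))"
    by (intro tendsto_cnj exp_series_tendsto_L w w0) auto
  moreover have "(\<lambda>n. exp_series (\<lambda>n. (cnj \<circ> chi) n * of_real (real n powr (- 1))) (w n)) \<longlonglongrightarrow> dirichlet_L (cnj \<circ> chi) (of_real 1)"
    by (intro C.exp_series_tendsto_L w w0) auto
  moreover have "cnj (exp_series (\<lambda>n. chi n * of_real (real n powr (- 1))) (w n)) = exp_series (\<lambda>n. (cnj \<circ> chi) n * of_real (real n powr (- 1))) (w n)" for n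
    by (subst cnj_exp_series[OF cb w]) simp
  ultimately show ?thesis using LIMSEQ_unique by (simp only: of_real_1) blast
qed

lemma sigma_chi_0_eq_dconv: "sigma_chi (of_nat 0) chi = dconv chi (\<lambda>_. 1)"
proof
  fix n show "sigma_chi (of_nat 0) chi n = dconv chi (\<lambda>_. 1) n"
    using sigma_chi_altdef[of n 0 chi] by (cases "n = 0") (auto simp: dconv_def sigma_chi_def)
qed

lemma lambert_continuous_on: "continuous_on {0<..} (lambert k)"
  unfolding lambert_def by (rule exp_series_continuous_on[OF sigma_chi_bound])

text \<open>Expanding both Lambert series gives pairs (m, n) with the kernel integral depending only
  on m n v; grouping by N = m n produces the coefficients \<open>rho\<close>. All terms are
  nonnegative, so the term N = 1 alone is a lower bound.\<close>

lemma rankin_integral_ge: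
  assumes v: "0 < v" "v \<le> 1"
  shows "Re (LBINT t:{0<..}. lambert 0 t * cnj (lambert 0 (v / t)) / of_real t) \<ge> 2 * exp (- (2 * cosh 1))"
proof -
  define r where "r = sigma_chi (of_nat 0) chi"
  have r: "norm (r n) \<le> real n" for n using sigma_chi_bound[of 0 n] by (simp add: r_def)
  have r0: "r 0 = 0" using r[of 0] by simp
  obtain K where K: "K > 0" "\<And>t. t > 0 \<Longrightarrow> norm (lambert 0 t) \<le> K / t ^ 3"
  proof (rule exp_series_power_bound[of 1])
    fix K assume K: "K > 0" "\<And>a t. (\<And>n. norm (a n) \<le> 1 * real n ^ 1) \<Longrightarrow> t > 0 \<Longrightarrow> norm (exp_series a t) \<le> K / t ^ (1 + 2)"
    have "norm (lambert 0 t) \<le> K / t ^ 3" if "t > 0" for t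
      using K(2)[of "sigma_chi (of_nat 0) chi" t] sigma_chi_bound[of 0] that by (simp add: lambert_def numeral_3_eq_3)
    with K(1) show ?thesis by (rule that)
  qed simp
  \<comment> \<open>The kernel integral at parameters m and n v is \<open>B (m n v)\<close>. The
    coefficients grow at most linearly, so decay of order 3 (with 12 = 3! 2!) leaves n^-2 and
    permits all interchanges.\<close>
  define B where "B x = 2 * bessel_K0 (2 * sqrt x)" for x
  have B: "0 \<le> B x" "x > 0 \<Longrightarrow> B x \<le> 12 / x ^ 3" for x
    using bessel_K0_nonneg[of "2 * sqrt x"] bessel_K0_le_power[of x 3] by (auto simp: B_def fact_numeral)
  define J where "J = (LBINT t:{0<..}. lambert 0 t * cnj (lambert 0 (v / t)) / of_real t)"
  define I where "I m = (LBINT t:{0<..}. r m * (of_real (exp (- (real m * t))) * (cnj (lambert 0 (v / t)) / of_real t)))" for m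
  have lam_cont: "continuous_on {0<..} (\<lambda>t. lambert 0 (v / t))"
    by (rule continuous_on_compose2[OF lambert_continuous_on]) (use v in \<open>auto intro!: continuous_intros\<close>)
  have sm2: "summable (\<lambda>n. real n powr (-2))" by (subst summable_real_powr_iff) auto
  have inner: "((\<lambda>n. r m * (cnj (r n) * of_real (B (real m * real n * v)))) has_sum I m) {1..}" if m: "m \<ge> 1" for m
  proof -
    define g where "g n t = cnj (r n) * of_real (exp (- (real m * t + (real n * v) / t)) / t)" for n t
      have int: "set_integrable lborel {0<..} (g n)" for n
    proof (cases "n = 0")
      case False
      then show ?thesis unfolding g_def
        by (intro set_integrable_mult_right set_integrable_of_real set_integrable_bessel_kernel) (use m v in auto)
    qed (simp add: g_def r0 set_integrable_def)
    have val: "(LBINT t:{0<..}. exp (- (real m * t + (real n * v) / t)) / t) = B (real m * real n * v)" if "n \<noteq> 0" for n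
      by (subst set_integral_bessel_kernel) (use m v that in \<open>auto simp: B_def mult.assoc\<close>)
    have gval: "(LBINT t:{0<..}. g n t) = cnj (r n) * of_real (B (real m * real n * v))" for n
    proof (cases "n = 0")
      case False
      then show ?thesis unfolding g_def by (simp only: set_integral_mult_right set_integral_complex_of_real val[OF False])
    qed (simp add: g_def r0 set_lebesgue_integral_def)
    have nval: "norm (LBINT t:{0<..}. norm (g n t)) \<le> (12 / v ^ 3) * real n powr (-2)" for n
    proof (cases "n = 0")
      case True
      then show ?thesis by (simp add: g_def r0 set_lebesgue_integral_def)
    next
      case False
      have "(LBINT t:{0<..}. norm (g n t)) = (LBINT t:{0<..}. norm (r n) * (exp (- (real m * t + (real n * v) / t)) / t))"
        by (intro set_lebesgue_integral_cong) (auto simp: g_def norm_mult norm_divide)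
      also have "\<dots> = norm (r n) * B (real m * real n * v)" by (simp only: set_integral_mult_right val[OF False])
      also have "\<dots> \<le> real n * (12 / (real n * v) ^ 3)"
      proof (intro mult_mono r)
        have "B (real m * real n * v) \<le> 12 / (real m * real n * v) ^ 3" using m v False by (intro B(2)) auto
        also have "\<dots> \<le> 12 / (real n * v) ^ 3"
        proof (intro divide_left_mono power_mono)
          have "1 * (real n * v) \<le> real m * (real n * v)" using m v by (intro mult_right_mono) auto
          then show "real n * v \<le> real m * real n * v" by (simp add: mult.assoc)
        qed (use m v False in auto)
        finally show "B (real m * real n * v) \<le> 12 / (real n * v) ^ 3" .
      qed (use B in auto)
      also have "\<dots> = (12 / v ^ 3) * real n powr (-2)"
        using False v by (simp add: powr_minus powr_numeral power_mult_distrib field_simps eval_nat_numeral)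
      finally show ?thesis by (subst real_norm_def, subst abs_of_nonneg) (auto intro!: set_integral_nonneg)
    qed
    have gs: "(\<lambda>n. g n t) sums (of_real (exp (- (real m * t))) * (cnj (lambert 0 (v / t)) / of_real t))" "summable (\<lambda>n. norm (g n t))"
      if t: "t > 0" for t
    proof -
      have vt: "v / t > 0" using v t by simp
      have eq: "g n t = (of_real (exp (- (real m * t))) / of_real t) * cnj (r n * of_real (exp (- (real n * (v / t)))))" for n
      proof -
        have "exp (- (real m * t + (real n * v) / t)) = exp (- (real m * t)) * exp (- (real n * (v / t)))"
          unfolding exp_add[symmetric] by simp
        then show ?thesis by (simp only: g_def) simp
      qed
      have "(\<lambda>n. cnj (r n * of_real (exp (- (real n * (v / t)))))) sums cnj (lambert 0 (v / t))"
        unfolding sums_cnj lambert_def r_def by (rule exp_series_sums[OF sigma_chi_bound vt])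
      from sums_mult[OF this, of "of_real (exp (- (real m * t))) / of_real t"]
      show "(\<lambda>n. g n t) sums (of_real (exp (- (real m * t))) * (cnj (lambert 0 (v / t)) / of_real t))"
        unfolding eq by simp
      have "summable (\<lambda>n. norm (of_real (exp (- (real m * t))) / complex_of_real t) * norm (r n * of_real (exp (- (real n * (v / t))))))"
        unfolding r_def by (intro summable_mult exp_series_abs_summable[OF sigma_chi_bound vt])
      then show "summable (\<lambda>n. norm (g n t))" unfolding eq norm_mult complex_mod_cnj .
    qed
    have sm: "summable (\<lambda>n. LBINT t:{0<..}. norm (g n t))"
      by (rule summable_comparison_test'[OF _ nval]) (intro summable_mult sm2)
    have "(\<lambda>n. LBINT t:{0<..}. g n t) sums (LBINT t:{0<..}. (\<Sum>n. g n t))"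
      by (rule set_integral_sums[OF int sm]) (use gs(2) in auto)
    moreover have "(LBINT t:{0<..}. (\<Sum>n. g n t)) = (LBINT t:{0<..}. of_real (exp (- (real m * t))) * (cnj (lambert 0 (v / t)) / of_real t))"
      by (intro set_lebesgue_integral_cong) (use sums_unique[OF gs(1)] in auto)
    ultimately have "(\<lambda>n. r m * (LBINT t:{0<..}. g n t)) sums I m"
      unfolding I_def set_integral_mult_right by (intro sums_mult) simp
    moreover have "summable (\<lambda>n. norm (r m * (LBINT t:{0<..}. g n t)))"
    proof -
      have "norm (LBINT t:{0<..}. g n t) \<le> (LBINT t:{0<..}. norm (g n t))" for n by (rule set_integral_norm_bound[OF int])
      then have "summable (\<lambda>n. norm (LBINT t:{0<..}. g n t))" by (intro summable_comparison_test'[OF sm]) auto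
      then show ?thesis unfolding norm_mult by (rule summable_mult)
    qed
    ultimately have "((\<lambda>n. r m * (LBINT t:{0<..}. g n t)) has_sum I m) UNIV" by (rule norm_summable_imp_has_sum[rotated])
    then show ?thesis unfolding gval by (subst has_sum_atLeast_1) (auto simp: r0)
  qed
  have outer: "(I has_sum J) {1..}"
  proof -
    define f where "f m t = r m * (of_real (exp (- (real m * t))) * (cnj (lambert 0 (v / t)) / of_real t))" for m and t :: real
    have cont: "continuous_on {0<..} (f m)" for m unfolding f_def by (intro continuous_intros lam_cont) auto
    have bound: "norm (f m t) \<le> (norm (r m) * (K / v ^ 3)) * (t powr (3 - 1) * exp (- (real m * t)))" if t: "t > 0" for m t
    proof -
      have "norm (lambert 0 (v / t)) \<le> K / (v / t) ^ 3" using v t by (intro K) auto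
      then have "norm (r m) * (exp (- (real m * t)) * (norm (lambert 0 (v / t)) / t)) \<le> norm (r m) * (exp (- (real m * t)) * ((K / (v / t) ^ 3) / t))"
        using t by (intro mult_left_mono divide_right_mono) auto
      also have "\<dots> = (norm (r m) * (K / v ^ 3)) * (t powr (3 - 1) * exp (- (real m * t)))"
        using t v by (simp add: powr_numeral power_divide field_simps eval_nat_numeral)
      finally show ?thesis using t by (simp add: f_def norm_mult norm_divide)
    qed
    have int: "set_integrable lborel {0<..} (f m)" for m
    proof (cases "m = 0")
      case False
      show ?thesis
        by (rule set_integrable_dominated_pos[OF _ cont bound], intro set_integrable_mult_right set_integrable_Gamma) (use False in auto)
    qed (simp add: f_def r0 set_integrable_def)
    have nval: "norm (LBINT t:{0<..}. norm (f m t)) \<le> (2 * K / v ^ 3) * real m powr (-2)" for m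
    proof (cases "m = 0")
      case False
      have "(LBINT t:{0<..}. norm (f m t)) \<le> (LBINT t:{0<..}. (norm (r m) * (K / v ^ 3)) * (t powr (3 - 1) * exp (- (real m * t))))"
        by (rule set_integral_mono[OF set_integrable_norm[OF int] set_integrable_mult_right[OF set_integrable_Gamma]])
           (use False bound in auto)
      also have "\<dots> = (norm (r m) * (K / v ^ 3)) * (Gamma 3 / real m powr 3)"
        by (subst set_integral_mult_right, subst set_integral_Gamma) (use False in auto)
      also have "\<dots> \<le> (real m * (K / v ^ 3)) * (2 / real m powr 3)"
        using K(1) v by (intro mult_mono r) (auto simp: Gamma_numeral)
      also have "\<dots> = (2 * K / v ^ 3) * real m powr (-2)"
        using False v by (simp add: powr_minus powr_numeral field_simps eval_nat_numeral)
      finally show ?thesis by (subst real_norm_def, subst abs_of_nonneg) (auto intro!: set_integral_nonneg)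
    qed (simp add: f_def r0 set_lebesgue_integral_def)
    have fs: "(\<lambda>m. f m t) sums (lambert 0 t * cnj (lambert 0 (v / t)) / of_real t)" "summable (\<lambda>m. norm (f m t))" if t: "t > 0" for t
    proof -
      have eq: "f m t = (r m * of_real (exp (- (real m * t)))) * (cnj (lambert 0 (v / t)) / of_real t)" for m by (simp add: f_def)
      from sums_mult2[OF exp_series_sums[OF sigma_chi_bound t, of 0], of "cnj (lambert 0 (v / t)) / of_real t"]
      show "(\<lambda>m. f m t) sums (lambert 0 t * cnj (lambert 0 (v / t)) / of_real t)" unfolding eq lambert_def r_def by simp
      have "summable (\<lambda>m. norm (r m * of_real (exp (- (real m * t)))) * norm (cnj (lambert 0 (v / t)) / of_real t))"
        unfolding r_def by (intro summable_mult2 exp_series_abs_summable[OF sigma_chi_bound t])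
      then show "summable (\<lambda>m. norm (f m t))" unfolding eq norm_mult[of "r _ * _"] .
    qed
    have sm: "summable (\<lambda>m. LBINT t:{0<..}. norm (f m t))"
      by (rule summable_comparison_test'[OF _ nval]) (intro summable_mult sm2)
    have "I sums (LBINT t:{0<..}. (\<Sum>m. f m t))"
      using set_integral_sums[OF int sm fs(2)] unfolding I_def[abs_def] f_def by simp
    moreover have "(LBINT t:{0<..}. (\<Sum>m. f m t)) = J"
      unfolding J_def by (intro set_lebesgue_integral_cong) (use sums_unique[OF fs(1)] in auto)
    moreover have "summable (\<lambda>m. norm (I m))"
    proof -
      have "norm (I m) \<le> (LBINT t:{0<..}. norm (f m t))" for m
        using set_integral_norm_bound[OF int] unfolding I_def f_def by simp
      then show ?thesis by (intro summable_comparison_test'[OF sm]) auto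
    qed
    ultimately have "(I has_sum J) UNIV" using norm_summable_imp_has_sum by blast
    then show ?thesis by (subst has_sum_atLeast_1) (auto simp: I_def r0 set_lebesgue_integral_def)
  qed
  have pairs: "((\<lambda>(m, n). r m * (cnj (r n) * of_real (B (real m * real n * v)))) has_sum J) ({1..} \<times> {1..})"
  proof (rule has_sum_SigmaI)
    show "((\<lambda>n. case (m, n) of (m, n) \<Rightarrow> r m * (cnj (r n) * of_real (B (real m * real n * v)))) has_sum I m) {1..}" if "m \<in> {1..}" for m
      using inner[of m] that by simp
    show "(I has_sum J) {1..}" by (rule outer)
    have s1: "(\<lambda>n. real n powr (-2)) summable_on {1::nat..}"
    proof -
      have "(\<lambda>n::nat. real n powr (-2)) summable_on UNIV"
        using sm2 by (subst summable_on_UNIV_nonneg_real_iff) auto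
      then show ?thesis by (rule summable_on_subset) simp
    qed
    have "(\<lambda>(m, n). ((12 / v ^ 3) * real m powr (-2)) * real n powr (-2)) summable_on {1::nat..} \<times> {1::nat..}"
      by (intro summable_on_product summable_on_cmult_right s1) (use v in auto)
    then have "(\<lambda>x. norm (case x of (m, n) \<Rightarrow> r m * (cnj (r n) * of_real (B (real m * real n * v))))) summable_on {1..} \<times> {1..}"
    proof (rule Infinite_Sum.abs_summable_on_comparison_test')
      fix x :: "nat \<times> nat" assume "x \<in> {1..} \<times> {1..}"
      then obtain m n where x: "x = (m, n)" "m \<ge> 1" "n \<ge> 1" by auto
      have "norm (r m * (cnj (r n) * of_real (B (real m * real n * v)))) = norm (r m) * (norm (r n) * B (real m * real n * v))"
        using B(1) by (simp add: norm_mult)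
      also have "\<dots> \<le> real m * (real n * (12 / (real m * real n * v) ^ 3))"
        using x v B(1) by (intro mult_mono r B(2) mult_nonneg_nonneg) auto
      also have "\<dots> = ((12 / v ^ 3) * real m powr (-2)) * real n powr (-2)"
        using x v by (simp add: powr_minus powr_numeral power_mult_distrib field_simps eval_nat_numeral)
      finally show "norm (case x of (m, n) \<Rightarrow> r m * (cnj (r n) * of_real (B (real m * real n * v)))) \<le>
          (case x of (m, n) \<Rightarrow> ((12 / v ^ 3) * real m powr (-2)) * real n powr (-2))" by (simp add: x)
    qed
    then show "(\<lambda>(m, n). r m * (cnj (r n) * of_real (B (real m * real n * v)))) summable_on {1..} \<times> {1..}"
      by (rule abs_summable_summable)
  qed
  have cr: "cnj (r n) = dconv (cnj \<circ> chi) (\<lambda>_. 1) n" for n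
    unfolding r_def sigma_chi_0_eq_dconv by (simp add: dconv_def)
  have rr: "r = dconv chi (\<lambda>_. 1)" unfolding r_def sigma_chi_0_eq_dconv ..
  have "((\<lambda>N. \<Sum>d | d dvd N. r d * (cnj (r (N div d)) * of_real (B (real d * real (N div d) * v)))) has_sum J) {1..}"
    by (rule has_sum_divisors[OF pairs])
  also have "?this \<longleftrightarrow> ((\<lambda>N. rho N * of_real (B (real N * v))) has_sum J) {1..}"
  proof (rule has_sum_cong)
    fix N :: nat assume "N \<in> {1..}"
    then have N: "N \<noteq> 0" by simp
    have "real d * real (N div d) = real N" if "d dvd N" for d
      using that by (metis dvd_mult_div_cancel of_nat_mult)
    then show "(\<Sum>d | d dvd N. r d * (cnj (r (N div d)) * of_real (B (real d * real (N div d) * v)))) = rho N * of_real (B (real N * v))"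
      using N unfolding rho_def rr[symmetric] cr[symmetric, abs_def] by (simp add: dconv_def[of r] cr sum_distrib_right mult.assoc)
  qed
  finally have "((\<lambda>N. Re (rho N * of_real (B (real N * v)))) has_sum Re J) {1..}" by (rule has_sum_Re)
  moreover have "0 \<le> Re (rho N * of_real (B (real N * v)))" for N
    using rho_nonneg[of N] B(1)[of "real N * v"] by auto
  ultimately have "(\<Sum>N\<in>{1}. Re (rho N * of_real (B (real N * v)))) \<le> Re J"
    by (intro finite_sum_le_has_sum) auto
  moreover have "rho 1 = 1" by (simp add: rho_def dconv_def)
  moreover have "B v \<ge> 2 * exp (- (2 * cosh 1))"
    unfolding B_def using v by (intro mult_left_mono bessel_K0_ge) auto
  ultimately show ?thesis unfolding J_def by simp
qed

theorem dirichlet_L_1_nonzero: "dirichlet_L chi 1 \<noteq> 0"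
proof
  assume L1: "dirichlet_L chi 1 = 0"
  \<comment> \<open>By the functional equation at 0. With both values zero, only the dual series is
    left in the transformation.\<close>
  have L0: "dirichlet_L chi 0 = 0"
    using dirichlet_L_functional_equation[of 0] cnj_dirichlet_L_1 L1 by simp
  define \<tau> where "\<tau> = norm (gauss_sum q chi)"
  have \<tau>: "\<tau> > 0" using gauss_sum_nonzero by (simp add: \<tau>_def)
  obtain K where K: "K > 0" "\<And>a t. (\<And>n. norm (a n) \<le> 1 * real n ^ 1) \<Longrightarrow> t > 0 \<Longrightarrow> norm (exp_series a t) \<le> K / t ^ (1 + 2)"
    using exp_series_power_bound[of 1] by auto
  obtain K' where K': "K' > 0" "\<And>a t. (\<And>n. norm (a n) \<le> 1 * real n ^ 1) \<Longrightarrow> t \<ge> 1 \<Longrightarrow> norm (exp_series a t) \<le> K' * exp (- t / 2)"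
    using exp_series_exp_bound[of 1] by auto
  define K1 where "K1 = (2 * pi / \<tau>) * (K * (real q / (4 * pi\<^sup>2)) ^ 3)"
  have K1: "K1 > 0" unfolding K1_def using K(1) \<tau> q_gt_2 by (intro mult_pos_pos divide_pos_pos zero_less_power) auto
  \<comment> \<open>The dual series at 4 pi^2 / (q y) is O (y^3), and the prefactor costs one power.
    Order 2 is enough both for a quotient by t that stays bounded near 0 and for the limit.\<close>
  have small: "norm (lambert 0 y) \<le> K1 * y\<^sup>2" if y: "y > 0" for y
  proof -
    have \<eta>: "4 * pi\<^sup>2 / (real q * y) > 0" using y q_gt_2 by simp
    have "lambert 0 y = (-2 * of_real pi * \<i> / of_real y) / cnj (gauss_sum q chi) * lambert_dual 0 (4 * pi\<^sup>2 / (real q * y))"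
      using lambert_transformation_0[OF y] L1 L0 by simp
    then have "norm (lambert 0 y) = (2 * pi / y) / \<tau> * norm (lambert_dual 0 (4 * pi\<^sup>2 / (real q * y)))"
      using y by (simp add: norm_mult norm_divide \<tau>_def)
    also have "\<dots> \<le> (2 * pi / y) / \<tau> * (K / (4 * pi\<^sup>2 / (real q * y)) ^ (1 + 2))"
      unfolding lambert_dual_def using y \<tau> \<eta> sigma_bar_chi_bound[of 0]
      by (intro mult_left_mono K(2)) auto
    also have "\<dots> = K1 * y\<^sup>2"
      using y \<tau> q_gt_2 by (simp add: K1_def power_divide power_mult_distrib field_simps eval_nat_numeral)
    finally show ?thesis .
  qed
  have large: "norm (lambert 0 y) \<le> K' * exp (- y / 2)" if "y \<ge> 1" for y
    unfolding lambert_def using that sigma_chi_bound[of 0] by (intro K') auto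
  define M where "M = max K' (K1 * exp (1/2))"
  have M: "M > 0" using K'(1) by (simp add: M_def)
  \<comment> \<open>The measure dt / t is charged to the first factor, so that the second factor
    only has to be bounded.\<close>
  have div: "norm (lambert 0 t) / t \<le> M * exp (- t / 2)" if t: "t > 0" for t
  proof (cases "t \<ge> 1")
    case True
    have "norm (lambert 0 t) / t \<le> (K' * exp (- t / 2)) / 1" using large[OF True] True K'(1) by (intro frac_le) auto
    also have "\<dots> \<le> M * exp (- t / 2)" by (simp add: M_def)
    finally show ?thesis .
  next
    case False
    have "norm (lambert 0 t) / t \<le> (K1 * t\<^sup>2) / t" using small[OF t] t by (intro divide_right_mono) auto
    also have "\<dots> = K1 * t" using t by (simp add: power2_eq_square)
    also have "\<dots> \<le> K1 * (exp (1/2) * exp (- t / 2))"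
    proof (intro mult_left_mono)
      have "t \<le> 1" using False by simp
      also have "1 \<le> exp (1/2) * exp (- t / 2)" using False unfolding exp_add[symmetric] by simp
      finally show "t \<le> exp (1/2) * exp (- t / 2)" .
    qed (use K1 in simp)
    also have "\<dots> \<le> M * exp (- t / 2)" by (simp add: M_def)
    finally show ?thesis .
  qed
  have bdd: "norm (lambert 0 y) \<le> K1 + K'" if y: "y > 0" for y
  proof (cases "y \<ge> 1")
    case True
    have "K' * exp (- y / 2) \<le> K' * 1" using y K'(1) by (intro mult_left_mono) auto
    then show ?thesis using large[OF True] K1 by linarith
  next
    case False
    have "K1 * y\<^sup>2 \<le> K1 * 1" using False y K1 by (intro mult_left_mono power_le_one) auto
    then show ?thesis using small[OF y] K'(1) by linarith
  qed
  define v where "v n = 1 / (real n + 1)" for n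
  have v: "0 < v n" "v n \<le> 1" for n by (auto simp: v_def)
  have v0: "v \<longlonglongrightarrow> 0" unfolding v_def by real_asymp
  have "(\<lambda>n. LBINT t:{0<..}. lambert 0 t * cnj (lambert 0 (v n / t)) / of_real t) \<longlonglongrightarrow> (LBINT t:{0::real<..}. (0::complex))"
  proof (rule set_integral_pos_dominated_convergence)
    show "set_integrable lborel {0<..} (\<lambda>t. (M * (K1 + K')) * (t powr 0 * exp (- t / 2)))"
      by (rule set_integrable_powr_exp) simp
    show "continuous_on {0<..} (\<lambda>t. lambert 0 t * cnj (lambert 0 (v n / t)) / of_real t)" for n
      by (intro continuous_intros lambert_continuous_on continuous_on_compose2[OF lambert_continuous_on, where f = "\<lambda>t. v n / t"])
         (use v in auto)
    fix t :: real assume t: "t > 0"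
    have le: "norm (lambert 0 t * cnj (lambert 0 (v n / t)) / of_real t) \<le> (M * exp (- t / 2)) * norm (lambert 0 (v n / t))" for n
      using mult_right_mono[OF div[OF t], of "norm (lambert 0 (v n / t))"] t by (simp add: norm_mult norm_divide)
    show "norm (lambert 0 t * cnj (lambert 0 (v n / t)) / of_real t) \<le> (M * (K1 + K')) * (t powr 0 * exp (- t / 2))" for n
    proof -
      have "(M * exp (- t / 2)) * norm (lambert 0 (v n / t)) \<le> (M * exp (- t / 2)) * (K1 + K')"
        using M v t by (intro mult_left_mono bdd) auto
      with le[of n] t show ?thesis by (simp add: mult_ac)
    qed
    have "(\<lambda>n. (M * exp (- t / 2)) * (K1 * (v n / t)\<^sup>2)) \<longlonglongrightarrow> (M * exp (- t / 2)) * (K1 * (0 / t)\<^sup>2)"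
      using t by (intro tendsto_intros v0) auto
    then have "(\<lambda>n. (M * exp (- t / 2)) * (K1 * (v n / t)\<^sup>2)) \<longlonglongrightarrow> 0" by simp
    then show "(\<lambda>n. lambert 0 t * cnj (lambert 0 (v n / t)) / of_real t) \<longlonglongrightarrow> 0"
    proof (rule Lim_null_comparison[rotated], intro always_eventually allI)
      fix n
      have "(M * exp (- t / 2)) * norm (lambert 0 (v n / t)) \<le> (M * exp (- t / 2)) * (K1 * (v n / t)\<^sup>2)"
        using M v t by (intro mult_left_mono small) auto
      with le[of n] show "norm (lambert 0 t * cnj (lambert 0 (v n / t)) / of_real t) \<le> (M * exp (- t / 2)) * (K1 * (v n / t)\<^sup>2)"
        by linarith
    qed
  qed auto
  then have "(\<lambda>n. LBINT t:{0<..}. lambert 0 t * cnj (lambert 0 (v n / t)) / of_real t) \<longlonglongrightarrow> 0"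
    by (simp add: set_lebesgue_integral_def)
  from tendsto_Re[OF this] have "0 \<ge> 2 * exp (- (2 * cosh (1::real)))"
    using rankin_integral_ge[OF v] by (intro LIMSEQ_le_const[where X = "\<lambda>n. Re (LBINT t:{0<..}. lambert 0 t * cnj (lambert 0 (v n / t)) / of_real t)"]) auto
  then show False using exp_gt_zero[of "- (2 * cosh (1::real))"] by linarith
qed

end

section \<open>Limits at the pole of the zeta function\<close>

lemma tannery_sequentially:
  fixes a :: "nat \<Rightarrow> nat \<Rightarrow> 'a :: {real_normed_algebra, banach}"
  assumes "\<And>k. (\<lambda>n. a k n) \<longlonglongrightarrow> b k" "\<And>k n. norm (a k n) \<le> M k" "summable M"
  shows "(\<lambda>n. \<Sum>k. a k n) \<longlonglongrightarrow> (\<Sum>k. b k)"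
  using tannerys_theorem[of a b sequentially M] assms by (auto simp: case_prod_unfold)

definition zeta_at_one_plus :: "real \<Rightarrow> real" where
  "zeta_at_one_plus s = (\<Sum>n. real (Suc n) powr (- (1 + s)))"

lemma zeta_at_one_plus_sums: "s > 0 \<Longrightarrow> (\<lambda>n. real (Suc n) powr (- (1 + s))) sums zeta_at_one_plus s"
  unfolding zeta_at_one_plus_def
  using summable_Suc_iff[of "\<lambda>n. real n powr (- (1 + s))"] by (intro summable_sums) (simp add: summable_real_powr_iff)

lemma filterlim_inverse_Suc_at_right_0: "filterlim (\<lambda>N. 1 / (real N + 1)) (at_right 0) sequentially"
  by real_asymp

text \<open>The pole 1/s is written as the telescoping series of (n^-s - (n+1)^-s) / s. Two
  applications of the mean value theorem bound each difference by 2 / n^2 uniformly in s, so the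
  limit may be taken termwise and gives the series of 1/n + ln n - ln (n + 1).\<close>

lemma zeta_at_one_plus_limit:
  "(\<lambda>N. zeta_at_one_plus (1 / (real N + 1)) - 1 / (1 / (real N + 1))) \<longlonglongrightarrow> euler_mascheroni"
proof -
  define s where "s N = 1 / (real N + 1)" for N
  have s: "0 < s N" "s N \<le> 1" for N by (auto simp: s_def)
  have sl: "filterlim s (at_right 0) sequentially" unfolding s_def by (rule filterlim_inverse_Suc_at_right_0)
  define a where "a n N = real (Suc n) powr (- (1 + s N)) - (real (Suc n) powr (- s N) - real (Suc (Suc n)) powr (- s N)) / s N" for n N
  have sums: "(\<lambda>n. a n N) sums (zeta_at_one_plus (s N) - 1 / s N)" for N
  proof -
    have "(\<lambda>n. real (Suc n) powr (- s N)) \<longlonglongrightarrow> 0" using s[of N] by real_asymp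
    from telescope_sums'[OF this] have "(\<lambda>n. real (Suc n) powr (- s N) - real (Suc (Suc n)) powr (- s N)) sums (real (Suc 0) powr (- s N) - 0)" .
    from sums_divide[OF this, of "s N"] have "(\<lambda>n. (real (Suc n) powr (- s N) - real (Suc (Suc n)) powr (- s N)) / s N) sums (1 / s N)" by simp
    from sums_diff[OF zeta_at_one_plus_sums[OF s(1)[of N]] this] show ?thesis unfolding a_def .
  qed
  have bound: "norm (a n N) \<le> 2 * real (Suc n) powr (-2)" for n N
  proof -
    define x where "x = real (Suc n)"
    define \<sigma> where "\<sigma> = s N"
    have x: "x \<ge> 1" and \<sigma>: "0 < \<sigma>" "\<sigma> \<le> 1" using s[of N] by (auto simp: x_def \<sigma>_def)
    have d1: "DERIV (\<lambda>u. - (u powr (- \<sigma>)) / \<sigma>) u :> u powr (- \<sigma> - 1)" if "u > 0" for u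
      using that \<sigma> by (auto intro!: derivative_eq_intros)
    have "\<exists>\<xi>>x. \<xi> < x + 1 \<and> - ((x + 1) powr (- \<sigma>)) / \<sigma> - (- (x powr (- \<sigma>)) / \<sigma>) = (x + 1 - x) * \<xi> powr (- \<sigma> - 1)"
      by (rule MVT2) (use d1 x in auto)
    then obtain \<xi> where \<xi>: "x < \<xi>" "\<xi> < x + 1" "(x powr (- \<sigma>) - (x + 1) powr (- \<sigma>)) / \<sigma> = \<xi> powr (- \<sigma> - 1)"
      by (auto simp: diff_divide_distrib)
    have d2: "DERIV (\<lambda>u. u powr (- \<sigma> - 1)) u :> (- \<sigma> - 1) * u powr (- \<sigma> - 2)" if "u > 0" for u
    proof -
      have "- \<sigma> - 2 = - \<sigma> - 1 - 1" by simp
      then show ?thesis using has_real_derivative_powr[OF that, of "- \<sigma> - 1"] by (simp only:)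
    qed
    have "\<exists>\<zeta>>x. \<zeta> < \<xi> \<and> \<xi> powr (- \<sigma> - 1) - x powr (- \<sigma> - 1) = (\<xi> - x) * ((- \<sigma> - 1) * \<zeta> powr (- \<sigma> - 2))"
      by (rule MVT2) (use d2 x \<xi> in auto)
    then obtain \<zeta> where \<zeta>: "x < \<zeta>" "\<zeta> < \<xi>" "x powr (- \<sigma> - 1) - \<xi> powr (- \<sigma> - 1) = (\<xi> - x) * ((1 + \<sigma>) * \<zeta> powr (- \<sigma> - 2))"
      by (auto simp: algebra_simps)
    have "a n N = x powr (- \<sigma> - 1) - \<xi> powr (- \<sigma> - 1)"
    proof -
      have "- (1 + \<sigma>) = - \<sigma> - 1" "real (Suc (Suc n)) = x + 1" by (auto simp: x_def)
      then show ?thesis unfolding a_def \<sigma>_def[symmetric] x_def[symmetric] by (simp only: \<xi>(3))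
    qed
    then have "norm (a n N) = \<bar>\<xi> - x\<bar> * ((1 + \<sigma>) * \<zeta> powr (- \<sigma> - 2))"
      unfolding \<zeta>(3) using \<sigma> by (simp add: abs_mult)
    also have "\<dots> \<le> 1 * (2 * x powr (-2))"
    proof (intro mult_mono)
      have "\<zeta> powr (- \<sigma> - 2) \<le> \<zeta> powr (-2)" using \<zeta> x \<sigma> by (intro powr_mono) auto
      also have "\<dots> \<le> x powr (-2)" using \<zeta> x by (intro powr_mono2') auto
      finally show "\<zeta> powr (- \<sigma> - 2) \<le> x powr (-2)" .
    qed (use \<xi> \<sigma> in auto)
    finally show ?thesis by (simp add: x_def)
  qed
  have lim: "(\<lambda>N. a n N) \<longlonglongrightarrow> inverse (of_nat (n + 1)) + ln (of_nat (n + 1)) - ln (of_nat (n + 2))" for n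
  proof -
    have "((\<lambda>\<sigma>. x powr (- (1 + \<sigma>)) - (x powr (- \<sigma>) - y powr (- \<sigma>)) / \<sigma>) \<longlongrightarrow> inverse x + ln x - ln y) (at_right 0)"
      if xy: "x > 0" "y > 0" for x y :: real
    proof -
      have "((\<lambda>\<sigma>. x powr (- (1 + \<sigma>)) - (x powr (- \<sigma>) - y powr (- \<sigma>)) / \<sigma>) \<longlongrightarrow> exp (- ln x) - (ln y - ln x)) (at_right 0)"
        using xy by real_asymp
      moreover have "exp (- ln x) - (ln y - ln x) = inverse x + ln x - ln y" using xy by (simp add: exp_minus)
      ultimately show ?thesis by (simp only:)
    qed
    from filterlim_compose[OF this[of "real (Suc n)" "real (Suc (Suc n))"] sl] show ?thesis
      unfolding a_def by (simp add: add.commute)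
  qed
  have "summable (\<lambda>n. 2 * real (Suc n) powr (-2))"
    using summable_Suc_iff[of "\<lambda>n. real n powr (-2)"] by (intro summable_mult) (simp add: summable_real_powr_iff)
  from tannery_sequentially[OF lim bound this]
  have "(\<lambda>N. \<Sum>n. a n N) \<longlonglongrightarrow> (\<Sum>n. inverse (of_nat (n + 1)) + ln (of_nat (n + 1)) - ln (of_nat (n + 2)))" .
  then show ?thesis
    using sums_unique[OF sums] sums_unique[OF euler_mascheroni_sum_real] by (simp add: s_def)
qed

text \<open>Since Gamma (1 + s) = s Gamma (s), this is the difference quotient of Gamma at 1, whose
  limit is \<open>Digamma 1\<close>.\<close>

lemma Gamma_limit_0: "(\<lambda>N. Gamma (1 / (real N + 1)) - 1 / (1 / (real N + 1))) \<longlonglongrightarrow> - euler_mascheroni"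
proof -
  define s where "s N = 1 / (real N + 1)" for N
  have s: "0 < s N" for N by (simp add: s_def)
  have sl: "filterlim s (at 0) sequentially" unfolding s_def by real_asymp
  have "(Gamma has_field_derivative Gamma 1 * Digamma 1) (at (1::real))"
    by (rule has_field_derivative_Gamma) auto
  then have "((\<lambda>h. (Gamma (1 + h) - Gamma 1) / h) \<longlongrightarrow> - euler_mascheroni) (at (0::real))"
    by (simp add: DERIV_def)
  from filterlim_compose[OF this sl] have "(\<lambda>N. (Gamma (1 + s N) - 1) / s N) \<longlonglongrightarrow> - euler_mascheroni" by simp
  moreover have "(Gamma (1 + s N) - 1) / s N = Gamma (s N) - 1 / s N" for N
  proof -
    have "s N \<notin> \<int>\<^sub>\<le>\<^sub>0" using s[of N] by (auto elim!: nonpos_Ints_cases)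
    then have "Gamma (1 + s N) = s N * Gamma (s N)" using Gamma_plus1[of "s N"] by (simp add: add.commute)
    then show ?thesis using s[of N] by (simp add: field_simps)
  qed
  ultimately show ?thesis by (simp add: s_def)
qed

lemma summable_on_nat_powr_atLeast_1:
  assumes "\<alpha> > (1::real)"
  shows "(\<lambda>n::nat. real n powr (- \<alpha>)) summable_on {1..}"
proof -
  have "summable (\<lambda>n::nat. real n powr (- \<alpha>))" using assms by (subst summable_real_powr_iff) auto
  then have "(\<lambda>n::nat. real n powr (- \<alpha>)) summable_on UNIV"
    by (subst summable_on_UNIV_nonneg_real_iff) auto
  then show ?thesis by (rule summable_on_subset) simp
qed

lemma real_power_times_powr:
  "j \<ge> 1 \<Longrightarrow> real j ^ k * real j powr (- \<alpha>) = real j powr (- (\<alpha> - real k))"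
  by (simp add: powr_realpow[symmetric] powr_add[symmetric])

text \<open>The series is the product zeta (alpha) zeta (alpha - k), both factors being convergent
  in this range.\<close>

lemma summable_divisor_power_sum:
  assumes \<alpha>: "\<alpha> > real k + 1"
  shows "summable (\<lambda>n. divisor_power_sum k n * real n powr (- \<alpha>))"
proof -
  have "(\<lambda>(j, n). real j powr (- (\<alpha> - real k)) * real n powr (- \<alpha>)) summable_on {1::nat..} \<times> {1::nat..}"
    using \<alpha> by (intro summable_on_product summable_on_nat_powr_atLeast_1) auto
  also have "?this \<longleftrightarrow> (\<lambda>(j, n). real j ^ k * (real j * real n) powr (- \<alpha>)) summable_on {1::nat..} \<times> {1::nat..}"
  proof (rule summable_on_cong)
    fix x :: "nat \<times> nat" assume "x \<in> {1..} \<times> {1..}"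
    then obtain j n where x: "x = (j, n)" "j \<ge> 1" by auto
    show "(case x of (j, n) \<Rightarrow> real j powr (- (\<alpha> - real k)) * real n powr (- \<alpha>)) = (case x of (j, n) \<Rightarrow> real j ^ k * (real j * real n) powr (- \<alpha>))"
      unfolding x(1) prod.case powr_mult real_power_times_powr[OF x(2), symmetric] by simp
  qed
  finally obtain S where "((\<lambda>(j, n). real j ^ k * (real j * real n) powr (- \<alpha>)) has_sum S) ({1::nat..} \<times> {1::nat..})"
    by (auto simp: summable_on_def)
  from has_sum_divisors[OF this]
  have "((\<lambda>n. \<Sum>d | d dvd n. real d ^ k * (real d * real (n div d)) powr (- \<alpha>)) has_sum S) {1..}" .
  also have "?this \<longleftrightarrow> ((\<lambda>n. divisor_power_sum k n * real n powr (- \<alpha>)) has_sum S) {1..}"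
  proof (rule has_sum_cong)
    fix n :: nat assume "n \<in> {1..}"
    have "real d * real (n div d) = real n" if "d dvd n" for d
      using that by (metis dvd_mult_div_cancel of_nat_mult)
    then show "(\<Sum>d | d dvd n. real d ^ k * (real d * real (n div d)) powr (- \<alpha>)) = divisor_power_sum k n * real n powr (- \<alpha>)"
      by (simp add: divisor_power_sum_def sum_distrib_right)
  qed
  finally have "((\<lambda>n. divisor_power_sum k n * real n powr (- \<alpha>)) has_sum S) UNIV"
    by (rule has_sum_cong_neutral[THEN iffD1, rotated -1]) (auto simp: not_less_eq_eq)
  then show ?thesis by (rule sums_summable[OF has_sum_imp_sums])
qed

section \<open>The Mellin regularisation\<close>

context odd_primitive_character
begin

text \<open>With exponent s + k + 1 the power d^k is absorbed into d^-(1 + s), which isolates the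
  zeta factor and its pole at s = 0.\<close>

lemma sigma_bar_dirichlet_series:
  assumes s: "s > 0"
  shows "(\<lambda>n. sigma_bar_chi (of_nat k) (cnj \<circ> chi) (Suc n) * of_real (real (Suc n) powr (- (s + real k + 1)))) sums
           (of_real (zeta_at_one_plus s) * dirichlet_L (cnj \<circ> chi) (of_real (s + real k + 1)))"
proof -
  interpret C: odd_primitive_character q "cnj \<circ> chi" by (rule cnj_character)
  define \<alpha> where "\<alpha> = s + real k + 1"
  have \<alpha>: "\<alpha> > 1" using s by (simp add: \<alpha>_def)
  define Lk where "Lk = dirichlet_L (cnj \<circ> chi) (of_real \<alpha>)"
  have inner: "((\<lambda>n. cnj (chi n) * of_real (real n powr (- \<alpha>))) has_sum Lk) {1..}"
  proof -
    have "((\<lambda>n. cnj (chi (Suc n)) * of_real (real (Suc n) powr (- \<alpha>))) has_sum Lk) UNIV"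
    proof (rule norm_summable_imp_has_sum)
      show "(\<lambda>n. cnj (chi (Suc n)) * of_real (real (Suc n) powr (- \<alpha>))) sums Lk"
        using C.dirichlet_L_sums[of "of_real \<alpha>"] \<alpha> unfolding Lk_def of_real_nat_powr_minus by simp
      show "summable (\<lambda>n. norm (cnj (chi (Suc n)) * of_real (real (Suc n) powr (- \<alpha>))))"
      proof (rule summable_comparison_test'[OF summable_Suc_powr[OF \<alpha>]])
        show "norm (norm (cnj (chi (Suc n)) * of_real (real (Suc n) powr (- \<alpha>)))) \<le> real (Suc n) powr (- \<alpha>)" for n
          using mult_right_mono[OF norm_chi_le_1[of "Suc n"], of "real (Suc n) powr (- \<alpha>)"] by (simp add: norm_mult)
      qed
    qed
    then have "((\<lambda>n. cnj (chi n) * of_real (real n powr (- \<alpha>))) has_sum Lk) UNIV"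
      by (subst (asm) has_sum_Suc_iff[of "\<lambda>n. cnj (chi n) * of_real (real n powr (- \<alpha>))"]) auto
    then show ?thesis by (subst has_sum_atLeast_1) auto
  qed
  have zeta: "((\<lambda>j. complex_of_real (real j powr (- (1 + s)))) has_sum of_real (zeta_at_one_plus s)) {1..}"
  proof -
    have "((\<lambda>j. real (Suc j) powr (- (1 + s))) has_sum zeta_at_one_plus s) UNIV"
      using zeta_at_one_plus_sums[OF s] by (intro norm_summable_imp_has_sum) (auto simp: sums_iff)
    then have "((\<lambda>j. real j powr (- (1 + s))) has_sum zeta_at_one_plus s) UNIV"
      by (subst (asm) has_sum_Suc_iff[of "\<lambda>j. real j powr (- (1 + s))"]) auto
    then have "((\<lambda>j. complex_of_real (real j powr (- (1 + s)))) has_sum of_real (zeta_at_one_plus s)) UNIV"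
      by (rule has_sum_of_real)
    then show ?thesis by (subst has_sum_atLeast_1) auto
  qed
  have pairs: "((\<lambda>(j, n). complex_of_real (real j powr (- (1 + s))) * (cnj (chi n) * of_real (real n powr (- \<alpha>)))) has_sum
      of_real (zeta_at_one_plus s) * Lk) ({1..} \<times> {1..})"
  proof (rule has_sum_SigmaI)
    show "((\<lambda>n. case (j, n) of (j, n) \<Rightarrow> complex_of_real (real j powr (- (1 + s))) * (cnj (chi n) * of_real (real n powr (- \<alpha>)))) has_sum
        complex_of_real (real j powr (- (1 + s))) * Lk) {1..}" for j
      unfolding prod.case by (rule has_sum_cmult_right[OF inner])
    show "((\<lambda>j. complex_of_real (real j powr (- (1 + s))) * Lk) has_sum of_real (zeta_at_one_plus s) * Lk) {1..}"
      by (rule has_sum_cmult_left[OF zeta])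
    have "(\<lambda>(j, n). real j powr (- (1 + s)) * real n powr (- \<alpha>)) summable_on {1::nat..} \<times> {1::nat..}"
      using s \<alpha> by (intro summable_on_product summable_on_nat_powr_atLeast_1) auto
    then have "(\<lambda>x. norm (case x of (j, n) \<Rightarrow> complex_of_real (real j powr (- (1 + s))) * (cnj (chi n) * of_real (real n powr (- \<alpha>))))) summable_on {1..} \<times> {1..}"
    proof (rule Infinite_Sum.abs_summable_on_comparison_test')
      fix x :: "nat \<times> nat"
      obtain j n where x: "x = (j, n)" by fastforce
      show "norm (case x of (j, n) \<Rightarrow> complex_of_real (real j powr (- (1 + s))) * (cnj (chi n) * of_real (real n powr (- \<alpha>)))) \<le>
          (case x of (j, n) \<Rightarrow> real j powr (- (1 + s)) * real n powr (- \<alpha>))"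
        using mult_right_mono[OF norm_chi_le_1[of n], of "real j powr (- (1 + s)) * real n powr (- \<alpha>)"]
        by (simp add: x norm_mult mult_ac)
    qed
    then show "(\<lambda>(j, n). complex_of_real (real j powr (- (1 + s))) * (cnj (chi n) * of_real (real n powr (- \<alpha>)))) summable_on {1..} \<times> {1..}"
      by (rule abs_summable_summable)
  qed
  have "((\<lambda>n. \<Sum>d | d dvd n. complex_of_real (real d powr (- (1 + s))) * (cnj (chi (n div d)) * of_real (real (n div d) powr (- \<alpha>)))) has_sum
      of_real (zeta_at_one_plus s) * Lk) {1..}"
    by (rule has_sum_divisors[OF pairs])
  also have "?this \<longleftrightarrow> ((\<lambda>n. sigma_bar_chi (of_nat k) (cnj \<circ> chi) n * of_real (real n powr (- \<alpha>))) has_sum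
      of_real (zeta_at_one_plus s) * Lk) {1..}"
  proof (rule has_sum_cong)
    fix n :: nat assume "n \<in> {1..}"
    then have n: "n \<ge> 1" by simp
    have "complex_of_real (real d powr (- (1 + s))) * (cnj (chi (n div d)) * of_real (real (n div d) powr (- \<alpha>))) =
        of_nat d ^ k * (cnj \<circ> chi) (n div d) * of_real (real n powr (- \<alpha>))" if d: "d dvd n" for d
    proof -
      have d1: "d \<ge> 1" using d n by (simp add: Suc_le_eq dvd_pos_nat)
      have "real d * real (n div d) = real n" using d by (metis dvd_mult_div_cancel of_nat_mult)
      then have "real n powr (- \<alpha>) = real d powr (- \<alpha>) * real (n div d) powr (- \<alpha>)" by (metis powr_mult)
      moreover have "real d powr (- (1 + s)) = real d ^ k * real d powr (- \<alpha>)"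
      proof -
        have "\<alpha> - real k = 1 + s" by (simp add: \<alpha>_def)
        then show ?thesis unfolding real_power_times_powr[OF d1] by (simp only:)
      qed
      ultimately show ?thesis by simp
    qed
    then show "(\<Sum>d | d dvd n. complex_of_real (real d powr (- (1 + s))) * (cnj (chi (n div d)) * of_real (real (n div d) powr (- \<alpha>)))) =
        sigma_bar_chi (of_nat k) (cnj \<circ> chi) n * of_real (real n powr (- \<alpha>))"
      unfolding sigma_bar_chi_altdef[OF n] sum_distrib_right by (intro sum.cong) auto
  qed
  finally have "((\<lambda>n. sigma_bar_chi (of_nat k) (cnj \<circ> chi) n * of_real (real n powr (- \<alpha>))) has_sum of_real (zeta_at_one_plus s) * Lk) UNIV"
    by (subst (asm) has_sum_atLeast_1) auto
  then have "((\<lambda>n. sigma_bar_chi (of_nat k) (cnj \<circ> chi) (Suc n) * of_real (real (Suc n) powr (- \<alpha>))) has_sum of_real (zeta_at_one_plus s) * Lk) UNIV"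
    by (subst has_sum_Suc_iff[of "\<lambda>n. sigma_bar_chi (of_nat k) (cnj \<circ> chi) n * of_real (real n powr (- \<alpha>))"]) auto
  then show ?thesis unfolding Lk_def \<alpha>_def by (rule has_sum_imp_sums)
qed

lemma lambert_bound:
  obtains K where "K > 0" "\<And>t. t > 0 \<Longrightarrow> norm (lambert k t) \<le> K / t ^ (k + 3)"
proof (rule exp_series_power_bound[of "Suc k"])
  fix K assume K: "K > 0" "\<And>a t. (\<And>n. norm (a n) \<le> 1 * real n ^ Suc k) \<Longrightarrow> t > 0 \<Longrightarrow> norm (exp_series a t) \<le> K / t ^ (Suc k + 2)"
  have "norm (lambert k t) \<le> K / t ^ (k + 3)" if "t > 0" for t
  proof -
    have "Suc k + 2 = k + 3" by simp
    then show ?thesis using K(2)[OF sigma_chi_bound that] unfolding lambert_def by (simp only:)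
  qed
  with K(1) show ?thesis by (rule that)
qed simp

text \<open>The kernel integral with p = 1 and r = n A. Decay of order k + 3 of the Bessel values
  against coefficients of order n^(k + 1) leaves n^-2.\<close>

lemma lambert_bessel_sums:
  assumes A: "A > 0"
  shows "(\<lambda>n. sigma_chi (of_nat k) chi n * of_real (2 * bessel_K0 (2 * sqrt (real n * A)))) sums
           (LBINT t:{0<..}. of_real (exp (- t) / t) * lambert k (A / t))"
proof -
  define f where "f n t = sigma_chi (of_nat k) chi n * of_real (exp (- (1 * t + (real n * A) / t)) / t)" for n and t :: real
  have s0: "sigma_chi (of_nat k) chi 0 = 0" by (simp add: sigma_chi_def)
  have int: "set_integrable lborel {0<..} (f n)" for n
  proof (cases "n = 0")
    case False
    then show ?thesis unfolding f_def
      by (intro set_integrable_mult_right set_integrable_of_real set_integrable_bessel_kernel) (use A in auto)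
  qed (simp add: f_def s0 set_integrable_def)
  have val: "(LBINT t:{0<..}. exp (- (1 * t + (real n * A) / t)) / t) = 2 * bessel_K0 (2 * sqrt (real n * A))" if "n \<noteq> 0" for n
    using set_integral_bessel_kernel[of 1 "real n * A"] A that by simp
  have fval: "(LBINT t:{0<..}. f n t) = sigma_chi (of_nat k) chi n * of_real (2 * bessel_K0 (2 * sqrt (real n * A)))" for n
  proof (cases "n = 0")
    case False
    then show ?thesis unfolding f_def by (simp only: set_integral_mult_right set_integral_complex_of_real val[OF False])
  qed (simp add: f_def s0 set_lebesgue_integral_def)
  define C where "C = fact (k + 3) * fact (k + 2) / A ^ (k + 3)"
  have nval: "norm (LBINT t:{0<..}. norm (f n t)) \<le> C * real n powr (-2)" for n
  proof (cases "n = 0")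
    case False
    have "(LBINT t:{0<..}. norm (f n t)) = (LBINT t:{0<..}. norm (sigma_chi (of_nat k) chi n) * (exp (- (1 * t + (real n * A) / t)) / t))"
      by (intro set_lebesgue_integral_cong) (auto simp: f_def norm_mult norm_divide)
    also have "\<dots> = norm (sigma_chi (of_nat k) chi n) * (2 * bessel_K0 (2 * sqrt (real n * A)))"
      by (simp only: set_integral_mult_right val[OF False])
    also have "\<dots> \<le> real n ^ Suc k * (fact (k + 3) * fact (k + 3 - 1) / (real n * A) ^ (k + 3))"
      using sigma_chi_bound[of k n] False A bessel_K0_nonneg by (intro mult_mono bessel_K0_le_power) auto
    also have "\<dots> = C * real n powr (-2)"
    proof -
      have "(real n * A) ^ (k + 3) = real n ^ Suc k * ((real n)\<^sup>2 * A ^ (k + 3))"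
        by (simp add: power_mult_distrib power_add power2_eq_square eval_nat_numeral)
      moreover have "real n ^ Suc k * (F / (real n ^ Suc k * ((real n)\<^sup>2 * G))) = (F / G) * (1 / (real n)\<^sup>2)" for F G :: real
        using False by simp
      moreover have "real n powr (-2) = 1 / (real n)\<^sup>2" using False by (simp add: powr_minus powr_numeral divide_inverse)
      moreover have "k + 3 - 1 = k + 2" by simp
      ultimately show ?thesis by (simp only: C_def)
    qed
    finally show ?thesis by (subst real_norm_def, subst abs_of_nonneg) (auto intro!: set_integral_nonneg)
  qed (simp add: f_def s0 set_lebesgue_integral_def)
  have fs: "(\<lambda>n. f n t) sums (of_real (exp (- t) / t) * lambert k (A / t))" "summable (\<lambda>n. norm (f n t))" if t: "t > 0" for t
  proof -
    have At: "A / t > 0" using A t by simp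
    have eq: "f n t = of_real (exp (- t) / t) * (sigma_chi (of_nat k) chi n * of_real (exp (- (real n * (A / t)))))" for n
    proof -
      have "exp (- (1 * t + (real n * A) / t)) = exp (- t) * exp (- (real n * (A / t)))"
        unfolding exp_add[symmetric] by simp
      then show ?thesis by (simp only: f_def) simp
    qed
    from sums_mult[OF exp_series_sums[OF sigma_chi_bound At, of k], of "of_real (exp (- t) / t)"]
    show "(\<lambda>n. f n t) sums (of_real (exp (- t) / t) * lambert k (A / t))" unfolding eq lambert_def .
    have "summable (\<lambda>n. norm (complex_of_real (exp (- t) / t)) * norm (sigma_chi (of_nat k) chi n * of_real (exp (- (real n * (A / t))))))"
      by (intro summable_mult exp_series_abs_summable[OF sigma_chi_bound At])
    then show "summable (\<lambda>n. norm (f n t))" unfolding eq norm_mult[of "of_real (exp (- t) / t)"] .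
  qed
  have sm: "summable (\<lambda>n. LBINT t:{0<..}. norm (f n t))"
    by (rule summable_comparison_test'[OF _ nval]) (intro summable_mult, subst summable_real_powr_iff, simp)
  have "(\<lambda>n. LBINT t:{0<..}. f n t) sums (LBINT t:{0<..}. (\<Sum>n. f n t))"
    by (rule set_integral_sums[OF int sm]) (use fs(2) in auto)
  moreover have "(LBINT t:{0<..}. (\<Sum>n. f n t)) = (LBINT t:{0<..}. of_real (exp (- t) / t) * lambert k (A / t))"
    by (intro set_lebesgue_integral_cong) (use sums_unique[OF fs(1)] in auto)
  ultimately show ?thesis unfolding fval by simp
qed

lemma continuous_on_lambert_div: "A > 0 \<Longrightarrow> continuous_on {0<..} (\<lambda>t. lambert k (A / t))"
  by (rule continuous_on_compose2[OF lambert_continuous_on]) (auto intro!: continuous_intros)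

text \<open>On this side nothing is singular at s = 0: the power bound makes
  \<open>lambert k (A / t)\<close> small of order t^(k + 3) near 0. For 0 < s <= 1 the power t^(s -
  1) lies below 1/t + 1, which gives the majorant \<open>h\<close>.\<close>

lemma lambert_integral_limit:
  assumes A: "A > 0" and s: "\<And>N. 0 < s N" "\<And>N. s N \<le> 1" "s \<longlonglongrightarrow> 0"
  shows "(\<lambda>N. LBINT t:{0<..}. of_real (t powr (s N - 1) * exp (- t)) * lambert k (A / t)) \<longlonglongrightarrow>
           (LBINT t:{0<..}. of_real (exp (- t) / t) * lambert k (A / t))"
proof -
  obtain K where K: "K > 0" "\<And>t. t > 0 \<Longrightarrow> norm (lambert k t) \<le> K / t ^ (k + 3)" using lambert_bound by blast
  define h where "h t = (K / A ^ (k + 3)) * (t powr (real (k + 3) - 1) * exp (- (1 * t))) +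
     (K / A ^ (k + 3)) * (t powr (real (k + 4) - 1) * exp (- (1 * t)))" for t
  show ?thesis
  proof (rule set_integral_pos_dominated_convergence)
    show "set_integrable lborel {0<..} h"
      unfolding h_def by (intro set_integral_add(1) set_integrable_mult_right set_integrable_Gamma) auto
    show "continuous_on {0<..} (\<lambda>t. of_real (t powr (s N - 1) * exp (- t)) * lambert k (A / t))" for N
      by (intro continuous_intros continuous_on_lambert_div A) auto
    show "continuous_on {0<..} (\<lambda>t. of_real (exp (- t) / t) * lambert k (A / t))"
      by (intro continuous_intros continuous_on_lambert_div A) auto
    fix t :: real assume t: "t > 0"
    show "norm (of_real (t powr (s N - 1) * exp (- t)) * lambert k (A / t)) \<le> h t" for N
    proof -
      have "t powr (s N - 1) \<le> t powr (-1) + t powr 0"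
      proof (cases "t \<ge> 1")
        case True
        then have "t powr (s N - 1) \<le> t powr 0" using s(2)[of N] by (intro powr_mono) auto
        then show ?thesis using powr_ge_zero[of t "-1"] by linarith
      next
        case False
        then have "t powr (s N - 1) \<le> t powr (-1)" using s(1)[of N] t by (intro powr_mono') auto
        then show ?thesis using powr_ge_zero[of t 0] by linarith
      qed
      then have "(t powr (s N - 1) * exp (- t)) * norm (lambert k (A / t)) \<le> ((t powr (-1) + t powr 0) * exp (- t)) * (K / (A / t) ^ (k + 3))"
        using A t by (intro mult_mono K) auto
      also have "K / (A / t) ^ (k + 3) = (K / A ^ (k + 3)) * t powr real (k + 3)"
      proof -
        have "t powr real (k + 3) = t ^ (k + 3)" by (rule powr_realpow[OF t])
        then show ?thesis by (simp only:) (simp add: power_divide)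
      qed
      also have "((t powr (-1) + t powr 0) * exp (- t)) * ((K / A ^ (k + 3)) * t powr real (k + 3)) =
         (K / A ^ (k + 3)) * ((t powr (-1) * t powr real (k + 3)) * exp (- t)) + (K / A ^ (k + 3)) * ((t powr 0 * t powr real (k + 3)) * exp (- t))"
        by (simp only: ring_distribs mult_ac)
      also have "t powr (-1) * t powr real (k + 3) = t powr (real (k + 3) - 1)" unfolding powr_add[symmetric] by simp
      also have "t powr 0 * t powr real (k + 3) = t powr (real (k + 4) - 1)" unfolding powr_add[symmetric] by (simp add: add.commute)
      finally have "(t powr (s N - 1) * exp (- t)) * norm (lambert k (A / t)) \<le> h t" unfolding h_def by simp
      moreover have "norm (complex_of_real (t powr (s N - 1) * exp (- t))) = t powr (s N - 1) * exp (- t)"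
        unfolding norm_of_real by simp
      ultimately show ?thesis unfolding norm_mult[of "of_real (t powr (s N - 1) * exp (- t))"] by (simp only:)
    qed
    have "(\<lambda>N. of_real (t powr (s N - 1) * exp (- t)) * lambert k (A / t)) \<longlonglongrightarrow> of_real (t powr (0 - 1) * exp (- t)) * lambert k (A / t)"
      using t by (intro tendsto_intros s(3)) auto
    moreover have "t powr (0 - 1) * exp (- t) = exp (- t) / t" using t by (simp add: powr_minus divide_inverse)
    ultimately show "(\<lambda>N. of_real (t powr (s N - 1) * exp (- t)) * lambert k (A / t)) \<longlonglongrightarrow> of_real (exp (- t) / t) * lambert k (A / t)"
      by (simp only:)
  qed
qed

text \<open>Each term contributes Gamma (s + k + 1) (c / (n + c))^(s + k + 1). Here
  \<open>s > 0\<close> is essential: it raises the exponent above k + 1, where the divisor sums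
  become summable.\<close>

lemma
  assumes c: "c > 0" and s: "s > 0"
  shows dual_integrable: "set_integrable lborel {0<..} (\<lambda>t. of_real (t powr (s + real k) * exp (- t)) * lambert_dual k (t / c))"
    and dual_integral_sums: "(\<lambda>n. sigma_bar_chi (of_nat k) (cnj \<circ> chi) (Suc n) * of_real ((c / (real (Suc n) + c)) powr (s + real k + 1))) sums
       (of_real (1 / Gamma (s + real k + 1)) * (LBINT t:{0<..}. of_real (t powr (s + real k) * exp (- t)) * lambert_dual k (t / c)))"
proof -
  define \<alpha> where "\<alpha> = s + real k + 1"
  have \<alpha>: "\<alpha> > real k + 1" using s by (simp add: \<alpha>_def)
  have G: "Gamma \<alpha> > 0" using \<alpha> by (intro Gamma_real_pos) auto
  define S where "S n = sigma_bar_chi (of_nat k) (cnj \<circ> chi) n" for n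
  have s0: "S 0 = 0" by (simp add: S_def sigma_bar_chi_def)
  define f where "f n t = S n * of_real (t powr (\<alpha> - 1) * exp (- ((1 + real n / c) * t)))" for n and t :: real
  have p: "1 + real n / c > 0" for n using c by (simp add: add_pos_nonneg)
  have \<alpha>0: "\<alpha> > 0" using \<alpha> by linarith
  have int: "set_integrable lborel {0<..} (f n)" for n
    unfolding f_def by (intro set_integrable_mult_right set_integrable_of_real set_integrable_Gamma \<alpha>0 p)
  have pc: "1 / (1 + real n / c) powr \<alpha> = (c / (real n + c)) powr \<alpha>" for n
  proof -
    have "c / (real n + c) = 1 / (1 + real n / c)" using c by (simp add: field_simps)
    then show ?thesis using p[of n] by (simp only: powr_divide powr_one_eq_one)
  qed
  have val: "(LBINT t:{0<..}. t powr (\<alpha> - 1) * exp (- ((1 + real n / c) * t))) = Gamma \<alpha> * (c / (real n + c)) powr \<alpha>" for n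
    unfolding pc[symmetric] using set_integral_Gamma[OF \<alpha>0 p] by simp
  have fval: "(LBINT t:{0<..}. f n t) = S n * of_real (Gamma \<alpha> * (c / (real n + c)) powr \<alpha>)" for n
    unfolding f_def by (simp only: set_integral_mult_right set_integral_complex_of_real val)
  have nval: "norm (LBINT t:{0<..}. norm (f n t)) \<le> (Gamma \<alpha> * c powr \<alpha>) * (divisor_power_sum k n * real n powr (- \<alpha>))" for n
  proof (cases "n = 0")
    case False
    have "(LBINT t:{0<..}. norm (f n t)) = (LBINT t:{0<..}. norm (S n) * (t powr (\<alpha> - 1) * exp (- ((1 + real n / c) * t))))"
      by (intro set_lebesgue_integral_cong) (auto simp: f_def norm_mult)
    also have "\<dots> = norm (S n) * (Gamma \<alpha> * (c / (real n + c)) powr \<alpha>)" by (simp only: set_integral_mult_right val)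
    also have "\<dots> \<le> divisor_power_sum k n * (Gamma \<alpha> * (c / real n) powr \<alpha>)"
    proof (intro mult_mono)
      show "norm (S n) \<le> divisor_power_sum k n" unfolding S_def by (rule norm_sigma_bar_chi_le)
      show "(c / (real n + c)) powr \<alpha> \<le> (c / real n) powr \<alpha>"
        using c \<alpha>0 False by (intro powr_mono2 divide_left_mono) auto
    qed (use G divisor_power_sum_nonneg in auto)
    also have "(c / real n) powr \<alpha> = c powr \<alpha> * real n powr (- \<alpha>)"
      using c by (simp add: powr_divide powr_minus_divide)
    finally show ?thesis by (subst real_norm_def, subst abs_of_nonneg) (auto intro!: set_integral_nonneg simp: mult_ac)
  qed (simp add: f_def s0 set_lebesgue_integral_def)
  have fs: "(\<lambda>n. f n t) sums (of_real (t powr (s + real k) * exp (- t)) * lambert_dual k (t / c))" "summable (\<lambda>n. norm (f n t))" if t: "t > 0" for t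
  proof -
    have tc: "t / c > 0" using c t by simp
    have eq: "f n t = of_real (t powr (s + real k) * exp (- t)) * (S n * of_real (exp (- (real n * (t / c)))))" for n
    proof -
      have "exp (- ((1 + real n / c) * t)) = exp (- t) * exp (- (real n * (t / c)))"
        unfolding exp_add[symmetric] by (simp add: algebra_simps)
      then show ?thesis by (simp only: f_def) (simp add: \<alpha>_def)
    qed
    from sums_mult[OF exp_series_sums[OF sigma_bar_chi_bound tc, of k], of "of_real (t powr (s + real k) * exp (- t))"]
    show "(\<lambda>n. f n t) sums (of_real (t powr (s + real k) * exp (- t)) * lambert_dual k (t / c))" unfolding eq lambert_dual_def S_def .
    have "summable (\<lambda>n. norm (complex_of_real (t powr (s + real k) * exp (- t))) * norm (S n * of_real (exp (- (real n * (t / c))))))"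
      unfolding S_def by (intro summable_mult exp_series_abs_summable[OF sigma_bar_chi_bound tc])
    then show "summable (\<lambda>n. norm (f n t))" unfolding eq norm_mult[of "of_real (t powr (s + real k) * exp (- t))"] .
  qed
  have sm: "summable (\<lambda>n. LBINT t:{0<..}. norm (f n t))"
    by (rule summable_comparison_test'[OF _ nval]) (intro summable_mult summable_divisor_power_sum \<alpha>)
  have "set_integrable lborel {0<..} (\<lambda>t. \<Sum>n. f n t)"
    by (rule set_integrable_suminf[OF int sm]) (use fs(2) in auto)
  also have "?this \<longleftrightarrow> set_integrable lborel {0<..} (\<lambda>t. of_real (t powr (s + real k) * exp (- t)) * lambert_dual k (t / c))"
    by (rule set_integrable_cong) (use sums_unique[OF fs(1)] in auto)
  finally show "set_integrable lborel {0<..} (\<lambda>t. of_real (t powr (s + real k) * exp (- t)) * lambert_dual k (t / c))" .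
  have "(\<lambda>n. LBINT t:{0<..}. f n t) sums (LBINT t:{0<..}. (\<Sum>n. f n t))"
    by (rule set_integral_sums[OF int sm]) (use fs(2) in auto)
  also have "(LBINT t:{0<..}. (\<Sum>n. f n t)) = (LBINT t:{0<..}. of_real (t powr (s + real k) * exp (- t)) * lambert_dual k (t / c))"
    by (intro set_lebesgue_integral_cong) (use sums_unique[OF fs(1)] in auto)
  finally have "(\<lambda>n. of_real (1 / Gamma \<alpha>) * (S n * of_real (Gamma \<alpha> * (c / (real n + c)) powr \<alpha>))) sums
      (of_real (1 / Gamma \<alpha>) * (LBINT t:{0<..}. of_real (t powr (s + real k) * exp (- t)) * lambert_dual k (t / c)))"
    unfolding fval by (rule sums_mult)
  moreover have "of_real (1 / Gamma \<alpha>) * (S n * of_real (Gamma \<alpha> * (c / (real n + c)) powr \<alpha>)) = S n * of_real ((c / (real n + c)) powr \<alpha>)" for n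
    using G by simp
  ultimately have "(\<lambda>n. S n * of_real ((c / (real n + c)) powr \<alpha>)) sums
      (of_real (1 / Gamma \<alpha>) * (LBINT t:{0<..}. of_real (t powr (s + real k) * exp (- t)) * lambert_dual k (t / c)))"
    by (simp only:)
  then show "(\<lambda>n. sigma_bar_chi (of_nat k) (cnj \<circ> chi) (Suc n) * of_real ((c / (real (Suc n) + c)) powr (s + real k + 1))) sums
       (of_real (1 / Gamma (s + real k + 1)) * (LBINT t:{0<..}. of_real (t powr (s + real k) * exp (- t)) * lambert_dual k (t / c)))"
    unfolding S_def[symmetric] \<alpha>_def[symmetric]
    by (subst sums_Suc_iff[of "\<lambda>n. S n * of_real ((c / (real n + c)) powr \<alpha>)"]) (simp add: s0)
qed


text \<open>The transformation is inserted at y = A / t. The dual argument becomes t / c with c = q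
  A / (4 pi^2), and the factor t^(k + 1) of the transformation raises the weight to t^(s +
  k).\<close>

lemma regularised_integral:
  assumes k: "even k" and A: "A > 0" and s: "s > 0"
  shows "(LBINT t:{0<..}. of_real (t powr (s - 1) * exp (- t)) * lambert k (A / t)) =
     (if k = 0 then dirichlet_L chi 1 / of_real A else 0) * of_real (Gamma (s + 1)) -
     dirichlet_L chi (- of_nat k) / 2 * of_real (Gamma s) +
     (-2 * of_real pi * \<i>) ^ Suc k / cnj (gauss_sum q chi) / of_real A ^ Suc k *
       (LBINT t:{0<..}. of_real (t powr (s + real k) * exp (- t)) * lambert_dual k (t / (real q * A / (4 * pi\<^sup>2))))"
proof -
  define c where "c = real q * A / (4 * pi\<^sup>2)"
  have c: "c > 0" using A q_gt_2 by (simp add: c_def)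
  define P where "P = (if k = 0 then dirichlet_L chi 1 / of_real A else 0)"
  define L where "L = dirichlet_L chi (- of_nat k)"
  define \<beta> where "\<beta> = (-2 * of_real pi * \<i>) ^ Suc k / cnj (gauss_sum q chi) / of_real A ^ Suc k"
  define f1 where "f1 t = P * of_real (t powr ((s + 1) - 1) * exp (- (1 * t)))" for t :: real
  define f2 where "f2 t = L / 2 * of_real (t powr (s - 1) * exp (- (1 * t)))" for t :: real
  define f3 where "f3 t = \<beta> * (of_real (t powr (s + real k) * exp (- t)) * lambert_dual k (t / c))" for t :: real
  have i1: "set_integrable lborel {0<..} f1" and i2: "set_integrable lborel {0<..} f2"
    unfolding f1_def f2_def using s by (intro set_integrable_mult_right set_integrable_of_real set_integrable_Gamma; simp)+
  have i3: "set_integrable lborel {0<..} f3"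
    unfolding f3_def by (intro set_integrable_mult_right dual_integrable c s)
  have v1: "(LBINT t:{0<..}. f1 t) = P * of_real (Gamma (s + 1))"
    unfolding f1_def set_integral_mult_right set_integral_complex_of_real by (subst set_integral_Gamma) (use s in auto)
  have v2: "(LBINT t:{0<..}. f2 t) = L / 2 * of_real (Gamma s)"
    unfolding f2_def set_integral_mult_right set_integral_complex_of_real by (subst set_integral_Gamma) (use s in auto)
  have v3: "(LBINT t:{0<..}. f3 t) = \<beta> * (LBINT t:{0<..}. of_real (t powr (s + real k) * exp (- t)) * lambert_dual k (t / c))"
    unfolding f3_def by (rule set_integral_mult_right)
  have "(LBINT t:{0<..}. of_real (t powr (s - 1) * exp (- t)) * lambert k (A / t)) = (LBINT t:{0<..}. (f1 t - f2 t) + f3 t)"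
  proof (intro set_lebesgue_integral_cong allI impI)
    fix t :: real assume "t \<in> {0<..}"
    then have t: "t > 0" by simp
    define wt where "wt = complex_of_real (t powr (s - 1) * exp (- t))"
    have At: "A / t > 0" using A t by simp
    have "4 * pi\<^sup>2 / (real q * (A / t)) = t / c" using A t q_gt_2 by (simp add: c_def field_simps)
    then have lam: "lambert k (A / t) = (if k = 0 then dirichlet_L chi 1 / of_real (A / t) else 0) - L / 2 +
        (-2 * of_real pi * \<i> / of_real (A / t)) ^ Suc k / cnj (gauss_sum q chi) * lambert_dual k (t / c)"
      using lambert_transformation[OF At k] by (simp only: L_def)
    have e1: "wt * (if k = 0 then dirichlet_L chi 1 / of_real (A / t) else 0) = f1 t"
    proof -
      have "t powr (s - 1) * exp (- t) * t = t powr ((s + 1) - 1) * exp (- (1 * t))" using t by (simp add: powr_diff)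
      then have "wt * of_real t = of_real (t powr ((s + 1) - 1) * exp (- (1 * t)))" unfolding wt_def of_real_mult[symmetric] by (simp only:)
      then show ?thesis unfolding f1_def P_def using t A by (simp add: mult_ac flip: of_real_mult)
    qed
    have e2: "wt * (L / 2) = f2 t" unfolding f2_def wt_def by simp
    have e3: "wt * ((-2 * of_real pi * \<i> / of_real (A / t)) ^ Suc k / cnj (gauss_sum q chi) * lambert_dual k (t / c)) = f3 t"
    proof -
      have "-2 * of_real pi * \<i> / of_real (A / t) = (-2 * of_real pi * \<i> / of_real A) * complex_of_real t" using A t by simp
      then have pw: "(-2 * of_real pi * \<i> / of_real (A / t)) ^ Suc k = (-2 * of_real pi * \<i>) ^ Suc k / of_real A ^ Suc k * complex_of_real (t ^ Suc k)"
        by (simp only: power_mult_distrib power_divide of_real_power)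
      have "t powr (s - 1) * exp (- t) * t ^ Suc k = t powr (s + real k) * exp (- t)"
      proof -
        have "t powr (s - 1) * t ^ Suc k = t powr (s - 1) * t powr (real (Suc k))" by (subst powr_realpow[OF t]) simp
        also have "\<dots> = t powr (s + real k)" unfolding powr_add[symmetric] by (simp add: add.commute)
        finally show ?thesis by (metis mult.assoc mult.commute)
      qed
      then have "wt * complex_of_real (t ^ Suc k) = of_real (t powr (s + real k) * exp (- t))" unfolding wt_def of_real_mult[symmetric] by (simp only:)
      then have e: "of_real (t powr (s + real k) * exp (- t)) = wt * complex_of_real (t ^ Suc k)" ..
      show ?thesis unfolding pw f3_def \<beta>_def e by (simp only: mult_ac times_divide_eq_left times_divide_eq_right divide_divide_eq_left)
    qed
    show "of_real (t powr (s - 1) * exp (- t)) * lambert k (A / t) = (f1 t - f2 t) + f3 t"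
      unfolding lam wt_def[symmetric] ring_distribs e1 e2 e3 ..
  qed auto
  also have "\<dots> = ((LBINT t:{0<..}. f1 t) - (LBINT t:{0<..}. f2 t)) + (LBINT t:{0<..}. f3 t)"
    by (subst set_integral_add(2)[OF set_integral_diff(1)[OF i1 i2] i3], subst set_integral_diff(2)[OF i1 i2]) simp
  finally show ?thesis unfolding v1 v2 v3 P_def L_def \<beta>_def c_def .
qed

text \<open>By the mean value theorem the difference decays one power faster than its two parts,
  hence is summable even at s = 0. The maximum with 1 bounds the power of \<open>c\<close> uniformly
  for s in [0, 1].\<close>

lemma sigma_bar_difference_bound:
  assumes c: "c > 0" and s: "0 \<le> s" "s \<le> 1"
  shows "norm (sigma_bar_chi (of_nat k) (cnj \<circ> chi) (Suc n) *
           of_real ((c / real (Suc n)) powr (s + real k + 1) - (c / (real (Suc n) + c)) powr (s + real k + 1))) \<le>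
         (max 1 c ^ (k + 2) * ((real k + 2) * c)) * (divisor_power_sum k (Suc n) * real (Suc n) powr (- (real k + 2)))"
proof -
  define \<alpha> where "\<alpha> = s + real k + 1"
  have \<alpha>: "\<alpha> \<ge> real k + 1" "\<alpha> \<le> real k + 2" using s by (auto simp: \<alpha>_def)
  define x where "x = real (Suc n)"
  have x: "x \<ge> 1" by (simp add: x_def)
  have d: "DERIV (\<lambda>u. - (u powr (- \<alpha>))) u :> \<alpha> * u powr (- \<alpha> - 1)" if "u > 0" for u
    using DERIV_minus[OF has_real_derivative_powr[OF that, of "- \<alpha>"]] by simp
  have "\<exists>\<xi>>x. \<xi> < x + c \<and> - ((x + c) powr (- \<alpha>)) - (- (x powr (- \<alpha>))) = (x + c - x) * (\<alpha> * \<xi> powr (- \<alpha> - 1))"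
    by (rule MVT2) (use d x c in auto)
  then obtain \<xi> where \<xi>: "x < \<xi>" "x powr (- \<alpha>) - (x + c) powr (- \<alpha>) = c * (\<alpha> * \<xi> powr (- \<alpha> - 1))" by auto
  have eq: "(c / x) powr \<alpha> - (c / (x + c)) powr \<alpha> = c powr \<alpha> * (c * (\<alpha> * \<xi> powr (- \<alpha> - 1)))"
    unfolding \<xi>(2)[symmetric] using c x by (simp add: powr_divide powr_minus_divide right_diff_distrib)
  have "\<bar>(c / x) powr \<alpha> - (c / (x + c)) powr \<alpha>\<bar> = c powr \<alpha> * (c * (\<alpha> * \<xi> powr (- \<alpha> - 1)))"
    unfolding eq using c \<alpha> by (intro abs_of_nonneg) auto
  also have "\<dots> \<le> max 1 c ^ (k + 2) * (c * ((real k + 2) * x powr (- (real k + 2))))"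
  proof (intro mult_mono)
    have "c powr \<alpha> \<le> max 1 c powr \<alpha>" using c \<alpha> by (intro powr_mono2) auto
    also have "\<dots> \<le> max 1 c powr (real (k + 2))" using \<alpha> by (intro powr_mono) auto
    also have "\<dots> = max 1 c ^ (k + 2)" by (rule powr_realpow) auto
    finally show "c powr \<alpha> \<le> max 1 c ^ (k + 2)" .
    have "\<xi> powr (- \<alpha> - 1) \<le> x powr (- \<alpha> - 1)" using \<xi> x \<alpha> by (intro powr_mono2') auto
    also have "\<dots> \<le> x powr (- (real k + 2))" using x \<alpha> by (intro powr_mono) auto
    finally show "\<xi> powr (- \<alpha> - 1) \<le> x powr (- (real k + 2))" .
  qed (use c \<alpha> in auto)
  finally have le: "\<bar>(c / x) powr \<alpha> - (c / (x + c)) powr \<alpha>\<bar> \<le> max 1 c ^ (k + 2) * (c * ((real k + 2) * x powr (- (real k + 2))))" .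
  have "norm (sigma_bar_chi (of_nat k) (cnj \<circ> chi) (Suc n)) * \<bar>(c / x) powr \<alpha> - (c / (x + c)) powr \<alpha>\<bar> \<le>
      divisor_power_sum k (Suc n) * (max 1 c ^ (k + 2) * (c * ((real k + 2) * x powr (- (real k + 2)))))"
    by (intro mult_mono norm_sigma_bar_chi_le le divisor_power_sum_nonneg) auto
  then show ?thesis unfolding norm_mult[of "sigma_bar_chi _ _ _"] norm_of_real x_def[symmetric] \<alpha>_def[symmetric] by (simp add: mult_ac)
qed

text \<open>The functional equation at - k - s absorbs Gamma, the Gauss sum and the powers of pi and
  q. What multiplies zeta (1 + s) thereby becomes a function with value L (- k, chi) / 2 at s = 0,
  which is what cancels the pole of Gamma (s). The bound s < 1 keeps the cosine away from 0.\<close>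

lemma completed_L_factor:
  assumes k: "even k" and A: "A > 0" and s: "0 < s" "s < 1"
  shows "(-2 * of_real pi * \<i>) ^ Suc k / cnj (gauss_sum q chi) / of_real A ^ Suc k *
      of_real (Gamma (s + real k + 1) * (real q * A / (4 * pi\<^sup>2)) powr (s + real k + 1)) *
      dirichlet_L (cnj \<circ> chi) (of_real (s + real k + 1)) =
    1 / 2 * exp (of_real s * of_real (ln (A / (2 * pi)))) / cos (of_real pi * of_real s / 2) * dirichlet_L chi (- of_nat k - of_real s)"
proof -
  obtain l where l: "k = 2 * l" using k by blast
  define \<tau> where "\<tau> = cnj (gauss_sum q chi)"
  have \<tau>: "\<tau> \<noteq> 0" using gauss_sum_nonzero by (simp add: \<tau>_def)
  define \<alpha> where "\<alpha> = s + real k + 1"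
  define G where "G = complex_of_real (Gamma \<alpha>)"
  define Lk where "Lk = dirichlet_L (cnj \<circ> chi) (of_real \<alpha>)"
  define C where "C = cos (pi * s / 2)"
  have C: "C > 0"
  proof -
    have "0 < pi * s / 2" "pi * s / 2 < pi / 2" using s mult_strict_left_mono[OF s(2), of pi] by auto
    then show ?thesis unfolding C_def by (intro cos_gt_zero) auto
  qed
  have co: "cos (complex_of_real pi * of_real s / 2) = of_real C"
    unfolding C_def by (simp add: cos_of_real[symmetric])
  define e where "e = (-1 :: complex) ^ l"
  have "dirichlet_L chi (- of_nat k - of_real s) = fe_factor (- of_nat k - of_real s) * Lk"
  proof -
    have "1 - (- of_nat k - of_real s) = complex_of_real \<alpha>" by (simp add: \<alpha>_def)
    then show ?thesis using dirichlet_L_functional_equation[of "- of_nat k - of_real s"] s by (simp add: Lk_def)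
  qed
  moreover have "fe_factor (- of_nat k - of_real s) = (-2 * \<i> / \<tau>) * G * (e * of_real C) * of_real ((2 * pi / q) powr (- \<alpha>))"
  proof -
    have g: "1 - (- of_nat k - of_real s) = complex_of_real \<alpha>" by (simp add: \<alpha>_def)
    have "cos (complex_of_real pi * (- of_nat k - of_real s) / 2) = e * of_real C"
    proof -
      have "complex_of_real pi * (- of_nat k - of_real s) / 2 = - of_real (real l * pi + pi * s / 2)"
        by (simp add: l field_simps)
      then have "cos (complex_of_real pi * (- of_nat k - of_real s) / 2) = of_real (cos (real l * pi + pi * s / 2))"
        by (simp only: cos_minus cos_of_real)
      also have "cos (real l * pi + pi * s / 2) = (-1) ^ l * C" by (simp add: cos_add cos_npi sin_npi C_def)
      finally show ?thesis by (simp add: e_def)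
    qed
    moreover have "complex_of_real (2 * pi / q) powr (- of_nat k - of_real s - 1) = of_real ((2 * pi / q) powr (- \<alpha>))"
    proof -
      have "- of_nat k - of_real s - 1 = complex_of_real (- \<alpha>)" by (simp add: \<alpha>_def)
      then show ?thesis using powr_of_real[of "2 * pi / q" "- \<alpha>"] q_gt_2 by (simp only:) simp
    qed
    ultimately show ?thesis unfolding fe_factor_def g Gamma_complex_of_real G_def \<tau>_def by (simp only:)
  qed
  ultimately have FE: "dirichlet_L chi (- of_nat k - of_real s) = (-2 * \<i> / \<tau>) * G * (e * of_real C) * of_real ((2 * pi / q) powr (- \<alpha>)) * Lk"
    by (simp only:)
  have pw: "(-2 * of_real pi * \<i>) ^ Suc k = - \<i> * e * of_real ((2 * pi) ^ Suc k)"
  proof -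
    have "(-2 * of_real pi * \<i>) ^ Suc k = (- \<i>) ^ Suc k * of_real ((2 * pi) ^ Suc k)"
    proof -
      have "-2 * of_real pi * \<i> = (- \<i>) * complex_of_real (2 * pi)" by simp
      then show ?thesis by (simp only: power_mult_distrib[of "- \<i>"] of_real_power)
    qed
    also have "(- \<i>) ^ Suc k = - \<i> * e" by (simp add: l e_def power_mult)
    finally show ?thesis .
  qed
  have real: "(2 * pi) ^ Suc k / A ^ Suc k * (real q * A / (4 * pi\<^sup>2)) powr \<alpha> = (A / (2 * pi)) powr s * (2 * pi / q) powr (- \<alpha>)"
  proof -
    define X where "X = A / (2 * pi)"
    have X: "X > 0" using A by (simp add: X_def)
    have "real q * A / (4 * pi\<^sup>2) = X / (2 * pi / q)" using q_gt_2 by (simp add: X_def field_simps power2_eq_square)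
    then have "(real q * A / (4 * pi\<^sup>2)) powr \<alpha> = (X / (2 * pi / q)) powr \<alpha>" by (simp only:)
    also have "\<dots> = X powr \<alpha> * (2 * pi / q) powr (- \<alpha>)"
      unfolding powr_minus divide_inverse[of "X"] by (subst powr_mult) (simp_all only: inverse_powr)
    also have "X powr \<alpha> = X powr s * X ^ Suc k"
    proof -
      have "\<alpha> = s + real (Suc k)" by (simp add: \<alpha>_def)
      then show ?thesis using powr_add[of X s "real (Suc k)"] powr_realpow[OF X, of "Suc k"] by (simp only:)
    qed
    finally have "(2 * pi) ^ Suc k / A ^ Suc k * (real q * A / (4 * pi\<^sup>2)) powr \<alpha> =
       ((2 * pi) ^ Suc k / A ^ Suc k * X ^ Suc k) * (X powr s * (2 * pi / q) powr (- \<alpha>))" by (simp only: mult_ac)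
    also have "(2 * pi) ^ Suc k / A ^ Suc k * X ^ Suc k = 1"
      unfolding power_divide[symmetric] power_mult_distrib[symmetric] X_def using A by simp
    finally show ?thesis by (simp add: X_def)
  qed
  have ex: "exp (of_real s * of_real (ln (A / (2 * pi)))) = complex_of_real ((A / (2 * pi)) powr s)"
    using A by (simp add: powr_def exp_of_real[symmetric])
  define Q where "Q = complex_of_real ((2 * pi / q) powr (- \<alpha>))"
  define R where "R = complex_of_real ((A / (2 * pi)) powr s)"
  have "(-2 * of_real pi * \<i>) ^ Suc k / \<tau> / of_real A ^ Suc k * of_real (Gamma \<alpha> * (real q * A / (4 * pi\<^sup>2)) powr \<alpha>) * Lk =
      - \<i> * e / \<tau> * G * of_real ((2 * pi) ^ Suc k / A ^ Suc k * (real q * A / (4 * pi\<^sup>2)) powr \<alpha>) * Lk"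
    unfolding pw G_def by simp
  also have "\<dots> = - \<i> * e / \<tau> * G * (R * Q) * Lk" unfolding real R_def Q_def by simp
  also have "\<dots> = 1 / 2 * R / of_real C * ((-2 * \<i> / \<tau>) * G * (e * of_real C) * Q * Lk)"
    using C by simp
  also have "\<dots> = 1 / 2 * exp (of_real s * of_real (ln (A / (2 * pi)))) / cos (of_real pi * of_real s / 2) * dirichlet_L chi (- of_nat k - of_real s)"
    unfolding ex co FE R_def Q_def ..
  finally show ?thesis unfolding \<tau>_def Lk_def \<alpha>_def .
qed

text \<open>The source of both L' and the logarithm in the final formula; the cosine is stationary
  at 0 and contributes nothing.\<close>

lemma completed_L_factor_DERIV:
  fixes k :: nat and B :: real
  defines "V \<equiv> \<lambda>z. 1 / 2 * exp (z * of_real B) / cos (of_real pi * z / 2) * dirichlet_L chi (- of_nat k - z)"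
  shows "(V has_field_derivative (dirichlet_L chi (- of_nat k) * of_real B - deriv (dirichlet_L chi) (- of_nat k)) / 2) (at 0)"
proof -
  have "(dirichlet_L chi has_field_derivative deriv (dirichlet_L chi) (- of_nat k)) (at (- of_nat k - 0))"
    using dirichlet_L_holomorphic by (simp add: holomorphic_derivI)
  then have "((\<lambda>z. dirichlet_L chi (- of_nat k - z)) has_field_derivative deriv (dirichlet_L chi) (- of_nat k) * (- 1)) (at 0)"
    by (rule DERIV_chain2) (auto intro!: derivative_eq_intros)
  then show ?thesis unfolding V_def by (auto intro!: derivative_eq_intros simp: field_simps)
qed

text \<open>The leading term is 1 and the others together are at most pi^2 / 6 - 1, which is less
  than 1.\<close>

lemma dirichlet_L_ge_2_nonzero:
  assumes "p \<ge> 2"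
  shows "dirichlet_L chi (of_nat p) \<noteq> 0"
proof
  assume 0: "dirichlet_L chi (of_nat p) = 0"
  have "(\<lambda>n. chi (Suc n) / of_nat (Suc n) ^ p) sums 0"
    using has_sum_imp_sums[OF dirichlet_L_has_sum[OF assms]] 0 by simp
  then have "(\<lambda>n. chi (Suc (Suc n)) / of_nat (Suc (Suc n)) ^ p) sums (- 1)"
    by (subst sums_Suc_iff[of "\<lambda>n. chi (Suc n) / of_nat (Suc n) ^ p"]) simp
  then have n1: "norm (\<Sum>n. chi (Suc (Suc n)) / of_nat (Suc (Suc n)) ^ p) = 1" by (simp add: sums_iff)
  have "(\<lambda>n. 1 / (real n + 1)\<^sup>2) sums (pi\<^sup>2 / 6)" using inverse_squares_sums by (simp add: add.commute)
  then have sq: "(\<lambda>n. 1 / (real (Suc n) + 1)\<^sup>2) sums (pi\<^sup>2 / 6 - 1)"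
    by (subst sums_Suc_iff[of "\<lambda>n. 1 / (real n + 1)\<^sup>2"]) simp
  have "norm (\<Sum>n. chi (Suc (Suc n)) / of_nat (Suc (Suc n)) ^ p) \<le> (\<Sum>n. 1 / (real (Suc n) + 1)\<^sup>2)"
  proof (rule norm_suminf_le)
    show "summable (\<lambda>n. 1 / (real (Suc n) + 1)\<^sup>2)" using sq by (rule sums_summable)
    fix n
    have "norm (chi (Suc (Suc n)) / of_nat (Suc (Suc n)) ^ p) \<le> 1 / real (Suc (Suc n)) ^ p"
      unfolding norm_divide norm_power norm_of_nat by (intro divide_right_mono norm_chi_le_1) auto
    also have "\<dots> \<le> 1 / real (Suc (Suc n)) ^ 2" using assms by (intro divide_left_mono power_increasing) auto
    finally show "norm (chi (Suc (Suc n)) / of_nat (Suc (Suc n)) ^ p) \<le> 1 / (real (Suc n) + 1)\<^sup>2" by (simp add: add.commute)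
  qed
  also have "\<dots> = pi\<^sup>2 / 6 - 1" using sq by (rule sums_unique[symmetric])
  finally have "12 \<le> pi\<^sup>2" using n1 by simp
  moreover have "pi\<^sup>2 < 12"
  proof -
    have "pi < 3.2" using pi_approx(2) by simp
    then have "pi * pi < 3.2 * 3.2" by (intro mult_strict_mono) auto
    then show ?thesis by (simp add: power2_eq_square)
  qed
  ultimately show False by simp
qed

text \<open>The functional equation carries nonvanishing at k + 1, for the conjugate character, over
  to - k; for \<open>k = 0\<close> this rests on the value at 1.\<close>

lemma dirichlet_L_neg_even_nonzero:
  assumes "even k"
  shows "dirichlet_L chi (- of_nat k) \<noteq> 0"
proof -
  interpret C: odd_primitive_character q "cnj \<circ> chi" by (rule cnj_character)
  have "dirichlet_L (cnj \<circ> chi) (of_nat (Suc k)) \<noteq> 0"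
  proof (cases "k = 0")
    case True
    then show ?thesis using C.dirichlet_L_1_nonzero by simp
  next
    case False
    then show ?thesis by (intro C.dirichlet_L_ge_2_nonzero) simp
  qed
  moreover have "fe_factor (- of_nat k) \<noteq> 0"
    unfolding fe_factor_neg_even[OF assms] using gauss_sum_nonzero q_gt_2 by simp
  ultimately show ?thesis using dirichlet_L_functional_equation[of "- of_nat k"] by simp
qed

lemma bessel_sum_evaluation:
  assumes k: "even k" and A: "A > 0"
  defines "c \<equiv> real q * A / (4 * pi\<^sup>2)"
  defines "T \<equiv> \<lambda>n. sigma_bar_chi (of_nat k) (cnj \<circ> chi) (Suc n) * (1 / of_nat (Suc n) ^ (k + 1) - 1 / (of_nat (Suc n) + of_real c) ^ (k + 1))"
  shows "summable T"
    and "(\<lambda>n. sigma_chi (of_nat k) chi (Suc n) * of_real (2 * bessel_K0 (2 * sqrt (real (Suc n) * A)))) sums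
     ((if k = 0 then dirichlet_L chi 1 / of_real A else 0) + dirichlet_L chi (- of_nat k) * of_real euler_mascheroni +
      (dirichlet_L chi (- of_nat k) * of_real (ln (A / (2 * pi))) - deriv (dirichlet_L chi) (- of_nat k)) / 2 -
      (-2 * of_real pi * \<i>) ^ Suc k / cnj (gauss_sum q chi) / of_real A ^ Suc k * of_nat (fact k) * (of_real c ^ Suc k * (\<Sum>n. T n)))"
proof -
  have c: "c > 0" using A q_gt_2 by (simp add: c_def)
  define P where "P = (if k = 0 then dirichlet_L chi 1 / of_real A else 0)"
  define L where "L = dirichlet_L chi (- of_nat k)"
  define L' where "L' = deriv (dirichlet_L chi) (- of_nat k)"
  define \<beta> where "\<beta> = (-2 * of_real pi * \<i>) ^ Suc k / cnj (gauss_sum q chi) / of_real A ^ Suc k"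
  define S where "S n = sigma_bar_chi (of_nat k) (cnj \<circ> chi) (Suc n)" for n
  define B where "B = ln (A / (2 * pi))"
  define V where "V z = 1 / 2 * exp (z * of_real B) / cos (of_real pi * z / 2) * dirichlet_L chi (- of_nat k - z)" for z
  \<comment> \<open>The minuend sums to zeta times L and the subtrahend to the dual integral, each
    for positive exponent only; the difference is dominated by \<open>M\<close> down to 0, where it
    is c^(k + 1) times \<open>T\<close>.\<close>
  define w where "w n \<sigma> = S n * of_real ((c / real (Suc n)) powr (\<sigma> + real k + 1) - (c / (real (Suc n) + c)) powr (\<sigma> + real k + 1))" for n \<sigma>
  define M where "M n = (max 1 c ^ (k + 2) * ((real k + 2) * c)) * (divisor_power_sum k (Suc n) * real (Suc n) powr (- (real k + 2)))" for n
  have wM: "norm (w n \<sigma>) \<le> M n" if "0 \<le> \<sigma>" "\<sigma> \<le> 1" for n \<sigma>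
    unfolding w_def M_def S_def by (rule sigma_bar_difference_bound[OF c that])
  have M: "summable M"
  proof -
    have "summable (\<lambda>n. divisor_power_sum k n * real n powr (- (real k + 2)))" by (rule summable_divisor_power_sum) simp
    then have "summable (\<lambda>n. divisor_power_sum k (Suc n) * real (Suc n) powr (- (real k + 2)))" by (subst summable_Suc_iff)
    then show ?thesis unfolding M_def by (rule summable_mult)
  qed
  have ws: "summable (\<lambda>n. w n \<sigma>)" if "0 \<le> \<sigma>" "\<sigma> \<le> 1" for \<sigma>
    by (rule summable_norm_cancel, rule summable_comparison_test'[OF M]) (use wM[OF that] in auto)
  have w0: "w n 0 = of_real c ^ Suc k * T n" for n
  proof -
    have p1: "(c / real (Suc n)) powr (0 + real k + 1) = (c / real (Suc n)) ^ Suc k"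
      using powr_realpow[of "c / real (Suc n)" "Suc k"] c by (simp add: add.commute)
    have p2: "(c / (real (Suc n) + c)) powr (0 + real k + 1) = (c / (real (Suc n) + c)) ^ Suc k"
      using powr_realpow[of "c / (real (Suc n) + c)" "Suc k"] c by (simp add: add.commute add_pos_pos)
    have "complex_of_real ((c / real (Suc n)) ^ Suc k - (c / (real (Suc n) + c)) ^ Suc k) =
        of_real c ^ Suc k * (1 / of_nat (Suc n) ^ Suc k - 1 / (of_nat (Suc n) + of_real c) ^ Suc k)"
      by (simp add: power_divide right_diff_distrib)
    then show ?thesis unfolding w_def T_def S_def p1 p2 by (simp only: Suc_eq_plus1 mult_ac)
  qed
  show sT: "summable T"
  proof -
    have "summable (\<lambda>n. (1 / of_real c ^ Suc k) * w n 0)" by (intro summable_mult ws) auto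
    then show ?thesis unfolding w0 using c by simp
  qed
  have sumw0: "(\<Sum>n. w n 0) = of_real c ^ Suc k * (\<Sum>n. T n)" unfolding w0 by (rule suminf_mult[OF sT])

  \<comment> \<open>Started at 1/2 instead of 1, since the cosine in
    \<open>completed_L_factor\<close> vanishes at s = 1. The limits proved for 1 / (N + 1) are
    shifted accordingly by \<open>LIMSEQ_Suc\<close>.\<close>
  define s where "s N = 1 / (real (Suc N) + 1)" for N
  have s: "0 < s N" "s N < 1" "s N \<le> 1" "0 \<le> s N" for N by (auto simp: s_def)
  have s0: "s \<longlonglongrightarrow> 0" unfolding s_def by real_asymp
  define I where "I N = (LBINT t:{0<..}. of_real (t powr (s N - 1) * exp (- t)) * lambert k (A / t))" for N
  define Z where "Z N = zeta_at_one_plus (s N)" for N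
  \<comment> \<open>The poles 1/s of Gamma and zeta are subtracted, and what is left of them is the
    difference quotient of \<open>V\<close> at 0.\<close>
  have I: "I N = P * of_real (Gamma (s N + 1)) + (- (L / 2) * of_real (Gamma (s N) - 1 / s N) +
      (V (of_real (s N)) * of_real (Z N - 1 / s N) + (V (0 + of_real (s N)) - V 0) / of_real (s N))) -
      \<beta> * of_real (Gamma (s N + real k + 1)) * (\<Sum>n. w n (s N))" for N
  proof -
    define \<alpha> where "\<alpha> = s N + real k + 1"
    define D where "D = (LBINT t:{0<..}. of_real (t powr (s N + real k) * exp (- t)) * lambert_dual k (t / c))"
    define G where "G = complex_of_real (Gamma \<alpha>)"
    have "\<alpha> > 0" using s(1)[of N] by (simp add: \<alpha>_def)
    from Gamma_real_pos[OF this] have G: "G \<noteq> 0" by (simp add: G_def)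
    define Lb where "Lb = dirichlet_L (cnj \<circ> chi) (of_real \<alpha>)"
    have "(\<lambda>n. S n * of_real ((c / (real (Suc n) + c)) powr \<alpha>)) sums (of_real (1 / Gamma \<alpha>) * D)"
      unfolding S_def D_def \<alpha>_def by (rule dual_integral_sums[OF c s(1)])
    then have 1: "(\<lambda>n. S n * of_real ((c / (real (Suc n) + c)) powr \<alpha>)) sums (D / G)" by (simp add: G_def)
    have "(\<lambda>n. of_real (c powr \<alpha>) * (S n * of_real (real (Suc n) powr (- \<alpha>)))) sums (of_real (c powr \<alpha>) * (of_real (Z N) * Lb))"
      unfolding S_def Z_def Lb_def \<alpha>_def by (rule sums_mult[OF sigma_bar_dirichlet_series[OF s(1)]])
    moreover have "of_real (c powr \<alpha>) * (S n * of_real (real (Suc n) powr (- \<alpha>))) = S n * of_real ((c / real (Suc n)) powr \<alpha>)" for n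
    proof -
      have "(c / real (Suc n)) powr \<alpha> = c powr \<alpha> * real (Suc n) powr (- \<alpha>)"
        using c by (simp add: powr_divide powr_minus_divide)
      then show ?thesis by (simp only: of_real_mult mult_ac)
    qed
    ultimately have 2: "(\<lambda>n. S n * of_real ((c / real (Suc n)) powr \<alpha>)) sums (of_real (c powr \<alpha>) * (of_real (Z N) * Lb))"
      by (simp only:)
    from sums_diff[OF 2 1] have "(\<lambda>n. w n (s N)) sums (of_real (c powr \<alpha>) * (of_real (Z N) * Lb) - D / G)"
      unfolding w_def \<alpha>_def[symmetric] by (simp only: of_real_diff right_diff_distrib)
    then have "(\<Sum>n. w n (s N)) = of_real (c powr \<alpha>) * (of_real (Z N) * Lb) - D / G" by (simp add: sums_iff)
    then have "D / G = of_real (c powr \<alpha>) * (of_real (Z N) * Lb) - (\<Sum>n. w n (s N))" by simp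
    then have "G * (D / G) = G * (of_real (c powr \<alpha>) * (of_real (Z N) * Lb) - (\<Sum>n. w n (s N)))" by (simp only:)
    then have D: "D = G * of_real (c powr \<alpha>) * Lb * of_real (Z N) - G * (\<Sum>n. w n (s N))" using G by (simp add: algebra_simps)
    have V: "\<beta> * (G * of_real (c powr \<alpha>)) * Lb = V (of_real (s N))"
      using completed_L_factor[OF k A s(1,2)[of N]] unfolding \<beta>_def G_def c_def \<alpha>_def Lb_def V_def B_def of_real_mult .
    have V0: "V 0 = L / 2" by (simp add: V_def L_def)
    have "I N = P * of_real (Gamma (s N + 1)) - L / 2 * of_real (Gamma (s N)) + \<beta> * D"
      unfolding I_def P_def L_def \<beta>_def D_def c_def by (rule regularised_integral[OF k A s(1)])
    also have "\<beta> * D = (\<beta> * (G * of_real (c powr \<alpha>)) * Lb) * of_real (Z N) - \<beta> * G * (\<Sum>n. w n (s N))"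
      unfolding D by (simp add: algebra_simps)
    also have "\<dots> = V (of_real (s N)) * of_real (Z N) - \<beta> * G * (\<Sum>n. w n (s N))" unfolding V ..
    finally have IN: "I N = P * of_real (Gamma (s N + 1)) - L / 2 * of_real (Gamma (s N)) +
        (V (of_real (s N)) * of_real (Z N) - \<beta> * G * (\<Sum>n. w n (s N)))" .
    \<comment> \<open>Used with r = 1/s; the identity holds for every r because the coefficients of
      r add up to l - v + (v - l) = 0.\<close>
    have regroup: "p - l * g + (v * z - b) = p + (- l * (g - r) + (v * (z - r) + (v - l) * r)) - b" for p l g v z b r :: complex
      by (simp add: algebra_simps)
    have "u / of_real (s N) = u * of_real (1 / s N)" for u :: complex by simp
    then show ?thesis unfolding IN V0 of_real_diff G_def \<alpha>_def add_0 by (simp only: regroup[where r = "of_real (1 / s N)"])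
  qed
  have limG: "(\<lambda>N. of_real (Gamma (s N) - 1 / s N)) \<longlonglongrightarrow> complex_of_real (- euler_mascheroni)"
    using LIMSEQ_Suc[OF Gamma_limit_0] unfolding s_def by (rule tendsto_of_real)
  have limZ: "(\<lambda>N. of_real (Z N - 1 / s N)) \<longlonglongrightarrow> complex_of_real euler_mascheroni"
    using LIMSEQ_Suc[OF zeta_at_one_plus_limit] unfolding s_def Z_def by (rule tendsto_of_real)
  have VD: "(V has_field_derivative (L * of_real B - L') / 2) (at 0)"
    unfolding V_def[abs_def] L_def L'_def by (rule completed_L_factor_DERIV)
  have sc: "filterlim (\<lambda>N. complex_of_real (s N)) (at 0) sequentially"
  proof -
    have "(\<lambda>N. complex_of_real (s N)) \<longlonglongrightarrow> of_real 0" by (rule tendsto_of_real[OF s0])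
    then show ?thesis using s(1) by (auto simp: filterlim_at less_imp_neq[THEN not_sym])
  qed
  have limV': "(\<lambda>N. (V (0 + of_real (s N)) - V 0) / of_real (s N)) \<longlonglongrightarrow> (L * of_real B - L') / 2"
    using filterlim_compose[OF VD[unfolded DERIV_def] sc] by simp
  have V0: "V 0 = L / 2" by (simp add: V_def L_def)
  have limV: "(\<lambda>N. V (of_real (s N))) \<longlonglongrightarrow> L / 2"
  proof -
    have "isCont V 0" using VD by (rule DERIV_isCont)
    from isCont_tendsto_compose[OF this tendsto_of_real[OF s0, unfolded of_real_0]] show ?thesis unfolding V0 .
  qed
  have limW: "(\<lambda>N. \<Sum>n. w n (s N)) \<longlonglongrightarrow> (\<Sum>n. w n 0)"
  proof (rule tannery_sequentially[OF _ _ M])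
    show "norm (w n (s N)) \<le> M n" for n N using s by (intro wM) auto
    show "(\<lambda>N. w n (s N)) \<longlonglongrightarrow> w n 0" for n
      unfolding w_def using c by (intro tendsto_intros s0) (auto simp: add_nonneg_eq_0_iff)
  qed
  have limG1: "(\<lambda>N. of_real (Gamma (s N + 1))) \<longlonglongrightarrow> complex_of_real (Gamma (0 + 1))"
    and limGk: "(\<lambda>N. of_real (Gamma (s N + real k + 1))) \<longlonglongrightarrow> complex_of_real (Gamma (0 + real k + 1))"
    by (intro tendsto_intros s0; auto elim!: nonpos_Ints_cases)+
  have Gk: "Gamma (0 + real k + 1) = fact k" using Gamma_fact[of k, where 'a = real] by (simp add: add.commute)
  \<comment> \<open>Euler's constant arrives twice with weight L / 2, once from Gamma and once from
    zeta.\<close>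
  have "I \<longlonglongrightarrow> P * of_real (Gamma (0 + 1)) + (- (L / 2) * of_real (- euler_mascheroni) +
      (L / 2 * of_real euler_mascheroni + (L * of_real B - L') / 2)) - \<beta> * of_real (Gamma (0 + real k + 1)) * (\<Sum>n. w n 0)"
    unfolding I by (intro tendsto_intros limG1 limGk limG limZ limV limV' limW)
  moreover have "I \<longlonglongrightarrow> (LBINT t:{0<..}. of_real (exp (- t) / t) * lambert k (A / t))"
    unfolding I_def by (rule lambert_integral_limit[OF A s(1) s(3) s0])
  ultimately have J: "(LBINT t:{0<..}. of_real (exp (- t) / t) * lambert k (A / t)) = P * of_real (Gamma (0 + 1)) + (- (L / 2) * of_real (- euler_mascheroni) +
      (L / 2 * of_real euler_mascheroni + (L * of_real B - L') / 2)) - \<beta> * of_real (Gamma (0 + real k + 1)) * (\<Sum>n. w n 0)"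
    using LIMSEQ_unique by blast
  have J': "(LBINT t:{0<..}. of_real (exp (- t) / t) * lambert k (A / t)) = P + L * of_real euler_mascheroni + (L * of_real B - L') / 2 -
      \<beta> * of_nat (fact k) * (of_real c ^ Suc k * (\<Sum>n. T n))"
    unfolding J Gk sumw0 by simp
  have "(\<lambda>n. sigma_chi (of_nat k) chi (Suc n) * of_real (2 * bessel_K0 (2 * sqrt (real (Suc n) * A)))) sums
     (LBINT t:{0<..}. of_real (exp (- t) / t) * lambert k (A / t))"
    using lambert_bessel_sums[OF A, of k]
    by (subst sums_Suc_iff[of "\<lambda>n. sigma_chi (of_nat k) chi n * of_real (2 * bessel_K0 (2 * sqrt (real n * A)))"]) (simp add: sigma_chi_def)
  then show "(\<lambda>n. sigma_chi (of_nat k) chi (Suc n) * of_real (2 * bessel_K0 (2 * sqrt (real (Suc n) * A)))) sums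
     ((if k = 0 then dirichlet_L chi 1 / of_real A else 0) + dirichlet_L chi (- of_nat k) * of_real euler_mascheroni +
      (dirichlet_L chi (- of_nat k) * of_real (ln (A / (2 * pi))) - deriv (dirichlet_L chi) (- of_nat k)) / 2 -
      (-2 * of_real pi * \<i>) ^ Suc k / cnj (gauss_sum q chi) / of_real A ^ Suc k * of_nat (fact k) * (of_real c ^ Suc k * (\<Sum>n. T n)))"
    unfolding J' P_def L_def L'_def \<beta>_def B_def .
qed

end

theorem theorem2p2:
  fixes k q :: nat and chi :: "nat \<Rightarrow> complex" and a x :: real
  assumes "even k"
    and "primitive_dirichlet_char q chi"
    and "odd_dirichlet_char q chi"
    and "a > 0" and "x > 0"
  shows "summable (\<lambda>n. sigma_bar_chi (of_nat k) (cnj \<circ> chi) (Suc n) *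
            (1 / of_nat (Suc n) ^ (k + 1)
             - 1 / (of_nat (Suc n) + of_real (a\<^sup>2 * q * x / (16 * pi\<^sup>2))) ^ (k + 1)))
    \<and> (\<lambda>n. sigma_chi (of_nat k) chi (Suc n) * of_real (bessel_K0 (a * sqrt (real (Suc n) * x))))
      sums
      ((if k = 0 then 1 else 0) * 2 / of_real (a\<^sup>2 * x) * dirichlet_L chi 1
       - dirichlet_L chi (- of_nat k) / 4 *
           (of_real (ln (8 * pi / a\<^sup>2))
            + deriv (dirichlet_L chi) (- of_nat k) / dirichlet_L chi (- of_nat k)
            - 2 * of_real euler_mascheroni)
       + dirichlet_L chi (- of_nat k) / 4 * of_real (ln x)
       + (-1) ^ (k div 2) * \<i> * of_nat (fact k) * of_nat q ^ k / (2 * (2 * of_real pi) ^ (k + 1))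
         * gauss_sum q chi
         * (\<Sum>n. sigma_bar_chi (of_nat k) (cnj \<circ> chi) (Suc n) *
            (1 / of_nat (Suc n) ^ (k + 1)
             - 1 / (of_nat (Suc n) + of_real (a\<^sup>2 * q * x / (16 * pi\<^sup>2))) ^ (k + 1))))"
proof -
  interpret odd_primitive_character q chi by (rule odd_primitive_character.intro) (fact assms)+
  \<comment> \<open>Makes 2 sqrt (n A) = a sqrt (n x), and then q A / (4 pi^2) is the shift in the
    statement.\<close>
  define A where "A = a\<^sup>2 * x / 4"
  have A: "A > 0" using assms by (simp add: A_def)
  define T where "T n = sigma_bar_chi (of_nat k) (cnj \<circ> chi) (Suc n) *
            (1 / of_nat (Suc n) ^ (k + 1) - 1 / (of_nat (Suc n) + of_real (a\<^sup>2 * q * x / (16 * pi\<^sup>2))) ^ (k + 1))" for n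
  define c where "c = real q * A / (4 * pi\<^sup>2)"
  have c: "a\<^sup>2 * q * x / (16 * pi\<^sup>2) = c" by (simp add: c_def A_def field_simps)
  define L where "L = dirichlet_L chi (- of_nat k)"
  define L' where "L' = deriv (dirichlet_L chi) (- of_nat k)"
  define \<tau> where "\<tau> = gauss_sum q chi"
  \<comment> \<open>The limit produces L' undivided; this is what allows it to be written as L times
    the quotient L' / L.\<close>
  have Lnz: "L \<noteq> 0" unfolding L_def by (rule dirichlet_L_neg_even_nonzero[OF assms(1)])
  have sm: "summable T" unfolding T_def c c_def by (rule bessel_sum_evaluation(1)[OF assms(1) A])
  define R where "R = (if k = 0 then dirichlet_L chi 1 / of_real A else 0) + L * of_real euler_mascheroni +
      (L * of_real (ln (A / (2 * pi))) - L') / 2 -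
      (-2 * of_real pi * \<i>) ^ Suc k / cnj \<tau> / of_real A ^ Suc k * of_nat (fact k) * (of_real c ^ Suc k * (\<Sum>n. T n))"
  have "(\<lambda>n. sigma_chi (of_nat k) chi (Suc n) * of_real (2 * bessel_K0 (2 * sqrt (real (Suc n) * A)))) sums R"
    unfolding R_def L_def L'_def \<tau>_def T_def c unfolding c_def by (rule bessel_sum_evaluation(2)[OF assms(1) A])
  from sums_mult[OF this, of "1/2"]
  have "(\<lambda>n. 1/2 * (sigma_chi (of_nat k) chi (Suc n) * of_real (2 * bessel_K0 (2 * sqrt (real (Suc n) * A))))) sums (1/2 * R)" .
  moreover have "2 * sqrt (real n * A) = a * sqrt (real n * x)" for n
  proof -
    have "real n * A = (a / 2)\<^sup>2 * (real n * x)" by (simp add: A_def power2_eq_square field_simps)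
    then have "2 * sqrt (real n * A) = 2 * (sqrt ((a / 2)\<^sup>2) * sqrt (real n * x))" by (simp only: real_sqrt_mult)
    then show ?thesis using assms(4) by simp
  qed
  then have "1/2 * (sigma_chi (of_nat k) chi (Suc n) * of_real (2 * bessel_K0 (2 * sqrt (real (Suc n) * A)))) =
      sigma_chi (of_nat k) chi (Suc n) * of_real (bessel_K0 (a * sqrt (real (Suc n) * x)))" for n
    by (simp only:) simp
  ultimately have sums: "(\<lambda>n. sigma_chi (of_nat k) chi (Suc n) * of_real (bessel_K0 (a * sqrt (real (Suc n) * x)))) sums (1/2 * R)"
    by (simp only:)
  \<comment> \<open>The parameter \<open>A\<close> cancels because c / A = q / (2 pi)^2. One factor
    q is lost in 1 / cnj tau = tau / q, and (- i)^(k + 1) supplies the sign and the factor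
    i.\<close>
  have coeff: "1/2 * ((-2 * of_real pi * \<i>) ^ Suc k / cnj \<tau> / of_real A ^ Suc k * of_nat (fact k) * (of_real c ^ Suc k * X)) =
      - ((-1) ^ (k div 2) * \<i> * of_nat (fact k) * of_nat q ^ k / (2 * (2 * of_real pi) ^ (k + 1)) * \<tau> * X)" for X
  proof -
    obtain l where l: "k = 2 * l" using assms(1) by blast
    have tau: "1 / cnj \<tau> = \<tau> / of_nat q"
      using norm_gauss_sum gauss_sum_nonzero q_gt_2 by (simp add: \<tau>_def field_simps)
    have ratio: "of_real c ^ Suc k / of_real A ^ Suc k = (of_nat q / (2 * of_real pi) ^ 2 :: complex) ^ Suc k"
    proof -
      have "complex_of_real c / of_real A = of_nat q / (2 * of_real pi) ^ 2"
        using A by (simp add: c_def power2_eq_square field_simps)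
      then show ?thesis by (simp only: power_divide[symmetric])
    qed
    have pw: "(-2 * of_real pi * \<i>) ^ Suc k = - \<i> * (-1) ^ l * (2 * of_real pi) ^ Suc k"
    proof -
      have "(-2 * of_real pi * \<i>) ^ Suc k = (- \<i>) ^ Suc k * (2 * complex_of_real pi) ^ Suc k"
      proof -
        have "-2 * of_real pi * \<i> = (- \<i>) * (2 * complex_of_real pi)" by simp
        then show ?thesis by (simp only: power_mult_distrib)
      qed
      also have "(- \<i>) ^ Suc k = - \<i> * (-1) ^ l" by (simp add: l power_mult)
      finally show ?thesis .
    qed
    have q0: "of_nat q \<noteq> (0::complex)" using q_gt_2 by simp
    have "1/2 * ((-2 * of_real pi * \<i>) ^ Suc k / cnj \<tau> / of_real A ^ Suc k * of_nat (fact k) * (of_real c ^ Suc k * X)) =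
        1/2 * ((-2 * of_real pi * \<i>) ^ Suc k * (1 / cnj \<tau>) * (of_real c ^ Suc k / of_real A ^ Suc k) * of_nat (fact k) * X)"
      by simp
    also have "\<dots> = 1/2 * (- \<i> * (-1) ^ l * (2 * of_real pi) ^ Suc k * (\<tau> / of_nat q) * (of_nat q / (2 * of_real pi) ^ 2) ^ Suc k * of_nat (fact k) * X)"
      unfolding pw tau ratio ..
    also have "\<dots> = - (\<i> * (-1) ^ l * (((2 * of_real pi) ^ Suc k * (of_nat q / (2 * of_real pi) ^ 2) ^ Suc k) / of_nat q) * of_nat (fact k) / 2 * \<tau> * X)"
      by simp
    also have "(2 * of_real pi) ^ Suc k * (of_nat q / (2 * of_real pi) ^ 2) ^ Suc k = of_nat q ^ Suc k / (2 * complex_of_real pi) ^ Suc k"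
      unfolding power_mult_distrib[symmetric] power_divide[symmetric] by (simp add: power2_eq_square)
    also have "(of_nat q ^ Suc k / (2 * complex_of_real pi) ^ Suc k) / of_nat q = of_nat q ^ k / (2 * complex_of_real pi) ^ Suc k"
      using q0 by simp
    finally show ?thesis by (simp add: l mult_ac)
  qed
  \<comment> \<open>A / (2 pi) = x a^2 / (8 pi), which is split as the statement displays
    it.\<close>
  have lnA: "ln (A / (2 * pi)) = ln x - ln (8 * pi / a\<^sup>2)"
    using assms by (simp add: A_def ln_div ln_mult flip: ln_divide_pos)
  have "1/2 * R = (if k = 0 then 1 else 0) * 2 / of_real (a\<^sup>2 * x) * dirichlet_L chi 1
       - L / 4 * (of_real (ln (8 * pi / a\<^sup>2)) + L' / L - 2 * of_real euler_mascheroni)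
       + L / 4 * of_real (ln x)
       + (-1) ^ (k div 2) * \<i> * of_nat (fact k) * of_nat q ^ k / (2 * (2 * of_real pi) ^ (k + 1)) * \<tau> * (\<Sum>n. T n)"
  proof -
    have P: "1/2 * (if k = 0 then dirichlet_L chi 1 / of_real A else 0) = (if k = 0 then 1 else 0) * 2 / of_real (a\<^sup>2 * x) * dirichlet_L chi 1"
      using assms by (simp add: A_def)
    have Q: "1/2 * (L * of_real euler_mascheroni) + 1/2 * ((L * of_real (ln (A / (2 * pi))) - L') / 2) =
       - (L / 4 * (of_real (ln (8 * pi / a\<^sup>2)) + L' / L - 2 * of_real euler_mascheroni)) + L / 4 * of_real (ln x)"
      unfolding lnA using Lnz by (simp add: field_simps)
    have "1/2 * R = 1/2 * (if k = 0 then dirichlet_L chi 1 / of_real A else 0) +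
       (1/2 * (L * of_real euler_mascheroni) + 1/2 * ((L * of_real (ln (A / (2 * pi))) - L') / 2)) -
       1/2 * ((-2 * of_real pi * \<i>) ^ Suc k / cnj \<tau> / of_real A ^ Suc k * of_nat (fact k) * (of_real c ^ Suc k * (\<Sum>n. T n)))"
      unfolding R_def by (simp only: ring_distribs add.assoc)
    then show ?thesis unfolding P Q coeff by simp
  qed
  with sums sm show ?thesis unfolding T_def L_def L'_def \<tau>_def by (simp only:)
qed

end
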